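(* Let $\chi$ be a positive integer and $c_\ell=\frac\chi{192\pi}$. Let $g_{\overline N}$ be the instanton corrected q-map metric associated to the prepotential $\mathfrak F=-\frac16\frac{(Z^1)^3}{Z^0}+\chi\frac{(Z^0)^2\zeta(3)}{2(2\pi\mathrm i)^3}$ and the BPS indices $\Omega(q_0\gamma^0)=-\chi$ for $q_0\neq0$, $\Omega(\gamma)=0$ otherwise, and let $\widetilde N$ be the domain (on which $g_{\overline N}$ is defined and positive definite) $$\widetilde N=\{(\tau_2,b+\mathrm it,\tau_1,\zeta^1,\tilde\zeta_0,\tilde\zeta_1,\sigma)\in\mathbb R_{>0}\times(\mathbb R+\mathrm i\mathbb R_{>0})\times\mathbb R^4\times\mathbb R:\ R_1(t,\tau)>0,\ R_2(t,\tau)>0\}.$$ Then the positive definite quaternionic-Kähler manifold $(\widetilde N,g_{\overline N})$ has an effective action by isometries of the group $\mathrm{SL}(2,\mathbb Z)\ltimes(\mathbb R\ltimes H_4)$, where $\mathrm{SL}(2,\mathbb Z)$ acts by the S-duality action and $\mathbb R$ and $H_4$ act as described in the context.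
   Context: Repeated indices $i,j\in\{0,1\}$ are summed; $\tau=\tau_1+\mathrm i\tau_2$. **Domain functions.** $R_1(t,\tau)=\frac{t^3}3-\frac{\chi}{4(2\pi)^3}\sum_{(m,n)\ne(0,0)}|m\tau+n|^{-3}$ and $R_2(t,\tau)=\frac{t^3}3-\frac{3\chi}{4(2\pi)^3}\sum_{(m,n)\ne(0,0)}|m\tau+n|^{-3}-\frac{(3\chi)^2}{(4\pi)^6}\big(\sum_{(m,n)\ne(0,0)}|m\tau+n|^{-3}\big)^2R_1(t,\tau)^{-1}$, sums over $(m,n)\in\mathbb Z^2$. **The metric.** Let $M^{\mathrm{cl}}=\{(Z^0,Z^1)\in\mathbb C^2:Z^0\ne0,\ \mathrm{Im}(Z^1/Z^0)>0\}$, $z^0=1$, $z^1=Z^1/Z^0=b+\mathrm it$, $\tau_{ij}=\partial^2\mathfrak F/\partial Z^i\partial Z^j$. On $M^{\mathrm{cl}}\times\mathbb R^4\times\mathbb R$ use coordinates $(Z^0,Z^1,\zeta^0,\zeta^1,\tilde\zeta_0,\tilde\zeta_1,\sigma)$. With $K_\nu$ the modified Bessel functions of the second kind, for $q\in\mathbb Z\setminus\{0\}$ let $$V_q=\tfrac1{2\pi}\sum_{k>0}e^{-2\pi\mathrm ikq\zeta^0}K_0(2\pi k|qZ^0|),\quad A_q=-\tfrac1{4\pi}\sum_{k>0}e^{-2\pi\mathrm ikq\zeta^0}|qZ^0|K_1(2\pi k|qZ^0|)\Big(\tfrac{dZ^0}{Z^0}-\tfrac{d\overline Z^0}{\overline Z^0}\Big),$$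 $$\eta_q=\tfrac{\mathrm i}{8\pi^2}\sum_{k>0}\tfrac{e^{-2\pi\mathrm ikq\zeta^0}}k|qZ^0|K_1(2\pi k|qZ^0|)\Big(\tfrac{dZ^0}{Z^0}-\tfrac{d\overline Z^0}{\overline Z^0}\Big).$$ Let $T_{ij}=-\mathrm{Im}\,\tau_{ij}+\chi\,\delta_{i0}\delta_{j0}\sum_{q\ne0}q^2V_q$ with inverse $T^{ij}$; $W_i=d\tilde\zeta_i-\tau_{ij}d\zeta^j$; $W_0^{\mathrm{inst}}=\chi\sum_{q\ne0}q(A_q+\mathrm iqV_qd\zeta^0)$, $W_1^{\mathrm{inst}}=0$; $$g_N=2\pi\big(T_{ij}dZ^id\overline Z^j+(W_i+W_i^{\mathrm{inst}})T^{ij}(\overline W_j+\overline W_j^{\mathrm{inst}})\big),\qquad\omega_1+\mathrm i\omega_2=2\pi dZ^i\wedge(W_i+W_i^{\mathrm{inst}}).$$ Let $V=2\mathrm i(Z^i\partial_{Z^i}-\overline Z^i\partial_{\overline Z^i})$, $r^2=-\mathrm{Im}(\tau_{ij})Z^i\overline Z^j$, $f=2\pi\big(r^2-8c_\ell+\chi\sum_{q\ne0}\eta_q(V)\big)$, $f_3=f-\frac12g_N(V,V)$, $d^c=\mathrm i(\overline\partial-\partial)$, $\theta_0=-\frac12df$, $\theta_1=\frac12\iota_V\omega_2$, $\theta_2=-\frac12\iota_V\omega_1$, $\theta_3=\pi(d\sigma+\tilde\zeta_id\zeta^i-\zeta^id\tilde\zeta_i)+\frac\pi2d^cr^2+2\pi\chi\sum_{q\ne0}\eta_q$,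 $\eta=\theta_3-\frac12\iota_Vg_N$. The instanton corrected q-map metric is $$g_{\overline N}=-\frac1f\Big(\frac2{f_3}\eta^2+g_N-\frac2f\sum_{k=0}^3\theta_k^2\Big)\Big|_{\{\mathrm{Arg}Z^0=0\}},$$ where $\{\mathrm{Arg}Z^0=0\}$ carries the coordinates $(\tau_2,b+\mathrm it,\tau_1,\zeta^1,\tilde\zeta_0,\tilde\zeta_1,\sigma)$ with $\tau_2=|Z^0|$, $\tau_1=\zeta^0$. **Type IIB coordinates and actions.** Coordinates $(\tau,b+\mathrm it,c^1,c_1,c_0,\psi)$ are defined by $\zeta^0=\tau_1$, $\zeta^1=-(c^1-\tau_1b)$, $\tilde\zeta_1=c_1+\frac12b(c^1-\tau_1b)$, $\tilde\zeta_0=c_0-\frac16b^2(c^1-\tau_1b)$, $\sigma=-2(\psi+\frac12\tau_1c_0)+c_1(c^1-\tau_1b)-\frac16bc^1(c^1-\tau_1b)$. The S-duality action of $\begin{pmatrix}\alpha&\beta\\\gamma&\delta\end{pmatrix}\in\mathrm{SL}(2,\mathbb Z)$ is $\tau\mapsto\frac{\alpha\tau+\beta}{\gamma\tau+\delta}$, $t\mapsto|\gamma\tau+\delta|t$, $c_1\mapsto c_1$, $(c^1,b)\mapsto(\alpha c^1+\beta b,\gamma c^1+\delta b)$, $(c_0,\psi)\mapsto(\delta c_0-\gamma\psi,-\beta c_0+\alpha\psi)$. The element $v\in\mathbb R$ fixes $\tau_2,\zeta^0,\sigma$ and maps $z^1\mapsto z^1+v$, $\zeta^1\mapsto\zeta^1+\zeta^0v$,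 $\tilde\zeta_0\mapsto\tilde\zeta_0+\frac16v^3\zeta^0+\frac12v^2\zeta^1-\tilde\zeta_1v$, $\tilde\zeta_1\mapsto\tilde\zeta_1-\frac12\zeta^0v^2-v\zeta^1$. $H_4=\{(\eta^i,\tilde\eta_i,\kappa)\in\mathrm{Heis}_5(\mathbb R):\eta^0=0\}$ fixes $\tau_2,z^1$ and maps $(\zeta^i,\tilde\zeta_i,\sigma)\mapsto(\zeta^i+\eta^i,\tilde\zeta_i+\tilde\eta_i,\sigma+\kappa+\tilde\zeta_i\eta^i-\zeta^i\tilde\eta_i)$; the group law of $\mathrm{Heis}_5(\mathbb R)$ is $(\eta,\tilde\eta,\kappa)(\eta',\tilde\eta',\kappa')=(\eta+\eta',\tilde\eta+\tilde\eta',\kappa+\kappa'+\eta^i\tilde\eta'_i-\tilde\eta_i\eta'^i)$. The semidirect products are those determined by these actions. *)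

theory Defs
  imports "HOL-Analysis.Analysis" "HOL-Algebra.Group_Action"
begin

text \<open>
  The indices \<open>i, j \<in> {0, 1}\<close> are the elements \<open>0\<close> and \<open>1\<close> of the numeral type \<open>2\<close>.
  A tangent vector at a point of an open subset of a Euclidean space is an element of that space.
  Differential one-forms are functions of a point and a tangent vector; a symmetric bilinear form
  is a function of a point and two tangent vectors.
\<close>

type_synonym nspace = "(complex^2) \<times> (real^2) \<times> (real^2) \<times> real"
  \<comment> \<open>\<open>((Z\<^sup>0, Z\<^sup>1), (\<zeta>\<^sup>0, \<zeta>\<^sup>1), (\<zeta>~\<^sub>0, \<zeta>~\<^sub>1), \<sigma>)\<close>\<close>

type_synonym iia = "real \<times> complex \<times> (real^2) \<times> (real^2) \<times> real"
  \<comment> \<open>\<open>(\<tau>\<^sub>2, b + i t, (\<zeta>\<^sup>0 = \<tau>\<^sub>1, \<zeta>\<^sup>1), (\<zeta>~\<^sub>0, \<zeta>~\<^sub>1), \<sigma>)\<close>\<close>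

type_synonym iib = "complex \<times> complex \<times> real \<times> real \<times> real \<times> real"
  \<comment> \<open>\<open>(\<tau>, b + i t, c\<^sup>1, c\<^sub>1, c\<^sub>0, \<psi>)\<close>\<close>

definition pair :: "'a \<Rightarrow> 'a \<Rightarrow> 'a^2" where
  "pair x y = (\<chi> i. if i = 0 then x else y)"

abbreviation Z_of :: "nspace \<Rightarrow> complex^2" where "Z_of P \<equiv> fst P"
abbreviation zeta_of :: "nspace \<Rightarrow> real^2" where "zeta_of P \<equiv> fst (snd P)"
abbreviation tzeta_of :: "nspace \<Rightarrow> real^2" where "tzeta_of P \<equiv> fst (snd (snd P))"
abbreviation sigma_of :: "nspace \<Rightarrow> real" where "sigma_of P \<equiv> snd (snd (snd P))"


section \<open>Special functions\<close>

definition bessel_K :: "real \<Rightarrow> real \<Rightarrow> real" where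
  "bessel_K \<nu> x = integral {0..} (\<lambda>s. exp (- x * cosh s) * cosh (\<nu> * s))"
  \<comment> \<open>modified Bessel function of the second kind, for \<open>x > 0\<close>\<close>

definition zeta3 :: real where
  "zeta3 = (\<Sum>n. 1 / real (Suc n) ^ 3)"

definition eisenstein :: "complex \<Rightarrow> real" where
  "eisenstein \<tau> =
    (\<Sum>\<^sub>\<infinity>(m, n)\<in>(UNIV :: (int \<times> int) set) - {(0, 0)}. 1 / cmod (of_int m * \<tau> + of_int n) ^ 3)"


section \<open>The domain\<close>

definition R1 :: "nat \<Rightarrow> real \<Rightarrow> complex \<Rightarrow> real" where
  "R1 chi t \<tau> = t ^ 3 / 3 - real chi / (4 * (2 * pi) ^ 3) * eisenstein \<tau>"

definition R2 :: "nat \<Rightarrow> real \<Rightarrow> complex \<Rightarrow> real" where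
  "R2 chi t \<tau> = t ^ 3 / 3 - 3 * real chi / (4 * (2 * pi) ^ 3) * eisenstein \<tau>
     - (3 * real chi)\<^sup>2 / (4 * pi) ^ 6 * (eisenstein \<tau>)\<^sup>2 * inverse (R1 chi t \<tau>)"

definition iia_space :: "iia set" where
  "iia_space = {(\<tau>2, z, \<zeta>, \<zeta>t, \<sigma>). \<tau>2 > 0 \<and> Im z > 0}"

definition N_tilde :: "nat \<Rightarrow> iia set" where
  "N_tilde chi = {(\<tau>2, z, \<zeta>, \<zeta>t, \<sigma>). \<tau>2 > 0 \<and> Im z > 0 \<and>
     R1 chi (Im z) (Complex (\<zeta> $ 0) \<tau>2) > 0 \<and> R2 chi (Im z) (Complex (\<zeta> $ 0) \<tau>2) > 0}"


section \<open>The instanton corrected q-map metric\<close>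

definition prepotential :: "nat \<Rightarrow> complex^2 \<Rightarrow> complex" where
  "prepotential chi Z = - (1 / 6) * (Z $ 1) ^ 3 / Z $ 0
     + of_nat chi * ((Z $ 0)\<^sup>2 * of_real zeta3) / (2 * (2 * of_real pi * \<i>) ^ 3)"

definition holo_partial :: "2 \<Rightarrow> (complex^2 \<Rightarrow> complex) \<Rightarrow> complex^2 \<Rightarrow> complex" where
  "holo_partial i G Z = deriv (\<lambda>w. G (\<chi> k. if k = i then w else Z $ k)) (Z $ i)"

definition tau :: "(complex^2 \<Rightarrow> complex) \<Rightarrow> complex^2 \<Rightarrow> 2 \<Rightarrow> 2 \<Rightarrow> complex" where
  "tau \<FF> Z i j = holo_partial i (holo_partial j \<FF>) Z"

definition dlog_Z0 :: "nspace \<Rightarrow> nspace \<Rightarrow> complex" where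
  "dlog_Z0 P X = Z_of X $ 0 / Z_of P $ 0 - cnj (Z_of X $ 0) / cnj (Z_of P $ 0)"

definition inst_V :: "int \<Rightarrow> nspace \<Rightarrow> complex" where
  "inst_V q P = 1 / (2 * of_real pi) *
     (\<Sum>\<^sub>\<infinity>k\<in>{1::nat..}. exp (- 2 * of_real pi * \<i> * of_nat k * of_int q * of_real (zeta_of P $ 0)) *
        of_real (bessel_K 0 (2 * pi * real k * cmod (of_int q * Z_of P $ 0))))"

definition inst_A :: "int \<Rightarrow> nspace \<Rightarrow> nspace \<Rightarrow> complex" where
  "inst_A q P X = - (1 / (4 * of_real pi)) *
     (\<Sum>\<^sub>\<infinity>k\<in>{1::nat..}. exp (- 2 * of_real pi * \<i> * of_nat k * of_int q * of_real (zeta_of P $ 0)) *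
        of_real (cmod (of_int q * Z_of P $ 0) *
          bessel_K 1 (2 * pi * real k * cmod (of_int q * Z_of P $ 0)))) *
     dlog_Z0 P X"

definition inst_eta :: "int \<Rightarrow> nspace \<Rightarrow> nspace \<Rightarrow> complex" where
  "inst_eta q P X = \<i> / (8 * (of_real pi)\<^sup>2) *
     (\<Sum>\<^sub>\<infinity>k\<in>{1::nat..}. exp (- 2 * of_real pi * \<i> * of_nat k * of_int q * of_real (zeta_of P $ 0)) / of_nat k *
        of_real (cmod (of_int q * Z_of P $ 0) *
          bessel_K 1 (2 * pi * real k * cmod (of_int q * Z_of P $ 0)))) *
     dlog_Z0 P X"

text \<open>
  The sums over \<open>q \<noteq> 0\<close> of \<open>q\<^sup>2 V\<^sub>q\<close> and of \<open>\<eta>\<^sub>q\<close> are real, because the terms for \<open>q\<close> and \<open>-q\<close>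
  are complex conjugate; \<open>Re\<close> below only changes the type.
\<close>

definition T_mat :: "(complex^2 \<Rightarrow> complex) \<Rightarrow> nat \<Rightarrow> nspace \<Rightarrow> real^2^2" where
  "T_mat \<FF> chi P = (\<chi> i j. - Im (tau \<FF> (Z_of P) i j)
     + (if i = 0 \<and> j = 0
        then real chi * Re (\<Sum>\<^sub>\<infinity>q\<in>UNIV - {0}. (of_int q)\<^sup>2 * inst_V q P) else 0))"

definition W_form :: "(complex^2 \<Rightarrow> complex) \<Rightarrow> nspace \<Rightarrow> 2 \<Rightarrow> nspace \<Rightarrow> complex" where
  "W_form \<FF> P i X = of_real (tzeta_of X $ i)
     - (\<Sum>j\<in>UNIV. tau \<FF> (Z_of P) i j * of_real (zeta_of X $ j))"

definition W_inst :: "nat \<Rightarrow> nspace \<Rightarrow> 2 \<Rightarrow> nspace \<Rightarrow> complex" where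
  "W_inst chi P i X =
     (if i = 0
      then of_nat chi * (\<Sum>\<^sub>\<infinity>q\<in>UNIV - {0}. of_int q *
             (inst_A q P X + \<i> * of_int q * inst_V q P * of_real (zeta_of X $ 0)))
      else 0)"

definition W_tot :: "(complex^2 \<Rightarrow> complex) \<Rightarrow> nat \<Rightarrow> nspace \<Rightarrow> 2 \<Rightarrow> nspace \<Rightarrow> complex" where
  "W_tot \<FF> chi P i X = W_form \<FF> P i X + W_inst chi P i X"

text \<open>
  A product \<open>\<alpha> \<beta>\<close> of one-forms in a metric is the symmetrised tensor product, so that
  \<open>h\<^sub>i\<^sub>j \<alpha>\<^sup>i cnj \<alpha>\<^sup>j\<close>, with \<open>h\<close> real symmetric, is the real part of a Hermitian form.
\<close>

definition g_N :: "(complex^2 \<Rightarrow> complex) \<Rightarrow> nat \<Rightarrow> nspace \<Rightarrow> nspace \<Rightarrow> nspace \<Rightarrow> real" where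
  "g_N \<FF> chi P X Y = 2 * pi * Re (\<Sum>i\<in>UNIV. \<Sum>j\<in>UNIV.
       of_real (T_mat \<FF> chi P $ i $ j) * Z_of X $ i * cnj (Z_of Y $ j)
     + W_tot \<FF> chi P i X * of_real (matrix_inv (T_mat \<FF> chi P) $ i $ j) * cnj (W_tot \<FF> chi P j Y))"

definition omega12 :: "(complex^2 \<Rightarrow> complex) \<Rightarrow> nat \<Rightarrow> nspace \<Rightarrow> nspace \<Rightarrow> nspace \<Rightarrow> complex" where
  "omega12 \<FF> chi P X Y = 2 * of_real pi * (\<Sum>i\<in>UNIV.
       Z_of X $ i * W_tot \<FF> chi P i Y - Z_of Y $ i * W_tot \<FF> chi P i X)"
  \<comment> \<open>\<open>\<omega>\<^sub>1 + i \<omega>\<^sub>2\<close>\<close>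

definition V_field :: "nspace \<Rightarrow> nspace" where
  "V_field P = ((\<chi> i. 2 * \<i> * Z_of P $ i), 0, 0, 0)"
  \<comment> \<open>a real vector field is given by its \<open>\<partial>/\<partial>Z\<^sup>i\<close> components; those along \<open>\<partial>/\<partial>cnj Z\<^sup>i\<close> are conjugate\<close>

definition r_squared :: "(complex^2 \<Rightarrow> complex) \<Rightarrow> complex^2 \<Rightarrow> real" where
  "r_squared \<FF> Z = - Re (\<Sum>i\<in>UNIV. \<Sum>j\<in>UNIV. of_real (Im (tau \<FF> Z i j)) * Z $ i * cnj (Z $ j))"

definition f_fun :: "(complex^2 \<Rightarrow> complex) \<Rightarrow> nat \<Rightarrow> real \<Rightarrow> nspace \<Rightarrow> real" where
  "f_fun \<FF> chi c P = 2 * pi * (r_squared \<FF> (Z_of P) - 8 * c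
     + real chi * Re (\<Sum>\<^sub>\<infinity>q\<in>UNIV - {0}. inst_eta q P (V_field P)))"

definition f3_fun :: "(complex^2 \<Rightarrow> complex) \<Rightarrow> nat \<Rightarrow> real \<Rightarrow> nspace \<Rightarrow> real" where
  "f3_fun \<FF> chi c P = f_fun \<FF> chi c P - 1 / 2 * g_N \<FF> chi P (V_field P) (V_field P)"

definition del :: "(complex^2 \<Rightarrow> real) \<Rightarrow> complex^2 \<Rightarrow> complex^2 \<Rightarrow> complex" where
  "del h Z X = (of_real (frechet_derivative h (at Z) X)
     - \<i> * of_real (frechet_derivative h (at Z) (\<i> *s X))) / 2"

definition delbar :: "(complex^2 \<Rightarrow> real) \<Rightarrow> complex^2 \<Rightarrow> complex^2 \<Rightarrow> complex" where
  "delbar h Z X = (of_real (frechet_derivative h (at Z) X)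
     + \<i> * of_real (frechet_derivative h (at Z) (\<i> *s X))) / 2"

definition d_c :: "(complex^2 \<Rightarrow> real) \<Rightarrow> complex^2 \<Rightarrow> complex^2 \<Rightarrow> real" where
  "d_c h Z X = Re (\<i> * (delbar h Z X - del h Z X))"

definition theta0 :: "(complex^2 \<Rightarrow> complex) \<Rightarrow> nat \<Rightarrow> real \<Rightarrow> nspace \<Rightarrow> nspace \<Rightarrow> real" where
  "theta0 \<FF> chi c P X = - 1 / 2 * frechet_derivative (f_fun \<FF> chi c) (at P) X"

definition theta1 :: "(complex^2 \<Rightarrow> complex) \<Rightarrow> nat \<Rightarrow> nspace \<Rightarrow> nspace \<Rightarrow> real" where
  "theta1 \<FF> chi P X = 1 / 2 * Im (omega12 \<FF> chi P (V_field P) X)"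

definition theta2 :: "(complex^2 \<Rightarrow> complex) \<Rightarrow> nat \<Rightarrow> nspace \<Rightarrow> nspace \<Rightarrow> real" where
  "theta2 \<FF> chi P X = - 1 / 2 * Re (omega12 \<FF> chi P (V_field P) X)"

definition theta3 :: "(complex^2 \<Rightarrow> complex) \<Rightarrow> nat \<Rightarrow> nspace \<Rightarrow> nspace \<Rightarrow> real" where
  "theta3 \<FF> chi P X =
     pi * (sigma_of X + (\<Sum>i\<in>UNIV. tzeta_of P $ i * zeta_of X $ i - zeta_of P $ i * tzeta_of X $ i))
     + pi / 2 * d_c (r_squared \<FF>) (Z_of P) (Z_of X)
     + 2 * pi * real chi * Re (\<Sum>\<^sub>\<infinity>q\<in>UNIV - {0}. inst_eta q P X)"

definition eta_form :: "(complex^2 \<Rightarrow> complex) \<Rightarrow> nat \<Rightarrow> nspace \<Rightarrow> nspace \<Rightarrow> real" where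
  "eta_form \<FF> chi P X = theta3 \<FF> chi P X - 1 / 2 * g_N \<FF> chi P (V_field P) X"

definition qk_form ::
  "(complex^2 \<Rightarrow> complex) \<Rightarrow> nat \<Rightarrow> real \<Rightarrow> nspace \<Rightarrow> nspace \<Rightarrow> nspace \<Rightarrow> real" where
  "qk_form \<FF> chi c P X Y = - 1 / f_fun \<FF> chi c P *
     (2 / f3_fun \<FF> chi c P * (eta_form \<FF> chi P X * eta_form \<FF> chi P Y) + g_N \<FF> chi P X Y
      - 2 / f_fun \<FF> chi c P *
        (theta0 \<FF> chi c P X * theta0 \<FF> chi c P Y + theta1 \<FF> chi P X * theta1 \<FF> chi P Y
         + theta2 \<FF> chi P X * theta2 \<FF> chi P Y + theta3 \<FF> chi P X * theta3 \<FF> chi P Y))"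

text \<open>The inclusion of the hypersurface \<open>Arg Z\<^sup>0 = 0\<close>, in the coordinates \<open>\<tau>\<^sub>2 = |Z\<^sup>0|\<close>, \<open>z\<^sup>1 = Z\<^sup>1 / Z\<^sup>0\<close>.\<close>

fun slice :: "iia \<Rightarrow> nspace" where
  "slice (\<tau>2, z, \<zeta>, \<zeta>t, \<sigma>) = (pair (of_real \<tau>2) (of_real \<tau>2 * z), \<zeta>, \<zeta>t, \<sigma>)"

definition qmap_metric ::
  "(complex^2 \<Rightarrow> complex) \<Rightarrow> nat \<Rightarrow> real \<Rightarrow> iia \<Rightarrow> iia \<Rightarrow> iia \<Rightarrow> real" where
  "qmap_metric \<FF> chi c p X Y = qk_form \<FF> chi c (slice p)
     (frechet_derivative slice (at p) X) (frechet_derivative slice (at p) Y)"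

definition qmap_metric_defined :: "(complex^2 \<Rightarrow> complex) \<Rightarrow> nat \<Rightarrow> real \<Rightarrow> iia \<Rightarrow> bool" where
  "qmap_metric_defined \<FF> chi c p \<longleftrightarrow> invertible (T_mat \<FF> chi (slice p)) \<and>
     f_fun \<FF> chi c (slice p) \<noteq> 0 \<and> f3_fun \<FF> chi c (slice p) \<noteq> 0"


section \<open>Isometries\<close>

definition positive_definite :: "('a::real_vector \<Rightarrow> 'a \<Rightarrow> real) \<Rightarrow> bool" where
  "positive_definite B \<longleftrightarrow> bilinear B \<and> (\<forall>X Y. B X Y = B Y X) \<and> (\<forall>X. X \<noteq> 0 \<longrightarrow> B X X > 0)"

primrec Ck_on :: "nat \<Rightarrow> 'a::real_normed_vector set \<Rightarrow> ('a \<Rightarrow> 'b::real_normed_vector) \<Rightarrow> bool" where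
  "Ck_on 0 S F \<longleftrightarrow> continuous_on S F"
| "Ck_on (Suc k) S F \<longleftrightarrow>
     F differentiable_on S \<and> (\<forall>v. Ck_on k S (\<lambda>x. frechet_derivative F (at x) v))"

definition smooth_on :: "'a::real_normed_vector set \<Rightarrow> ('a \<Rightarrow> 'b::real_normed_vector) \<Rightarrow> bool" where
  "smooth_on S F \<longleftrightarrow> (\<forall>k. Ck_on k S F)"

definition isometry_on ::
  "'a::real_normed_vector set \<Rightarrow> ('a \<Rightarrow> 'a \<Rightarrow> 'a \<Rightarrow> real) \<Rightarrow> ('a \<Rightarrow> 'a) \<Rightarrow> bool" where
  "isometry_on S g F \<longleftrightarrow> bij_betw F S S \<and> smooth_on S F \<and> smooth_on S (inv_into S F) \<and>
     (\<forall>p\<in>S. \<forall>X Y.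
        g (F p) (frechet_derivative F (at p) X) (frechet_derivative F (at p) Y) = g p X Y)"


section \<open>Semidirect products\<close>

definition semidirect ::
  "('a, 'm) monoid_scheme \<Rightarrow> ('b, 'n) monoid_scheme \<Rightarrow> ('a \<Rightarrow> 'b \<Rightarrow> 'b) \<Rightarrow> ('a \<times> 'b) monoid" where
  "semidirect G H \<phi> = \<lparr>carrier = carrier G \<times> carrier H,
     monoid.mult = (\<lambda>(g, h) (g', h'). (g \<otimes>\<^bsub>G\<^esub> g', h \<otimes>\<^bsub>H\<^esub> \<phi> g h')),
     one = (\<one>\<^bsub>G\<^esub>, \<one>\<^bsub>H\<^esub>)\<rparr>"

text \<open>
  If \<open>G\<close> and \<open>H\<close> act on \<open>E\<close>, \<open>H\<close> effectively, and \<open>G\<close> normalises \<open>H\<close> as transformations of \<open>E\<close>,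
  then \<open>g\<close> acts on \<open>H\<close> by conjugation, \<open>h \<mapsto> g h g\<^sup>-\<^sup>1\<close>. The pair \<open>(g, h)\<close> acts on \<open>E\<close> as \<open>h \<circ> g\<close>.
\<close>

definition conjugation ::
  "'x set \<Rightarrow> ('a \<Rightarrow> 'x \<Rightarrow> 'x) \<Rightarrow> ('b, 'n) monoid_scheme \<Rightarrow> ('b \<Rightarrow> 'x \<Rightarrow> 'x) \<Rightarrow> 'a \<Rightarrow> 'b \<Rightarrow> 'b" where
  "conjugation E actG H actH g h =
     (THE h'. h' \<in> carrier H \<and> (\<forall>x\<in>E. actH h' (actG g x) = actG g (actH h x)))"

definition semidirect_act ::
  "('a \<Rightarrow> 'x \<Rightarrow> 'x) \<Rightarrow> ('b \<Rightarrow> 'x \<Rightarrow> 'x) \<Rightarrow> 'a \<times> 'b \<Rightarrow> 'x \<Rightarrow> 'x" where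
  "semidirect_act actG actH = (\<lambda>(g, h) x. actH h (actG g x))"


section \<open>The groups and their actions\<close>

definition SL2Z :: "(int^2^2) monoid" where
  "SL2Z = \<lparr>carrier = {A. det A = 1}, monoid.mult = (**), one = mat 1\<rparr>"

fun iib_to_iia :: "iib \<Rightarrow> iia" where
  "iib_to_iia (\<tau>, z, cu1, c1, c0, \<psi>) =
     (let \<tau>1 = Re \<tau>; b = Re z in
      (Im \<tau>, z,
       pair \<tau>1 (- (cu1 - \<tau>1 * b)),
       pair (c0 - 1 / 6 * b\<^sup>2 * (cu1 - \<tau>1 * b)) (c1 + 1 / 2 * b * (cu1 - \<tau>1 * b)),
       - 2 * (\<psi> + 1 / 2 * \<tau>1 * c0) + c1 * (cu1 - \<tau>1 * b) - 1 / 6 * b * cu1 * (cu1 - \<tau>1 * b)))"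

fun S_duality_iib :: "int^2^2 \<Rightarrow> iib \<Rightarrow> iib" where
  "S_duality_iib A (\<tau>, z, cu1, c1, c0, \<psi>) =
     (let \<alpha> = A $ 0 $ 0; \<beta> = A $ 0 $ 1; \<gamma> = A $ 1 $ 0; \<delta> = A $ 1 $ 1; b = Re z; t = Im z in
      ((of_int \<alpha> * \<tau> + of_int \<beta>) / (of_int \<gamma> * \<tau> + of_int \<delta>),
       Complex (of_int \<gamma> * cu1 + of_int \<delta> * b) (cmod (of_int \<gamma> * \<tau> + of_int \<delta>) * t),
       of_int \<alpha> * cu1 + of_int \<beta> * b,
       c1,
       of_int \<delta> * c0 - of_int \<gamma> * \<psi>,
       - of_int \<beta> * c0 + of_int \<alpha> * \<psi>))"

definition S_duality :: "int^2^2 \<Rightarrow> iia \<Rightarrow> iia" where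
  "S_duality A p = iib_to_iia (S_duality_iib A (the_inv iib_to_iia p))"

definition R_add :: "real monoid" where
  "R_add = \<lparr>carrier = UNIV, monoid.mult = (+), one = 0\<rparr>"

fun R_act :: "real \<Rightarrow> iia \<Rightarrow> iia" where
  "R_act v (\<tau>2, z, \<zeta>, \<zeta>t, \<sigma>) =
     (\<tau>2, z + of_real v,
      pair (\<zeta> $ 0) (\<zeta> $ 1 + \<zeta> $ 0 * v),
      pair (\<zeta>t $ 0 + 1 / 6 * v ^ 3 * \<zeta> $ 0 + 1 / 2 * v\<^sup>2 * \<zeta> $ 1 - \<zeta>t $ 1 * v)
           (\<zeta>t $ 1 - 1 / 2 * \<zeta> $ 0 * v\<^sup>2 - v * \<zeta> $ 1),
      \<sigma>)"

definition Heis5 :: "((real^2) \<times> (real^2) \<times> real) monoid" where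
  "Heis5 = \<lparr>carrier = UNIV,
     monoid.mult = (\<lambda>(\<eta>, \<eta>t, \<kappa>) (\<eta>', \<eta>t', \<kappa>').
       (\<eta> + \<eta>', \<eta>t + \<eta>t', \<kappa> + \<kappa>' + (\<Sum>i\<in>UNIV. \<eta> $ i * \<eta>t' $ i - \<eta>t $ i * \<eta>' $ i))),
     one = (0, 0, 0)\<rparr>"

definition H4 :: "((real^2) \<times> (real^2) \<times> real) monoid" where
  "H4 = Heis5\<lparr>carrier := {(\<eta>, \<eta>t, \<kappa>). \<eta> $ 0 = 0}\<rparr>"

fun Heis5_act :: "(real^2) \<times> (real^2) \<times> real \<Rightarrow> iia \<Rightarrow> iia" where
  "Heis5_act (\<eta>, \<eta>t, \<kappa>) (\<tau>2, z, \<zeta>, \<zeta>t, \<sigma>) =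
     (\<tau>2, z, \<zeta> + \<eta>, \<zeta>t + \<eta>t, \<sigma> + \<kappa> + (\<Sum>i\<in>UNIV. \<zeta>t $ i * \<eta> $ i - \<zeta> $ i * \<eta>t $ i))"

definition R_H4 :: "(real \<times> ((real^2) \<times> (real^2) \<times> real)) monoid" where
  "R_H4 = semidirect R_add H4 (conjugation iia_space R_act H4 Heis5_act)"

definition R_H4_act :: "real \<times> ((real^2) \<times> (real^2) \<times> real) \<Rightarrow> iia \<Rightarrow> iia" where
  "R_H4_act = semidirect_act R_act Heis5_act"

definition SL2Z_R_H4 :: "((int^2^2) \<times> (real \<times> ((real^2) \<times> (real^2) \<times> real))) monoid" where
  "SL2Z_R_H4 = semidirect SL2Z R_H4 (conjugation iia_space S_duality R_H4 R_H4_act)"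

definition SL2Z_R_H4_act :: "(int^2^2) \<times> (real \<times> ((real^2) \<times> (real^2) \<times> real)) \<Rightarrow> iia \<Rightarrow> iia" where
  "SL2Z_R_H4_act = semidirect_act S_duality R_H4_act"

end

theory Submission
  imports Defs "HOL-Real_Asymp.Real_Asymp"
begin

text \<open>
  Poisson summation turns the instanton sums into lattice sums. Integrating Lipschitz' formulas for
  \<open>\<Sum>\<^sub>n (w + n)\<^sup>-\<^sup>2\<close> and \<open>\<Sum>\<^sub>n (w + n)\<^sup>-\<^sup>3\<close> at \<open>w = x + i a cosh s\<close> over \<open>s\<close> produces the Bessel functions, and the
  sums over \<open>q\<close> and \<open>k\<close> become \<open>E(\<tau>) = \<Sum> |m \<tau> + n|\<^sup>-\<^sup>3\<close> and \<open>G(\<tau>) = \<Sum> (m \<tau> + n)\<^sup>2 / |m \<tau> + n|\<^sup>5\<close>; the terms with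
  \<open>m = 0\<close> come from the \<open>\<zeta>(3)\<close> term of the prepotential and from the one-loop constant. In particular
  \<open>f = 4 \<pi> \<tau>\<^sub>2\<^sup>2 R\<^sub>1\<close>.

  In terms of the four complex one-forms \<open>a, c, p, d\<tau>\<close> (see \<open>forms\<close>) the metric is an explicit real quadratic
  form whose coefficients are rational in \<open>\<tau>\<^sub>2\<close>, \<open>t\<close>, \<open>E\<close> and \<open>G\<close>. Positivity follows from \<open>|G| \<le> E\<close>. With
  \<open>j = \<gamma> \<tau> + \<delta>\<close>, S-duality multiplies \<open>a\<close> and \<open>c\<close> by \<open>1/j\<close> and \<open>d\<tau>\<close> by \<open>1/j\<^sup>2\<close>, fixes \<open>p\<close>, multiplies \<open>t\<close> by \<open>|j|\<close>,
  \<open>E\<close> by \<open>|j|\<^sup>3\<close> and \<open>G\<close> by \<open>|j|\<^sup>3 cnj j / j\<close>; the quadratic form is invariant under these substitutions. The actions of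
  \<open>\<real>\<close> and \<open>H\<^sub>4\<close> fix all four forms and all coefficients. Finally, in type IIB coordinates \<open>R_H4\<close> consists
  of polynomial shifts that S-duality permutes.
\<close>

section \<open>Lipschitz' formulas\<close>

text \<open>The point \<open>x + i a cosh s\<close> is chosen because
  \<open>bessel_K \<nu> (2 pi q a)\<close> integrates
  \<open>exp (- 2 pi q a cosh s) cosh (\<nu> s)\<close>: the Fourier side of Lipschitz' formula
  becomes a Bessel series term by term, while on the lattice side v = sinh s leaves elementary
  integrals. The obstacle is weight two, where the sum of the absolute values over n, times cosh s,
  does not decay in s. Subtracting a telescoping series repairs this; its boundary terms produce the
  zero frequency 2 / a^2, whose sum over a = m Im \<tau> is a multiple of zeta(2), and exactly this
  constant is removed by \<open>c_l = chi / (192 pi)\<close>. G is the only companion of E that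
  occurs, because dE is a combination of E and G, and so are the sums of \<open>V_q\<close> and
  \<open>A_q\<close>. The semidirect products are given by conjugation inside the transformations of
  the ambient space. Hence the automorphisms are determined only once the inner group acts
  faithfully and is normalised; in return, faithfulness reduces every group identity to one between
  maps.\<close>

lemma Digamma_reflection_upper:
  fixes w :: complex
  assumes "Im w > 0"
  shows "Digamma (1 - w) - Digamma w =
    of_real pi * \<i> * (exp (2 * of_real pi * \<i> * w) + 1) / (exp (2 * of_real pi * \<i> * w) - 1)"
proof -
  have nz: "w \<notin> \<int>\<^sub>\<le>\<^sub>0" "1 - w \<notin> \<int>\<^sub>\<le>\<^sub>0"
    using assms by (auto elim!: nonpos_Ints_cases simp: complex_eq_iff)
  \<comment> \<open>Both sides of the reflection formula
    \<open>rGamma z * rGamma (1 - z) = sin (pi z) / pi\<close> are differentiated; the quotient is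
    pi cot(pi w), which is then written in exp(2 pi i w).\<close>
  have "((\<lambda>z. rGamma z * rGamma (1 - z)) has_field_derivative
      rGamma w * rGamma (1 - w) * (Digamma (1 - w) - Digamma w)) (at w)"
    using nz by (auto intro!: derivative_eq_intros simp: algebra_simps)
  moreover have "(\<lambda>z. rGamma z * rGamma (1 - z)) = (\<lambda>z::complex. sin (of_real pi * z) / of_real pi)"
    by (simp add: rGamma_reflection_complex)
  moreover have "((\<lambda>z::complex. sin (of_real pi * z) / of_real pi) has_field_derivative cos (of_real pi * w)) (at w)"
    by (auto intro!: derivative_eq_intros)
  ultimately have *: "sin (of_real pi * w) / of_real pi * (Digamma (1 - w) - Digamma w) = cos (of_real pi * w)"
    using DERIV_unique rGamma_reflection_complex by metis
  define Q where "Q = exp (of_real pi * \<i> * w)"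
  have Q0: "Q \<noteq> 0" by (simp add: Q_def)
  have Q2: "exp (2 * of_real pi * \<i> * w) = Q\<^sup>2"
    by (simp add: Q_def power2_eq_square mult_ac flip: exp_add)
  have s: "sin (of_real pi * w) = (Q - 1 / Q) / (2 * \<i>)" and c: "cos (of_real pi * w) = (Q + 1 / Q) / 2"
    by (simp_all add: sin_exp_eq' cos_exp_eq Q_def exp_minus field_simps)
  have "norm (exp (2 * of_real pi * \<i> * w)) < 1"
    using assms by simp
  hence Q1: "Q\<^sup>2 \<noteq> 1" unfolding Q2 by auto
  have q1: "Q - 1 / Q = (Q\<^sup>2 - 1) / Q" and q2: "Q + 1 / Q = (Q\<^sup>2 + 1) / Q"
    using Q0 by (auto simp: field_simps power2_eq_square)
  have "sin (of_real pi * w) \<noteq> 0" unfolding s q1 using Q0 Q1 by simp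
  hence "Digamma (1 - w) - Digamma w = of_real pi * (cos (of_real pi * w) / sin (of_real pi * w))"
    using * by (simp add: field_simps)
  also have "cos (of_real pi * w) / sin (of_real pi * w) = \<i> * (Q\<^sup>2 + 1) / (Q\<^sup>2 - 1)"
    unfolding s c q1 q2 using Q0 Q1 by (simp add: field_simps)
  finally show ?thesis unfolding Q2 by simp
qed

text \<open>Successive derivatives of \<open>Digamma_reflection_upper\<close>, an identity on the
  open upper half plane. The argument 1 - w contributes a sign each time, so sum and difference
  alternate.\<close>

lemma Polygamma_reflection_upper:
  fixes w :: complex
  assumes "Im w > 0"
  defines "Q \<equiv> exp (2 * of_real pi * \<i> * w)"
  shows "Polygamma 1 (1 - w) + Polygamma 1 w = - 4 * of_real pi ^ 2 * Q / (1 - Q)\<^sup>2"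
    and "Polygamma 2 w - Polygamma 2 (1 - w) = - 8 * of_real pi ^ 3 * \<i> * Q * (1 + Q) / (1 - Q) ^ 3"
proof -
  define q where "q = (\<lambda>w::complex. exp (2 * of_real pi * \<i> * w))"
  have q1: "q w \<noteq> 1" if "Im w > 0" for w
  proof -
    have "norm (q w) < 1" using that by (simp add: q_def)
    thus ?thesis by auto
  qed
  have dq: "(q has_field_derivative 2 * of_real pi * \<i> * q w) (at w)" for w
    unfolding q_def by (auto intro!: derivative_eq_intros)
  have nz: "w \<notin> \<int>\<^sub>\<le>\<^sub>0" "1 - w \<notin> \<int>\<^sub>\<le>\<^sub>0" if "Im w > 0" for w
    using that by (auto elim!: nonpos_Ints_cases simp: complex_eq_iff)
  have op: "open {w. Im w > 0}" by (rule open_halfspace_Im_gt)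
  have 1: "Polygamma 1 (1 - w) + Polygamma 1 w = - 4 * of_real pi ^ 2 * q w / (1 - q w)\<^sup>2"
    if w: "Im w > 0" for w
  proof -
    have "((\<lambda>w. Digamma (1 - w) - Digamma w) has_field_derivative - (Polygamma 1 (1 - w) + Polygamma 1 w)) (at w)"
      using nz[OF w] by (auto intro!: derivative_eq_intros)
    moreover have "((\<lambda>w. of_real pi * \<i> * (q w + 1) / (q w - 1)) has_field_derivative
        4 * of_real pi ^ 2 * q w / (1 - q w)\<^sup>2) (at w)"
      using q1[OF w] by (auto intro!: derivative_eq_intros dq simp: divide_simps power2_eq_square)
         (auto simp: algebra_simps)
    hence "((\<lambda>w. Digamma (1 - w) - Digamma w) has_field_derivative 4 * of_real pi ^ 2 * q w / (1 - q w)\<^sup>2) (at w)"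
      by (rule has_field_derivative_transform_within_open[OF _ op])
         (use w Digamma_reflection_upper in \<open>auto simp: q_def\<close>)
    ultimately show ?thesis using DERIV_unique by fastforce
  qed
  show "Polygamma 1 (1 - w) + Polygamma 1 w = - 4 * of_real pi ^ 2 * Q / (1 - Q)\<^sup>2"
    using 1[OF assms(1)] by (simp add: Q_def q_def)
  have "((\<lambda>w. Polygamma 1 (1 - w) + Polygamma 1 w) has_field_derivative (Polygamma 2 w - Polygamma 2 (1 - w))) (at w)"
    using nz[OF assms(1)] by (auto intro!: derivative_eq_intros simp: numeral_2_eq_2)
  moreover have "((\<lambda>w. - 4 * of_real pi ^ 2 * q w / (1 - q w)\<^sup>2) has_field_derivative
      - 8 * of_real pi ^ 3 * \<i> * q w * (1 + q w) / (1 - q w) ^ 3) (at w)"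
    using q1[OF assms(1)] by (auto intro!: derivative_eq_intros dq simp: divide_simps power2_eq_square power3_eq_cube)
       (auto simp: algebra_simps)
  hence "((\<lambda>w. Polygamma 1 (1 - w) + Polygamma 1 w) has_field_derivative
      - 8 * of_real pi ^ 3 * \<i> * q w * (1 + q w) / (1 - q w) ^ 3) (at w)"
    by (rule has_field_derivative_transform_within_open[OF _ op]) (use assms(1) 1 in auto)
  ultimately show "Polygamma 2 w - Polygamma 2 (1 - w) = - 8 * of_real pi ^ 3 * \<i> * Q * (1 + Q) / (1 - Q) ^ 3"
    using DERIV_unique unfolding Q_def q_def by fastforce
qed

lemma sums_Suc_mult_power:
  fixes z :: complex
  assumes "norm z < 1"
  shows "(\<lambda>n. of_nat (Suc n) * z ^ Suc n) sums (z / (1 - z)\<^sup>2)"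
  using sums_mult[OF geometric_deriv_sums[OF assms], of z] by (simp add: mult_ac)

text \<open>One more application of z d/dz to the geometric series: \<open>diffs\<close> yields the
  coefficients (n + 1)(n + 2), and removing n + 1 leaves (n + 1)^2.\<close>

lemma sums_Suc_square_mult_power:
  fixes z :: complex
  assumes "norm z < 1"
  shows "(\<lambda>n. of_nat (Suc n) ^ 2 * z ^ Suc n) sums (z * (1 + z) / (1 - z) ^ 3)"
proof -
  have "(\<lambda>n. diffs (\<lambda>n. of_nat (Suc n)) n * z ^ n) sums (2 / (1 - z) ^ 3)"
  proof (rule termdiffs_sums_strong)
    show "(\<lambda>n. of_nat (Suc n) * w ^ n) sums (1 / (1 - w)\<^sup>2)" if "norm w < 1" for w :: complex
      using geometric_deriv_sums[OF that] .
    have "z \<noteq> 1" using assms by auto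
    thus "((\<lambda>w. 1 / (1 - w)\<^sup>2) has_field_derivative 2 / (1 - z) ^ 3) (at z)"
      by (auto intro!: derivative_eq_intros simp: divide_simps power2_eq_square power3_eq_cube)
  qed (rule assms)
  from sums_mult[OF sums_diff[OF this geometric_deriv_sums[OF assms]], of z]
  have "(\<lambda>n. z * (diffs (\<lambda>n. of_nat (Suc n)) n * z ^ n - of_nat (Suc n) * z ^ n)) sums
      (z * (2 / (1 - z) ^ 3 - 1 / (1 - z)\<^sup>2))" .
  moreover have "z * (2 / (1 - z) ^ 3 - 1 / (1 - z)\<^sup>2) = z * (1 + z) / (1 - z) ^ 3"
  proof -
    have "z \<noteq> 1" using assms by auto
    thus ?thesis by (simp add: divide_simps power2_eq_square power3_eq_cube)
  qed
  moreover have "z * (diffs (\<lambda>n. of_nat (Suc n)) n * z ^ n - of_nat (Suc n) * z ^ n) = of_nat (Suc n) ^ 2 * z ^ Suc n" for n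
    by (simp add: diffs_def algebra_simps power2_eq_square)
  ultimately show ?thesis by (simp only:)
qed

text \<open>The series of \<open>Polygamma 1\<close> at w and at 1 - w run over the shifts n >= 0
  and n = - k - 1 < 0, so together they form the sum over all integers, which the reflection formula
  evaluates. The common value S stays existential because only the link between the two series is
  used.\<close>

lemma lipschitz_2:
  fixes w :: complex
  assumes "Im w > 0"
  shows "\<exists>S. (\<lambda>k. 1 / (w + of_nat k)\<^sup>2 + 1 / (w - of_nat k - 1)\<^sup>2) sums (- 4 * of_real pi ^ 2 * S) \<and>
         (\<lambda>n. of_nat (Suc n) * exp (2 * of_real pi * \<i> * w) ^ Suc n) sums S"
proof -
  define Q where "Q = exp (2 * of_real pi * \<i> * w)"
  have Q1: "norm Q < 1" using assms by (simp add: Q_def)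
  have nz: "w \<noteq> 0" "1 - w \<noteq> 0" using assms by auto
  have "(\<lambda>k. inverse ((w + of_nat k) ^ Suc 1) + inverse ((1 - w + of_nat k) ^ Suc 1)) sums
     ((-1) ^ Suc 1 * Polygamma 1 w / fact 1 + (-1) ^ Suc 1 * Polygamma 1 (1 - w) / fact 1)"
    by (intro sums_add Polygamma_LIMSEQ nz) auto
  also have "(\<lambda>k. inverse ((w + of_nat k) ^ Suc 1) + inverse ((1 - w + of_nat k) ^ Suc 1)) =
     (\<lambda>k. 1 / (w + of_nat k)\<^sup>2 + 1 / (w - of_nat k - 1)\<^sup>2)"
  proof
    fix k
    have "(1 - w + of_nat k)\<^sup>2 = (w - of_nat k - 1)\<^sup>2" by (simp add: power2_eq_square algebra_simps)
    thus "inverse ((w + of_nat k) ^ Suc 1) + inverse ((1 - w + of_nat k) ^ Suc 1) = 1 / (w + of_nat k)\<^sup>2 + 1 / (w - of_nat k - 1)\<^sup>2"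
      by (simp add: divide_inverse numeral_2_eq_2)
  qed
  also have "(-1) ^ Suc 1 * Polygamma 1 w / fact 1 + (-1) ^ Suc 1 * Polygamma 1 (1 - w) / fact 1 =
     - 4 * of_real pi ^ 2 * (Q / (1 - Q)\<^sup>2)"
    using Polygamma_reflection_upper(1)[OF assms] by (simp add: Q_def algebra_simps)
  finally show ?thesis using sums_Suc_mult_power[OF Q1] unfolding Q_def by blast
qed

text \<open>As in weight two, but the odd power reverses the sign of the terms coming from 1 - w, so
  the two \<open>Polygamma 2\<close> series are subtracted.\<close>

lemma lipschitz_3:
  fixes w :: complex
  assumes "Im w > 0"
  shows "\<exists>S. (\<lambda>k. 1 / (w + of_nat k) ^ 3 + 1 / (w - of_nat k - 1) ^ 3) sums (4 * of_real pi ^ 3 * \<i> * S) \<and>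
         (\<lambda>n. of_nat (Suc n) ^ 2 * exp (2 * of_real pi * \<i> * w) ^ Suc n) sums S"
proof -
  define Q where "Q = exp (2 * of_real pi * \<i> * w)"
  have Q1: "norm Q < 1" using assms by (simp add: Q_def)
  have nz: "w \<noteq> 0" "1 - w \<noteq> 0" using assms by auto
  have "(\<lambda>k. inverse ((w + of_nat k) ^ Suc 2) - inverse ((1 - w + of_nat k) ^ Suc 2)) sums
     ((-1) ^ Suc 2 * Polygamma 2 w / fact 2 - (-1) ^ Suc 2 * Polygamma 2 (1 - w) / fact 2)"
    by (intro sums_diff Polygamma_LIMSEQ nz) auto
  also have "(\<lambda>k. inverse ((w + of_nat k) ^ Suc 2) - inverse ((1 - w + of_nat k) ^ Suc 2)) =
     (\<lambda>k. 1 / (w + of_nat k) ^ 3 + 1 / (w - of_nat k - 1) ^ 3)"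
  proof
    fix k
    have "(w - of_nat k - 1) = - (1 - w + of_nat k)" by simp
    hence "(w - of_nat k - 1) ^ 3 = - ((1 - w + of_nat k) ^ 3)" by (metis power_minus_odd odd_numeral)
    thus "inverse ((w + of_nat k) ^ Suc 2) - inverse ((1 - w + of_nat k) ^ Suc 2) = 1 / (w + of_nat k) ^ 3 + 1 / (w - of_nat k - 1) ^ 3"
      by (simp add: divide_inverse numeral_3_eq_3 numeral_2_eq_2)
  qed
  also have "(-1) ^ Suc 2 * Polygamma 2 w / fact 2 - (-1) ^ Suc 2 * Polygamma 2 (1 - w) / fact 2 =
     - (Polygamma 2 w - Polygamma 2 (1 - w)) / 2"
    by (simp add: field_simps)
  also have "\<dots> = 4 * of_real pi ^ 3 * \<i> * (Q * (1 + Q) / (1 - Q) ^ 3)"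
    by (subst Polygamma_reflection_upper(2)[OF assms]) (simp add: Q_def mult.assoc)
  finally show ?thesis using sums_Suc_square_mult_power[OF Q1] unfolding Q_def by blast
qed

section \<open>Bessel functions and Poisson summation\<close>

text \<open>Dominated convergence for partial sums. The majorant h must bound the sums of absolute
  values uniformly in n; this requirement is what later asks for kernels of cubic decay.\<close>

lemma sums_integral_dominated:
  fixes F :: "nat \<Rightarrow> real \<Rightarrow> real"
  assumes int: "\<And>k. (F k has_integral y k) S" and h: "h integrable_on S"
    and bound: "\<And>n s. s \<in> S \<Longrightarrow> (\<Sum>k<n. \<bar>F k s\<bar>) \<le> h s"
    and sums: "\<And>s. s \<in> S \<Longrightarrow> (\<lambda>k. F k s) sums G s"
  shows "y sums integral S G"
proof -
  have i: "((\<lambda>s. \<Sum>k<n. F k s) has_integral (\<Sum>k<n. y k)) S" for n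
    by (intro has_integral_sum int) auto
  have "(\<lambda>n. integral S (\<lambda>s. \<Sum>k<n. F k s)) \<longlonglongrightarrow> integral S G"
  proof (rule dominated_convergence(2))
    show "(\<lambda>s. \<Sum>k<n. F k s) integrable_on S" for n using i by blast
    show "norm (\<Sum>k<n. F k s) \<le> h s" if "s \<in> S" for n s
      using order_trans[OF sum_abs[of "\<lambda>k. F k s" "{..<n}"] bound[OF that]] by simp
    show "(\<lambda>n. \<Sum>k<n. F k s) \<longlonglongrightarrow> G s" if "s \<in> S" for s
      using sums[OF that] by (simp add: sums_def)
  qed (rule h)
  thus ?thesis using integral_unique[OF i] by (simp add: sums_def)
qed

lemma has_integral_to_inf_antiderivative:
  fixes \<phi> \<Phi> :: "real \<Rightarrow> real"
  assumes der: "\<And>s. s \<ge> 0 \<Longrightarrow> (\<Phi> has_real_derivative \<phi> s) (at s)"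
    and nonneg: "\<And>s. s \<ge> 0 \<Longrightarrow> \<phi> s \<ge> 0" and lim: "(\<Phi> \<longlongrightarrow> L) at_top" and zero: "\<Phi> 0 = 0"
  shows "(\<phi> has_integral L) {0..}"
proof -
  have int: "(\<phi> has_integral \<Phi> y) {0..y}" if "y \<ge> 0" for y
    using fundamental_theorem_of_calculus[of 0 y \<Phi> \<phi>] that der zero
    by (simp add: has_real_derivative_iff_has_vector_derivative[symmetric] has_field_derivative_at_within)
  show ?thesis
  proof (rule has_integral_to_inf)
    show "\<phi> integrable_on {0..y}" for y using int[of y] by (cases "y \<ge> 0") auto
    have "eventually (\<lambda>y. integral {0..y} \<phi> = \<Phi> y) at_top"
      using eventually_ge_at_top[of 0] by eventually_elim (use int in auto)
    thus "((\<lambda>y. integral {0..y} \<phi>) \<longlongrightarrow> L) at_top" using lim by (simp add: filterlim_cong)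
  qed (use nonneg in auto)
qed

lemma sinh_at_top: "filterlim (sinh :: real \<Rightarrow> real) at_top at_top"
  by real_asymp

text \<open>Under v = sinh s these are the integrals over v >= 0 of (\<rho>^2 + a^2 v^2)^(-k) for k
  = 1, 2, 3. \<open>P1\<close> is the arctangent, and \<open>P2\<close>, \<open>P3\<close> follow
  from it by the usual reduction formula for the exponent.\<close>

lemma has_integral_cosh_over_power:
  fixes a \<rho> :: real
  assumes a: "a > 0" and \<rho>: "\<rho> > 0"
  shows "((\<lambda>s. cosh s / (\<rho>\<^sup>2 + a\<^sup>2 * (sinh s)\<^sup>2)) has_integral pi / (2 * a * \<rho>)) {0..}" (is ?A)
    and "((\<lambda>s. cosh s / (\<rho>\<^sup>2 + a\<^sup>2 * (sinh s)\<^sup>2)\<^sup>2) has_integral pi / (4 * a * \<rho> ^ 3)) {0..}" (is ?B)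
    and "((\<lambda>s. cosh s / (\<rho>\<^sup>2 + a\<^sup>2 * (sinh s)\<^sup>2) ^ 3) has_integral 3 * pi / (16 * a * \<rho> ^ 5)) {0..}" (is ?C)
proof -
  define N where "N = (\<lambda>v. \<rho>\<^sup>2 + a\<^sup>2 * v\<^sup>2)"
  define P1 where "P1 = (\<lambda>v. arctan (a * v / \<rho>) / (a * \<rho>))"
  define P2 where "P2 = (\<lambda>v. (v / N v + P1 v) / (2 * \<rho>\<^sup>2))"
  define P3 where "P3 = (\<lambda>v. (v / (N v)\<^sup>2 + 3 * P2 v) / (4 * \<rho>\<^sup>2))"
  have N0: "N v > 0" for v using \<rho> by (auto simp: N_def intro: add_pos_nonneg)
  have dN: "(N has_real_derivative 2 * a\<^sup>2 * v) (at v)" for v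
    unfolding N_def by (auto intro!: derivative_eq_intros)
  have d1: "(P1 has_real_derivative 1 / N v) (at v)" for v
  proof -
    have "(P1 has_real_derivative inverse (1 + (a * v / \<rho>)\<^sup>2) * (a / \<rho>) / (a * \<rho>)) (at v)"
      unfolding P1_def using a \<rho> by (auto intro!: derivative_eq_intros)
    moreover have "inverse (1 + (a * v / \<rho>)\<^sup>2) * (a / \<rho>) / (a * \<rho>) = 1 / N v"
    proof -
      have "1 + (a * v / \<rho>)\<^sup>2 = N v / \<rho>\<^sup>2" using \<rho> by (simp add: N_def field_simps)
      thus ?thesis using a \<rho> N0[of v] by (simp add: field_simps power2_eq_square)
    qed
    ultimately show ?thesis by simp
  qed
  have alg2: "((1 * N v - v * (2 * a\<^sup>2 * v)) / (N v * N v) + 1 / N v) / (2 * \<rho>\<^sup>2) = 1 / (N v)\<^sup>2" for v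
  proof -
    have e: "1 * N v - v * (2 * a\<^sup>2 * v) + N v = 2 * \<rho>\<^sup>2" by (simp add: N_def power2_eq_square algebra_simps)
    have "((1 * N v - v * (2 * a\<^sup>2 * v)) / (N v * N v) + 1 / N v) = (1 * N v - v * (2 * a\<^sup>2 * v) + N v) / (N v)\<^sup>2"
      using N0[of v] by (simp add: field_simps power2_eq_square)
    thus ?thesis unfolding e using \<rho> by simp
  qed
  have d2: "(P2 has_real_derivative 1 / (N v)\<^sup>2) (at v)" for v
  proof -
    have "(P2 has_real_derivative ((1 * N v - v * (2 * a\<^sup>2 * v)) / (N v * N v) + 1 / N v) / (2 * \<rho>\<^sup>2)) (at v)"
      unfolding P2_def using N0[of v] \<rho>
      by (intro DERIV_cdivide DERIV_add DERIV_divide d1 dN DERIV_ident) auto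
    thus ?thesis unfolding alg2 .
  qed
  have d3: "(P3 has_real_derivative 1 / (N v) ^ 3) (at v)" for v
  proof -
    have n: "N v \<noteq> 0" "\<rho> \<noteq> 0" using N0[of v] \<rho> by auto
    have "(P3 has_real_derivative ((1 * (N v)\<^sup>2 - v * (2 * N v * (2 * a\<^sup>2 * v))) / ((N v)\<^sup>2 * (N v)\<^sup>2) + 3 * (1 / (N v)\<^sup>2)) / (4 * \<rho>\<^sup>2)) (at v)"
    proof -
      have "((\<lambda>v. (N v)\<^sup>2) has_real_derivative 2 * N v * (2 * a\<^sup>2 * v)) (at v)"
        by (auto intro!: derivative_eq_intros dN)
      thus ?thesis unfolding P3_def using n
        by (intro DERIV_cdivide DERIV_add DERIV_divide DERIV_cmult d2 DERIV_ident) auto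
    qed
    moreover have "((1 * (N v)\<^sup>2 - v * (2 * N v * (2 * a\<^sup>2 * v))) / ((N v)\<^sup>2 * (N v)\<^sup>2) + 3 * (1 / (N v)\<^sup>2)) = (4 * \<rho>\<^sup>2) / (N v) ^ 3"
    proof -
      have e: "N v - 4 * a\<^sup>2 * v\<^sup>2 + 3 * N v = 4 * \<rho>\<^sup>2" by (simp add: N_def algebra_simps)
      have "((1 * (N v)\<^sup>2 - v * (2 * N v * (2 * a\<^sup>2 * v))) / ((N v)\<^sup>2 * (N v)\<^sup>2) + 3 * (1 / (N v)\<^sup>2)) = (N v - 4 * a\<^sup>2 * v\<^sup>2 + 3 * N v) / (N v) ^ 3"
        using n by (simp add: divide_simps) (simp add: algebra_simps eval_nat_numeral)
      thus ?thesis unfolding e .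
    qed
    ultimately show ?thesis using n by simp
  qed
  have l1: "(P1 \<longlongrightarrow> pi / 2 / (a * \<rho>)) at_top"
  proof -
    have "filterlim (\<lambda>v. a * v / \<rho>) at_top at_top" using a \<rho> by real_asymp
    hence "((\<lambda>v. arctan (a * v / \<rho>)) \<longlongrightarrow> pi / 2) at_top"
      by (rule filterlim_compose[OF tendsto_arctan_at_top])
    thus ?thesis unfolding P1_def using a \<rho> by (intro tendsto_intros) auto
  qed
  have l2: "(P2 \<longlongrightarrow> (0 + pi / 2 / (a * \<rho>)) / (2 * \<rho>\<^sup>2)) at_top"
  proof -
    have "((\<lambda>v. v / N v) \<longlongrightarrow> 0) at_top" unfolding N_def using a \<rho> by real_asymp
    thus ?thesis unfolding P2_def using \<rho> by (intro tendsto_intros l1) auto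
  qed
  have l3: "(P3 \<longlongrightarrow> (0 + 3 * ((0 + pi / 2 / (a * \<rho>)) / (2 * \<rho>\<^sup>2))) / (4 * \<rho>\<^sup>2)) at_top"
  proof -
    have "((\<lambda>v. v / (N v)\<^sup>2) \<longlongrightarrow> 0) at_top" unfolding N_def using a \<rho> by real_asymp
    thus ?thesis unfolding P3_def using \<rho> by (intro tendsto_intros l2) auto
  qed
  have comp: "((\<lambda>s. cosh s / (N (sinh s)) ^ k) has_integral L) {0..}"
    if d: "\<And>v. (P has_real_derivative 1 / (N v) ^ k) (at v)" and l: "(P \<longlongrightarrow> L) at_top" and z: "P 0 = 0" for P L k
  proof (rule has_integral_to_inf_antiderivative[where \<Phi> = "\<lambda>s. P (sinh s)"])
    show "((\<lambda>s. P (sinh s)) has_real_derivative cosh s / (N (sinh s)) ^ k) (at s)" for s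
    proof -
      have "(sinh has_real_derivative cosh s) (at s)" by (auto intro!: derivative_eq_intros)
      from DERIV_chain2[OF d this] show ?thesis by simp
    qed
    show "((\<lambda>s. P (sinh s)) \<longlongrightarrow> L) at_top" by (rule filterlim_compose[OF l sinh_at_top])
  qed (use z N0 in \<open>auto intro: less_imp_le simp: less_imp_le\<close>)
  have z: "P1 0 = 0" "P2 0 = 0" "P3 0 = 0" by (simp_all add: P1_def P2_def P3_def)
  show ?A using comp[of P1 1, OF _ l1] d1 z(1) by (simp add: N_def mult_ac)
  show ?B using comp[of P2 2, OF _ l2] d2 z(2) by (simp add: N_def power2_eq_square power3_eq_cube mult_ac)
  show ?C using comp[of P3 3, OF _ l3] d3 z(3) by (simp add: N_def power2_eq_square power3_eq_cube mult_ac eval_nat_numeral)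
qed

text \<open>Since |y + i a cosh s|^2 = \<rho>^2 + a^2 sinh(s)^2, each integrand is cosh s times a
  combination of inverse powers of this quantity with coefficients depending on y only. In the third
  one the factor cosh s is supplied by the imaginary part of an odd power. The first one serves the
  telescoping correction in weight two.\<close>

lemma kernel_integrals:
  fixes a y :: real
  assumes a: "a > 0"
  defines "\<rho> \<equiv> cmod (Complex y a)"
  shows "((\<lambda>s. cosh s * Re (1 / Complex y (a * cosh s))) has_integral pi * y / (2 * a * \<rho>)) {0..}"
    and "((\<lambda>s. cosh s * Re (1 / Complex y (a * cosh s) ^ 2)) has_integral - (pi * a / 2) / \<rho> ^ 3) {0..}"
    and "((\<lambda>s. Im (1 / Complex y (a * cosh s) ^ 3)) has_integral pi / 4 * (a\<^sup>2 - 2 * y\<^sup>2) / \<rho> ^ 5) {0..}"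
    and "((\<lambda>s. cosh s * Re (1 / Complex y (a * cosh s) ^ 3)) has_integral - (3 * pi * a / 4) * y / \<rho> ^ 5) {0..}"
proof -
  have \<rho>2: "\<rho>\<^sup>2 = y\<^sup>2 + a\<^sup>2" by (simp add: \<rho>_def cmod_power2)
  have \<rho>: "\<rho> > 0" using a by (auto simp: \<rho>_def complex_eq_iff)
  note J = has_integral_cosh_over_power[OF a \<rho>]
  define N where "N s = \<rho>\<^sup>2 + a\<^sup>2 * (sinh s)\<^sup>2" for s
  note J' = J[folded N_def]
  have N: "N s = y\<^sup>2 + (a * cosh s)\<^sup>2" for s
    unfolding N_def \<rho>2 power_mult_distrib by (simp add: cosh_square_eq algebra_simps)
  have N0: "N s > 0" for s using \<rho> by (auto simp: N_def intro: add_pos_nonneg)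
  have inv: "1 / Complex y u = Complex (y / (y\<^sup>2 + u\<^sup>2)) (- u / (y\<^sup>2 + u\<^sup>2))" for u
    by (simp add: complex_eq_iff divide_complex_def)
  have p2: "Complex p q ^ 2 = Complex (p\<^sup>2 - q\<^sup>2) (2 * p * q)" for p q
    by (simp add: complex_eq_iff power2_eq_square)
  have p3: "Complex p q ^ 3 = Complex (p ^ 3 - 3 * p * q\<^sup>2) (3 * p\<^sup>2 * q - q ^ 3)" for p q
    by (simp add: complex_eq_iff power2_eq_square power3_eq_cube algebra_simps)
  have r1: "Re (1 / Complex y (a * cosh s)) = y * (1 / N s)" for s
    unfolding inv N by simp
  have r2: "Re (1 / Complex y (a * cosh s) ^ 2) = 2 * y\<^sup>2 * (1 / (N s)\<^sup>2) - 1 / N s" for s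
  proof -
    have "Re (1 / Complex y (a * cosh s) ^ 2) = (y / N s)\<^sup>2 - (- (a * cosh s) / N s)\<^sup>2"
      unfolding power_one_over[symmetric] inv N[symmetric] by (simp only: p2 complex.sel)
    also have "\<dots> = (2 * y\<^sup>2 - N s) / (N s)\<^sup>2" using N0[of s]
      by (simp add: power_divide N diff_divide_distrib add_divide_distrib)
    also have "\<dots> = 2 * y\<^sup>2 * (1 / (N s)\<^sup>2) - 1 / N s" using N0[of s]
      by (simp add: diff_divide_distrib power2_eq_square)
    finally show ?thesis .
  qed
  have N23: "1 / (N s)\<^sup>2 = N s / (N s) ^ 3" for s
    using N0[of s] by (simp add: power2_eq_square power3_eq_cube)
  have r3: "Re (1 / Complex y (a * cosh s) ^ 3) = 4 * y ^ 3 * (1 / (N s) ^ 3) - 3 * y * (1 / (N s)\<^sup>2)" for s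
  proof -
    have "Re (1 / Complex y (a * cosh s) ^ 3) = (y / N s) ^ 3 - 3 * (y / N s) * (- (a * cosh s) / N s)\<^sup>2"
      unfolding power_one_over[symmetric] inv N[symmetric] by (simp only: p3 complex.sel)
    also have "\<dots> = (y ^ 3 - 3 * y * (N s - y\<^sup>2)) / (N s) ^ 3"
      using N0[of s] by (simp add: N power_divide diff_divide_distrib add_divide_distrib power2_eq_square power3_eq_cube)
    also have "\<dots> = 4 * y ^ 3 * (1 / (N s) ^ 3) - 3 * y * (1 / (N s)\<^sup>2)"
    proof -
      have e: "y ^ 3 - 3 * y * (N s - y\<^sup>2) = 4 * y ^ 3 - 3 * y * N s"
        by (simp add: algebra_simps power2_eq_square power3_eq_cube)
      show ?thesis unfolding N23 e by (simp add: diff_divide_distrib)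
    qed
    finally show ?thesis .
  qed
  have i3: "Im (1 / Complex y (a * cosh s) ^ 3) = a * (cosh s / (N s)\<^sup>2) - 4 * y\<^sup>2 * a * (cosh s / (N s) ^ 3)" for s
  proof -
    have "Im (1 / Complex y (a * cosh s) ^ 3) = 3 * (y / N s)\<^sup>2 * (- (a * cosh s) / N s) - (- (a * cosh s) / N s) ^ 3"
      unfolding power_one_over[symmetric] inv N[symmetric] by (simp only: p3 complex.sel)
    also have "\<dots> = (a * cosh s) * (- 3 * y\<^sup>2 + (N s - y\<^sup>2)) / (N s) ^ 3"
      using N0[of s] by (simp add: N power_divide diff_divide_distrib add_divide_distrib power2_eq_square power3_eq_cube algebra_simps)
    also have "\<dots> = a * (cosh s * (1 / (N s)\<^sup>2)) - 4 * y\<^sup>2 * a * (cosh s / (N s) ^ 3)"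
      unfolding N23 by (simp add: diff_divide_distrib[symmetric] algebra_simps)
    also have "\<dots> = a * (cosh s / (N s)\<^sup>2) - 4 * y\<^sup>2 * a * (cosh s / (N s) ^ 3)" by simp
    finally show ?thesis .
  qed
  show "((\<lambda>s. cosh s * Re (1 / Complex y (a * cosh s))) has_integral pi * y / (2 * a * \<rho>)) {0..}"
    using has_integral_mult_right[OF J'(1), of y] by (simp add: r1 mult_ac)
  have "((\<lambda>s. 2 * y\<^sup>2 * (cosh s / (N s)\<^sup>2) - cosh s / N s) has_integral (2 * y\<^sup>2 * (pi / (4 * a * \<rho> ^ 3)) - pi / (2 * a * \<rho>))) {0..}"
    by (intro has_integral_diff has_integral_mult_right J')
  moreover have "2 * y\<^sup>2 * (pi / (4 * a * \<rho> ^ 3)) - pi / (2 * a * \<rho>) = - (pi * a / 2) / \<rho> ^ 3"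
  proof -
    have "2 * y\<^sup>2 * (pi / (4 * a * \<rho> ^ 3)) - pi / (2 * a * \<rho>) = pi / (2 * a * \<rho> ^ 3) * (y\<^sup>2 - \<rho>\<^sup>2)"
      using a \<rho> by (simp add: divide_simps) (simp add: algebra_simps power2_eq_square power3_eq_cube)
    also have "\<dots> = - (pi * a / 2) / \<rho> ^ 3" unfolding \<rho>2 using a \<rho> by (simp add: field_simps power2_eq_square)
    finally show ?thesis .
  qed
  moreover have "2 * y\<^sup>2 * (cosh s / (N s)\<^sup>2) - cosh s / N s = cosh s * Re (1 / Complex y (a * cosh s) ^ 2)" for s
    unfolding r2 by (simp add: algebra_simps)
  ultimately show "((\<lambda>s. cosh s * Re (1 / Complex y (a * cosh s) ^ 2)) has_integral - (pi * a / 2) / \<rho> ^ 3) {0..}"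
    by simp
  have "((\<lambda>s. a * (cosh s / (N s)\<^sup>2) - 4 * y\<^sup>2 * a * (cosh s / (N s) ^ 3)) has_integral (a * (pi / (4 * a * \<rho> ^ 3)) - 4 * y\<^sup>2 * a * (3 * pi / (16 * a * \<rho> ^ 5)))) {0..}"
    by (intro has_integral_diff has_integral_mult_right J')
  moreover have "a * (pi / (4 * a * \<rho> ^ 3)) - 4 * y\<^sup>2 * a * (3 * pi / (16 * a * \<rho> ^ 5)) = pi / 4 * (a\<^sup>2 - 2 * y\<^sup>2) / \<rho> ^ 5"
  proof -
    have "a * (pi / (4 * a * \<rho> ^ 3)) - 4 * y\<^sup>2 * a * (3 * pi / (16 * a * \<rho> ^ 5)) = pi / (4 * \<rho> ^ 5) * (\<rho>\<^sup>2 - 3 * y\<^sup>2)"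
      using a \<rho> by (simp add: divide_simps) (simp add: algebra_simps eval_nat_numeral)
    also have "\<dots> = pi / 4 * (a\<^sup>2 - 2 * y\<^sup>2) / \<rho> ^ 5" unfolding \<rho>2 by simp
    finally show ?thesis .
  qed
  ultimately show "((\<lambda>s. Im (1 / Complex y (a * cosh s) ^ 3)) has_integral pi / 4 * (a\<^sup>2 - 2 * y\<^sup>2) / \<rho> ^ 5) {0..}"
    unfolding i3 by simp
  have "((\<lambda>s. 4 * y ^ 3 * (cosh s / (N s) ^ 3) - 3 * y * (cosh s / (N s)\<^sup>2)) has_integral (4 * y ^ 3 * (3 * pi / (16 * a * \<rho> ^ 5)) - 3 * y * (pi / (4 * a * \<rho> ^ 3)))) {0..}"
    by (intro has_integral_diff has_integral_mult_right J')
  moreover have "4 * y ^ 3 * (3 * pi / (16 * a * \<rho> ^ 5)) - 3 * y * (pi / (4 * a * \<rho> ^ 3)) = - (3 * pi * a / 4) * y / \<rho> ^ 5"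
  proof -
    have "4 * y ^ 3 * (3 * pi / (16 * a * \<rho> ^ 5)) - 3 * y * (pi / (4 * a * \<rho> ^ 3)) = 3 * pi * y / (4 * a * \<rho> ^ 5) * (y\<^sup>2 - \<rho>\<^sup>2)"
      using a \<rho> by (simp add: divide_simps) (simp add: algebra_simps eval_nat_numeral)
    also have "\<dots> = - (3 * pi * a / 4) * y / \<rho> ^ 5" unfolding \<rho>2 using a by (simp add: field_simps power2_eq_square)
    finally show ?thesis .
  qed
  moreover have "4 * y ^ 3 * (cosh s / (N s) ^ 3) - 3 * y * (cosh s / (N s)\<^sup>2) = cosh s * Re (1 / Complex y (a * cosh s) ^ 3)" for s
    unfolding r3 by (simp add: algebra_simps)
  ultimately show "((\<lambda>s. cosh s * Re (1 / Complex y (a * cosh s) ^ 3)) has_integral - (3 * pi * a / 4) * y / \<rho> ^ 5) {0..}"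
    by simp
qed

text \<open>Im w = m Im \<tau> controls m, and then n = w - m \<tau> controls n. The constant
  depends on \<tau> only through \<epsilon> and R, so that it also serves the termwise
  differentiation on a ball. The factor 2 absorbs the summand 1, as |m| + |n| >= 1.\<close>

lemma lattice_norm_bound:
  fixes \<tau> :: complex and m n :: int
  assumes \<epsilon>: "\<epsilon> > 0" "Im \<tau> \<ge> \<epsilon>" and R: "cmod \<tau> \<le> R" and mn: "(m, n) \<noteq> (0, 0)"
  shows "1 + \<bar>real_of_int m\<bar> + \<bar>real_of_int n\<bar> \<le> 2 * (1 + (1 + R) / \<epsilon>) * cmod (of_int m * \<tau> + of_int n)"
proof -
  define w where "w = of_int m * \<tau> + of_int n"
  have "\<bar>real_of_int m\<bar> * \<epsilon> \<le> \<bar>real_of_int m\<bar> * Im \<tau>" using \<epsilon> by (intro mult_left_mono) auto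
  also have "\<dots> = \<bar>Im w\<bar>" using \<epsilon> by (simp add: w_def abs_mult)
  also have "\<dots> \<le> cmod w" by (rule abs_Im_le_cmod)
  finally have m: "\<bar>real_of_int m\<bar> \<le> cmod w / \<epsilon>" using \<epsilon> by (simp add: field_simps)
  have "\<bar>real_of_int n\<bar> = cmod (w - of_int m * \<tau>)" by (simp add: w_def)
  also have "\<dots> \<le> cmod w + \<bar>real_of_int m\<bar> * cmod \<tau>" by (metis norm_triangle_ineq4 norm_mult norm_of_int)
  also have "\<dots> \<le> cmod w + cmod w / \<epsilon> * R" using m R \<epsilon> by (intro add_mono mult_mono) auto
  finally have n: "\<bar>real_of_int n\<bar> \<le> cmod w + cmod w / \<epsilon> * R" .
  have "1 \<le> \<bar>m\<bar> + \<bar>n\<bar>" using mn by auto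
  hence "1 \<le> \<bar>real_of_int m\<bar> + \<bar>real_of_int n\<bar>" by linarith
  moreover have "1 + A + B \<le> 2 * (A + B)" if "1 \<le> A + B" for A B :: real using that by simp
  ultimately have "1 + \<bar>real_of_int m\<bar> + \<bar>real_of_int n\<bar> \<le> 2 * (\<bar>real_of_int m\<bar> + \<bar>real_of_int n\<bar>)" by blast
  also have "\<dots> \<le> 2 * (cmod w / \<epsilon> + (cmod w + cmod w / \<epsilon> * R))" by (intro mult_left_mono add_mono m n) auto
  also have "\<dots> = 2 * (1 + (1 + R) / \<epsilon>) * cmod w" using \<epsilon> by (simp add: field_simps)
  finally show ?thesis by (simp add: w_def)
qed

text \<open>The exponent 3/2 is the half of the cubic decay that is reserved for the index; it
  exceeds 1, which is enough for convergence.\<close>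

lemma summable_kernel_powr:
  fixes x a :: real
  assumes a: "a > 0"
  shows "summable (\<lambda>k. cmod (Complex (x + real k) a) powr (- 3 / 2))"
    and "summable (\<lambda>k. cmod (Complex (x - real k - 1) a) powr (- 3 / 2))"
proof -
  define C where "C = 2 * (1 + (1 + cmod (Complex x a)) / a)"
  have C: "C > 0" using a by (auto simp: C_def intro!: mult_pos_pos add_pos_nonneg divide_nonneg_pos)
  have b: "cmod (Complex (x + of_int n) a) powr (- 3 / 2) \<le> C powr (3 / 2) * real (Suc k) powr (- 3 / 2)"
    if "real k \<le> \<bar>real_of_int n\<bar>" for n k
  proof -
    have e: "of_int 1 * Complex x a + of_int n = Complex (x + of_int n) a" by (simp add: complex_eq_iff)
    have 1: "real (Suc k) \<le> C * cmod (Complex (x + of_int n) a)"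
      using lattice_norm_bound[of a "Complex x a" "cmod (Complex x a)" 1 n] a that
      unfolding e C_def by simp
    hence "real (Suc k) / C \<le> cmod (Complex (x + of_int n) a)" using C by (simp add: field_simps)
    hence "cmod (Complex (x + of_int n) a) powr (- 3 / 2) \<le> (real (Suc k) / C) powr (- 3 / 2)"
      using C by (intro powr_mono2') auto
    also have "\<dots> = C powr (3 / 2) * real (Suc k) powr (- 3 / 2)"
      using C by (simp add: powr_divide powr_minus field_simps)
    finally show ?thesis .
  qed
  have "summable (\<lambda>k. real (Suc k) powr (- 3 / 2))"
    by (subst summable_Suc_iff) (simp add: summable_real_powr_iff)
  hence s: "summable (\<lambda>k. C powr (3 / 2) * real (Suc k) powr (- 3 / 2))" by (rule summable_mult)
  show "summable (\<lambda>k. cmod (Complex (x + real k) a) powr (- 3 / 2))"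
    by (rule summable_comparison_test'[OF s, of 0]) (use b[of _ "int _"] in auto)
  show "summable (\<lambda>k. cmod (Complex (x - real k - 1) a) powr (- 3 / 2))"
  proof (rule summable_comparison_test'[OF s, of 0])
    fix k :: nat
    have "x - real k - 1 = x + of_int (- int k - 1)" by simp
    thus "norm (cmod (Complex (x - real k - 1) a) powr (- 3 / 2)) \<le> C powr (3 / 2) * real (Suc k) powr (- 3 / 2)"
      using b[of k "- int k - 1"] by (simp add: algebra_simps)
  qed
qed

text \<open>The cubic decay is shared equally. One half becomes |y + i a|^(-3/2), summable over the
  shifts of y; the other half, (a cosh s)^(-3/2), multiplied by cosh s leaves cosh(s)^(-1/2), which
  decays like exp(- s / 2).\<close>

lemma kernel_dominated:
  fixes a y s p :: real
  assumes a: "a > 0"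
    and p: "cmod (Complex y (a * cosh s)) powr (3 / 2) * (a * cosh s) powr (3 / 2) \<le> p"
  shows "cosh s / p \<le> a powr (- 3 / 2) * 2 powr (1 / 2) * exp (- (1 / 2) * s) * cmod (Complex y a) powr (- 3 / 2)"
proof -
  have c: "cosh s > 0" by (simp add: cosh_real_pos)
  have c1: "cosh s \<ge> 1" by (simp add: cosh_real_ge_1)
  have y: "cmod (Complex y a) > 0" using a by (auto simp: complex_eq_iff)
  have "a \<le> a * cosh s" using a c1 by simp
  hence "a\<^sup>2 \<le> (a * cosh s)\<^sup>2" using a by (intro power_mono) auto
  hence "cmod (Complex y a) \<le> cmod (Complex y (a * cosh s))"
    unfolding complex_norm by (intro real_sqrt_le_mono) simp
  hence "cmod (Complex y a) powr (3 / 2) * (a * cosh s) powr (3 / 2) \<le> p"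
    using y by (intro order_trans[OF mult_right_mono p] powr_mono2) auto
  moreover from this have "p > 0" by (rule less_le_trans[rotated]) (use y a c in \<open>intro mult_pos_pos, auto\<close>)
  ultimately have "cosh s / p \<le> cosh s / (cmod (Complex y a) powr (3 / 2) * (a * cosh s) powr (3 / 2))"
    using y a c by (intro divide_left_mono mult_pos_pos) auto
  also have "\<dots> = a powr (- 3 / 2) * (cosh s * cosh s powr (- 3 / 2)) * cmod (Complex y a) powr (- 3 / 2)"
    using a c by (simp add: powr_mult powr_minus field_simps)
  also have "cosh s * cosh s powr (- 3 / 2) = cosh s powr (- 1 / 2)"
    using c powr_add[of "cosh s" 1 "- 3 / 2"] by simp
  also have "a powr (- 3 / 2) * cosh s powr (- 1 / 2) * cmod (Complex y a) powr (- 3 / 2) \<le>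
     a powr (- 3 / 2) * (2 powr (1 / 2) * exp (- (1 / 2) * s)) * cmod (Complex y a) powr (- 3 / 2)"
  proof (intro mult_right_mono mult_left_mono)
    have "exp s / 2 \<le> cosh s" by (simp add: cosh_def)
    hence "cosh s powr (- 1 / 2) \<le> (exp s / 2) powr (- 1 / 2)" by (intro powr_mono2') auto
    also have "\<dots> = 2 powr (1 / 2) * exp (- (1 / 2) * s)"
      by (simp add: powr_divide powr_minus exp_powr_real field_simps exp_minus)
    finally show "cosh s powr (- 1 / 2) \<le> 2 powr (1 / 2) * exp (- (1 / 2) * s)" .
  qed auto
  finally show ?thesis by (simp add: mult.assoc)
qed

text \<open>\<open>bessel_K\<close> is an \<open>integral\<close> and carries information only once
  integrability is known. For |\<nu>| <= 1 the factor cosh(\<nu> s) is at most cosh s, and exp(u) >=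
  u^2 / 2 at u = x cosh s bounds the integrand by a multiple of 1 / cosh s, hence of exp(-
  s).\<close>

lemma bessel_K_has_integral:
  assumes x: "x > 0" and \<nu>: "\<bar>\<nu>\<bar> \<le> 1"
  shows "((\<lambda>s. exp (- x * cosh s) * cosh (\<nu> * s)) has_integral bessel_K \<nu> x) {0..}"
proof -
  have "(\<lambda>s. exp (- x * cosh s) * cosh (\<nu> * s)) integrable_on {0..}"
  proof (rule measurable_bounded_by_integrable_imp_integrable)
    show "(\<lambda>s. exp (- x * cosh s) * cosh (\<nu> * s)) \<in> borel_measurable (lebesgue_on {0..})"
      by (intro continuous_imp_measurable_on_sets_lebesgue continuous_intros) auto
    show "(\<lambda>s. 4 / x\<^sup>2 * exp (- 1 * s)) integrable_on {0..}"
      by (intro integrable_on_mult_right integrable_on_exp_minus_to_infinity) simp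
    show "norm (exp (- x * cosh s) * cosh (\<nu> * s)) \<le> 4 / x\<^sup>2 * exp (- 1 * s)" if "s \<in> {0..}" for s
    proof -
      define c where "c = cosh s"
      have s: "s \<ge> 0" using that by simp
      have c: "c \<ge> exp s / 2" "c > 0" by (simp_all add: c_def cosh_def cosh_real_pos add_pos_pos)
      have "cosh (\<nu> * s) = cosh \<bar>\<nu> * s\<bar>" by (simp add: abs_if)
      also have "\<dots> \<le> c" unfolding c_def using \<nu> s
        by (subst cosh_real_nonneg_le_iff) (auto simp: abs_mult intro: mult_left_le_one_le)
      finally have k: "cosh (\<nu> * s) \<le> c" .
      have "(x * c)\<^sup>2 / 2 \<le> 1 + x * c + (x * c)\<^sup>2 / 2" using x c by simp
      also have "\<dots> \<le> exp (x * c)" using x c by (intro exp_lower_Taylor_quadratic) auto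
      finally have "x\<^sup>2 * c\<^sup>2 \<le> 2 * exp (x * c)" by (simp add: power_mult_distrib)
      hence "exp (- x * c) * c \<le> 2 / x\<^sup>2 * (1 / c)"
        using x c by (simp add: exp_minus field_simps power2_eq_square)
      also have "\<dots> \<le> 2 / x\<^sup>2 * (1 / (exp s / 2))"
        using c x by (intro mult_left_mono divide_left_mono) auto
      also have "\<dots> = 4 / x\<^sup>2 * exp (- 1 * s)" by (simp add: exp_minus field_simps)
      finally have 1: "exp (- x * c) * c \<le> 4 / x\<^sup>2 * exp (- 1 * s)" .
      have "exp (- x * c) * cosh (\<nu> * s) \<le> exp (- x * c) * c" using k by simp
      from order_trans[OF this 1] show ?thesis by (simp add: c_def abs_mult)
    qed
  qed auto
  thus ?thesis unfolding bessel_K_def by (rule integrable_integral)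
qed

lemma summable_square_exp:
  fixes b :: real
  assumes "b > 0"
  shows "summable (\<lambda>q. real (Suc q) ^ 2 * exp (- b * real (Suc q)))"
proof -
  have "norm (complex_of_real (exp (- b))) < 1" using assms by simp
  from sums_summable[OF sums_Suc_square_mult_power[OF this]]
  have "summable (\<lambda>n. Re (of_nat (Suc n) ^ 2 * complex_of_real (exp (- b)) ^ Suc n))"
    by (rule summable_Re)
  moreover have "Re (of_nat (Suc n) ^ 2 * complex_of_real (exp (- b)) ^ Suc n) = real (Suc n) ^ 2 * exp (- b * real (Suc n))" for n
  proof -
    have "of_nat (Suc n) ^ 2 * complex_of_real (exp (- b)) ^ Suc n = of_real (real (Suc n) ^ 2 * exp (- b) ^ Suc n)"
      by (simp only: of_real_mult of_real_power of_real_of_nat_eq)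
    thus ?thesis by (simp only: Re_complex_of_real exp_of_nat_mult[symmetric] mult.commute)
  qed
  ultimately show ?thesis by simp
qed

text \<open>Interchanges the sum over frequencies with the Bessel integral. The inequality q + cosh
  s <= 2 q cosh s splits the exponential into a factor summable in q, even against q^2, and a factor
  integrable in s.\<close>

lemma bessel_series_sums:
  fixes c :: "nat \<Rightarrow> real"
  assumes a: "a > 0" and \<nu>: "\<bar>\<nu>\<bar> \<le> 1" and c: "\<And>q. \<bar>c q\<bar> \<le> real (Suc q) ^ 2"
    and G: "\<And>s. s \<ge> 0 \<Longrightarrow> (\<lambda>q. c q * (exp (- (2 * pi * real (Suc q) * a) * cosh s) * cosh (\<nu> * s))) sums G s"
  shows "(\<lambda>q. c q * bessel_K \<nu> (2 * pi * real (Suc q) * a)) sums integral {0..} G"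
proof -
  define C where "C = (\<Sum>q. real (Suc q) ^ 2 * exp (- (pi * a) * real (Suc q)))"
  have sm: "summable (\<lambda>q. real (Suc q) ^ 2 * exp (- (pi * a) * real (Suc q)))"
    using a by (intro summable_square_exp) auto
  show ?thesis
  proof (rule sums_integral_dominated)
    show "((\<lambda>s. c q * (exp (- (2 * pi * real (Suc q) * a) * cosh s) * cosh (\<nu> * s))) has_integral
        c q * bessel_K \<nu> (2 * pi * real (Suc q) * a)) {0..}" for q
      using a \<nu> by (intro has_integral_mult_right bessel_K_has_integral) auto
    show "(\<lambda>s. C * (exp (- (pi * a) * cosh s) * cosh (\<nu> * s))) integrable_on {0..}"
      using a \<nu> by (intro integrable_on_mult_right has_integral_integrable[OF bessel_K_has_integral]) auto
    show "(\<Sum>q<n. \<bar>c q * (exp (- (2 * pi * real (Suc q) * a) * cosh s) * cosh (\<nu> * s))\<bar>) \<le>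
        C * (exp (- (pi * a) * cosh s) * cosh (\<nu> * s))" for n s
    proof -
      have "(\<Sum>q<n. \<bar>c q * (exp (- (2 * pi * real (Suc q) * a) * cosh s) * cosh (\<nu> * s))\<bar>) \<le>
         (\<Sum>q<n. (real (Suc q) ^ 2 * exp (- (pi * a) * real (Suc q))) * (exp (- (pi * a) * cosh s) * cosh (\<nu> * s)))"
      proof (intro sum_mono)
        fix q
        have c1: "cosh s \<ge> 1" by (simp add: cosh_real_ge_1)
        have q1: "real (Suc q) \<ge> 1" by simp
        have "0 \<le> (real (Suc q) - 1) * cosh s + real (Suc q) * (cosh s - 1)"
          using c1 q1 by (intro add_nonneg_nonneg mult_nonneg_nonneg) auto
        hence "real (Suc q) + cosh s \<le> 2 * real (Suc q) * cosh s" by (simp add: algebra_simps)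
        hence "(pi * a) * (real (Suc q) + cosh s) \<le> (pi * a) * (2 * real (Suc q) * cosh s)"
          using a by (intro mult_left_mono) auto
        hence e: "exp (- (2 * pi * real (Suc q) * a) * cosh s) \<le> exp (- (pi * a) * real (Suc q)) * exp (- (pi * a) * cosh s)"
          unfolding exp_add[symmetric] exp_le_cancel_iff by (simp add: algebra_simps)
        have "\<bar>c q * (exp (- (2 * pi * real (Suc q) * a) * cosh s) * cosh (\<nu> * s))\<bar> =
           \<bar>c q\<bar> * (exp (- (2 * pi * real (Suc q) * a) * cosh s) * cosh (\<nu> * s))"
          by (simp add: abs_mult)
        also have "\<dots> \<le> real (Suc q) ^ 2 * (exp (- (pi * a) * real (Suc q)) * exp (- (pi * a) * cosh s) * cosh (\<nu> * s))"
          by (intro mult_mono c mult_right_mono e) auto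
        finally show "\<bar>c q * (exp (- (2 * pi * real (Suc q) * a) * cosh s) * cosh (\<nu> * s))\<bar> \<le>
           (real (Suc q) ^ 2 * exp (- (pi * a) * real (Suc q))) * (exp (- (pi * a) * cosh s) * cosh (\<nu> * s))"
          by (simp only: mult_ac)
      qed
      also have "\<dots> = (\<Sum>q<n. real (Suc q) ^ 2 * exp (- (pi * a) * real (Suc q))) * (exp (- (pi * a) * cosh s) * cosh (\<nu> * s))"
        by (simp only: sum_distrib_right)
      also have "\<dots> \<le> C * (exp (- (pi * a) * cosh s) * cosh (\<nu> * s))"
        unfolding C_def by (intro mult_right_mono sum_le_suminf sm) auto
      finally show ?thesis .
    qed
  qed (use G in auto)
qed

lemma exp_power_Re_Im:
  fixes x u :: real
  shows "Re (exp (2 * of_real pi * \<i> * Complex x u) ^ n) = cos (2 * pi * real n * x) * exp (- (2 * pi * real n * u))"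
    and "Im (exp (2 * of_real pi * \<i> * Complex x u) ^ n) = sin (2 * pi * real n * x) * exp (- (2 * pi * real n * u))"
  by (simp_all add: exp_of_nat_mult[symmetric] Re_exp Im_exp mult_ac)

lemma Re_Im_of_nat_power_mult:
  "Re (of_nat n ^ j * z) = real n ^ j * Re z" "Im (of_nat n ^ j * z) = real n ^ j * Im z"
proof -
  have "of_nat n ^ j * z = of_real (real n ^ j) * z" by simp
  thus "Re (of_nat n ^ j * z) = real n ^ j * Re z" "Im (of_nat n ^ j * z) = real n ^ j * Im z"
    by simp_all
qed

section \<open>Poisson summation for the three Bessel series\<close>

context
  fixes a x :: real
  assumes a: "a > 0"
begin

text \<open>The constant of a dominating function \<open>C exp (- s / 2)\<close> for interchanging sums over \<open>n\<close> with integrals over \<open>s\<close>.\<close>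

definition dom_const :: real where
  "dom_const = a powr (- 3 / 2) * 2 powr (1 / 2) *
     ((\<Sum>k. cmod (Complex (x + real k) a) powr (- 3 / 2)) + (\<Sum>k. cmod (Complex (x - real k - 1) a) powr (- 3 / 2)))"

lemma dominating_integrable: "(\<lambda>s. dom_const * exp (- (1 / 2) * s)) integrable_on {0..}"
  by (intro integrable_on_mult_right integrable_on_exp_minus_to_infinity) simp

lemma dominated_sum:
  fixes F :: "nat \<Rightarrow> real"
  assumes F: "\<And>k. \<bar>F k\<bar> \<le> cosh s / p k + cosh s / p' k"
    and p: "\<And>k. cmod (Complex (x + real k) (a * cosh s)) powr (3 / 2) * (a * cosh s) powr (3 / 2) \<le> p k"
    and p': "\<And>k. cmod (Complex (x - real k - 1) (a * cosh s)) powr (3 / 2) * (a * cosh s) powr (3 / 2) \<le> p' k"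
  shows "(\<Sum>k<n. \<bar>F k\<bar>) \<le> dom_const * exp (- (1 / 2) * s)"
proof -
  define M where "M = a powr (- 3 / 2) * 2 powr (1 / 2) * exp (- (1 / 2) * s)"
  have M: "M \<ge> 0" by (simp add: M_def)
  have "(\<Sum>k<n. \<bar>F k\<bar>) \<le> (\<Sum>k<n. M * cmod (Complex (x + real k) a) powr (- 3 / 2) + M * cmod (Complex (x - real k - 1) a) powr (- 3 / 2))"
    unfolding M_def by (intro sum_mono order_trans[OF F] add_mono kernel_dominated[OF a] p p')
  also have "\<dots> = M * ((\<Sum>k<n. cmod (Complex (x + real k) a) powr (- 3 / 2)) + (\<Sum>k<n. cmod (Complex (x - real k - 1) a) powr (- 3 / 2)))"
    by (simp add: sum.distrib sum_distrib_left distrib_left)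
  also have "\<dots> \<le> M * ((\<Sum>k. cmod (Complex (x + real k) a) powr (- 3 / 2)) + (\<Sum>k. cmod (Complex (x - real k - 1) a) powr (- 3 / 2)))"
    by (intro mult_left_mono M add_mono sum_le_suminf summable_kernel_powr[OF a]) auto
  also have "\<dots> = dom_const * exp (- (1 / 2) * s)" by (simp add: M_def dom_const_def mult_ac)
  finally show ?thesis .
qed

text \<open>Everything rests on a cosh s <= |y + i a cosh s|. In the mixed bound the exponent 3/2 of
  a cosh s is divided as 1/2 + 1 between the two neighbouring points y and y'; this serves the
  telescoped kernel 1 / (w^2 (w + 1)).\<close>

lemma cubic_bound:
  "cmod (Complex y (a * cosh s)) powr (3 / 2) * (a * cosh s) powr (3 / 2) \<le> cmod (Complex y (a * cosh s)) ^ 3"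
  and mixed_bound:
  "cmod (Complex y (a * cosh s)) powr (3 / 2) * (a * cosh s) powr (3 / 2) \<le>
     cmod (Complex y (a * cosh s)) ^ 2 * cmod (Complex y' (a * cosh s))"
proof -
  define u where "u = a * cosh s"
  have u: "u > 0" using a by (simp add: u_def cosh_real_pos)
  define A where "A = cmod (Complex y u)"
  define A' where "A' = cmod (Complex y' u)"
  have le: "u \<le> A" "u \<le> A'" using abs_Im_le_cmod[of "Complex y u"] abs_Im_le_cmod[of "Complex y' u"] u
    by (auto simp: A_def A'_def)
  have A: "A > 0" "A' > 0" using le u by linarith+
  have "A powr (3 / 2) * u powr (3 / 2) \<le> A powr (3 / 2) * A powr (3 / 2)"
    using le u by (intro mult_left_mono powr_mono2) auto
  also have "\<dots> = A ^ 3" using A by (simp add: powr_add[symmetric] powr_numeral)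
  finally show "cmod (Complex y (a * cosh s)) powr (3 / 2) * (a * cosh s) powr (3 / 2) \<le> cmod (Complex y (a * cosh s)) ^ 3"
    unfolding A_def u_def .
  have "A powr (3 / 2) * u powr (3 / 2) = A powr (3 / 2) * (u powr (1 / 2) * u powr 1)"
    using u powr_add[of u "1 / 2" 1] by simp
  also have "\<dots> \<le> A powr (3 / 2) * (A powr (1 / 2) * A' powr 1)"
    using le u by (intro mult_left_mono mult_mono powr_mono2) auto
  also have "\<dots> = A ^ 2 * A'" using A by (simp add: mult.assoc[symmetric] powr_add[symmetric] powr_numeral)
  finally show "cmod (Complex y (a * cosh s)) powr (3 / 2) * (a * cosh s) powr (3 / 2) \<le>
     cmod (Complex y (a * cosh s)) ^ 2 * cmod (Complex y' (a * cosh s))"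
    unfolding A_def u_def A'_def .
qed

lemma shift_Complex:
  "Complex x u + of_nat k = Complex (x + real k) u" "Complex x u - of_nat k - 1 = Complex (x - real k - 1) u"
  by (simp_all add: complex_eq_iff)

text \<open>The imaginary part of the weight three formula at x + i a cosh s, integrated over s.
  Weight three accounts for the factor q^2 on the Bessel side, and the third of
  \<open>kernel_integrals\<close> for the lattice side.\<close>

lemma bessel_K0_poisson:
  defines "S \<equiv> \<lambda>q. real (Suc q) ^ 2 * cos (2 * pi * real (Suc q) * x) * bessel_K 0 (2 * pi * real (Suc q) * a)"
  shows "summable S"
    and "(\<lambda>k. (a\<^sup>2 - 2 * (x + real k)\<^sup>2) / cmod (Complex (x + real k) a) ^ 5 +
              (a\<^sup>2 - 2 * (x - real k - 1)\<^sup>2) / cmod (Complex (x - real k - 1) a) ^ 5) sums (16 * pi\<^sup>2 * suminf S)"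
proof -
  define f where "f y s = Im (1 / Complex y (a * cosh s) ^ 3)" for y s
  define G where "G s = (\<Sum>k. f (x + real k) s + f (x - real k - 1) s)" for s
  define I where "I y = pi / 4 * (a\<^sup>2 - 2 * y\<^sup>2) / cmod (Complex y a) ^ 5" for y
  have ex: "(\<lambda>k. f (x + real k) s + f (x - real k - 1) s) sums G s \<and>
     (\<lambda>q. real (Suc q) ^ 2 * cos (2 * pi * real (Suc q) * x) * (exp (- (2 * pi * real (Suc q) * a) * cosh s) * cosh (0 * s)))
       sums (1 / (4 * pi ^ 3) * G s)" for s
  proof -
    have "Im (Complex x (a * cosh s)) > 0" using a by (simp add: cosh_real_pos)
    from lipschitz_3[OF this] obtain T where
      1: "(\<lambda>k. 1 / (Complex x (a * cosh s) + of_nat k) ^ 3 + 1 / (Complex x (a * cosh s) - of_nat k - 1) ^ 3) sums (4 * of_real pi ^ 3 * \<i> * T)"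
      and 2: "(\<lambda>n. of_nat (Suc n) ^ 2 * exp (2 * of_real pi * \<i> * Complex x (a * cosh s)) ^ Suc n) sums T" by blast
    have 3: "(\<lambda>k. f (x + real k) s + f (x - real k - 1) s) sums (4 * pi ^ 3 * Re T)"
      using sums_Im[OF 1] unfolding f_def shift_Complex by simp
    hence G: "G s = 4 * pi ^ 3 * Re T" unfolding G_def by (rule sums_unique[symmetric])
    have e: "Re (of_nat (Suc n) ^ 2 * exp (2 * of_real pi * \<i> * Complex x (a * cosh s)) ^ Suc n) =
       real (Suc n) ^ 2 * cos (2 * pi * real (Suc n) * x) * (exp (- (2 * pi * real (Suc n) * a) * cosh s) * cosh (0 * s))" for n
    proof -
      have "Re (of_nat (Suc n) ^ 2 * exp (2 * of_real pi * \<i> * Complex x (a * cosh s)) ^ Suc n) =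
        real (Suc n) ^ 2 * Re (exp (2 * of_real pi * \<i> * Complex x (a * cosh s)) ^ Suc n)"
        by (rule Re_Im_of_nat_power_mult)
      thus ?thesis unfolding exp_power_Re_Im by (simp add: mult_ac)
    qed
    have "(\<lambda>q. real (Suc q) ^ 2 * cos (2 * pi * real (Suc q) * x) * (exp (- (2 * pi * real (Suc q) * a) * cosh s) * cosh (0 * s))) sums Re T"
      using sums_Re[OF 2] unfolding e .
    thus ?thesis using 3 G by simp
  qed
  have A: "(\<lambda>k. I (x + real k) + I (x - real k - 1)) sums integral {0..} G"
  proof (rule sums_integral_dominated[OF _ dominating_integrable])
    show "((\<lambda>s. f (x + real k) s + f (x - real k - 1) s) has_integral I (x + real k) + I (x - real k - 1)) {0..}" for k
      unfolding f_def I_def by (intro has_integral_add kernel_integrals[OF a])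
    show "(\<Sum>k<n. \<bar>f (x + real k) s + f (x - real k - 1) s\<bar>) \<le> dom_const * exp (- (1 / 2) * s)" for n s
    proof (rule dominated_sum[where p = "\<lambda>k. cmod (Complex (x + real k) (a * cosh s)) ^ 3" and p' = "\<lambda>k. cmod (Complex (x - real k - 1) (a * cosh s)) ^ 3"])
      have b: "\<bar>f y s\<bar> \<le> cosh s / cmod (Complex y (a * cosh s)) ^ 3" for y
      proof -
        have "\<bar>f y s\<bar> \<le> cmod (1 / Complex y (a * cosh s) ^ 3)" unfolding f_def by (rule abs_Im_le_cmod)
        also have "\<dots> = 1 / cmod (Complex y (a * cosh s)) ^ 3" by (simp add: norm_divide norm_power)
        also have "\<dots> \<le> cosh s / cmod (Complex y (a * cosh s)) ^ 3" by (intro divide_right_mono) (auto simp: cosh_real_ge_1)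
        finally show ?thesis .
      qed
      show "\<bar>f (x + real k) s + f (x - real k - 1) s\<bar> \<le> cosh s / cmod (Complex (x + real k) (a * cosh s)) ^ 3 + cosh s / cmod (Complex (x - real k - 1) (a * cosh s)) ^ 3" for k
        using b[of "x + real k"] b[of "x - real k - 1"] by linarith
    qed (rule cubic_bound)+
  qed (use ex in auto)
  have B: "S sums integral {0..} (\<lambda>s. 1 / (4 * pi ^ 3) * G s)"
    unfolding S_def
    by (rule bessel_series_sums[OF a]) (use ex in \<open>auto simp: abs_mult intro!: mult_left_le\<close>)
  thus "summable S" by (rule sums_summable)
  have "integral {0..} (\<lambda>s. 1 / (4 * pi ^ 3) * G s) = 1 / (4 * pi ^ 3) * integral {0..} G" by (rule integral_mult_right)
  hence "integral {0..} G = 4 * pi ^ 3 * suminf S" using sums_unique[OF B] by (simp add: field_simps)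
  from sums_mult[OF A[unfolded this], of "4 / pi"]
  show "(\<lambda>k. (a\<^sup>2 - 2 * (x + real k)\<^sup>2) / cmod (Complex (x + real k) a) ^ 5 +
              (a\<^sup>2 - 2 * (x - real k - 1)\<^sup>2) / cmod (Complex (x - real k - 1) a) ^ 5) sums (16 * pi\<^sup>2 * suminf S)"
  proof -
    have "4 / pi * (pi / 4 * A / B) = A / B" for A B :: real by simp
    hence "4 / pi * (I y + I y') = (a\<^sup>2 - 2 * y\<^sup>2) / cmod (Complex y a) ^ 5 + (a\<^sup>2 - 2 * y'\<^sup>2) / cmod (Complex y' a) ^ 5" for y y'
      unfolding I_def distrib_left by (simp only:)
    moreover have "4 / pi * (4 * pi ^ 3 * suminf S) = 16 * pi\<^sup>2 * suminf S" by (simp add: power2_eq_square power3_eq_cube)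
    ultimately show "(\<lambda>k. 4 / pi * (I (x + real k) + I (x - real k - 1))) sums (4 / pi * (4 * pi ^ 3 * suminf S)) \<Longrightarrow> ?thesis"
      by (simp only:)
  qed
qed

text \<open>Multiplying the weight three formula by cosh s before integrating replaces
  \<open>K_0\<close> by \<open>K_1\<close>; its real part, because of the factor i in front of the
  series, selects the sine.\<close>

lemma bessel_K1_poisson_odd:
  defines "S \<equiv> \<lambda>q. real (Suc q) ^ 2 * sin (2 * pi * real (Suc q) * x) * bessel_K 1 (2 * pi * real (Suc q) * a)"
  shows "summable S"
    and "(\<lambda>k. (x + real k) / cmod (Complex (x + real k) a) ^ 5 +
              (x - real k - 1) / cmod (Complex (x - real k - 1) a) ^ 5) sums (16 * pi\<^sup>2 / (3 * a) * suminf S)"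
proof -
  define f where "f y s = cosh s * Re (1 / Complex y (a * cosh s) ^ 3)" for y s
  define G where "G s = (\<Sum>k. f (x + real k) s + f (x - real k - 1) s)" for s
  define I where "I y = - (3 * pi * a / 4) * y / cmod (Complex y a) ^ 5" for y
  have ex: "(\<lambda>k. f (x + real k) s + f (x - real k - 1) s) sums G s \<and>
     (\<lambda>q. real (Suc q) ^ 2 * sin (2 * pi * real (Suc q) * x) * (exp (- (2 * pi * real (Suc q) * a) * cosh s) * cosh (1 * s)))
       sums (- 1 / (4 * pi ^ 3) * G s)" for s
  proof -
    have "Im (Complex x (a * cosh s)) > 0" using a by (simp add: cosh_real_pos)
    from lipschitz_3[OF this] obtain T where
      1: "(\<lambda>k. 1 / (Complex x (a * cosh s) + of_nat k) ^ 3 + 1 / (Complex x (a * cosh s) - of_nat k - 1) ^ 3) sums (4 * of_real pi ^ 3 * \<i> * T)"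
      and 2: "(\<lambda>n. of_nat (Suc n) ^ 2 * exp (2 * of_real pi * \<i> * Complex x (a * cosh s)) ^ Suc n) sums T" by blast
    have 3: "(\<lambda>k. f (x + real k) s + f (x - real k - 1) s) sums (cosh s * (- 4 * pi ^ 3 * Im T))"
      using sums_mult[OF sums_Re[OF 1], of "cosh s"] unfolding f_def shift_Complex by (simp add: distrib_left)
    hence G: "G s = cosh s * (- 4 * pi ^ 3 * Im T)" unfolding G_def by (rule sums_unique[symmetric])
    have e: "Im (of_nat (Suc n) ^ 2 * exp (2 * of_real pi * \<i> * Complex x (a * cosh s)) ^ Suc n) =
       real (Suc n) ^ 2 * sin (2 * pi * real (Suc n) * x) * exp (- (2 * pi * real (Suc n) * a) * cosh s)" for n
    proof -
      have "Im (of_nat (Suc n) ^ 2 * exp (2 * of_real pi * \<i> * Complex x (a * cosh s)) ^ Suc n) =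
        real (Suc n) ^ 2 * Im (exp (2 * of_real pi * \<i> * Complex x (a * cosh s)) ^ Suc n)"
        by (rule Re_Im_of_nat_power_mult)
      thus ?thesis unfolding exp_power_Re_Im by (simp add: mult_ac)
    qed
    have "(\<lambda>q. cosh s * (real (Suc q) ^ 2 * sin (2 * pi * real (Suc q) * x) * exp (- (2 * pi * real (Suc q) * a) * cosh s))) sums (cosh s * Im T)"
      using sums_mult[OF sums_Im[OF 2], of "cosh s"] unfolding e .
    thus ?thesis using 3 G by (simp add: mult_ac)
  qed
  have A: "(\<lambda>k. I (x + real k) + I (x - real k - 1)) sums integral {0..} G"
  proof (rule sums_integral_dominated[OF _ dominating_integrable])
    show "((\<lambda>s. f (x + real k) s + f (x - real k - 1) s) has_integral I (x + real k) + I (x - real k - 1)) {0..}" for k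
      unfolding f_def I_def by (intro has_integral_add kernel_integrals[OF a])
    show "(\<Sum>k<n. \<bar>f (x + real k) s + f (x - real k - 1) s\<bar>) \<le> dom_const * exp (- (1 / 2) * s)" for n s
    proof (rule dominated_sum[where p = "\<lambda>k. cmod (Complex (x + real k) (a * cosh s)) ^ 3" and p' = "\<lambda>k. cmod (Complex (x - real k - 1) (a * cosh s)) ^ 3"])
      have b: "\<bar>f y s\<bar> \<le> cosh s / cmod (Complex y (a * cosh s)) ^ 3" for y
      proof -
        have "\<bar>f y s\<bar> = cosh s * \<bar>Re (1 / Complex y (a * cosh s) ^ 3)\<bar>" by (simp add: f_def abs_mult)
        also have "\<dots> \<le> cosh s * cmod (1 / Complex y (a * cosh s) ^ 3)" by (intro mult_left_mono abs_Re_le_cmod) auto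
        also have "\<dots> = cosh s / cmod (Complex y (a * cosh s)) ^ 3" by (simp add: norm_divide norm_power)
        finally show ?thesis .
      qed
      show "\<bar>f (x + real k) s + f (x - real k - 1) s\<bar> \<le> cosh s / cmod (Complex (x + real k) (a * cosh s)) ^ 3 + cosh s / cmod (Complex (x - real k - 1) (a * cosh s)) ^ 3" for k
        using b[of "x + real k"] b[of "x - real k - 1"] by linarith
    qed (rule cubic_bound)+
  qed (use ex in auto)
  have B: "S sums integral {0..} (\<lambda>s. - 1 / (4 * pi ^ 3) * G s)"
    unfolding S_def
    by (rule bessel_series_sums[OF a]) (use ex in \<open>auto simp: abs_mult intro!: mult_left_le\<close>)
  thus "summable S" by (rule sums_summable)
  have "integral {0..} (\<lambda>s. - 1 / (4 * pi ^ 3) * G s) = - 1 / (4 * pi ^ 3) * integral {0..} G" by (rule integral_mult_right)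
  hence "integral {0..} G = - 4 * pi ^ 3 * suminf S" using sums_unique[OF B] by (simp add: field_simps)
  from sums_mult[OF A[unfolded this], of "- 4 / (3 * pi * a)"]
  show "(\<lambda>k. (x + real k) / cmod (Complex (x + real k) a) ^ 5 +
              (x - real k - 1) / cmod (Complex (x - real k - 1) a) ^ 5) sums (16 * pi\<^sup>2 / (3 * a) * suminf S)"
  proof -
    have "- 4 / (3 * pi * a) * (- (3 * pi * a / 4) * A / B) = A / B" for A B :: real using a by simp
    hence "- 4 / (3 * pi * a) * (I y + I y') = y / cmod (Complex y a) ^ 5 + y' / cmod (Complex y' a) ^ 5" for y y'
      unfolding I_def distrib_left by (simp only:)
    moreover have "- 4 / (3 * pi * a) * (- 4 * pi ^ 3 * suminf S) = 16 * pi\<^sup>2 / (3 * a) * suminf S" by (simp add: power2_eq_square power3_eq_cube)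
    ultimately show "(\<lambda>k. - 4 / (3 * pi * a) * (I (x + real k) + I (x - real k - 1))) sums (- 4 / (3 * pi * a) * (- 4 * pi ^ 3 * suminf S)) \<Longrightarrow> ?thesis"
      by (simp only:)
  qed
qed

text \<open>In weight two the sum over n of cosh s / |w + n|^2 tends to a nonzero constant for large
  s, so no majorant exists. The difference g(y) - g(y + 1) of the weight one kernels is subtracted:
  it turns 1 / w^2 into 1 / (w^2 (w + 1)), which is dominated. For fixed s these differences sum to
  0, but their integrals sum to a nonzero boundary value, and that value is the zero frequency 2 /
  a^2.\<close>

lemma bessel_K1_poisson_even:
  defines "S \<equiv> \<lambda>q. real (Suc q) * cos (2 * pi * real (Suc q) * x) * bessel_K 1 (2 * pi * real (Suc q) * a)"
  shows "summable S"
    and "(\<lambda>k. 1 / cmod (Complex (x + real k) a) ^ 3 + 1 / cmod (Complex (x - real k - 1) a) ^ 3) sums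
           (2 / a\<^sup>2 + 8 * pi / a * suminf S)"
proof -
  define g where "g y s = cosh s * Re (1 / Complex y (a * cosh s))" for y s
  define f where "f y s = cosh s * Re (1 / Complex y (a * cosh s) ^ 2) - (g y s - g (y + 1) s)" for y s
  define G where "G s = (\<Sum>k. f (x + real k) s + f (x - real k - 1) s)" for s
  define J where "J y = pi * y / (2 * a * cmod (Complex y a))" for y
  define I where "I y = - (pi * a / 2) / cmod (Complex y a) ^ 3 - (J y - J (y + 1))" for y
  have ex: "(\<lambda>k. f (x + real k) s + f (x - real k - 1) s) sums G s \<and>
     (\<lambda>q. real (Suc q) * cos (2 * pi * real (Suc q) * x) * (exp (- (2 * pi * real (Suc q) * a) * cosh s) * cosh (1 * s)))
       sums (- 1 / (4 * pi\<^sup>2) * G s)" for s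
  proof -
    have "Im (Complex x (a * cosh s)) > 0" using a by (simp add: cosh_real_pos)
    from lipschitz_2[OF this] obtain T where
      1: "(\<lambda>k. 1 / (Complex x (a * cosh s) + of_nat k)\<^sup>2 + 1 / (Complex x (a * cosh s) - of_nat k - 1)\<^sup>2) sums (- 4 * of_real pi ^ 2 * T)"
      and 2: "(\<lambda>n. of_nat (Suc n) * exp (2 * of_real pi * \<i> * Complex x (a * cosh s)) ^ Suc n) sums T" by blast
    have "Re (- 4 * of_real pi ^ 2 * T) = - 4 * pi\<^sup>2 * Re T"
      by (simp flip: of_real_power)
    hence 3: "(\<lambda>k. cosh s * Re (1 / Complex (x + real k) (a * cosh s) ^ 2) + cosh s * Re (1 / Complex (x - real k - 1) (a * cosh s) ^ 2)) sums (cosh s * (- 4 * pi\<^sup>2 * Re T))"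
      using sums_mult[OF sums_Re[OF 1], of "cosh s"] unfolding shift_Complex by (simp add: distrib_left)
    \<comment> \<open>At fixed s both ends of the telescope decay like 1 / n, so the correction does
      not change the sum.\<close>
    have "(\<lambda>n. g (x - real n) s - g (x + real n) s) \<longlonglongrightarrow> 0"
    proof -
      have "g y s = cosh s * (y / (y\<^sup>2 + (a * cosh s)\<^sup>2))" for y
        by (simp add: g_def divide_complex_def)
      moreover have "((\<lambda>n. C * ((x - real n) / ((x - real n)\<^sup>2 + U\<^sup>2)) - C * ((x + real n) / ((x + real n)\<^sup>2 + U\<^sup>2))) \<longlongrightarrow> 0) at_top" for C U :: real
        by real_asymp
      ultimately show ?thesis by simp
    qed
    from telescope_sums[OF this]
    have 4: "(\<lambda>k. g (x - real (Suc k)) s - g (x + real (Suc k)) s - (g (x - real k) s - g (x + real k) s)) sums 0" by simp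
    have "(\<lambda>k. f (x + real k) s + f (x - real k - 1) s) sums (cosh s * (- 4 * pi\<^sup>2 * Re T) - 0)"
      using sums_diff[OF 3 4] unfolding f_def by (simp add: algebra_simps)
    hence 5: "(\<lambda>k. f (x + real k) s + f (x - real k - 1) s) sums (cosh s * (- 4 * pi\<^sup>2 * Re T))" by simp
    hence G: "G s = cosh s * (- 4 * pi\<^sup>2 * Re T)" unfolding G_def by (rule sums_unique[symmetric])
    have e: "Re (of_nat (Suc n) * exp (2 * of_real pi * \<i> * Complex x (a * cosh s)) ^ Suc n) =
       real (Suc n) * cos (2 * pi * real (Suc n) * x) * exp (- (2 * pi * real (Suc n) * a) * cosh s)" for n
    proof -
      have "Re (of_nat (Suc n) * exp (2 * of_real pi * \<i> * Complex x (a * cosh s)) ^ Suc n) =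
        real (Suc n) * Re (exp (2 * of_real pi * \<i> * Complex x (a * cosh s)) ^ Suc n)"
        using Re_Im_of_nat_power_mult(1)[of "Suc n" 1] by (simp only: power_one_right)
      thus ?thesis unfolding exp_power_Re_Im by (simp add: mult_ac)
    qed
    have "(\<lambda>q. cosh s * (real (Suc q) * cos (2 * pi * real (Suc q) * x) * exp (- (2 * pi * real (Suc q) * a) * cosh s))) sums (cosh s * Re T)"
      using sums_mult[OF sums_Re[OF 2], of "cosh s"] unfolding e .
    thus ?thesis using 5 G by (simp add: mult_ac)
  qed
  have A: "(\<lambda>k. I (x + real k) + I (x - real k - 1)) sums integral {0..} G"
  proof (rule sums_integral_dominated[OF _ dominating_integrable])
    show "((\<lambda>s. f (x + real k) s + f (x - real k - 1) s) has_integral I (x + real k) + I (x - real k - 1)) {0..}" for k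
      unfolding f_def g_def I_def J_def by (intro has_integral_add has_integral_diff kernel_integrals[OF a])
    show "(\<Sum>k<n. \<bar>f (x + real k) s + f (x - real k - 1) s\<bar>) \<le> dom_const * exp (- (1 / 2) * s)" for n s
    proof (rule dominated_sum[where p = "\<lambda>k. cmod (Complex (x + real k) (a * cosh s)) ^ 2 * cmod (Complex (x + real k + 1) (a * cosh s))"
          and p' = "\<lambda>k. cmod (Complex (x - real k - 1) (a * cosh s)) ^ 2 * cmod (Complex (x - real k - 1 + 1) (a * cosh s))"])
      have b: "\<bar>f y s\<bar> \<le> cosh s / (cmod (Complex y (a * cosh s)) ^ 2 * cmod (Complex (y + 1) (a * cosh s)))" for y
      proof -
        define U where "U = Complex y (a * cosh s)"
        have U1: "Complex (y + 1) (a * cosh s) = U + 1" by (simp add: U_def complex_eq_iff)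
        have nz: "U \<noteq> 0" "U + 1 \<noteq> 0" using a by (auto simp: U_def complex_eq_iff)
        have "f y s = cosh s * Re (1 / U ^ 2 - (1 / U - 1 / (U + 1)))"
          unfolding f_def g_def U1 U_def[symmetric] by (simp add: algebra_simps)
        also have "1 / U ^ 2 - (1 / U - 1 / (U + 1)) = 1 / (U ^ 2 * (U + 1))"
          using nz by (simp add: divide_simps) (simp add: algebra_simps power2_eq_square)
        finally have "\<bar>f y s\<bar> = cosh s * \<bar>Re (1 / (U ^ 2 * (U + 1)))\<bar>" by (simp add: abs_mult)
        also have "\<dots> \<le> cosh s * cmod (1 / (U ^ 2 * (U + 1)))" by (intro mult_left_mono abs_Re_le_cmod) auto
        also have "\<dots> = cosh s / (cmod U ^ 2 * cmod (U + 1))" by (simp add: norm_divide norm_power norm_mult)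
        finally show ?thesis unfolding U1 U_def[symmetric] .
      qed
      show "\<bar>f (x + real k) s + f (x - real k - 1) s\<bar> \<le> cosh s / (cmod (Complex (x + real k) (a * cosh s)) ^ 2 * cmod (Complex (x + real k + 1) (a * cosh s)))
         + cosh s / (cmod (Complex (x - real k - 1) (a * cosh s)) ^ 2 * cmod (Complex (x - real k - 1 + 1) (a * cosh s)))" for k
        using b[of "x + real k"] b[of "x - real k - 1"] by linarith
    qed (rule mixed_bound)+
  qed (use ex in auto)
  have le: "\<bar>real (Suc q) * cos (2 * pi * real (Suc q) * x)\<bar> \<le> real (Suc q) ^ 2" for q
  proof -
    have "\<bar>real (Suc q) * cos (2 * pi * real (Suc q) * x)\<bar> \<le> real (Suc q)"
      unfolding abs_mult by (intro order_trans[OF mult_left_le]) auto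
    also have "\<dots> \<le> real (Suc q) ^ 2" unfolding power2_eq_square by (intro mult_le_cancel_left1[THEN iffD2]) auto
    finally show ?thesis .
  qed
  have B: "S sums integral {0..} (\<lambda>s. - 1 / (4 * pi\<^sup>2) * G s)"
    unfolding S_def by (rule bessel_series_sums[OF a _ le]) (use ex in auto)
  thus "summable S" by (rule sums_summable)
  have "integral {0..} (\<lambda>s. - 1 / (4 * pi\<^sup>2) * G s) = - 1 / (4 * pi\<^sup>2) * integral {0..} G" by (rule integral_mult_right)
  hence IG: "integral {0..} G = - 4 * pi\<^sup>2 * suminf S" using sums_unique[OF B] by (simp add: field_simps)
  \<comment> \<open>After integration the ends of the telescope no longer vanish: J tends to pi / (2
    a) at plus infinity and to - pi / (2 a) at minus infinity.\<close>
  have "(\<lambda>n. J (x - real n) - J (x + real n)) \<longlonglongrightarrow> - pi / a"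
  proof -
    have "((\<lambda>n. pi / (2 * a) * ((x - real n) / sqrt ((x - real n)\<^sup>2 + a\<^sup>2)) - pi / (2 * a) * ((x + real n) / sqrt ((x + real n)\<^sup>2 + a\<^sup>2)))
       \<longlongrightarrow> pi / (2 * a) * (- 1) - pi / (2 * a) * 1) at_top"
    proof (intro tendsto_intros)
      show "((\<lambda>n. (x - real n) / sqrt ((x - real n)\<^sup>2 + a\<^sup>2)) \<longlongrightarrow> - 1) at_top" by real_asymp
      show "((\<lambda>n. (x + real n) / sqrt ((x + real n)\<^sup>2 + a\<^sup>2)) \<longlongrightarrow> 1) at_top" by real_asymp
    qed
    thus ?thesis unfolding J_def complex_norm by simp
  qed
  from telescope_sums[OF this]
  have "(\<lambda>k. J (x - real (Suc k)) - J (x + real (Suc k)) - (J (x - real k) - J (x + real k))) sums (- pi / a)" by simp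
  from sums_mult[OF sums_add[OF A[unfolded IG] this], of "- 2 / (pi * a)"]
  have "(\<lambda>k. - 2 / (pi * a) * (I (x + real k) + I (x - real k - 1) + (J (x - real (Suc k)) - J (x + real (Suc k)) - (J (x - real k) - J (x + real k))))) sums
    (- 2 / (pi * a) * (- 4 * pi\<^sup>2 * suminf S + - pi / a))" .
  moreover have "- 2 / (pi * a) * (I (x + real k) + I (x - real k - 1) + (J (x - real (Suc k)) - J (x + real (Suc k)) - (J (x - real k) - J (x + real k)))) =
      1 / cmod (Complex (x + real k) a) ^ 3 + 1 / cmod (Complex (x - real k - 1) a) ^ 3" for k
  proof -
    have "I (x + real k) + I (x - real k - 1) + (J (x - real (Suc k)) - J (x + real (Suc k)) - (J (x - real k) - J (x + real k))) =
      - (pi * a / 2) * (1 / cmod (Complex (x + real k) a) ^ 3 + 1 / cmod (Complex (x - real k - 1) a) ^ 3)"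
      unfolding I_def by (simp add: algebra_simps)
    moreover have "- 2 / (pi * a) * (- (pi * a / 2) * A) = A" for A using a by simp
    ultimately show ?thesis by (simp only:)
  qed
  moreover have "- 2 / (pi * a) * (- 4 * pi\<^sup>2 * suminf S + - pi / a) = 2 / a\<^sup>2 + 8 * pi / a * suminf S"
    using a by (simp add: field_simps power2_eq_square)
  ultimately show "(\<lambda>k. 1 / cmod (Complex (x + real k) a) ^ 3 + 1 / cmod (Complex (x - real k - 1) a) ^ 3) sums
           (2 / a\<^sup>2 + 8 * pi / a * suminf S)" by simp
qed

end

section \<open>Lattice sums\<close>

abbreviation int_lattice :: "(int \<times> int) set" where "int_lattice \<equiv> UNIV - {(0, 0)}"

lemma summable_int_powr: "(\<lambda>n::int. (1 + \<bar>real_of_int n\<bar>) powr (- 3 / 2)) summable_on UNIV"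
proof -
  have "summable (\<lambda>k. real (Suc k) powr (- 3 / 2))"
    by (subst summable_Suc_iff) (simp add: summable_real_powr_iff)
  hence s: "(\<lambda>k. real (Suc k) powr (- 3 / 2)) summable_on UNIV"
    by (intro summable_nonneg_imp_summable_on) auto
  have "(\<lambda>n::int. (1 + \<bar>real_of_int n\<bar>) powr (- 3 / 2)) summable_on (range int \<union> range (\<lambda>k. - int k))"
  proof (rule summable_on_union)
    show "(\<lambda>n::int. (1 + \<bar>real_of_int n\<bar>) powr (- 3 / 2)) summable_on range int"
      using s by (subst summable_on_reindex) (auto simp: o_def inj_on_def)
    show "(\<lambda>n::int. (1 + \<bar>real_of_int n\<bar>) powr (- 3 / 2)) summable_on range (\<lambda>k. - int k)"
      using s by (subst summable_on_reindex) (auto simp: o_def inj_on_def)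
  qed
  moreover have "range int \<union> range (\<lambda>k. - int k) = UNIV"
    by (auto intro: int_cases2)
  ultimately show ?thesis by simp
qed

text \<open>The cube dominates (1 + |m|)^(3/2) (1 + |n|)^(3/2), which reduces the double series to a
  product of two convergent single ones.\<close>

lemma summable_lattice_cube:
  "(\<lambda>(m, n). 1 / (1 + \<bar>real_of_int m\<bar> + \<bar>real_of_int n\<bar>) ^ 3) summable_on (UNIV :: (int \<times> int) set)"
proof (rule summable_on_comparison_test)
  let ?f = "\<lambda>n::int. (1 + \<bar>real_of_int n\<bar>) powr (- 3 / 2)"
  have "(\<lambda>(m, n). ?f m * ?f n) summable_on Sigma UNIV (\<lambda>_. UNIV)"
  proof (rule summable_on_SigmaI)
    show "((\<lambda>n. case (m, n) of (m, n) \<Rightarrow> ?f m * ?f n) has_sum (?f m * infsum ?f UNIV)) UNIV" for m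
      using has_sum_cmult_right[OF has_sum_infsum[OF summable_int_powr]] by simp
    show "(\<lambda>m. ?f m * infsum ?f UNIV) summable_on UNIV"
      by (rule summable_on_cmult_left summable_int_powr)+
  qed auto
  thus "(\<lambda>(m, n). ?f m * ?f n) summable_on (UNIV :: (int \<times> int) set)" by simp
next
  fix mn :: "int \<times> int"
  obtain m n where mn: "mn = (m, n)" by fastforce
  define A B where "A = 1 + \<bar>real_of_int m\<bar>" and "B = 1 + \<bar>real_of_int n\<bar>"
  have AB: "A \<ge> 1" "B \<ge> 1" by (auto simp: A_def B_def)
  have "A powr (3 / 2) * B powr (3 / 2) \<le> (A + B - 1) powr (3 / 2) * (A + B - 1) powr (3 / 2)"
    using AB by (intro mult_mono powr_mono2) auto
  also have "\<dots> = (A + B - 1) ^ 3" using AB by (simp add: powr_add[symmetric] powr_numeral)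
  finally have "1 / (A + B - 1) ^ 3 \<le> 1 / (A powr (3 / 2) * B powr (3 / 2))"
    using AB by (intro divide_left_mono mult_pos_pos) auto
  also have "\<dots> = A powr (- 3 / 2) * B powr (- 3 / 2)" using AB by (simp add: powr_minus field_simps)
  finally have "1 / (A + B - 1) ^ 3 \<le> A powr (- 3 / 2) * B powr (- 3 / 2)" .
  moreover have "1 + \<bar>real_of_int m\<bar> + \<bar>real_of_int n\<bar> = A + B - 1" by (simp add: A_def B_def)
  ultimately show "(case mn of (m, n) \<Rightarrow> 1 / (1 + \<bar>real_of_int m\<bar> + \<bar>real_of_int n\<bar>) ^ 3) \<le>
      (case mn of (m, n) \<Rightarrow> (1 + \<bar>real_of_int m\<bar>) powr (- 3 / 2) * (1 + \<bar>real_of_int n\<bar>) powr (- 3 / 2))"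
    unfolding mn by (simp add: A_def B_def add_ac)
qed auto

lemma lattice_term_bound:
  fixes \<tau> :: complex
  assumes "\<epsilon> > 0" "Im \<tau> \<ge> \<epsilon>" "cmod \<tau> \<le> R" "(m, n) \<noteq> (0 :: int, 0 :: int)"
  shows "1 / cmod (of_int m * \<tau> + of_int n) ^ 3 \<le>
    (2 * (1 + (1 + R) / \<epsilon>)) ^ 3 * (1 / (1 + \<bar>real_of_int m\<bar> + \<bar>real_of_int n\<bar>) ^ 3)"
proof -
  define A w C where "A = 1 + \<bar>real_of_int m\<bar> + \<bar>real_of_int n\<bar>" and "w = cmod (of_int m * \<tau> + of_int n)"
    and "C = 2 * (1 + (1 + R) / \<epsilon>)"
  have A: "A > 0" by (simp add: A_def add_pos_nonneg)
  have le: "A \<le> C * w" unfolding A_def C_def w_def by (rule lattice_norm_bound[OF assms])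
  have "w \<ge> 0" by (simp add: w_def)
  moreover have "w \<noteq> 0" using le A by auto
  ultimately have w: "w > 0" by simp
  have "A ^ 3 \<le> (C * w) ^ 3" using le A by (intro power_mono) auto
  thus ?thesis unfolding A_def[symmetric] w_def[symmetric] C_def[symmetric] using A w
    by (simp add: field_simps power_mult_distrib)
qed

lemma summable_lattice:
  fixes F :: "int \<times> int \<Rightarrow> 'a :: banach"
  assumes \<tau>: "Im \<tau> > 0"
    and F: "\<And>m n. (m, n) \<noteq> (0, 0) \<Longrightarrow> norm (F (m, n)) \<le> C / cmod (of_int m * \<tau> + of_int n) ^ 3"
  shows "(\<lambda>x. norm (F x)) summable_on int_lattice"
proof (cases "C \<ge> 0")
  case C: True
  define M where "M = C * (2 * (1 + (1 + cmod \<tau>) / Im \<tau>)) ^ 3"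
  have "(\<lambda>(m, n). M * (1 / (1 + \<bar>real_of_int m\<bar> + \<bar>real_of_int n\<bar>) ^ 3)) summable_on int_lattice"
    using summable_on_subset[OF summable_on_cmult_right[OF summable_lattice_cube, of M]]
    by (simp add: case_prod_unfold)
  thus ?thesis
  proof (rule Infinite_Sum.abs_summable_on_comparison_test')
    fix mn assume "mn \<in> int_lattice"
    then obtain m n where mn: "mn = (m, n)" "(m, n) \<noteq> (0, 0)" by (cases mn) auto
    have "norm (F mn) \<le> C * (1 / cmod (of_int m * \<tau> + of_int n) ^ 3)" using F[OF mn(2)] mn(1) by simp
    also have "\<dots> \<le> C * ((2 * (1 + (1 + cmod \<tau>) / Im \<tau>)) ^ 3 * (1 / (1 + \<bar>real_of_int m\<bar> + \<bar>real_of_int n\<bar>) ^ 3))"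
      using \<tau> mn(2) C by (intro mult_left_mono lattice_term_bound) auto
    finally show "norm (F mn) \<le> (case mn of (m, n) \<Rightarrow> M * (1 / (1 + \<bar>real_of_int m\<bar> + \<bar>real_of_int n\<bar>) ^ 3))"
      by (simp add: mn(1) M_def mult.assoc)
  qed
next
  case False
  \<comment> \<open>The lattice point of (0, 1) is 1, so the bound there reads norm <= C and
    excludes a negative C.\<close>
  have "norm (F (0, 1)) \<le> C" using F[of 0 1] by simp
  hence False using False norm_ge_zero[of "F (0, 1)"] by linarith
  thus ?thesis ..
qed

text \<open>Puts an absolutely convergent sum over the integers into the paired form n = k, n = - k
  - 1 that the Poisson formulas produce.\<close>

lemma infsum_int_pairs:
  fixes h :: "int \<Rightarrow> 'a :: banach"
  assumes "h summable_on UNIV"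
  shows "(\<lambda>k. h (int k) + h (- int k - 1)) sums infsum h UNIV"
proof -
  have U: "range int \<union> range (\<lambda>k. - int k - 1) = UNIV"
  proof (intro equalityI subsetI)
    fix n :: int
    show "n \<in> range int \<union> range (\<lambda>k. - int k - 1)"
    proof (cases "n \<ge> 0")
      case True thus ?thesis by (intro UnI1 range_eqI[of _ _ "nat n"]) auto
    next
      case False thus ?thesis by (intro UnI2 range_eqI[of _ _ "nat (- n - 1)"]) auto
    qed
  qed auto
  have s: "h summable_on range int" "h summable_on range (\<lambda>k. - int k - 1)"
    by (rule summable_on_subset_banach[OF assms], simp)+
  have "infsum h UNIV = infsum h (range int) + infsum h (range (\<lambda>k. - int k - 1))"
    unfolding U[symmetric] by (rule infsum_Un_disjoint[OF s]) auto
  moreover have "((\<lambda>k. h (int k)) has_sum infsum h (range int)) UNIV"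
    using has_sum_infsum[OF s(1)] by (subst (asm) has_sum_reindex) (auto simp: o_def inj_on_def)
  moreover have "((\<lambda>k. h (- int k - 1)) has_sum infsum h (range (\<lambda>k. - int k - 1))) UNIV"
    using has_sum_infsum[OF s(2)] by (subst (asm) has_sum_reindex) (auto simp: o_def inj_on_def)
  ultimately show ?thesis by (simp only: sums_add has_sum_imp_sums)
qed

text \<open>The symmetry (m, n) -> (- m, - n) folds the lattice onto the rows m > 0 and the half
  axis m = 0, n > 0, each counted twice. The axis has no Poisson expansion of its own and is moved
  to the other side, where it becomes a multiple of zeta(3) or 0.\<close>

lemma infsum_lattice_even:
  fixes F :: "int \<times> int \<Rightarrow> real"
  assumes F: "(\<lambda>x. norm (F x)) summable_on int_lattice" and even: "\<And>m n. F (- m, - n) = F (m, n)"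
  shows "(\<lambda>k. 2 * (\<Sum>n. F (int (Suc k), int n) + F (int (Suc k), - int n - 1))) sums
      (infsum F int_lattice - 2 * (\<Sum>n. F (0, int (Suc n))))"
    and "\<And>k. (\<lambda>n. F (int (Suc k), int n) + F (int (Suc k), - int n - 1)) sums
      (\<Sum>n. F (int (Suc k), int n) + F (int (Suc k), - int n - 1))"
proof -
  have S: "F summable_on int_lattice" using F by (rule abs_summable_summable)
  have sub: "F summable_on A" if "A \<subseteq> int_lattice" for A using summable_on_subset[OF S that] .
  define P where "P = range (\<lambda>k. int (Suc k)) \<times> (UNIV :: int set)"
  define P' where "P' = range (\<lambda>k. - int (Suc k)) \<times> (UNIV :: int set)"
  define O1 where "O1 = range (\<lambda>n. (0 :: int, int (Suc n)))"
  define O2 where "O2 = range (\<lambda>n. (0 :: int, - int (Suc n)))"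
  have rng: "m \<in> range (\<lambda>k. int (Suc k)) \<longleftrightarrow> m > 0" for m
    by (auto intro: range_eqI[of _ _ "nat (m - 1)"])
  have rng': "m \<in> range (\<lambda>k. - int (Suc k)) \<longleftrightarrow> m < 0" for m
    by (auto intro: range_eqI[of _ _ "nat (- m - 1)"])
  have O1: "O1 = {(m, n). m = 0 \<and> n > 0}" and O2: "O2 = {(m, n). m = 0 \<and> n < 0}"
    using rng rng' unfolding O1_def O2_def by (auto simp: image_iff)
  have P: "P = {(m, n). m > 0}" "P' = {(m, n). m < 0}"
    unfolding P_def P'_def using rng rng' by auto
  have subs: "P \<subseteq> int_lattice" "P' \<subseteq> int_lattice" "O1 \<subseteq> int_lattice" "O2 \<subseteq> int_lattice"
    unfolding P O1 O2 by auto
  have L: "int_lattice = (P \<union> P') \<union> (O1 \<union> O2)" unfolding P O1 O2 by auto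
  have "infsum F int_lattice = infsum F (P \<union> P') + infsum F (O1 \<union> O2)"
    unfolding L by (intro infsum_Un_disjoint sub) (use subs in \<open>auto simp: P O1 O2\<close>)
  also have "infsum F (P \<union> P') = infsum F P + infsum F P'"
    by (intro infsum_Un_disjoint sub subs) (auto simp: P)
  also have "infsum F (O1 \<union> O2) = infsum F O1 + infsum F O2"
    by (intro infsum_Un_disjoint sub subs) (auto simp: O1 O2)
  also have "infsum F P' = infsum F P"
    by (rule infsum_reindex_bij_witness[of _ "\<lambda>(m, n). (- m, - n)" "\<lambda>(m, n). (- m, - n)"])
       (auto simp: P even)
  also have "infsum F O2 = infsum F O1"
  proof -
    have "F (0, - n) = F (0, n)" for n using even[of 0 n] by simp
    thus ?thesis
      by (intro infsum_reindex_bij_witness[of _ "\<lambda>(m, n). (- m, - n)" "\<lambda>(m, n). (- m, - n)"]) (auto simp: O1 O2)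
  qed
  finally have tot: "infsum F int_lattice = 2 * infsum F P + 2 * infsum F O1" by simp
  have "((\<lambda>n. F (0, int (Suc n))) has_sum infsum F O1) UNIV"
    using has_sum_infsum[OF sub[OF subs(3)]] unfolding O1_def
    by (subst (asm) has_sum_reindex) (auto simp: o_def inj_on_def)
  hence o: "(\<Sum>n. F (0, int (Suc n))) = infsum F O1" using has_sum_imp_sums sums_unique by metis
  have row: "(\<lambda>n. F (m, n)) summable_on UNIV" if "m \<in> range (\<lambda>k. int (Suc k))" for m
  proof -
    have "(\<lambda>(x, y). F (x, y)) summable_on P" using sub[OF subs(1)] by simp
    thus ?thesis unfolding P_def using that by (intro summable_on_SigmaD1[where f = "\<lambda>x y. F (x, y)"]) auto
  qed
  show rows: "(\<lambda>n. F (int (Suc k), int n) + F (int (Suc k), - int n - 1)) sums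
      (\<Sum>n. F (int (Suc k), int n) + F (int (Suc k), - int n - 1))" for k
    using infsum_int_pairs[OF row[of "int (Suc k)"]] by (simp add: sums_iff)
  have "((\<lambda>m. infsum (\<lambda>n. F (m, n)) UNIV) has_sum infsum F P) (range (\<lambda>k. int (Suc k)))"
  proof (rule has_sum_Sigma'[where f = F and B = "\<lambda>_. UNIV"])
    show "(F has_sum infsum F P) (range (\<lambda>k. int (Suc k)) \<times> UNIV)"
      using has_sum_infsum[OF sub[OF subs(1)]] unfolding P_def .
    show "((\<lambda>y. F (m, y)) has_sum infsum (\<lambda>n. F (m, n)) UNIV) UNIV" if "m \<in> range (\<lambda>k. int (Suc k))" for m
      using has_sum_infsum[OF row[OF that]] .
  qed
  hence "((\<lambda>k. infsum (\<lambda>n. F (int (Suc k), n)) UNIV) has_sum infsum F P) UNIV"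
    by (subst (asm) has_sum_reindex) (auto simp: o_def inj_on_def)
  hence "(\<lambda>k. infsum (\<lambda>n. F (int (Suc k), n)) UNIV) sums infsum F P" by (rule has_sum_imp_sums)
  moreover have "infsum (\<lambda>n. F (int (Suc k), n)) UNIV = (\<Sum>n. F (int (Suc k), int n) + F (int (Suc k), - int n - 1))" for k
    using infsum_int_pairs[OF row[of "int (Suc k)"]] by (simp add: sums_iff)
  ultimately have "(\<lambda>k. 2 * (\<Sum>n. F (int (Suc k), int n) + F (int (Suc k), - int n - 1))) sums (2 * infsum F P)"
    by (intro sums_mult) simp
  thus "(\<lambda>k. 2 * (\<Sum>n. F (int (Suc k), int n) + F (int (Suc k), - int n - 1))) sums
      (infsum F int_lattice - 2 * (\<Sum>n. F (0, int (Suc n))))" unfolding o tot by simp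
qed

section \<open>Interchange of the two instanton sums\<close>

lemma sums_nonzero_int_pairs:
  fixes h :: "int \<Rightarrow> 'a :: banach"
  assumes "h summable_on (UNIV - {0})"
  shows "(\<lambda>k. h (int (Suc k)) + h (- int (Suc k))) sums infsum h (UNIV - {0})"
proof -
  have U: "range (\<lambda>k. int (Suc k)) \<union> range (\<lambda>k. - int (Suc k)) = UNIV - {0}"
  proof (intro equalityI subsetI)
    fix n :: int assume "n \<in> UNIV - {0}"
    hence "n > 0 \<or> n < 0" by auto
    thus "n \<in> range (\<lambda>k. int (Suc k)) \<union> range (\<lambda>k. - int (Suc k))"
    proof
      assume "n > 0" thus ?thesis by (intro UnI1 range_eqI[of _ _ "nat (n - 1)"]) auto
    next
      assume "n < 0" thus ?thesis by (intro UnI2 range_eqI[of _ _ "nat (- n - 1)"]) auto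
    qed
  qed auto
  have s: "h summable_on range (\<lambda>k. int (Suc k))" "h summable_on range (\<lambda>k. - int (Suc k))"
    by (rule summable_on_subset_banach[OF assms], force)+
  have "infsum h (UNIV - {0}) = infsum h (range (\<lambda>k. int (Suc k))) + infsum h (range (\<lambda>k. - int (Suc k)))"
    unfolding U[symmetric] by (rule infsum_Un_disjoint[OF s]) auto
  moreover have "((\<lambda>k. h (int (Suc k))) has_sum infsum h (range (\<lambda>k. int (Suc k)))) UNIV"
    using has_sum_infsum[OF s(1)] by (subst (asm) has_sum_reindex) (auto simp: o_def inj_on_def)
  moreover have "((\<lambda>k. h (- int (Suc k))) has_sum infsum h (range (\<lambda>k. - int (Suc k)))) UNIV"
    using has_sum_infsum[OF s(2)] by (subst (asm) has_sum_reindex) (auto simp: o_def inj_on_def)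
  ultimately show ?thesis by (simp only: sums_add has_sum_imp_sums)
qed

text \<open>The instanton series are nested with q outside and k inside, whereas Poisson summation
  acts on q for fixed k: k is the row index m of the lattice and q the frequency dual to n. The
  exponential decay in k |q| justifies the exchange, and pairing q with - q makes each row a
  trigonometric series.\<close>

lemma infsum_instanton:
  fixes c :: "int \<Rightarrow> nat \<Rightarrow> complex"
  assumes b: "b > 0"
    and bound: "\<And>q k. q \<noteq> 0 \<Longrightarrow> k \<ge> 1 \<Longrightarrow> norm (c q k) \<le> M * ((real_of_int q)\<^sup>2 * exp (- b * (real k * \<bar>real_of_int q\<bar>)))"
    and row: "\<And>k. (\<lambda>q. c (int (Suc q)) (Suc k) + c (- int (Suc q)) (Suc k)) sums r k"
  shows "r sums (\<Sum>\<^sub>\<infinity>q\<in>UNIV - {0}. \<Sum>\<^sub>\<infinity>k\<in>{1..}. c q k)"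
proof -
  have M: "M \<ge> 0"
  proof -
    have "0 \<le> M * exp (- b)"
      by (rule order_trans[OF norm_ge_zero[of "c 1 1"]]) (use bound[of 1 1] in simp)
    thus ?thesis by (simp add: zero_le_mult_iff)
  qed
  define F where "F q = (real_of_int q)\<^sup>2 * exp (- b * \<bar>real_of_int q\<bar>)" for q
  have sF: "F summable_on (UNIV - {0})"
  proof -
    have s: "(\<lambda>k. real (Suc k) ^ 2 * exp (- b * real (Suc k))) summable_on UNIV"
      using summable_square_exp[OF b] by (intro summable_nonneg_imp_summable_on) auto
    have "F summable_on (range (\<lambda>k. int (Suc k)) \<union> range (\<lambda>k. - int (Suc k)))"
    proof (rule summable_on_union)
      show "F summable_on range (\<lambda>k. int (Suc k))"
        using s by (subst summable_on_reindex) (auto simp: o_def inj_on_def F_def)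
      show "F summable_on range (\<lambda>k. - int (Suc k))"
      proof (subst summable_on_reindex)
        have "(F \<circ> (\<lambda>k. - int (Suc k))) = (\<lambda>k. real (Suc k) ^ 2 * exp (- b * real (Suc k)))"
          by (simp only: o_def F_def of_int_minus of_int_of_nat_eq power2_minus abs_minus_cancel abs_of_nat)
        thus "(F \<circ> (\<lambda>k. - int (Suc k))) summable_on UNIV" using s by (simp only:)
      qed (simp add: inj_on_def)
    qed
    moreover have "UNIV - {0} \<subseteq> range (\<lambda>k. int (Suc k)) \<union> range (\<lambda>k. - int (Suc k))"
    proof
      fix n :: int assume "n \<in> UNIV - {0}"
      hence "n > 0 \<or> n < 0" by auto
      thus "n \<in> range (\<lambda>k. int (Suc k)) \<union> range (\<lambda>k. - int (Suc k))"
      proof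
        assume "n > 0" thus ?thesis by (intro UnI1 range_eqI[of _ _ "nat (n - 1)"]) auto
      next
        assume "n < 0" thus ?thesis by (intro UnI2 range_eqI[of _ _ "nat (- n - 1)"]) auto
      qed
    qed
    ultimately show ?thesis by (rule summable_on_subset)
  qed
  have sE: "(\<lambda>k. exp (- b * real k)) summable_on {1..}"
  proof -
    have "summable (\<lambda>k. exp (- b) ^ k)" using b by (intro summable_geometric) auto
    hence "summable (\<lambda>k. exp (- b * real k))" by (simp add: exp_of_nat_mult[symmetric] mult.commute)
    hence "(\<lambda>k. exp (- b * real k)) summable_on UNIV" by (intro summable_nonneg_imp_summable_on) auto
    thus ?thesis by (rule summable_on_subset) auto
  qed
  have "(\<lambda>(q, k). M * exp b * F q * exp (- b * real k)) summable_on Sigma (UNIV - {0}) (\<lambda>_. {1..})"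
  proof (rule summable_on_SigmaI)
    show "((\<lambda>k. case (q, k) of (q, k) \<Rightarrow> M * exp b * F q * exp (- b * real k)) has_sum
        (M * exp b * F q * infsum (\<lambda>k. exp (- b * real k)) {1..})) {1..}" for q
      using has_sum_cmult_right[OF has_sum_infsum[OF sE]] by simp
    show "(\<lambda>q. M * exp b * F q * infsum (\<lambda>k. exp (- b * real k)) {1..}) summable_on UNIV - {0}"
      by (intro summable_on_cmult_left summable_on_cmult_right sF)
  qed (use M in \<open>auto simp: F_def\<close>)
  hence "(\<lambda>qk. norm ((\<lambda>(q, k). c q k) qk)) summable_on Sigma (UNIV - {0}) (\<lambda>_. {1..})"
  proof (rule Infinite_Sum.abs_summable_on_comparison_test')
    fix qk :: "int \<times> nat" assume "qk \<in> Sigma (UNIV - {0}) (\<lambda>_. {1..})"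
    then obtain q k where qk: "qk = (q, k)" "q \<noteq> 0" "k \<ge> 1" by auto
    have q1: "\<bar>real_of_int q\<bar> \<ge> 1" using qk(2) by linarith
    have k1: "real k \<ge> 1" using qk(3) by simp
    \<comment> \<open>Gives k |q| >= k + |q| - 1, which separates the exponential into a factor in q
      and one in k at the cost of the constant exp b.\<close>
    have "0 \<le> (real k - 1) * (\<bar>real_of_int q\<bar> - 1)" using q1 k1 by (intro mult_nonneg_nonneg) auto
    hence "\<bar>real_of_int q\<bar> + real k - 1 \<le> real k * \<bar>real_of_int q\<bar>" by (simp add: algebra_simps)
    hence "b * (\<bar>real_of_int q\<bar> + real k - 1) \<le> b * (real k * \<bar>real_of_int q\<bar>)" using b by (intro mult_left_mono) auto
    hence "- b * (real k * \<bar>real_of_int q\<bar>) \<le> b + (- b * \<bar>real_of_int q\<bar> + - b * real k)" by (simp add: algebra_simps)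
    hence e: "exp (- b * (real k * \<bar>real_of_int q\<bar>)) \<le> exp b * (exp (- b * \<bar>real_of_int q\<bar>) * exp (- b * real k))"
      unfolding exp_add[symmetric] exp_le_cancel_iff .
    have "norm (c q k) \<le> M * ((real_of_int q)\<^sup>2 * exp (- b * (real k * \<bar>real_of_int q\<bar>)))" by (rule bound[OF qk(2,3)])
    also have "\<dots> \<le> M * ((real_of_int q)\<^sup>2 * (exp b * (exp (- b * \<bar>real_of_int q\<bar>) * exp (- b * real k))))"
      using M e by (intro mult_left_mono) auto
    finally show "norm ((\<lambda>(q, k). c q k) qk) \<le> (\<lambda>(q, k). M * exp b * F q * exp (- b * real k)) qk"
      unfolding qk(1) F_def by (simp add: mult_ac)
  qed
  hence S: "(\<lambda>(q, k). c q k) summable_on (UNIV - {0}) \<times> {1..}"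
    by (rule abs_summable_summable)
  hence S': "(\<lambda>(k, q). c q k) summable_on {1..} \<times> (UNIV - {0})"
    by (subst summable_on_swap) (simp add: case_prod_unfold)
  have col: "(\<lambda>q. c q k) summable_on (UNIV - {0})" if "k \<ge> 1" for k
    using S' that by (intro summable_on_SigmaD1[where f = "\<lambda>k q. c q k"]) auto
  have "infsum (\<lambda>q. infsum (\<lambda>k. c q k) {1..}) (UNIV - {0}) = infsum (\<lambda>k. infsum (\<lambda>q. c q k) (UNIV - {0})) {1..}"
    by (rule infsum_swap_banach[OF S])
  moreover have "(\<lambda>k. infsum (\<lambda>q. c q k) (UNIV - {0})) summable_on {1..}"
    using summable_on_Sigma_banach[OF S'] by simp
  hence "((\<lambda>k. infsum (\<lambda>q. c q k) (UNIV - {0})) has_sum infsum (\<lambda>k. infsum (\<lambda>q. c q k) (UNIV - {0})) {1..}) {1..}"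
    by (rule has_sum_infsum)
  hence "((\<lambda>k. infsum (\<lambda>q. c q (Suc k)) (UNIV - {0})) has_sum infsum (\<lambda>k. infsum (\<lambda>q. c q k) (UNIV - {0})) {1..}) UNIV"
  proof (subst has_sum_reindex_bij_betw[where g = Suc and B = "{1..}" and f = "\<lambda>k. infsum (\<lambda>q. c q k) (UNIV - {0})"])
    show "bij_betw Suc UNIV {1..}" by (rule bij_betwI[of _ _ _ "\<lambda>n. n - 1"]) auto
  qed
  moreover have "infsum (\<lambda>q. c q (Suc k)) (UNIV - {0}) = r k" for k
    using sums_unique2[OF sums_nonzero_int_pairs[OF col] row, of k] by simp
  ultimately show ?thesis using has_sum_imp_sums by simp
qed

lemma bessel_K_nonneg: "x > 0 \<Longrightarrow> \<bar>\<nu>\<bar> \<le> 1 \<Longrightarrow> bessel_K \<nu> x \<ge> 0"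
  by (rule has_integral_nonneg[OF bessel_K_has_integral]) auto

text \<open>Because cosh s >= 1, raising the argument from y to z costs at least exp(y - z) under
  the integral. With y the smallest argument that occurs, all instanton terms get one common
  constant.\<close>

lemma bessel_K_decay:
  assumes "0 < y" "y \<le> z" "\<bar>\<nu>\<bar> \<le> 1"
  shows "bessel_K \<nu> z \<le> exp y * bessel_K \<nu> y * exp (- z)"
proof -
  have "bessel_K \<nu> z \<le> exp (y - z) * bessel_K \<nu> y"
  proof (rule has_integral_le[OF bessel_K_has_integral has_integral_mult_right[OF bessel_K_has_integral]])
    fix s :: real
    have "0 \<le> (z - y) * (cosh s - 1)" using assms by (intro mult_nonneg_nonneg) (auto simp: cosh_real_ge_1)
    hence "exp (- z * cosh s) \<le> exp (y - z) * exp (- y * cosh s)"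
      unfolding exp_add[symmetric] exp_le_cancel_iff by (simp add: algebra_simps)
    hence "exp (- z * cosh s) * cosh (\<nu> * s) \<le> (exp (y - z) * exp (- y * cosh s)) * cosh (\<nu> * s)"
      by (rule mult_right_mono) simp
    thus "exp (- z * cosh s) * cosh (\<nu> * s) \<le> exp (y - z) * (exp (- y * cosh s) * cosh (\<nu> * s))"
      by (simp only: mult.assoc)
  qed (use assms in auto)
  thus ?thesis by (simp add: exp_diff exp_minus field_simps)
qed

text \<open>The companion of \<open>eisenstein\<close>, of weight \<open>(-1, 1)\<close> up to \<open>|j|\<^sup>3\<close>, through which its derivative is expressed.\<close>

definition latticeG :: "complex \<Rightarrow> complex" where
  "latticeG \<tau> = (\<Sum>\<^sub>\<infinity>(m, n)\<in>int_lattice. (of_int m * \<tau> + of_int n)\<^sup>2 / of_real (cmod (of_int m * \<tau> + of_int n)) ^ 5)"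

lemma int_lattice_nz:
  assumes "Im \<tau> > 0" "(m, n) \<noteq> (0 :: int, 0 :: int)"
  shows "of_int m * \<tau> + of_int n \<noteq> 0"
  using assms by (auto simp: complex_eq_iff)

lemma eisenstein_abs_summable:
  assumes "Im \<tau> > 0"
  shows "(\<lambda>x. norm ((\<lambda>(m, n). 1 / cmod (of_int m * \<tau> + of_int n) ^ 3) x)) summable_on int_lattice"
  by (rule summable_lattice[OF assms, where C = 1]) auto

lemma norm_square_over_fifth:
  fixes w :: complex
  assumes "w \<noteq> 0"
  shows "norm (w\<^sup>2 / of_real (cmod w) ^ 5) = 1 / cmod w ^ 3"
proof -
  have "(cmod w)\<^sup>2 / cmod w ^ 5 = 1 / cmod w ^ 3"
    using assms by (simp add: divide_simps flip: power_add)
  thus ?thesis by (simp add: norm_divide norm_power)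
qed

lemma latticeG_abs_summable:
  assumes "Im \<tau> > 0"
  shows "(\<lambda>x. norm ((\<lambda>(m, n). (of_int m * \<tau> + of_int n)\<^sup>2 / of_real (cmod (of_int m * \<tau> + of_int n)) ^ 5) x)) summable_on int_lattice"
proof (rule summable_lattice[OF assms, where C = 1])
  fix m n :: int assume "(m, n) \<noteq> (0, 0)"
  hence "of_int m * \<tau> + of_int n \<noteq> 0" using assms by (rule int_lattice_nz[rotated])
  thus "norm ((\<lambda>(m, n). (of_int m * \<tau> + of_int n)\<^sup>2 / of_real (cmod (of_int m * \<tau> + of_int n)) ^ 5) (m, n)) \<le> 1 / cmod (of_int m * \<tau> + of_int n) ^ 3"
    using norm_square_over_fifth by simp
qed

lemma norm_latticeG_le:
  assumes "Im \<tau> > 0"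
  shows "cmod (latticeG \<tau>) \<le> eisenstein \<tau>"
proof -
  have "cmod (latticeG \<tau>) \<le> infsum (\<lambda>x. norm ((\<lambda>(m, n). (of_int m * \<tau> + of_int n)\<^sup>2 / of_real (cmod (of_int m * \<tau> + of_int n)) ^ 5) x)) int_lattice"
    unfolding latticeG_def by (rule norm_infsum_bound[OF latticeG_abs_summable[OF assms]])
  also have "\<dots> = eisenstein \<tau>" unfolding eisenstein_def
  proof (rule infsum_cong)
    fix mn assume "mn \<in> int_lattice"
    then obtain m n where mn: "mn = (m, n)" "(m, n) \<noteq> (0, 0)" by (cases mn) auto
    have "of_int m * \<tau> + of_int n \<noteq> 0" using assms mn(2) by (rule int_lattice_nz)
    thus "norm ((\<lambda>(m, n). (of_int m * \<tau> + of_int n)\<^sup>2 / of_real (cmod (of_int m * \<tau> + of_int n)) ^ 5) mn) = (case mn of (m, n) \<Rightarrow> 1 / cmod (of_int m * \<tau> + of_int n) ^ 3)"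
      unfolding mn(1) using norm_square_over_fifth by simp
  qed
  finally show ?thesis .
qed

lemma eisenstein_pos:
  assumes "Im \<tau> > 0"
  shows "eisenstein \<tau> > 0"
proof -
  have "sum (\<lambda>(m, n). 1 / cmod (of_int m * \<tau> + of_int n) ^ 3) {(0, 1)} \<le> eisenstein \<tau>"
    unfolding eisenstein_def
    by (rule finite_sum_le_infsum) (use abs_summable_summable[OF eisenstein_abs_summable[OF assms]] in auto)
  thus ?thesis by simp
qed

section \<open>Instanton sums\<close>

context
  fixes \<tau> :: complex
  assumes \<tau>: "Im \<tau> > 0"
begin

text \<open>\<open>rowA\<close>, \<open>rowB\<close> and \<open>rowC\<close> are the frequency sums
  that belong to row m = k + 1 of the lattice. They carry the sums over \<open>\<eta>_q\<close>,
  over \<open>q^2 V_q\<close> and over \<open>q A_q\<close> respectively.\<close>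

definition rowA :: "nat \<Rightarrow> real" where
  "rowA k = (\<Sum>q. real (Suc q) * cos (2 * pi * real (Suc q) * (real (Suc k) * Re \<tau>)) * bessel_K 1 (2 * pi * real (Suc q) * (real (Suc k) * Im \<tau>)))"
definition rowB :: "nat \<Rightarrow> real" where
  "rowB k = (\<Sum>q. real (Suc q) ^ 2 * cos (2 * pi * real (Suc q) * (real (Suc k) * Re \<tau>)) * bessel_K 0 (2 * pi * real (Suc q) * (real (Suc k) * Im \<tau>)))"
definition rowC :: "nat \<Rightarrow> real" where
  "rowC k = (\<Sum>q. real (Suc q) ^ 2 * sin (2 * pi * real (Suc q) * (real (Suc k) * Re \<tau>)) * bessel_K 1 (2 * pi * real (Suc q) * (real (Suc k) * Im \<tau>)))"

lemma row_pos: "real (Suc k) * Im \<tau> > 0" using \<tau> by simp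

lemma lattice_row_Complex:
  "of_int (int (Suc k)) * \<tau> + of_int (int n) = Complex (real (Suc k) * Re \<tau> + real n) (real (Suc k) * Im \<tau>)"
  "of_int (int (Suc k)) * \<tau> + of_int (- int n - 1) = Complex (real (Suc k) * Re \<tau> - real n - 1) (real (Suc k) * Im \<tau>)"
  by (simp_all add: complex_eq_iff algebra_simps)

lemma eisenstein_rows:
  "(\<lambda>k. 2 * (2 / (real (Suc k) * Im \<tau>)\<^sup>2 + 8 * pi / (real (Suc k) * Im \<tau>) * rowA k)) sums (eisenstein \<tau> - 2 * zeta3)"
proof -
  let ?F = "\<lambda>(m, n). 1 / cmod (of_int m * \<tau> + of_int n) ^ 3"
  have "?F (- m, - n) = ?F (m, n)" for m n :: int
    using norm_minus_cancel[of "of_int m * \<tau> + of_int n"] by (simp add: algebra_simps)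
  note L = infsum_lattice_even(1)[of ?F, OF eisenstein_abs_summable[OF \<tau>] this]
  have "(\<Sum>n. ?F (int (Suc k), int n) + ?F (int (Suc k), - int n - 1)) =
      2 / (real (Suc k) * Im \<tau>)\<^sup>2 + 8 * pi / (real (Suc k) * Im \<tau>) * rowA k" for k
    using sums_unique[OF bessel_K1_poisson_even(2)[OF row_pos[of k], of "real (Suc k) * Re \<tau>"]]
    unfolding rowA_def prod.case lattice_row_Complex by simp
  moreover have "(\<Sum>n. ?F (0, int (Suc n))) = zeta3"
    unfolding zeta3_def prod.case by (simp flip: of_nat_Suc)
  ultimately show ?thesis using L unfolding eisenstein_def by simp
qed

lemma latticeG_has_sum:
  "((\<lambda>(m, n). (of_int m * \<tau> + of_int n)\<^sup>2 / of_real (cmod (of_int m * \<tau> + of_int n)) ^ 5) has_sum latticeG \<tau>) int_lattice"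
  unfolding latticeG_def by (rule has_sum_infsum[OF abs_summable_summable[OF latticeG_abs_summable[OF \<tau>]]])

lemma eisenstein_has_sum:
  "((\<lambda>(m, n). 1 / cmod (of_int m * \<tau> + of_int n) ^ 3) has_sum eisenstein \<tau>) int_lattice"
  unfolding eisenstein_def by (rule has_sum_infsum[OF abs_summable_summable[OF eisenstein_abs_summable[OF \<tau>]]])

lemma Re_Im_square_over_fifth:
  fixes w :: complex
  shows "Re (w\<^sup>2 / of_real (cmod w) ^ 5) = ((Re w)\<^sup>2 - (Im w)\<^sup>2) / cmod w ^ 5"
    and "Im (w\<^sup>2 / of_real (cmod w) ^ 5) = 2 * (Re w * Im w) / cmod w ^ 5"
  by (simp_all flip: of_real_power add: power2_eq_square)

text \<open>The kernel of \<open>bessel_K0_poisson\<close> at w = m \<tau> + n is (Im(w)^2 - 2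
  Re(w)^2) / |w|^5, which equals - 1/2 times the term of E plus - 3/2 times the real part of the
  term of G. On the axis it is - 2 / n^3, whence 4 zeta(3).\<close>

lemma lattice_rowsB:
  "(\<lambda>k. 2 * (16 * pi\<^sup>2 * rowB k)) sums (4 * zeta3 - (eisenstein \<tau> + 3 * Re (latticeG \<tau>)) / 2)"
proof -
  let ?F = "\<lambda>(m, n). ((Im (of_int m * \<tau> + of_int n))\<^sup>2 - 2 * (Re (of_int m * \<tau> + of_int n))\<^sup>2) / cmod (of_int m * \<tau> + of_int n) ^ 5"
  have pt: "?F x = - (1 / 2) * (\<lambda>(m, n). 1 / cmod (of_int m * \<tau> + of_int n) ^ 3) x
     + - (3 / 2) * Re ((\<lambda>(m, n). (of_int m * \<tau> + of_int n)\<^sup>2 / of_real (cmod (of_int m * \<tau> + of_int n)) ^ 5) x)"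
    if "x \<in> int_lattice" for x
  proof -
    obtain m n where "x = (m, n)" by (cases x)
    hence x: "x = (m, n)" "(m, n) \<noteq> (0, 0)" using that by auto
    define w where "w = of_int m * \<tau> + of_int n"
    have w: "w \<noteq> 0" unfolding w_def by (rule int_lattice_nz[OF \<tau> x(2)])
    have "1 / cmod w ^ 3 = (cmod w)\<^sup>2 / cmod w ^ 5"
      using w by (simp add: divide_simps flip: power_add)
    also have "\<dots> = ((Re w)\<^sup>2 + (Im w)\<^sup>2) / cmod w ^ 5" by (simp add: cmod_power2)
    finally have e: "1 / cmod w ^ 3 = ((Re w)\<^sup>2 + (Im w)\<^sup>2) / cmod w ^ 5" .
    show ?thesis unfolding x(1) prod.case w_def[symmetric] Re_Im_square_over_fifth e
      using w by (simp add: field_simps)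
  qed
  have "((\<lambda>x. - (1 / 2) * (\<lambda>(m, n). 1 / cmod (of_int m * \<tau> + of_int n) ^ 3) x
     + - (3 / 2) * Re ((\<lambda>(m, n). (of_int m * \<tau> + of_int n)\<^sup>2 / of_real (cmod (of_int m * \<tau> + of_int n)) ^ 5) x))
     has_sum (- (1 / 2) * eisenstein \<tau> + - (3 / 2) * Re (latticeG \<tau>))) int_lattice"
    by (intro has_sum_add has_sum_cmult_right eisenstein_has_sum has_sum_Re latticeG_has_sum)
  hence hs: "(?F has_sum (- (1 / 2) * eisenstein \<tau> + - (3 / 2) * Re (latticeG \<tau>))) int_lattice"
    by (subst has_sum_cong[OF pt])
  hence abs: "(\<lambda>x. norm (?F x)) summable_on int_lattice"
    using has_sum_imp_summable summable_on_iff_abs_summable_on_real by fastforce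
  have "?F (- m, - n) = ?F (m, n)" for m n :: int
  proof -
    have "of_int (- m) * \<tau> + of_int (- n) = - (of_int m * \<tau> + of_int n)" by simp
    thus ?thesis unfolding prod.case by (simp only: norm_minus_cancel uminus_complex.sel power2_minus)
  qed
  note L = infsum_lattice_even(1)[of ?F, OF abs this]
  have "(\<Sum>n. ?F (int (Suc k), int n) + ?F (int (Suc k), - int n - 1)) = 16 * pi\<^sup>2 * rowB k" for k
    using sums_unique[OF bessel_K0_poisson(2)[OF row_pos[of k], of "real (Suc k) * Re \<tau>"]]
    unfolding rowB_def prod.case lattice_row_Complex complex.sel by simp
  moreover have "(\<Sum>n. ?F (0, int (Suc n))) = - 2 * zeta3"
  proof -
    have "?F (0, int (Suc n)) = - 2 * (1 / real (Suc n) ^ 3)" for n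
      by (simp add: divide_simps eval_nat_numeral del: of_nat_Suc)
    moreover have "summable (\<lambda>n. 1 / real (Suc n) ^ 3)"
      using inverse_power_summable[of 3, where 'a = real] summable_Suc_iff[of "\<lambda>n. inverse (real n ^ 3)"]
      by (simp add: divide_inverse)
    ultimately show ?thesis unfolding zeta3_def by (simp only: suminf_mult)
  qed
  ultimately have "(\<lambda>k. 2 * (16 * pi\<^sup>2 * rowB k)) sums (infsum ?F int_lattice - 2 * (- 2 * zeta3))" using L by (simp only:)
  moreover have "infsum ?F int_lattice - 2 * (- 2 * zeta3) = 4 * zeta3 - (eisenstein \<tau> + 3 * Re (latticeG \<tau>)) / 2"
    unfolding infsumI[OF hs] by (simp add: field_simps)
  ultimately show ?thesis by (simp only:)
qed

text \<open>Re w Im w / |w|^5 is half the imaginary part of the term of G, and it vanishes on the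
  axis m = 0, so no zeta value appears.\<close>

lemma lattice_rowsC:
  "(\<lambda>k. 2 * (16 * pi\<^sup>2 / 3 * rowC k)) sums (Im (latticeG \<tau>) / 2)"
proof -
  let ?F = "\<lambda>(m, n). (Re (of_int m * \<tau> + of_int n) * Im (of_int m * \<tau> + of_int n)) / cmod (of_int m * \<tau> + of_int n) ^ 5"
  have pt: "?F x = 1 / 2 * Im ((\<lambda>(m, n). (of_int m * \<tau> + of_int n)\<^sup>2 / of_real (cmod (of_int m * \<tau> + of_int n)) ^ 5) x)" for x
  proof (cases x)
    case (Pair m n)
    show ?thesis unfolding Pair prod.case Re_Im_square_over_fifth by simp
  qed
  have hs: "(?F has_sum (1 / 2 * Im (latticeG \<tau>))) int_lattice"
    unfolding pt by (intro has_sum_cmult_right has_sum_Im latticeG_has_sum)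
  hence abs: "(\<lambda>x. norm (?F x)) summable_on int_lattice"
    using has_sum_imp_summable summable_on_iff_abs_summable_on_real by fastforce
  have "?F (- m, - n) = ?F (m, n)" for m n :: int
  proof -
    have "of_int (- m) * \<tau> + of_int (- n) = - (of_int m * \<tau> + of_int n)" by simp
    thus ?thesis unfolding prod.case by (simp only: norm_minus_cancel uminus_complex.sel minus_mult_minus)
  qed
  note L = infsum_lattice_even(1)[of ?F, OF abs this]
  have "(\<Sum>n. ?F (int (Suc k), int n) + ?F (int (Suc k), - int n - 1)) = 16 * pi\<^sup>2 / 3 * rowC k" for k
  proof -
    define a where "a = real (Suc k) * Im \<tau>"
    have a: "a > 0" unfolding a_def by (rule row_pos)
    \<comment> \<open>Multiplication by a = Im w supplies the missing factor of the kernel and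
      removes 1 / a from the Poisson formula.\<close>
    from sums_mult[OF bessel_K1_poisson_odd(2)[OF a, of "real (Suc k) * Re \<tau>"], of a]
    have "(\<lambda>n. ?F (int (Suc k), int n) + ?F (int (Suc k), - int n - 1)) sums (a * (16 * pi\<^sup>2 / (3 * a) * rowC k))"
      unfolding rowC_def prod.case lattice_row_Complex complex.sel a_def[symmetric] by (simp only: distrib_left times_divide_eq_right mult.commute)
    thus ?thesis using a by (simp add: sums_iff)
  qed
  moreover have "(\<Sum>n. ?F (0, int (Suc n))) = 0" by simp
  ultimately have "(\<lambda>k. 2 * (16 * pi\<^sup>2 / 3 * rowC k)) sums (infsum ?F int_lattice - 2 * 0)" using L by (simp only:)
  moreover have "infsum ?F int_lattice - 2 * 0 = Im (latticeG \<tau>) / 2" unfolding infsumI[OF hs] by simp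
  ultimately show ?thesis by (simp only:)
qed

end

lemma exp_instanton:
  "exp (- 2 * of_real pi * \<i> * of_nat k * of_int q * of_real x) =
     Complex (cos (2 * pi * real_of_int q * (real k * x))) (- sin (2 * pi * real_of_int q * (real k * x)))"
proof -
  have "- 2 * of_real pi * \<i> * of_nat k * of_int q * of_real x = \<i> * of_real (- (2 * pi * real_of_int q * (real k * x)))"
    by simp
  thus ?thesis by (simp only: cis_conv_exp[symmetric]) (simp add: complex_eq_iff)
qed

lemma bessel_argument: "2 * pi * real k * cmod (of_int q * z) = 2 * pi * \<bar>real_of_int q\<bar> * (real k * cmod z)"
  by (simp add: norm_mult)

lemma bessel_K_instanton_bound:
  assumes r: "r > 0" and \<nu>: "\<bar>\<nu>\<bar> \<le> 1" and q: "q \<noteq> 0" and k: "k \<ge> 1"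
  shows "\<bar>bessel_K \<nu> (2 * pi * \<bar>real_of_int q\<bar> * (real k * r))\<bar> \<le>
    exp (2 * pi * r) * bessel_K \<nu> (2 * pi * r) * exp (- (2 * pi * r) * (real k * \<bar>real_of_int q\<bar>))"
proof -
  have q1: "\<bar>real_of_int q\<bar> \<ge> 1" using q by linarith
  have k1: "real k \<ge> 1" using k by simp
  have kq: "1 \<le> \<bar>real_of_int q\<bar> * real k" using mult_mono[OF q1 k1] by simp
  have "2 * pi * r * 1 \<le> 2 * pi * r * (\<bar>real_of_int q\<bar> * real k)" by (rule mult_left_mono[OF kq]) (use r in simp)
  hence le: "2 * pi * r \<le> 2 * pi * \<bar>real_of_int q\<bar> * (real k * r)" by (simp add: mult_ac)
  have "\<bar>bessel_K \<nu> (2 * pi * \<bar>real_of_int q\<bar> * (real k * r))\<bar> = bessel_K \<nu> (2 * pi * \<bar>real_of_int q\<bar> * (real k * r))"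
    using q1 k1 r by (intro abs_of_nonneg bessel_K_nonneg[OF _ \<nu>]) auto
  also have "\<dots> \<le> exp (2 * pi * r) * bessel_K \<nu> (2 * pi * r) * exp (- (2 * pi * \<bar>real_of_int q\<bar> * (real k * r)))"
    by (rule bessel_K_decay[OF _ le \<nu>]) (use r in simp)
  finally show ?thesis by (simp add: mult_ac)
qed

section \<open>Closed forms of the sums over V_q, A_q and eta_q\<close>

context
  fixes P :: nspace and \<tau> :: complex
  assumes Z0: "Z_of P $ 0 \<noteq> 0" and \<tau>_def: "\<tau> = Complex (zeta_of P $ 0) (cmod (Z_of P $ 0))"
begin

lemma inst_\<tau>: "Im \<tau> > 0" "cmod (Z_of P $ 0) = Im \<tau>" "zeta_of P $ 0 = Re \<tau>"
  using Z0 by (auto simp: \<tau>_def)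

lemma norm_q: "cmod (of_int q * Z_of P $ 0) = \<bar>real_of_int q\<bar> * Im \<tau>"
  by (simp add: norm_mult inst_\<tau>)

text \<open>The terms of q and - q add up to twice a cosine, which turns 1 / (2 pi) into 1 / pi; the
  scaling 1 / (32 pi^3) matches this with the factor 32 pi^2 of
  \<open>lattice_rowsB\<close>.\<close>

lemma inst_V_sum:
  "(\<Sum>\<^sub>\<infinity>q\<in>UNIV - {0}. (of_int q)\<^sup>2 * inst_V q P) =
     of_real (1 / (32 * pi ^ 3) * (4 * zeta3 - (eisenstein \<tau> + 3 * Re (latticeG \<tau>)) / 2))"
proof -
  define c :: "int \<Rightarrow> nat \<Rightarrow> complex" where "c q k = (of_int q)\<^sup>2 * (1 / (2 * of_real pi)) *
     (exp (- 2 * of_real pi * \<i> * of_nat k * of_int q * of_real (zeta_of P $ 0)) *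
      of_real (bessel_K 0 (2 * pi * real k * cmod (of_int q * Z_of P $ 0))))" for q k
  have V: "(of_int q)\<^sup>2 * inst_V q P = (\<Sum>\<^sub>\<infinity>k\<in>{1..}. c q k)" for q
    unfolding inst_V_def c_def infsum_cmult_right' by (simp only: mult.assoc)
  have "(\<lambda>k. of_real (1 / pi * rowB \<tau> k)) sums (\<Sum>\<^sub>\<infinity>q\<in>UNIV - {0}. \<Sum>\<^sub>\<infinity>k\<in>{1..}. c q k)"
  proof (rule infsum_instanton[where b = "2 * pi * Im \<tau>" and M = "1 / (2 * pi) * (exp (2 * pi * Im \<tau>) * bessel_K 0 (2 * pi * Im \<tau>))"])
    fix q :: int and k :: nat assume q: "q \<noteq> 0" "k \<ge> 1"
    have ba: "2 * pi * real k * (\<bar>real_of_int q\<bar> * Im \<tau>) = 2 * pi * \<bar>real_of_int q\<bar> * (real k * Im \<tau>)"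
      and qq: "\<bar>real_of_int q\<bar> * (\<bar>real_of_int q\<bar> * B) = (real_of_int q)\<^sup>2 * B" for B
      by (simp_all add: power2_eq_square mult.assoc[symmetric])
    have "norm (c q k) = 1 / (2 * pi) * ((real_of_int q)\<^sup>2 * \<bar>bessel_K 0 (2 * pi * \<bar>real_of_int q\<bar> * (real k * Im \<tau>))\<bar>)"
      unfolding c_def bessel_argument inst_\<tau>(2) by (simp add: norm_mult norm_power norm_divide)
    also have "\<dots> \<le> 1 / (2 * pi) * ((real_of_int q)\<^sup>2 * (exp (2 * pi * Im \<tau>) * bessel_K 0 (2 * pi * Im \<tau>) * exp (- (2 * pi * Im \<tau>) * (real k * \<bar>real_of_int q\<bar>))))"
      using bessel_K_instanton_bound[OF inst_\<tau>(1) _ q, of 0] by (intro mult_left_mono) auto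
    finally show "norm (c q k) \<le> 1 / (2 * pi) * (exp (2 * pi * Im \<tau>) * bessel_K 0 (2 * pi * Im \<tau>)) * ((real_of_int q)\<^sup>2 * exp (- (2 * pi * Im \<tau>) * (real k * \<bar>real_of_int q\<bar>)))"
      by (simp only: mult_ac)
  next
    fix k
    have "c (int (Suc q)) (Suc k) + c (- int (Suc q)) (Suc k) = of_real (1 / pi * (real (Suc q) ^ 2 * cos (2 * pi * real (Suc q) * (real (Suc k) * Re \<tau>)) * bessel_K 0 (2 * pi * real (Suc q) * (real (Suc k) * Im \<tau>))))" for q
      unfolding c_def bessel_argument exp_instanton inst_\<tau>(2,3)
      by (simp add: complex_eq_iff power2_eq_square field_simps del: of_nat_Suc)
    moreover have "(\<lambda>q. real (Suc q) ^ 2 * cos (2 * pi * real (Suc q) * (real (Suc k) * Re \<tau>)) * bessel_K 0 (2 * pi * real (Suc q) * (real (Suc k) * Im \<tau>))) sums rowB \<tau> k"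
      unfolding rowB_def[OF inst_\<tau>(1)] by (rule summable_sums[OF bessel_K0_poisson(1)[OF row_pos[OF inst_\<tau>(1)]]])
    ultimately show "(\<lambda>q. c (int (Suc q)) (Suc k) + c (- int (Suc q)) (Suc k)) sums of_real (1 / pi * rowB \<tau> k)"
      by (simp only: sums_of_real sums_mult)
  qed (use inst_\<tau> in simp)
  moreover have "(\<lambda>k. 1 / (32 * pi ^ 3) * (2 * (16 * pi\<^sup>2 * rowB \<tau> k))) sums (1 / (32 * pi ^ 3) * (4 * zeta3 - (eisenstein \<tau> + 3 * Re (latticeG \<tau>)) / 2))"
    by (rule sums_mult[OF lattice_rowsB[OF inst_\<tau>(1)]])
  hence "(\<lambda>k. of_real (1 / pi * rowB \<tau> k)) sums complex_of_real (1 / (32 * pi ^ 3) * (4 * zeta3 - (eisenstein \<tau> + 3 * Re (latticeG \<tau>)) / 2))"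
    unfolding sums_of_real_iff by (simp add: power2_eq_square power3_eq_cube)
  ultimately show ?thesis unfolding V using sums_unique2 by blast
qed

text \<open>The odd weight q makes the cosines of q and - q cancel and the sines add; this is the
  only way in which Im G enters the metric data apart from the derivative of E.\<close>

lemma inst_A_sum:
  "(\<Sum>\<^sub>\<infinity>q\<in>UNIV - {0}. of_int q * inst_A q P X) =
     \<i> * of_real (3 * Im \<tau> / (128 * pi ^ 3) * Im (latticeG \<tau>)) * dlog_Z0 P X"
proof -
  define c :: "int \<Rightarrow> nat \<Rightarrow> complex" where "c q k = of_int q * (- (1 / (4 * of_real pi))) *
     (exp (- 2 * of_real pi * \<i> * of_nat k * of_int q * of_real (zeta_of P $ 0)) *
      of_real (cmod (of_int q * Z_of P $ 0) * bessel_K 1 (2 * pi * real k * cmod (of_int q * Z_of P $ 0))))" for q k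
  have V: "of_int q * inst_A q P X = (\<Sum>\<^sub>\<infinity>k\<in>{1..}. c q k) * dlog_Z0 P X" for q
    unfolding inst_A_def c_def infsum_cmult_right' by (simp only: mult.assoc)
  have "(\<lambda>k. \<i> * of_real (Im \<tau> / (2 * pi) * rowC \<tau> k)) sums (\<Sum>\<^sub>\<infinity>q\<in>UNIV - {0}. \<Sum>\<^sub>\<infinity>k\<in>{1..}. c q k)"
  proof (rule infsum_instanton[where b = "2 * pi * Im \<tau>" and M = "Im \<tau> / (4 * pi) * (exp (2 * pi * Im \<tau>) * bessel_K 1 (2 * pi * Im \<tau>))"])
    fix q :: int and k :: nat assume q: "q \<noteq> 0" "k \<ge> 1"
    have ba: "2 * pi * real k * (\<bar>real_of_int q\<bar> * Im \<tau>) = 2 * pi * \<bar>real_of_int q\<bar> * (real k * Im \<tau>)"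
      and qq: "\<bar>real_of_int q\<bar> * (\<bar>real_of_int q\<bar> * B) = (real_of_int q)\<^sup>2 * B" for B
      by (simp_all add: power2_eq_square mult.assoc[symmetric])
    have "norm (c q k) = Im \<tau> / (4 * pi) * ((real_of_int q)\<^sup>2 * \<bar>bessel_K 1 (2 * pi * \<bar>real_of_int q\<bar> * (real k * Im \<tau>))\<bar>)"
      unfolding c_def norm_q ba using inst_\<tau>(1)
      by (simp add: norm_mult norm_divide abs_mult qq mult_ac)
    also have "\<dots> \<le> Im \<tau> / (4 * pi) * ((real_of_int q)\<^sup>2 * (exp (2 * pi * Im \<tau>) * bessel_K 1 (2 * pi * Im \<tau>) * exp (- (2 * pi * Im \<tau>) * (real k * \<bar>real_of_int q\<bar>))))"
      using bessel_K_instanton_bound[OF inst_\<tau>(1) _ q, of 1] inst_\<tau>(1) by (intro mult_left_mono) auto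
    finally show "norm (c q k) \<le> Im \<tau> / (4 * pi) * (exp (2 * pi * Im \<tau>) * bessel_K 1 (2 * pi * Im \<tau>)) * ((real_of_int q)\<^sup>2 * exp (- (2 * pi * Im \<tau>) * (real k * \<bar>real_of_int q\<bar>)))"
      by (simp only: mult_ac)
  next
    fix k
    have "c (int (Suc q)) (Suc k) + c (- int (Suc q)) (Suc k) = \<i> * of_real (Im \<tau> / (2 * pi) * (real (Suc q) ^ 2 * sin (2 * pi * real (Suc q) * (real (Suc k) * Re \<tau>)) * bessel_K 1 (2 * pi * real (Suc q) * (real (Suc k) * Im \<tau>))))" for q
      unfolding c_def bessel_argument exp_instanton norm_q inst_\<tau>(2,3)
      by (simp add: complex_eq_iff power2_eq_square field_simps del: of_nat_Suc)
    moreover have "(\<lambda>q. real (Suc q) ^ 2 * sin (2 * pi * real (Suc q) * (real (Suc k) * Re \<tau>)) * bessel_K 1 (2 * pi * real (Suc q) * (real (Suc k) * Im \<tau>))) sums rowC \<tau> k"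
      unfolding rowC_def[OF inst_\<tau>(1)] by (rule summable_sums[OF bessel_K1_poisson_odd(1)[OF row_pos[OF inst_\<tau>(1)]]])
    ultimately show "(\<lambda>q. c (int (Suc q)) (Suc k) + c (- int (Suc q)) (Suc k)) sums (\<i> * of_real (Im \<tau> / (2 * pi) * rowC \<tau> k))"
      by (simp only: sums_of_real sums_mult)
  qed (use inst_\<tau> in simp)
  moreover have "(\<lambda>k. 3 * Im \<tau> / (64 * pi ^ 3) * (2 * (16 * pi\<^sup>2 / 3 * rowC \<tau> k))) sums (3 * Im \<tau> / (64 * pi ^ 3) * (Im (latticeG \<tau>) / 2))"
    by (rule sums_mult[OF lattice_rowsC[OF inst_\<tau>(1)]])
  hence "(\<lambda>k. Im \<tau> / (2 * pi) * rowC \<tau> k) sums (3 * Im \<tau> / (128 * pi ^ 3) * Im (latticeG \<tau>))"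
    by (simp add: power2_eq_square power3_eq_cube mult.assoc)
  hence "(\<lambda>k. \<i> * of_real (Im \<tau> / (2 * pi) * rowC \<tau> k)) sums (\<i> * of_real (3 * Im \<tau> / (128 * pi ^ 3) * Im (latticeG \<tau>)))"
    by (intro sums_mult sums_of_real)
  ultimately show ?thesis unfolding V infsum_cmult_left' using sums_unique2 by metis
qed

text \<open>The factor 1 / k in \<open>\<eta>_q\<close> is the factor 1 / m of the Bessel term in
  \<open>eisenstein_rows\<close>. The latter also contains the zero frequency, which has to be
  subtracted; this is the origin of the constant 1 / (96 pi).\<close>

lemma inst_eta_sum:
  "(\<Sum>\<^sub>\<infinity>q\<in>UNIV - {0}. inst_eta q P X) =
     \<i> * of_real ((Im \<tau>)\<^sup>2 / (64 * pi ^ 3) * (eisenstein \<tau> - 2 * zeta3) - 1 / (96 * pi)) * dlog_Z0 P X"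
proof -
  define c :: "int \<Rightarrow> nat \<Rightarrow> complex" where "c q k = \<i> / (8 * (of_real pi)\<^sup>2) *
     (exp (- 2 * of_real pi * \<i> * of_nat k * of_int q * of_real (zeta_of P $ 0)) / of_nat k *
      of_real (cmod (of_int q * Z_of P $ 0) * bessel_K 1 (2 * pi * real k * cmod (of_int q * Z_of P $ 0))))" for q k
  have V: "inst_eta q P X = (\<Sum>\<^sub>\<infinity>k\<in>{1..}. c q k) * dlog_Z0 P X" for q
    unfolding inst_eta_def c_def infsum_cmult_right' by (simp only: mult.assoc)
  have "(\<lambda>k. \<i> * of_real (Im \<tau> / (4 * pi\<^sup>2 * real (Suc k)) * rowA \<tau> k)) sums (\<Sum>\<^sub>\<infinity>q\<in>UNIV - {0}. \<Sum>\<^sub>\<infinity>k\<in>{1..}. c q k)"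
  proof (rule infsum_instanton[where b = "2 * pi * Im \<tau>" and M = "Im \<tau> / (8 * pi\<^sup>2) * (exp (2 * pi * Im \<tau>) * bessel_K 1 (2 * pi * Im \<tau>))"])
    fix q :: int and k :: nat assume q: "q \<noteq> 0" "k \<ge> 1"
    have ba: "2 * pi * real k * (\<bar>real_of_int q\<bar> * Im \<tau>) = 2 * pi * \<bar>real_of_int q\<bar> * (real k * Im \<tau>)"
      and qq: "\<bar>real_of_int q\<bar> * (\<bar>real_of_int q\<bar> * B) = (real_of_int q)\<^sup>2 * B" for B
      by (simp_all add: power2_eq_square mult.assoc[symmetric])
    have "norm (c q k) = Im \<tau> / (8 * pi\<^sup>2) * ((\<bar>real_of_int q\<bar> / real k) * \<bar>bessel_K 1 (2 * pi * \<bar>real_of_int q\<bar> * (real k * Im \<tau>))\<bar>)"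
      unfolding c_def norm_q ba using inst_\<tau>(1)
      by (simp add: norm_mult norm_divide norm_power abs_mult)
    also have "\<dots> \<le> Im \<tau> / (8 * pi\<^sup>2) * ((real_of_int q)\<^sup>2 * (exp (2 * pi * Im \<tau>) * bessel_K 1 (2 * pi * Im \<tau>) * exp (- (2 * pi * Im \<tau>) * (real k * \<bar>real_of_int q\<bar>))))"
    proof (intro mult_left_mono mult_mono)
      have q1: "\<bar>real_of_int q\<bar> \<ge> 1" using q by linarith
      have k1: "real k \<ge> 1" using q by simp
      have "\<bar>real_of_int q\<bar> / real k \<le> \<bar>real_of_int q\<bar> / 1" using k1 by (intro divide_left_mono) auto
      also have "\<dots> \<le> \<bar>real_of_int q\<bar> * \<bar>real_of_int q\<bar>" using mult_left_mono[OF q1, of "\<bar>real_of_int q\<bar>"] by simp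
      finally show "\<bar>real_of_int q\<bar> / real k \<le> (real_of_int q)\<^sup>2" by (simp add: power2_eq_square)
    qed (use bessel_K_instanton_bound[OF inst_\<tau>(1) _ q, of 1] inst_\<tau>(1) in auto)
    finally show "norm (c q k) \<le> Im \<tau> / (8 * pi\<^sup>2) * (exp (2 * pi * Im \<tau>) * bessel_K 1 (2 * pi * Im \<tau>)) * ((real_of_int q)\<^sup>2 * exp (- (2 * pi * Im \<tau>) * (real k * \<bar>real_of_int q\<bar>)))"
      by (simp only: mult_ac)
  next
    fix k
    have "c (int (Suc q)) (Suc k) + c (- int (Suc q)) (Suc k) = \<i> * of_real (Im \<tau> / (4 * pi\<^sup>2 * real (Suc k)) * (real (Suc q) * cos (2 * pi * real (Suc q) * (real (Suc k) * Re \<tau>)) * bessel_K 1 (2 * pi * real (Suc q) * (real (Suc k) * Im \<tau>))))" for q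
    proof -
      have e: "c q k = \<i> * of_real (1 / (8 * pi\<^sup>2 * real k) * (\<bar>real_of_int q\<bar> * Im \<tau> * bessel_K 1 (2 * pi * \<bar>real_of_int q\<bar> * (real k * Im \<tau>)))) *
         Complex (cos (2 * pi * real_of_int q * (real k * Re \<tau>))) (- sin (2 * pi * real_of_int q * (real k * Re \<tau>)))" for q k
        unfolding c_def bessel_argument exp_instanton norm_q inst_\<tau>(2,3) by (simp add: mult_ac)
      show ?thesis unfolding e
        by (simp add: complex_eq_iff field_simps del: of_nat_Suc)
    qed
    moreover have "(\<lambda>q. real (Suc q) * cos (2 * pi * real (Suc q) * (real (Suc k) * Re \<tau>)) * bessel_K 1 (2 * pi * real (Suc q) * (real (Suc k) * Im \<tau>))) sums rowA \<tau> k"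
      unfolding rowA_def[OF inst_\<tau>(1)] by (rule summable_sums[OF bessel_K1_poisson_even(1)[OF row_pos[OF inst_\<tau>(1)]]])
    ultimately show "(\<lambda>q. c (int (Suc q)) (Suc k) + c (- int (Suc q)) (Suc k)) sums (\<i> * of_real (Im \<tau> / (4 * pi\<^sup>2 * real (Suc k)) * rowA \<tau> k))"
      by (simp only: sums_of_real sums_mult)
  qed (use inst_\<tau> in simp)
  \<comment> \<open>After scaling, the zero frequency of row m is 1 / (16 pi^3 m^2), independent of
    \<tau>; its sum is evaluated by zeta(2) = pi^2 / 6.\<close>
  moreover have "(\<lambda>k. (Im \<tau>)\<^sup>2 / (64 * pi ^ 3) * (2 * (2 / (real (Suc k) * Im \<tau>)\<^sup>2 + 8 * pi / (real (Suc k) * Im \<tau>) * rowA \<tau> k)) - 1 / (16 * pi ^ 3) * (1 / (real k + 1)\<^sup>2)) sums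
      ((Im \<tau>)\<^sup>2 / (64 * pi ^ 3) * (eisenstein \<tau> - 2 * zeta3) - 1 / (16 * pi ^ 3) * (pi\<^sup>2 / 6))"
    by (intro sums_diff sums_mult eisenstein_rows[OF inst_\<tau>(1)]) (use inverse_squares_sums in \<open>simp add: add_ac\<close>)
  moreover have "(Im \<tau>)\<^sup>2 / (64 * pi ^ 3) * (2 * (2 / (real (Suc k) * Im \<tau>)\<^sup>2 + 8 * pi / (real (Suc k) * Im \<tau>) * rowA \<tau> k)) - 1 / (16 * pi ^ 3) * (1 / (real k + 1)\<^sup>2)
     = Im \<tau> / (4 * pi\<^sup>2 * real (Suc k)) * rowA \<tau> k" for k
  proof -
    define r where "r = Im \<tau>" define K where "K = real (Suc k)"
    have nz: "r \<noteq> 0" "K \<noteq> 0" "pi \<noteq> 0" using inst_\<tau>(1) by (auto simp: r_def K_def)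
    have "r\<^sup>2 / (64 * pi ^ 3) * (2 * (2 / (K * r)\<^sup>2 + 8 * pi / (K * r) * A)) - 1 / (16 * pi ^ 3) * (1 / K\<^sup>2) = r / (4 * pi\<^sup>2 * K) * A" for A
      using nz by (simp add: divide_simps) (simp add: power2_eq_square power3_eq_cube algebra_simps)
    moreover have "real k + 1 = K" by (simp add: K_def)
    ultimately show ?thesis unfolding r_def K_def by metis
  qed
  moreover have "1 / (16 * pi ^ 3) * (pi\<^sup>2 / 6) = 1 / (96 * pi)" by (simp add: power2_eq_square power3_eq_cube)
  ultimately have "(\<lambda>k. Im \<tau> / (4 * pi\<^sup>2 * real (Suc k)) * rowA \<tau> k) sums ((Im \<tau>)\<^sup>2 / (64 * pi ^ 3) * (eisenstein \<tau> - 2 * zeta3) - 1 / (96 * pi))"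
    and s: "(\<lambda>k. \<i> * of_real (Im \<tau> / (4 * pi\<^sup>2 * real (Suc k)) * rowA \<tau> k)) sums (\<Sum>\<^sub>\<infinity>q\<in>UNIV - {0}. \<Sum>\<^sub>\<infinity>k\<in>{1..}. c q k)"
    by (simp_all only:)
  hence "(\<lambda>k. \<i> * of_real (Im \<tau> / (4 * pi\<^sup>2 * real (Suc k)) * rowA \<tau> k)) sums (\<i> * of_real ((Im \<tau>)\<^sup>2 / (64 * pi ^ 3) * (eisenstein \<tau> - 2 * zeta3) - 1 / (96 * pi)))"
    by (intro sums_mult sums_of_real)
  from sums_unique2[OF s this] show ?thesis unfolding V infsum_cmult_left' by (simp only:)
qed

end

section \<open>Modular covariance of E and G\<close>

lemma lattice_reindex_bij:
  fixes \<alpha> \<beta> \<gamma> \<delta> :: int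
  assumes det: "\<alpha> * \<delta> - \<beta> * \<gamma> = 1"
  shows "bij_betw (\<lambda>(m, n). (m * \<alpha> + n * \<gamma>, m * \<beta> + n * \<delta>)) int_lattice int_lattice"
proof (rule bij_betwI[of _ _ _ "\<lambda>(a, b). (a * \<delta> - b * \<gamma>, b * \<alpha> - a * \<beta>)"])
  have 1: "(m * \<alpha> + n * \<gamma>) * \<delta> - (m * \<beta> + n * \<delta>) * \<gamma> = m" for m n
  proof -
    have "(m * \<alpha> + n * \<gamma>) * \<delta> - (m * \<beta> + n * \<delta>) * \<gamma> = m * (\<alpha> * \<delta> - \<beta> * \<gamma>)" by (simp add: algebra_simps)
    thus ?thesis by (simp add: det)
  qed
  have 2: "(m * \<beta> + n * \<delta>) * \<alpha> - (m * \<alpha> + n * \<gamma>) * \<beta> = n" for m n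
  proof -
    have "(m * \<beta> + n * \<delta>) * \<alpha> - (m * \<alpha> + n * \<gamma>) * \<beta> = n * (\<alpha> * \<delta> - \<beta> * \<gamma>)" by (simp add: algebra_simps)
    thus ?thesis by (simp add: det)
  qed
  have 3: "(a * \<delta> - b * \<gamma>) * \<alpha> + (b * \<alpha> - a * \<beta>) * \<gamma> = a" for a b
  proof -
    have "(a * \<delta> - b * \<gamma>) * \<alpha> + (b * \<alpha> - a * \<beta>) * \<gamma> = a * (\<alpha> * \<delta> - \<beta> * \<gamma>)" by (simp add: algebra_simps)
    thus ?thesis by (simp add: det)
  qed
  have 4: "(a * \<delta> - b * \<gamma>) * \<beta> + (b * \<alpha> - a * \<beta>) * \<delta> = b" for a b
  proof -
    have "(a * \<delta> - b * \<gamma>) * \<beta> + (b * \<alpha> - a * \<beta>) * \<delta> = b * (\<alpha> * \<delta> - \<beta> * \<gamma>)" by (simp add: algebra_simps)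
    thus ?thesis by (simp add: det)
  qed
  have nz: "m = 0 \<and> n = 0" if "m * \<alpha> + n * \<gamma> = 0" "m * \<beta> + n * \<delta> = 0" for m n
    using 1[of m n] 2[of m n] unfolding that by simp
  show "(\<lambda>(m, n). (m * \<alpha> + n * \<gamma>, m * \<beta> + n * \<delta>)) \<in> int_lattice \<rightarrow> int_lattice"
  proof (rule Pi_I)
    fix x assume x: "x \<in> int_lattice"
    obtain m n where mn: "x = (m, n)" by (cases x)
    show "(\<lambda>(m, n). (m * \<alpha> + n * \<gamma>, m * \<beta> + n * \<delta>)) x \<in> int_lattice"
      using nz[of m n] x unfolding mn by auto
  qed
  have nz': "a = 0 \<and> b = 0" if "a * \<delta> - b * \<gamma> = 0" "b * \<alpha> - a * \<beta> = 0" for a b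
    using 3[of a b] 4[of a b] unfolding that by simp
  show "(\<lambda>(a, b). (a * \<delta> - b * \<gamma>, b * \<alpha> - a * \<beta>)) \<in> int_lattice \<rightarrow> int_lattice"
  proof (rule Pi_I)
    fix x assume x: "x \<in> int_lattice"
    obtain a b where ab: "x = (a, b)" by (cases x)
    show "(\<lambda>(a, b). (a * \<delta> - b * \<gamma>, b * \<alpha> - a * \<beta>)) x \<in> int_lattice"
      using nz'[of a b] x unfolding ab by auto
  qed
  show "(\<lambda>(a, b). (a * \<delta> - b * \<gamma>, b * \<alpha> - a * \<beta>)) ((\<lambda>(m, n). (m * \<alpha> + n * \<gamma>, m * \<beta> + n * \<delta>)) x) = x" for x
    by (cases x) (simp add: 1 2)
  show "(\<lambda>(m, n). (m * \<alpha> + n * \<gamma>, m * \<beta> + n * \<delta>)) ((\<lambda>(a, b). (a * \<delta> - b * \<gamma>, b * \<alpha> - a * \<beta>)) x) = x" for x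
    by (cases x) (simp add: 3 4)
qed

lemma moebius_denominator_nz:
  fixes \<tau> :: complex and \<alpha> \<beta> \<gamma> \<delta> :: int
  assumes "\<alpha> * \<delta> - \<beta> * \<gamma> = 1" "Im \<tau> > 0"
  shows "of_int \<gamma> * \<tau> + of_int \<delta> \<noteq> 0"
  by (rule int_lattice_nz[OF assms(2)]) (use assms(1) in auto)

lemma moebius_lattice_point:
  fixes \<tau> :: complex and \<alpha> \<beta> \<gamma> \<delta> :: int
  assumes "of_int \<gamma> * \<tau> + of_int \<delta> \<noteq> 0"
  shows "of_int m * ((of_int \<alpha> * \<tau> + of_int \<beta>) / (of_int \<gamma> * \<tau> + of_int \<delta>)) + of_int n =
    (of_int (m * \<alpha> + n * \<gamma>) * \<tau> + of_int (m * \<beta> + n * \<delta>)) / (of_int \<gamma> * \<tau> + of_int \<delta>)"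
  using assms by (simp add: field_simps)

text \<open>A lattice point of the transformed \<tau> is a lattice point of \<tau> divided by j,
  with coefficients permuted by an integral unimodular matrix. For G the factor is |j|^5 / j^2,
  rewritten with |j|^2 = j cnj j.\<close>

lemma eisenstein_moebius:
  fixes \<tau> :: complex and \<alpha> \<beta> \<gamma> \<delta> :: int
  assumes det: "\<alpha> * \<delta> - \<beta> * \<gamma> = 1" and \<tau>: "Im \<tau> > 0"
  defines "j \<equiv> of_int \<gamma> * \<tau> + of_int \<delta>"
  shows "eisenstein ((of_int \<alpha> * \<tau> + of_int \<beta>) / j) = cmod j ^ 3 * eisenstein \<tau>"
    and "latticeG ((of_int \<alpha> * \<tau> + of_int \<beta>) / j) = of_real (cmod j) ^ 3 * (cnj j / j) * latticeG \<tau>"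
proof -
  have j: "j \<noteq> 0" unfolding j_def by (rule moebius_denominator_nz[OF det \<tau>])
  note pt = moebius_lattice_point[of \<gamma> \<tau> \<delta>, folded j_def, OF j]
  let ?f = "\<lambda>(m, n). (m * \<alpha> + n * \<gamma>, m * \<beta> + n * \<delta>)"
  note bij = lattice_reindex_bij[OF det]
  have "eisenstein ((of_int \<alpha> * \<tau> + of_int \<beta>) / j) =
    (\<Sum>\<^sub>\<infinity>x\<in>int_lattice. cmod j ^ 3 * (\<lambda>(m, n). 1 / cmod (of_int m * \<tau> + of_int n) ^ 3) (?f x))"
    unfolding eisenstein_def by (intro infsum_cong) (simp only: case_prod_unfold fst_conv snd_conv pt norm_divide power_divide, simp)
  also have "\<dots> = cmod j ^ 3 * (\<Sum>\<^sub>\<infinity>x\<in>int_lattice. (\<lambda>(m, n). 1 / cmod (of_int m * \<tau> + of_int n) ^ 3) (?f x))"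
    by (rule infsum_cmult_right')
  also have "(\<Sum>\<^sub>\<infinity>x\<in>int_lattice. (\<lambda>(m, n). 1 / cmod (of_int m * \<tau> + of_int n) ^ 3) (?f x)) = eisenstein \<tau>"
    unfolding eisenstein_def by (rule infsum_reindex_bij_betw[OF bij])
  finally show "eisenstein ((of_int \<alpha> * \<tau> + of_int \<beta>) / j) = cmod j ^ 3 * eisenstein \<tau>" .
  have e: "(w / j)\<^sup>2 / of_real (cmod (w / j)) ^ 5 = of_real (cmod j) ^ 3 * (cnj j / j) * (w\<^sup>2 / of_real (cmod w) ^ 5)" for w
  proof -
    have "of_real (cmod j) ^ 5 = of_real (cmod j) ^ 3 * (j * cnj j)"
      unfolding complex_norm_square[symmetric] by (simp flip: power_add)
    thus ?thesis using j by (cases "w = 0") (simp_all add: norm_divide power_divide power2_eq_square field_simps)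
  qed
  have "latticeG ((of_int \<alpha> * \<tau> + of_int \<beta>) / j) =
    (\<Sum>\<^sub>\<infinity>x\<in>int_lattice. of_real (cmod j) ^ 3 * (cnj j / j) * (\<lambda>(m, n). (of_int m * \<tau> + of_int n)\<^sup>2 / of_real (cmod (of_int m * \<tau> + of_int n)) ^ 5) (?f x))"
    unfolding latticeG_def by (intro infsum_cong) (simp only: case_prod_unfold fst_conv snd_conv pt e)
  also have "\<dots> = of_real (cmod j) ^ 3 * (cnj j / j) * (\<Sum>\<^sub>\<infinity>x\<in>int_lattice. (\<lambda>(m, n). (of_int m * \<tau> + of_int n)\<^sup>2 / of_real (cmod (of_int m * \<tau> + of_int n)) ^ 5) (?f x))"
    by (rule infsum_cmult_right')
  also have "(\<Sum>\<^sub>\<infinity>x\<in>int_lattice. (\<lambda>(m, n). (of_int m * \<tau> + of_int n)\<^sup>2 / of_real (cmod (of_int m * \<tau> + of_int n)) ^ 5) (?f x)) = latticeG \<tau>"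
    unfolding latticeG_def by (rule infsum_reindex_bij_betw[OF bij])
  finally show "latticeG ((of_int \<alpha> * \<tau> + of_int \<beta>) / j) = of_real (cmod j) ^ 3 * (cnj j / j) * latticeG \<tau>" .
qed

section \<open>Derivative of the Eisenstein series\<close>

lemma has_derivative_inverse_cmod_cube:
  fixes \<tau> :: complex
  assumes "of_int m * \<tau> + of_int n \<noteq> 0"
  shows "((\<lambda>\<tau>. 1 / cmod (of_int m * \<tau> + of_int n) ^ 3) has_derivative
    (\<lambda>h. - 3 * real_of_int m * Re (cnj (of_int m * \<tau> + of_int n) * h) / cmod (of_int m * \<tau> + of_int n) ^ 5)) (at \<tau> within S)"
proof -
  define w where "w = of_int m * \<tau> + of_int n"
  have w: "w \<noteq> 0" using assms by (simp add: w_def)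
  have dn: "((\<lambda>\<tau>. cmod (of_int m * \<tau> + of_int n)) has_derivative (\<lambda>h. inner (of_int m * h) (sgn w))) (at \<tau> within S)"
  proof -
    have "((\<lambda>\<tau>. of_int m * \<tau> + of_int n) has_derivative (\<lambda>h. of_int m * h)) (at \<tau> within S)"
      by (auto intro!: derivative_eq_intros)
    from has_derivative_compose[OF this has_derivative_norm[OF assms]] show ?thesis by (simp add: w_def)
  qed
  have "((\<lambda>\<tau>. 1 / cmod (of_int m * \<tau> + of_int n) ^ 3) has_derivative
      (\<lambda>h. - (3 * (inner (of_int m * h) (sgn w) * cmod w ^ 2)) / (cmod w ^ 3 * cmod w ^ 3))) (at \<tau> within S)"
    using w by (auto intro!: derivative_eq_intros dn simp: w_def fun_eq_iff)
  moreover have "- (3 * (inner (of_int m * h) (sgn w) * cmod w ^ 2)) / (cmod w ^ 3 * cmod w ^ 3) =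
      - 3 * real_of_int m * Re (cnj w * h) / cmod w ^ 5" for h
  proof -
    have "inner (of_int m * h) (sgn w) = real_of_int m * Re (cnj w * h) / cmod w"
      by (simp add: sgn_div_norm inner_complex_def add_divide_distrib field_simps)
    thus ?thesis using w by (simp add: field_simps eval_nat_numeral)
  qed
  ultimately show ?thesis unfolding w_def by simp
qed

text \<open>Termwise differentiation along an enumeration of the lattice. The factor m produced by
  the chain rule is Im w / Im \<tau>, and 2 Im w Re(cnj w h) = |w|^2 Im h - Im(cnj(w^2) h) splits
  each term into one of E and one of G.\<close>

lemma eisenstein_has_derivative:
  fixes \<tau> :: complex
  assumes \<tau>: "Im \<tau> > 0"
  shows "(eisenstein has_derivative
    (\<lambda>h. - (3 / (2 * Im \<tau>)) * (eisenstein \<tau> * Im h - Im (cnj (latticeG \<tau>) * h)))) (at \<tau>)"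
proof -
  define e where "e = from_nat_into int_lattice"
  have inf: "infinite int_lattice"
    by (simp add: finite_prod infinite_UNIV_int)
  have bij: "bij_betw e UNIV int_lattice"
    unfolding e_def by (intro bij_betw_from_nat_into inf) auto
  have en: "e i \<in> int_lattice" for i using bij by (auto simp: bij_betw_def)
  define w where "w i z = of_int (fst (e i)) * z + of_int (snd (e i))" for i and z :: complex
  define f where "f i z = 1 / cmod (w i z) ^ 3" for i z
  define f' where "f' i z h = - 3 * real_of_int (fst (e i)) * Re (cnj (w i z) * h) / cmod (w i z) ^ 5" for i z h
  \<comment> \<open>On the ball of this radius Im z >= d and |z| <= R, so the single majorant
    \<open>M\<close> serves all its points, as uniform convergence of the derivatives
    requires.\<close>
  define d where "d = Im \<tau> / 2"
  define R where "R = cmod \<tau> + d"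
  define B where "B = ball \<tau> d"
  have d: "d > 0" using \<tau> by (simp add: d_def)
  have B: "Im z \<ge> d" "cmod z \<le> R" if "z \<in> B" for z
  proof -
    have n: "cmod (z - \<tau>) < d" using that by (simp add: B_def dist_norm norm_minus_commute)
    show "Im z \<ge> d" using abs_Im_le_cmod[of "z - \<tau>"] n by (simp add: d_def)
    show "cmod z \<le> R" using norm_triangle_sub[of z \<tau>] n by (simp add: R_def)
  qed
  have nz: "w i z \<noteq> 0" if "z \<in> B" for i z
    unfolding w_def using int_lattice_nz[of z "fst (e i)" "snd (e i)"] en[of i] B(1)[OF that] d by auto
  define M where "M i = 3 / d * (2 * (1 + (1 + R) / d)) ^ 3 * (1 / (1 + \<bar>real_of_int (fst (e i))\<bar> + \<bar>real_of_int (snd (e i))\<bar>) ^ 3)" for i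
  have sM: "summable M"
  proof -
    have "(\<lambda>(m, n). 3 / d * (2 * (1 + (1 + R) / d)) ^ 3 * (1 / (1 + \<bar>real_of_int m\<bar> + \<bar>real_of_int n\<bar>) ^ 3)) summable_on int_lattice"
      using summable_on_subset[OF summable_on_cmult_right[OF summable_lattice_cube, of "3 / d * (2 * (1 + (1 + R) / d)) ^ 3"]]
      by (simp add: case_prod_unfold)
    hence "M summable_on UNIV"
      by (subst (asm) summable_on_reindex_bij_betw[OF bij, symmetric]) (simp only: M_def[abs_def] case_prod_unfold)
    thus ?thesis by (rule summable_on_imp_summable)
  qed
  have bound: "\<bar>f' i z h\<bar> \<le> M i * norm h" if z: "z \<in> B" for i z h
  proof -
    have wp: "cmod (w i z) > 0" using nz[OF z] by simp
    have "\<bar>real_of_int (fst (e i))\<bar> * d \<le> \<bar>real_of_int (fst (e i))\<bar> * Im z" using B(1)[OF z] by (intro mult_left_mono) auto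
    also have "\<dots> = \<bar>Im (w i z)\<bar>" using B(1)[OF z] d by (simp add: w_def abs_mult)
    also have "\<dots> \<le> cmod (w i z)" by (rule abs_Im_le_cmod)
    finally have m: "\<bar>real_of_int (fst (e i))\<bar> \<le> cmod (w i z) / d" using d by (simp add: field_simps)
    have "\<bar>f' i z h\<bar> = 3 * (\<bar>real_of_int (fst (e i))\<bar> * \<bar>Re (cnj (w i z) * h)\<bar>) / cmod (w i z) ^ 5"
      by (simp add: f'_def abs_mult)
    also have "\<dots> \<le> 3 * (cmod (w i z) / d * (cmod (w i z) * norm h)) / cmod (w i z) ^ 5"
      using abs_Re_le_cmod[of "cnj (w i z) * h"] m d by (intro divide_right_mono mult_left_mono mult_mono) (auto simp: norm_mult)
    also have "\<dots> = 3 / d * (1 / cmod (w i z) ^ 3) * norm h"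
      using wp d by (simp add: field_simps eval_nat_numeral)
    also have "\<dots> \<le> M i * norm h"
    proof (rule mult_right_mono)
      have "1 / cmod (w i z) ^ 3 \<le> (2 * (1 + (1 + R) / d)) ^ 3 * (1 / (1 + \<bar>real_of_int (fst (e i))\<bar> + \<bar>real_of_int (snd (e i))\<bar>) ^ 3)"
        unfolding w_def using en[of i] by (intro lattice_term_bound d B[OF z]) auto
      thus "3 / d * (1 / cmod (w i z) ^ 3) \<le> M i" unfolding M_def mult.assoc using d by (intro mult_left_mono) auto
    qed simp
    finally show ?thesis .
  qed
  have sf': "summable (\<lambda>i. f' i z h)" if "z \<in> B" for z h
    by (rule summable_comparison_test'[OF summable_mult2[OF sM, of "norm h"], of 0]) (use bound[OF that] in auto)
  have sums_E: "(\<lambda>i. f i z) sums eisenstein z" if "z \<in> B" for z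
  proof -
    have "Im z > 0" using B(1)[OF that] d by simp
    from eisenstein_has_sum[OF this] show ?thesis
      by (subst (asm) has_sum_reindex_bij_betw[OF bij, symmetric])
         (auto simp: f_def w_def case_prod_unfold intro: has_sum_imp_sums)
  qed
  have \<tau>B: "\<tau> \<in> B" using d by (simp add: B_def)
  have "\<exists>g. \<forall>x\<in>B. (\<lambda>n. f n x) sums (g x) \<and> (g has_derivative (\<lambda>h. \<Sum>i. f' i x h)) (at x within B)"
  proof (rule has_derivative_series)
    show "convex B" by (simp add: B_def)
    show "(f n has_derivative f' n x) (at x within B)" if "x \<in> B" for n x
      unfolding f_def[abs_def] f'_def[abs_def] w_def by (rule has_derivative_inverse_cmod_cube) (use nz[OF that, of n] in \<open>simp add: w_def\<close>)
    show "\<forall>\<^sub>F n in sequentially. \<forall>x\<in>B. \<forall>h. norm ((\<Sum>i<n. f' i x h) - (\<Sum>i. f' i x h)) \<le> \<epsilon> * norm h" if "\<epsilon> > 0" for \<epsilon>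
    proof -
      from suminf_exist_split[OF that sM] obtain N where N: "\<And>n. n \<ge> N \<Longrightarrow> norm (\<Sum>i. M (i + n)) < \<epsilon>" by auto
      show ?thesis unfolding eventually_sequentially
      proof (intro exI[of _ N] allI impI ballI)
        fix n and x h :: complex assume n: "N \<le> n" and x: "x \<in> B"
        have s1: "summable (\<lambda>i. M (i + n) * norm h)" by (intro summable_mult2 summable_ignore_initial_segment sM)
        have "(\<Sum>i. f' i x h) = (\<Sum>i. f' (i + n) x h) + (\<Sum>i<n. f' i x h)"
          by (rule suminf_split_initial_segment[OF sf'[OF x]])
        hence "norm ((\<Sum>i<n. f' i x h) - (\<Sum>i. f' i x h)) = norm (\<Sum>i. f' (i + n) x h)" by simp
        also have "\<dots> \<le> (\<Sum>i. M (i + n) * norm h)"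
          by (rule norm_suminf_le[OF _ s1]) (use bound[OF x] in auto)
        also have "\<dots> = (\<Sum>i. M (i + n)) * norm h"
          by (rule suminf_mult2[symmetric]) (intro summable_ignore_initial_segment sM)
        also have "\<dots> \<le> \<epsilon> * norm h" using N[OF n] by (intro mult_right_mono) auto
        finally show "norm ((\<Sum>i<n. f' i x h) - (\<Sum>i. f' i x h)) \<le> \<epsilon> * norm h" .
      qed
    qed
    show "\<tau> \<in> B" by (rule \<tau>B)
    show "(\<lambda>n. f n \<tau>) sums eisenstein \<tau>" by (rule sums_E[OF \<tau>B])
  qed
  then obtain g where g: "\<And>x. x \<in> B \<Longrightarrow> (\<lambda>n. f n x) sums (g x)" "\<And>x. x \<in> B \<Longrightarrow> (g has_derivative (\<lambda>h. \<Sum>i. f' i x h)) (at x within B)"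
    by blast
  have gE: "g x = eisenstein x" if "x \<in> B" for x using sums_unique2[OF g(1)[OF that] sums_E[OF that]] .
  have oB: "open B" by (simp add: B_def)
  have "(g has_derivative (\<lambda>h. \<Sum>i. f' i \<tau> h)) (at \<tau>)"
    using g(2)[OF \<tau>B] at_within_open[OF \<tau>B oB] by simp
  hence D: "(eisenstein has_derivative (\<lambda>h. \<Sum>i. f' i \<tau> h)) (at \<tau>)"
    by (rule has_derivative_transform_within_open[OF _ oB \<tau>B]) (simp add: gE)
  have "(\<Sum>i. f' i \<tau> h) = - (3 / (2 * Im \<tau>)) * (eisenstein \<tau> * Im h - Im (cnj (latticeG \<tau>) * h))" for h
  proof -
    have "((\<lambda>x. - (3 / (2 * Im \<tau>)) * ((\<lambda>(m, n). 1 / cmod (of_int m * \<tau> + of_int n) ^ 3) x * Im h -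
         Im (cnj ((\<lambda>(m, n). (of_int m * \<tau> + of_int n)\<^sup>2 / of_real (cmod (of_int m * \<tau> + of_int n)) ^ 5) x) * h)))
       has_sum (- (3 / (2 * Im \<tau>)) * (eisenstein \<tau> * Im h - Im (cnj (latticeG \<tau>) * h)))) int_lattice"
    proof (intro has_sum_cmult_right)
      have "((\<lambda>x. Im (cnj ((\<lambda>(m, n). (of_int m * \<tau> + of_int n)\<^sup>2 / of_real (cmod (of_int m * \<tau> + of_int n)) ^ 5) x) * h))
          has_sum Im (cnj (latticeG \<tau>) * h)) int_lattice"
        by (intro has_sum_Im has_sum_cmult_left has_sum_cnj_iff[THEN iffD2] latticeG_has_sum[OF \<tau>])
      from has_sum_add[OF has_sum_cmult_left[OF eisenstein_has_sum[OF \<tau>], of "Im h"] has_sum_cmult_right[OF this, of "- 1"]]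
      show "((\<lambda>x. (\<lambda>(m, n). 1 / cmod (of_int m * \<tau> + of_int n) ^ 3) x * Im h -
         Im (cnj ((\<lambda>(m, n). (of_int m * \<tau> + of_int n)\<^sup>2 / of_real (cmod (of_int m * \<tau> + of_int n)) ^ 5) x) * h))
       has_sum (eisenstein \<tau> * Im h - Im (cnj (latticeG \<tau>) * h))) int_lattice"
        by (simp only: mult_minus1 add_uminus_conv_diff)
    qed
    hence "((\<lambda>i. (\<lambda>x. - (3 / (2 * Im \<tau>)) * ((\<lambda>(m, n). 1 / cmod (of_int m * \<tau> + of_int n) ^ 3) x * Im h -
         Im (cnj ((\<lambda>(m, n). (of_int m * \<tau> + of_int n)\<^sup>2 / of_real (cmod (of_int m * \<tau> + of_int n)) ^ 5) x) * h))) (e i))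
       has_sum (- (3 / (2 * Im \<tau>)) * (eisenstein \<tau> * Im h - Im (cnj (latticeG \<tau>) * h)))) UNIV"
      by (subst has_sum_reindex_bij_betw[OF bij])
    moreover have "(\<lambda>x. - (3 / (2 * Im \<tau>)) * ((\<lambda>(m, n). 1 / cmod (of_int m * \<tau> + of_int n) ^ 3) x * Im h -
         Im (cnj ((\<lambda>(m, n). (of_int m * \<tau> + of_int n)\<^sup>2 / of_real (cmod (of_int m * \<tau> + of_int n)) ^ 5) x) * h))) (e i) = f' i \<tau> h" for i
    proof -
      define u where "u = w i \<tau>"
      have u: "cmod u \<noteq> 0" using nz[OF \<tau>B] by (simp add: u_def)
      have m: "real_of_int (fst (e i)) = Im u / Im \<tau>" using \<tau> by (simp add: u_def w_def)
      have e: "1 / cmod u ^ 3 = ((Re u)\<^sup>2 + (Im u)\<^sup>2) / cmod u ^ 5"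
      proof -
        have "1 / cmod u ^ 3 = (cmod u)\<^sup>2 / cmod u ^ 5" using u by (simp add: divide_simps flip: power_add)
        thus ?thesis by (simp add: cmod_power2)
      qed
      have "1 / cmod u ^ 3 * Im h - Im (cnj (u\<^sup>2 / of_real (cmod u) ^ 5) * h) = 2 * (Im u * Re (cnj u * h)) / cmod u ^ 5"
        unfolding e times_complex.sel cnj.sel Re_Im_square_over_fifth[OF \<tau>]
        by (simp add: diff_divide_distrib[symmetric] add_divide_distrib[symmetric] times_divide_eq_left minus_divide_left del: minus_divide_left[symmetric])
           (simp add: algebra_simps power2_eq_square)
      hence "- (3 / (2 * Im \<tau>)) * (1 / cmod u ^ 3 * Im h - Im (cnj (u\<^sup>2 / of_real (cmod u) ^ 5) * h)) = - 3 * (Im u / Im \<tau>) * Re (cnj u * h) / cmod u ^ 5"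
        using \<tau> by simp
      thus ?thesis unfolding f'_def u_def[symmetric] m[symmetric] by (simp add: case_prod_unfold u_def w_def)
    qed
    ultimately have "((\<lambda>i. f' i \<tau> h) has_sum (- (3 / (2 * Im \<tau>)) * (eisenstein \<tau> * Im h - Im (cnj (latticeG \<tau>) * h)))) UNIV" by simp
    thus ?thesis using has_sum_imp_sums sums_unique by metis
  qed
  thus ?thesis using D by simp
qed

section \<open>The metric in an adapted coframe\<close>

lemma UNIV_2: "(UNIV :: 2 set) = {0, 1}"
  by (rule card_subset_eq[symmetric]) auto

lemma sum_UNIV_2: "(\<Sum>i\<in>(UNIV :: 2 set). f i) = f 0 + f 1"
  unfolding UNIV_2 by simp

lemma all_2: "(\<forall>i :: 2. P i) \<longleftrightarrow> P 0 \<and> P 1"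
  using UNIV_2 by (metis UNIV_I insertE singletonD)

lemma pair_nth [simp]: "pair x y $ 0 = x" "pair x y $ 1 = y"
  by (simp_all add: pair_def)

lemma linear_pair: "linear (\<lambda>xy. pair (fst xy) (snd xy) :: ('a :: euclidean_space)^2)"
  by (rule linearI) (simp_all add: vec_eq_iff all_2)

lemma has_derivative_pair [derivative_intros]:
  fixes f g :: "'b :: real_normed_vector \<Rightarrow> 'a :: euclidean_space"
  assumes "(f has_derivative f') (at x within S)" "(g has_derivative g') (at x within S)"
  shows "((\<lambda>x. pair (f x) (g x)) has_derivative (\<lambda>h. pair (f' h) (g' h))) (at x within S)"
  using bounded_linear.has_derivative[OF linear_conv_bounded_linear[THEN iffD1, OF linear_pair] has_derivative_Pair[OF assms]]
  by simp

lemma has_derivative_vec_nth [derivative_intros]: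
  assumes "(f has_derivative f') F"
  shows "((\<lambda>x. f x $ i) has_derivative (\<lambda>h. f' h $ i)) F"
  by (rule bounded_linear.has_derivative[OF bounded_linear_vec_nth assms])

section \<open>Prepotential, period matrix and the potential f\<close>

lemma holo_partial_prepotential:
  shows "Z $ 0 \<noteq> 0 \<Longrightarrow> holo_partial 0 (prepotential chi) Z =
       (1 / 6) * (Z $ 1) ^ 3 / (Z $ 0)\<^sup>2 + of_nat chi * of_real zeta3 * Z $ 0 / (2 * of_real pi * \<i>) ^ 3"
    and "holo_partial 1 (prepotential chi) Z = - (1 / 2) * (Z $ 1)\<^sup>2 / Z $ 0"
proof -
  define C :: complex where "C = (2 * of_real pi * \<i>) ^ 3"
  have C: "C \<noteq> 0" by (simp add: C_def)
  {
    assume Z: "Z $ 0 \<noteq> 0"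
    have "((\<lambda>w. - (1 / 6) * (Z $ 1) ^ 3 / w + of_nat chi * (w\<^sup>2 * of_real zeta3) / (2 * C)) has_field_derivative
        (1 / 6) * (Z $ 1) ^ 3 / (Z $ 0)\<^sup>2 + of_nat chi * of_real zeta3 * Z $ 0 / C) (at (Z $ 0))"
      using Z C by (auto intro!: derivative_eq_intros simp: power2_eq_square field_simps)
    thus "holo_partial 0 (prepotential chi) Z =
       (1 / 6) * (Z $ 1) ^ 3 / (Z $ 0)\<^sup>2 + of_nat chi * of_real zeta3 * Z $ 0 / (2 * of_real pi * \<i>) ^ 3"
      unfolding holo_partial_def prepotential_def C_def by (intro DERIV_imp_deriv) simp
  }
  \<comment> \<open>For \<open>Z $ 0 = 0\<close> both sides are 0 by the convention for division.
    The formula is therefore valid for every Z and can be rewritten under the second derivative in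
    \<open>tau\<close>.\<close>
  have "((\<lambda>w. - (1 / 6) * w ^ 3 / Z $ 0 + of_nat chi * ((Z $ 0)\<^sup>2 * of_real zeta3) / (2 * C)) has_field_derivative
      - (1 / 2) * (Z $ 1)\<^sup>2 / Z $ 0) (at (Z $ 1))"
    by (cases "Z $ 0 = 0") (auto intro!: derivative_eq_intros simp: power2_eq_square field_simps)
  thus "holo_partial 1 (prepotential chi) Z = - (1 / 2) * (Z $ 1)\<^sup>2 / Z $ 0"
    unfolding holo_partial_def prepotential_def C_def by (intro DERIV_imp_deriv) simp
qed

lemma tau_prepotential:
  assumes Z: "Z $ 0 \<noteq> 0"
  shows "tau (prepotential chi) Z 0 0 = - (1 / 3) * (Z $ 1 / Z $ 0) ^ 3 + \<i> * of_real (real chi * zeta3 / (8 * pi ^ 3))"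
    and "tau (prepotential chi) Z 0 1 = 1 / 2 * (Z $ 1 / Z $ 0)\<^sup>2"
    and "tau (prepotential chi) Z 1 0 = 1 / 2 * (Z $ 1 / Z $ 0)\<^sup>2"
    and "tau (prepotential chi) Z 1 1 = - (Z $ 1 / Z $ 0)"
proof -
  define C :: complex where "C = (2 * of_real pi * \<i>) ^ 3"
  have C: "C \<noteq> 0" by (simp add: C_def)
  have C': "1 / C = \<i> / (8 * of_real pi ^ 3)"
    by (simp add: C_def power_mult_distrib power3_eq_cube field_simps)
  have "((\<lambda>w. (1 / 6) * (Z $ 1) ^ 3 / w\<^sup>2 + of_nat chi * of_real zeta3 * w / C) has_field_derivative
      - (1 / 3) * (Z $ 1) ^ 3 / (Z $ 0) ^ 3 + of_nat chi * of_real zeta3 / C) (at (Z $ 0))"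
    using Z C by (auto intro!: derivative_eq_intros simp: power2_eq_square power3_eq_cube field_simps)
  hence "((\<lambda>w. holo_partial 0 (prepotential chi) (\<chi> k. if k = 0 then w else Z $ k)) has_field_derivative
      - (1 / 3) * (Z $ 1) ^ 3 / (Z $ 0) ^ 3 + of_nat chi * of_real zeta3 / C) (at (Z $ 0))"
    by (rule has_field_derivative_transform_within_open[of _ _ _ "- {0}"])
       (use Z in \<open>auto simp: holo_partial_prepotential C_def\<close>)
  hence "tau (prepotential chi) Z 0 0 = - (1 / 3) * (Z $ 1) ^ 3 / (Z $ 0) ^ 3 + of_nat chi * of_real zeta3 / C"
    unfolding tau_def by (subst holo_partial_def) (rule DERIV_imp_deriv)
  also have "of_nat chi * of_real zeta3 / C = of_nat chi * of_real zeta3 * (1 / C)" by simp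
  finally show "tau (prepotential chi) Z 0 0 = - (1 / 3) * (Z $ 1 / Z $ 0) ^ 3 + \<i> * of_real (real chi * zeta3 / (8 * pi ^ 3))"
    unfolding C' by (simp add: power_divide)
  have "((\<lambda>w. - (1 / 2) * (Z $ 1)\<^sup>2 / w) has_field_derivative 1 / 2 * (Z $ 1 / Z $ 0)\<^sup>2) (at (Z $ 0))"
    using Z by (auto intro!: derivative_eq_intros simp: power2_eq_square field_simps)
  thus "tau (prepotential chi) Z 0 1 = 1 / 2 * (Z $ 1 / Z $ 0)\<^sup>2"
    unfolding tau_def by (subst holo_partial_def) (intro DERIV_imp_deriv, simp add: holo_partial_prepotential)
  have "((\<lambda>w. (1 / 6) * w ^ 3 / (Z $ 0)\<^sup>2 + of_nat chi * of_real zeta3 * Z $ 0 / C) has_field_derivative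
      1 / 2 * (Z $ 1 / Z $ 0)\<^sup>2) (at (Z $ 1))"
    using Z by (auto intro!: derivative_eq_intros simp: power2_eq_square field_simps)
  thus "tau (prepotential chi) Z 1 0 = 1 / 2 * (Z $ 1 / Z $ 0)\<^sup>2"
    unfolding tau_def using Z by (subst holo_partial_def) (intro DERIV_imp_deriv, simp add: holo_partial_prepotential C_def)
  have "((\<lambda>w. - (1 / 2) * w\<^sup>2 / Z $ 0) has_field_derivative - (Z $ 1 / Z $ 0)) (at (Z $ 1))"
    using Z by (auto intro!: derivative_eq_intros)
  thus "tau (prepotential chi) Z 1 1 = - (Z $ 1 / Z $ 0)"
    unfolding tau_def by (subst holo_partial_def) (intro DERIV_imp_deriv, simp add: holo_partial_prepotential)
qed

lemma Im_powers:
  fixes z :: complex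
  shows "Im (z\<^sup>2) = 2 * Re z * Im z" "Im (z ^ 3) = 3 * (Re z)\<^sup>2 * Im z - (Im z) ^ 3"
    "Re (z\<^sup>2) = (Re z)\<^sup>2 - (Im z)\<^sup>2" "Re (z ^ 3) = (Re z) ^ 3 - 3 * Re z * (Im z)\<^sup>2"
  by (simp_all add: power2_eq_square power3_eq_cube algebra_simps)

lemma Im_half: "Im (1 / 2 * w) = Im w / 2" "Im (- (1 / 3) * w) = - Im w / 3"
  "Re (1 / 2 * w) = Re w / 2" "Re (- (1 / 3) * w) = - Re w / 3"
proof -
  have "1 / 2 * w = of_real (1 / 2) * w" "- (1 / 3) * w = of_real (- (1 / 3)) * w" by simp_all
  thus "Im (1 / 2 * w) = Im w / 2" "Im (- (1 / 3) * w) = - Im w / 3" "Re (1 / 2 * w) = Re w / 2" "Re (- (1 / 3) * w) = - Re w / 3"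
    by (simp_all only: times_complex.sel Re_complex_of_real Im_complex_of_real)
qed

lemma r_squared_prepotential:
  assumes Z: "Z $ 0 \<noteq> 0"
  shows "r_squared (prepotential chi) Z =
    (cmod (Z $ 0))\<^sup>2 * (2 * (Im (Z $ 1 / Z $ 0)) ^ 3 / 3 - real chi * zeta3 / (8 * pi ^ 3))"
proof -
  define z where "z = Z $ 1 / Z $ 0"
  define N where "N = (cmod (Z $ 0))\<^sup>2"
  have Z1: "Z $ 1 = z * Z $ 0" using Z by (simp add: z_def)
  have N: "Z $ 0 * cnj (Z $ 0) = of_real N" unfolding N_def complex_norm_square ..
  have "r_squared (prepotential chi) Z = - Re (of_real (Im (tau (prepotential chi) Z 0 0)) * (Z $ 0 * cnj (Z $ 0))
      + of_real (Im (1 / 2 * z\<^sup>2)) * (Z $ 0 * cnj (Z $ 0)) * cnj z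
      + (of_real (Im (1 / 2 * z\<^sup>2)) * (Z $ 0 * cnj (Z $ 0)) * z + of_real (Im (- z)) * (Z $ 0 * cnj (Z $ 0)) * (z * cnj z)))"
    unfolding r_squared_def sum_UNIV_2 tau_prepotential(2-4)[OF Z, folded z_def]
    unfolding Z1 complex_cnj_mult by (simp only: mult_ac)
  also have "\<dots> = - N * (Im (tau (prepotential chi) Z 0 0) + Im (1 / 2 * z\<^sup>2) * (2 * Re z) - Im z * ((Re z)\<^sup>2 + (Im z)\<^sup>2))"
    unfolding N by (simp add: power2_eq_square algebra_simps)
  also have "\<dots> = N * (2 * (Im z) ^ 3 / 3 - real chi * zeta3 / (8 * pi ^ 3))"
    unfolding tau_prepotential(1)[OF Z] z_def[symmetric] plus_complex.sel Im_half Im_powers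
    by (simp add: power2_eq_square power3_eq_cube field_simps)
  finally show ?thesis unfolding N_def z_def .
qed

definition kap :: "nat \<Rightarrow> real" where "kap chi = real chi / (32 * pi ^ 3)"

lemma R1_kap: "R1 chi t \<tau> = t ^ 3 / 3 - kap chi * eisenstein \<tau>"
  by (simp add: R1_def kap_def power_mult_distrib)

text \<open>What remains in the entry \<open>T_00\<close>, with a minus sign, after the zeta(3) of
  the prepotential has cancelled against the one in the sum of \<open>q^2 V_q\<close>.\<close>

definition Qf :: "nat \<Rightarrow> complex \<Rightarrow> real" where
  "Qf chi \<tau> = kap chi * (eisenstein \<tau> + 3 * Re (latticeG \<tau>)) / 2"

lemma dlog_V_field: "Z_of P $ 0 \<noteq> 0 \<Longrightarrow> dlog_Z0 P (V_field P) = 4 * \<i>"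
  by (simp add: dlog_Z0_def V_field_def)

text \<open>Two cancellations occur: the zeta(3) term of r^2 against the term - 2 zeta(3) of
  \<open>inst_eta_sum\<close>, and \<open>8 * c_l\<close> = chi / (24 pi) against 4 chi times the
  constant 1 / (96 pi).\<close>

lemma f_fun_prepotential:
  assumes Z: "Z_of P $ 0 \<noteq> 0" and c: "c_l = real chi / (192 * pi)"
  shows "f_fun (prepotential chi) chi c_l P =
    4 * pi * (cmod (Z_of P $ 0))\<^sup>2 * R1 chi (Im (Z_of P $ 1 / Z_of P $ 0)) (Complex (zeta_of P $ 0) (cmod (Z_of P $ 0)))"
proof -
  define r where "r = cmod (Z_of P $ 0)"
  define \<tau> where "\<tau> = Complex (zeta_of P $ 0) r"
  have "(\<Sum>\<^sub>\<infinity>q\<in>UNIV - {0}. inst_eta q P (V_field P)) =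
     \<i> * of_real (r\<^sup>2 / (64 * pi ^ 3) * (eisenstein \<tau> - 2 * zeta3) - 1 / (96 * pi)) * (4 * \<i>)"
    unfolding inst_eta_sum[OF Z refl] dlog_V_field[OF Z] \<tau>_def r_def by simp
  also have "\<dots> = of_real (- 4 * (r\<^sup>2 / (64 * pi ^ 3) * (eisenstein \<tau> - 2 * zeta3) - 1 / (96 * pi)))"
  proof -
    have "\<i> * of_real A * (4 * \<i>) = of_real (- 4 * A)" for A by (simp add: complex_eq_iff)
    thus ?thesis by blast
  qed
  finally have e: "Re (\<Sum>\<^sub>\<infinity>q\<in>UNIV - {0}. inst_eta q P (V_field P)) = - 4 * (r\<^sup>2 / (64 * pi ^ 3) * (eisenstein \<tau> - 2 * zeta3) - 1 / (96 * pi))"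
    by (simp only: Re_complex_of_real)
  show ?thesis unfolding f_fun_def e r_squared_prepotential[OF Z] R1_kap r_def[symmetric] \<tau>_def[symmetric] kap_def c
    by (simp add: field_simps)
qed

lemma T_mat_prepotential:
  assumes Z: "Z_of P $ 0 \<noteq> 0" and z: "z = Z_of P $ 1 / Z_of P $ 0"
    and \<tau>: "\<tau> = Complex (zeta_of P $ 0) (cmod (Z_of P $ 0))"
  shows "T_mat (prepotential chi) chi P $ 0 $ 0 = (Re z)\<^sup>2 * Im z - (Im z) ^ 3 / 3 - Qf chi \<tau>"
    and "T_mat (prepotential chi) chi P $ 0 $ 1 = - Re z * Im z"
    and "T_mat (prepotential chi) chi P $ 1 $ 0 = - Re z * Im z"
    and "T_mat (prepotential chi) chi P $ 1 $ 1 = Im z"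
proof -
  have "T_mat (prepotential chi) chi P $ 0 $ 0 = - (- Im (z ^ 3) / 3 + real chi * zeta3 / (8 * pi ^ 3))
      + real chi * (1 / (32 * pi ^ 3) * (4 * zeta3 - (eisenstein \<tau> + 3 * Re (latticeG \<tau>)) / 2))"
    unfolding T_mat_def inst_V_sum[OF Z \<tau>] Re_complex_of_real using Im_half(2)[of "z ^ 3"]
    by (simp add: tau_prepotential[OF Z] z[symmetric])
  also have "\<dots> = (Re z)\<^sup>2 * Im z - (Im z) ^ 3 / 3 - Qf chi \<tau>"
    unfolding Im_powers Qf_def kap_def by (simp add: field_simps)
  finally show "T_mat (prepotential chi) chi P $ 0 $ 0 = (Re z)\<^sup>2 * Im z - (Im z) ^ 3 / 3 - Qf chi \<tau>" .
  show "T_mat (prepotential chi) chi P $ 0 $ 1 = - Re z * Im z" "T_mat (prepotential chi) chi P $ 1 $ 0 = - Re z * Im z"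
    "T_mat (prepotential chi) chi P $ 1 $ 1 = Im z"
    using Im_half(1)[of "z\<^sup>2"] by (simp_all add: T_mat_def tau_prepotential[OF Z] z[symmetric] Im_powers)
qed

text \<open>Vectors tangent to Arg \<open>Z^0\<close> = 0 are killed by \<open>dlog_Z0\<close>, so
  \<open>A_q\<close> drops out and only the term with \<open>V_q\<close> survives; it merges with
  the zeta(3) part of \<open>\<tau>_00\<close> into \<open>Qf\<close>.\<close>

lemma W_tot_tangent:
  assumes Z: "Z_of P $ 0 \<noteq> 0" and z: "z = Z_of P $ 1 / Z_of P $ 0"
    and \<tau>: "\<tau> = Complex (zeta_of P $ 0) (cmod (Z_of P $ 0))" and X: "dlog_Z0 P X = 0"
  shows "W_tot (prepotential chi) chi P 0 X = of_real (tzeta_of X $ 0) + (1 / 3 * z ^ 3 - \<i> * of_real (Qf chi \<tau>)) * of_real (zeta_of X $ 0)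
       - 1 / 2 * z\<^sup>2 * of_real (zeta_of X $ 1)"
    and "W_tot (prepotential chi) chi P 1 X = of_real (tzeta_of X $ 1) - 1 / 2 * z\<^sup>2 * of_real (zeta_of X $ 0) + z * of_real (zeta_of X $ 1)"
proof -
  have A: "inst_A q P X = 0" for q by (simp add: inst_A_def X)
  have "W_inst chi P 0 X = of_nat chi * (\<Sum>\<^sub>\<infinity>q\<in>UNIV - {0}. (of_int q)\<^sup>2 * inst_V q P * (\<i> * of_real (zeta_of X $ 0)))"
    unfolding W_inst_def A by (simp add: power2_eq_square mult_ac)
  also have "\<dots> = of_nat chi * (of_real (1 / (32 * pi ^ 3) * (4 * zeta3 - (eisenstein \<tau> + 3 * Re (latticeG \<tau>)) / 2)) * (\<i> * of_real (zeta_of X $ 0)))"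
    unfolding infsum_cmult_left' inst_V_sum[OF Z \<tau>] ..
  also have "\<dots> = \<i> * of_real (real chi * zeta3 / (8 * pi ^ 3) - Qf chi \<tau>) * of_real (zeta_of X $ 0)"
    unfolding Qf_def kap_def by (simp add: field_simps)
  finally have W: "W_inst chi P 0 X = \<i> * of_real (real chi * zeta3 / (8 * pi ^ 3) - Qf chi \<tau>) * of_real (zeta_of X $ 0)" .
  show "W_tot (prepotential chi) chi P 0 X = of_real (tzeta_of X $ 0) + (1 / 3 * z ^ 3 - \<i> * of_real (Qf chi \<tau>)) * of_real (zeta_of X $ 0)
       - 1 / 2 * z\<^sup>2 * of_real (zeta_of X $ 1)"
    unfolding W_tot_def W W_form_def sum_UNIV_2 tau_prepotential[OF Z] z[symmetric] by (simp add: algebra_simps)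
  show "W_tot (prepotential chi) chi P 1 X = of_real (tzeta_of X $ 1) - 1 / 2 * z\<^sup>2 * of_real (zeta_of X $ 0) + z * of_real (zeta_of X $ 1)"
    unfolding W_tot_def W_form_def sum_UNIV_2 tau_prepotential[OF Z] z[symmetric] by (simp add: W_inst_def algebra_simps)
qed

text \<open>Complementary to \<open>W_tot_tangent\<close>: V rotates the phase of \<open>Z^0\<close>
  and has no components along \<open>\<zeta>\<close> and \<open>\<zeta>~\<close>, so only
  \<open>A_q\<close> contributes.\<close>

lemma W_tot_V_field:
  assumes Z: "Z_of P $ 0 \<noteq> 0" and \<tau>: "\<tau> = Complex (zeta_of P $ 0) (cmod (Z_of P $ 0))"
  shows "W_tot (prepotential chi) chi P 0 (V_field P) = of_real (- 3 * kap chi * Im \<tau> * Im (latticeG \<tau>))"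
    and "W_tot (prepotential chi) chi P 1 (V_field P) = 0"
proof -
  have z: "zeta_of (V_field P) = 0" "tzeta_of (V_field P) = 0" by (simp_all add: V_field_def)
  have "W_tot (prepotential chi) chi P 0 (V_field P) = of_nat chi * (\<Sum>\<^sub>\<infinity>q\<in>UNIV - {0}. of_int q * inst_A q P (V_field P))"
    by (simp add: W_tot_def W_form_def W_inst_def z)
  also have "\<dots> = of_nat chi * (\<i> * of_real (3 * Im \<tau> / (128 * pi ^ 3) * Im (latticeG \<tau>)) * (4 * \<i>))"
    unfolding inst_A_sum[OF Z \<tau>] dlog_V_field[OF Z] ..
  also have "\<dots> = of_real (- 3 * kap chi * Im \<tau> * Im (latticeG \<tau>))"
    unfolding kap_def by (simp add: field_simps)
  finally show "W_tot (prepotential chi) chi P 0 (V_field P) = of_real (- 3 * kap chi * Im \<tau> * Im (latticeG \<tau>))" .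
  show "W_tot (prepotential chi) chi P 1 (V_field P) = 0"
    by (simp add: W_tot_def W_form_def W_inst_def z)
qed

lemma matrix_inv_unique:
  fixes A B :: "real^2^2"
  assumes "A ** B = mat 1" "B ** A = mat 1"
  shows "matrix_inv A = B" and "invertible A"
proof -
  show "invertible A" using assms by (auto simp: invertible_def)
  hence "A ** matrix_inv A = mat 1" "matrix_inv A ** A = mat 1" unfolding invertible_def matrix_inv_def by (metis (mono_tags, lifting) someI_ex)+
  thus "matrix_inv A = B" using assms by (metis matrix_mul_assoc matrix_mul_lid matrix_mul_rid)
qed

lemma matrix_inv_2:
  fixes A :: "real^2^2"
  assumes d: "A $ 0 $ 0 * A $ 1 $ 1 - A $ 0 $ 1 * A $ 1 $ 0 = d" "d \<noteq> 0"
  shows "matrix_inv A $ 0 $ 0 = A $ 1 $ 1 / d" "matrix_inv A $ 0 $ 1 = - A $ 0 $ 1 / d"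
    "matrix_inv A $ 1 $ 0 = - A $ 1 $ 0 / d" "matrix_inv A $ 1 $ 1 = A $ 0 $ 0 / d" "invertible A"
proof -
  define B where "B = pair (pair (A $ 1 $ 1 / d) (- A $ 0 $ 1 / d)) (pair (- A $ 1 $ 0 / d) (A $ 0 $ 0 / d))"
  have "A ** B = mat 1" "B ** A = mat 1"
    using d by (auto simp: B_def matrix_matrix_mult_def mat_def vec_eq_iff all_2 sum_UNIV_2 field_simps)
  from matrix_inv_unique[OF this] show "matrix_inv A $ 0 $ 0 = A $ 1 $ 1 / d" "matrix_inv A $ 0 $ 1 = - A $ 0 $ 1 / d"
    "matrix_inv A $ 1 $ 0 = - A $ 1 $ 0 / d" "matrix_inv A $ 1 $ 1 = A $ 0 $ 0 / d" "invertible A"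
    by (simp_all add: B_def)
qed

text \<open>The determinant of \<open>T_mat\<close> is - t D. In D = B + Re g the part B is
  covariant under S-duality while g carries a phase, and the metric depends on them separately. The
  coefficient K below is B / 2.\<close>

definition Df :: "nat \<Rightarrow> real \<Rightarrow> complex \<Rightarrow> real" where
  "Df chi t \<tau> = t ^ 3 / 3 + Qf chi \<tau>"

definition Bf :: "nat \<Rightarrow> real \<Rightarrow> complex \<Rightarrow> real" where
  "Bf chi t \<tau> = t ^ 3 / 3 + kap chi * eisenstein \<tau> / 2"

definition Kf :: "nat \<Rightarrow> real \<Rightarrow> complex \<Rightarrow> real" where
  "Kf chi t \<tau> = t ^ 3 / 6 + kap chi * eisenstein \<tau> / 4"

definition gf :: "nat \<Rightarrow> complex \<Rightarrow> complex" where
  "gf chi \<tau> = of_real (3 / 2 * kap chi) * latticeG \<tau>"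

lemma Df_eq: "Df chi t \<tau> = Bf chi t \<tau> + Re (gf chi \<tau>)"
  by (simp add: Df_def Bf_def gf_def Qf_def algebra_simps add_divide_distrib)

lemma kap_nonneg: "kap chi \<ge> 0"
  by (simp add: kap_def)

text \<open>With x = \<open>kap\<close> E >= 0 one has R = t^3 / 3 - x, B = t^3 / 3 + x / 2 and |g|
  <= 3 x / 2, the last from |G| <= E. Every claim is then a linear consequence of x < t^3 / 3; these
  are exactly the inequalities consumed by \<open>gform_pos\<close>.\<close>

lemma coefficient_bounds:
  assumes \<tau>: "Im \<tau> > 0" and R: "R1 chi t \<tau> > 0"
  shows "cmod (gf chi \<tau>) < Bf chi t \<tau>" "Df chi t \<tau> > 0" "t > 0"
    "2 * cmod (gf chi \<tau>) < t ^ 3 - R1 chi t \<tau>" "cmod (gf chi \<tau>) < Bf chi t \<tau>"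
    "R1 chi t \<tau> + Bf chi t \<tau> + cmod (gf chi \<tau>) < t ^ 3" "R1 chi t \<tau> < t ^ 3"
    "Kf chi t \<tau> = (t ^ 3 - R1 chi t \<tau>) / 4"
proof -
  define x where "x = kap chi * eisenstein \<tau>"
  have x: "x \<ge> 0" using kap_nonneg eisenstein_pos[OF \<tau>] by (simp add: x_def less_imp_le)
  have R': "t ^ 3 / 3 - x > 0" using R by (simp add: R1_kap x_def)
  have "cmod (gf chi \<tau>) = 3 / 2 * (kap chi * cmod (latticeG \<tau>))"
    using kap_nonneg[of chi] by (simp add: gf_def norm_mult)
  also have "\<dots> \<le> 3 / 2 * x" unfolding x_def
    using norm_latticeG_le[OF \<tau>] kap_nonneg[of chi] by (intro mult_left_mono) auto
  finally have g: "cmod (gf chi \<tau>) \<le> 3 / 2 * x" .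
  have B: "Bf chi t \<tau> = t ^ 3 / 3 + x / 2" by (simp add: Bf_def x_def)
  have R1: "R1 chi t \<tau> = t ^ 3 / 3 - x" by (simp add: R1_kap x_def)
  show 1: "cmod (gf chi \<tau>) < Bf chi t \<tau>" "cmod (gf chi \<tau>) < Bf chi t \<tau>" unfolding B using g R' by linarith+
  show "Df chi t \<tau> > 0" unfolding Df_eq using 1 abs_Re_le_cmod[of "gf chi \<tau>"] by linarith
  have "t ^ 3 > 0" using R' x by linarith
  thus "t > 0" by (simp add: zero_less_power_eq)
  show "2 * cmod (gf chi \<tau>) < t ^ 3 - R1 chi t \<tau>" unfolding R1 using g R' by linarith
  show "R1 chi t \<tau> + Bf chi t \<tau> + cmod (gf chi \<tau>) < t ^ 3" unfolding R1 B using g R' by linarith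
  show "R1 chi t \<tau> < t ^ 3" unfolding R1 using R' x by linarith
  show "Kf chi t \<tau> = (t ^ 3 - R1 chi t \<tau>) / 4" unfolding R1 by (simp add: Kf_def x_def)
qed

text \<open>The shear \<open>Z^1\<close> -> \<open>Z^1 - b Z^0\<close> with b = Re z diagonalises T
  to diag(- D, t); dually \<open>W_0 + b W_1\<close> and \<open>W_1\<close> diagonalise its
  inverse.\<close>

lemma g_N_prepotential:
  assumes Z: "Z_of P $ 0 \<noteq> 0" and z: "z = Z_of P $ 1 / Z_of P $ 0"
    and \<tau>: "\<tau> = Complex (zeta_of P $ 0) (cmod (Z_of P $ 0))"
    and t: "Im z \<noteq> 0" and D: "D = Df chi (Im z) \<tau>" "D \<noteq> 0"
  defines "W \<equiv> W_tot (prepotential chi) chi P"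
  shows "g_N (prepotential chi) chi P X Y = 2 * pi * Re (
      - of_real D * (Z_of X $ 0 * cnj (Z_of Y $ 0))
      + of_real (Im z) * ((Z_of X $ 1 - of_real (Re z) * Z_of X $ 0) * cnj (Z_of Y $ 1 - of_real (Re z) * Z_of Y $ 0))
      - of_real (1 / D) * ((W 0 X + of_real (Re z) * W 1 X) * cnj (W 0 Y + of_real (Re z) * W 1 Y))
      + of_real (1 / Im z) * (W 1 X * cnj (W 1 Y)))"
    and "invertible (T_mat (prepotential chi) chi P)"
proof -
  let ?T = "T_mat (prepotential chi) chi P"
  define b t where "b = Re z" and "t = Im z"
  have t0: "t \<noteq> 0" using t by (simp add: t_def)
  note T = T_mat_prepotential[OF Z z \<tau>, of chi]
  have T': "?T $ 0 $ 0 = b\<^sup>2 * t - D" "?T $ 0 $ 1 = - b * t" "?T $ 1 $ 0 = - b * t" "?T $ 1 $ 1 = t"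
    unfolding T D Df_def b_def t_def by simp_all
  have det: "?T $ 0 $ 0 * ?T $ 1 $ 1 - ?T $ 0 $ 1 * ?T $ 1 $ 0 = - t * D"
    unfolding T' by (simp add: algebra_simps power2_eq_square)
  have nz: "- t * D \<noteq> 0" using t0 D by simp
  note I = matrix_inv_2[OF det nz]
  show "invertible ?T" by (rule I(5))
  have I': "matrix_inv ?T $ 0 $ 0 = - (1 / D)" "matrix_inv ?T $ 0 $ 1 = - (1 / D) * b"
    "matrix_inv ?T $ 1 $ 0 = - (1 / D) * b" "matrix_inv ?T $ 1 $ 1 = - (1 / D) * b\<^sup>2 + 1 / t"
    unfolding I T' using t0 D by (simp_all add: field_simps)
  show "g_N (prepotential chi) chi P X Y = 2 * pi * Re (
      - of_real D * (Z_of X $ 0 * cnj (Z_of Y $ 0))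
      + of_real (Im z) * ((Z_of X $ 1 - of_real (Re z) * Z_of X $ 0) * cnj (Z_of Y $ 1 - of_real (Re z) * Z_of Y $ 0))
      - of_real (1 / D) * ((W 0 X + of_real (Re z) * W 1 X) * cnj (W 0 Y + of_real (Re z) * W 1 Y))
      + of_real (1 / Im z) * (W 1 X * cnj (W 1 Y)))"
  proof -
    define iD it where "iD = 1 / D" and "it = 1 / t"
    show ?thesis
      unfolding g_N_def sum_UNIV_2 T' I' W_def[symmetric] b_def[symmetric] t_def[symmetric] iD_def[symmetric] it_def[symmetric]
      by (simp add: algebra_simps power2_eq_square)
  qed
qed

section \<open>The adapted one-forms\<close>

fun form_d :: "iia \<Rightarrow> complex" where
  "form_d (d\<tau>2, dz, d\<zeta>, d\<zeta>t, d\<sigma>) = Complex (d\<zeta> $ 0) d\<tau>2"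

text \<open>In type IIB coordinates this is \<open>dc^1 - \<tau> db\<close>, the contraction of an
  S-duality doublet.\<close>

fun form_u :: "iia \<Rightarrow> iia \<Rightarrow> complex" where
  "form_u (\<tau>2, z, \<zeta>, \<zeta>t, \<sigma>) (d\<tau>2, dz, d\<zeta>, d\<zeta>t, d\<sigma>) = Complex (Re z * d\<zeta> $ 0 - d\<zeta> $ 1) (- \<tau>2 * Re dz)"

text \<open>The real part is - 1/2 times the contact form of the Heisenberg fibre. In type IIB
  coordinates s is \<open>d\<psi> + \<tau> dc_0\<close> with a correction that makes it invariant
  under the shifts.\<close>

fun form_s :: "iia \<Rightarrow> iia \<Rightarrow> complex" where
  "form_s (\<tau>2, z, \<zeta>, \<zeta>t, \<sigma>) (d\<tau>2, dz, d\<zeta>, d\<zeta>t, d\<sigma>) = Complex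
     (- (d\<sigma> + \<zeta>t $ 0 * d\<zeta> $ 0 + \<zeta>t $ 1 * d\<zeta> $ 1 - \<zeta> $ 0 * d\<zeta>t $ 0 - \<zeta> $ 1 * d\<zeta>t $ 1) / 2)
     (\<tau>2 * (d\<zeta>t $ 0 + Re z * d\<zeta>t $ 1 + (Re z)\<^sup>2 / 2 * d\<zeta> $ 1 - (Re z) ^ 3 / 6 * d\<zeta> $ 0))"

text \<open>The imaginary part is half the differential of \<open>\<tau>_2 t^2\<close>, an S-duality
  invariant; the real part is \<open>dc_1 + (c^1 db - b dc^1) / 2\<close>.\<close>

fun form_p :: "iia \<Rightarrow> iia \<Rightarrow> complex" where
  "form_p (\<tau>2, z, \<zeta>, \<zeta>t, \<sigma>) (d\<tau>2, dz, d\<zeta>, d\<zeta>t, d\<sigma>) = Complex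
     (d\<zeta>t $ 1 + Re z * d\<zeta> $ 1 - (Re z)\<^sup>2 / 2 * d\<zeta> $ 0)
     (Im z * (\<tau>2 * Im dz + Im z * d\<tau>2 / 2))"

text \<open>Up to factors 2 pi and signs, the real and imaginary parts of a are
  \<open>theta_3\<close> and \<open>theta_1\<close>, whereas \<open>eta\<close> is expressed through
  c. Their difference is the multiple \<open>i \<tau>_2 t^2\<close> of u.\<close>

fun form_a :: "iia \<Rightarrow> iia \<Rightarrow> complex" where
  "form_a (\<tau>2, z, q) X = form_s (\<tau>2, z, q) X + \<i> * of_real (\<tau>2 * (Im z)\<^sup>2 / 2) * form_u (\<tau>2, z, q) X"

fun form_c :: "iia \<Rightarrow> iia \<Rightarrow> complex" where
  "form_c (\<tau>2, z, q) X = form_s (\<tau>2, z, q) X - \<i> * of_real (\<tau>2 * (Im z)\<^sup>2 / 2) * form_u (\<tau>2, z, q) X"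

text \<open>
  The metric in the coframe \<open>forms\<close>. The first summand is the quadratic form inverse to \<open>B |x|\<^sup>2 - Re (cnj g x\<^sup>2)\<close>.
\<close>

definition gform :: "real \<Rightarrow> real \<Rightarrow> real \<Rightarrow> real \<Rightarrow> real \<Rightarrow> complex \<Rightarrow>
    complex \<times> complex \<times> complex \<times> complex \<Rightarrow> complex \<times> complex \<times> complex \<times> complex \<Rightarrow> real" where
  "gform \<tau>2 t R B K g = (\<lambda>(a, c, p, d) (a', c', p', d').
     1 / (2 * \<tau>2\<^sup>2 * R) * (
       1 / \<tau>2\<^sup>2 * ((B * Re (c * cnj c') + Re (cnj g * c * c')) / (B\<^sup>2 - (cmod g)\<^sup>2)
          - Re ((a - c) * cnj (a' - c')) / t ^ 3 + Re (a * cnj a') / R)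
       + Re (p * cnj p') * ((t ^ 3 - R) / (t * R))
       - t / R * (Re (cnj p * cnj g * d') + Re (cnj p' * cnj g * d))
       + Re (d * cnj d') * (K + (cmod g)\<^sup>2 / R)))"

fun forms :: "iia \<Rightarrow> iia \<Rightarrow> complex \<times> complex \<times> complex \<times> complex" where
  "forms p X = (form_a p X, form_c p X, form_p p X, form_d X)"

fun dslice :: "iia \<Rightarrow> iia \<Rightarrow> nspace" where
  "dslice (\<tau>2, z, q) (d\<tau>2, dz, d\<zeta>, d\<zeta>t, d\<sigma>) =
     (pair (of_real d\<tau>2) (of_real d\<tau>2 * z + of_real \<tau>2 * dz), d\<zeta>, d\<zeta>t, d\<sigma>)"

section \<open>Derivatives of the slice, of r^2 and of f\<close>

lemma slice_has_derivative: "(slice has_derivative dslice p) (at p)"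
proof -
  have s: "slice = (\<lambda>p. (pair (of_real (fst p)) (of_real (fst p) * fst (snd p)), fst (snd (snd p)), fst (snd (snd (snd p))), snd (snd (snd (snd p)))))"
    by (auto simp: fun_eq_iff)
  have d: "dslice p = (\<lambda>X. (pair (of_real (fst X)) (of_real (fst X) * fst (snd p) + of_real (fst p) * fst (snd X)), fst (snd (snd X)), fst (snd (snd (snd X))), snd (snd (snd (snd X)))))"
    by (cases p) (auto simp: fun_eq_iff)
  show ?thesis unfolding s d
    by (auto intro!: derivative_eq_intros simp: algebra_simps)
qed

lemma frechet_slice: "frechet_derivative slice (at p) X = dslice p X"
  using frechet_derivative_at[OF slice_has_derivative] by metis

lemma frechet_derivativeI:
  assumes "(f has_derivative f') (at x)"
  shows "frechet_derivative f (at x) = f'"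
  using frechet_derivative_at[OF assms] by simp

lemma has_derivative_Im_mult_cnj:
  fixes Z :: "complex^2"
  shows "((\<lambda>Z. Im (Z $ 1 * cnj (Z $ 0))) has_derivative (\<lambda>h. Im (h $ 1 * cnj (Z $ 0) + Z $ 1 * cnj (h $ 0)))) (at Z)"
proof -
  have "((\<lambda>Z::complex^2. Z $ 1 * cnj (Z $ 0)) has_derivative (\<lambda>h. Z $ 1 * cnj (h $ 0) + h $ 1 * cnj (Z $ 0))) (at Z)"
    by (intro has_derivative_mult bounded_linear.has_derivative[OF bounded_linear_cnj] has_derivative_vec_nth has_derivative_ident)
  from bounded_linear.has_derivative[OF bounded_linear_Im this] show ?thesis by (simp add: add.commute)
qed

lemma has_derivative_cmod_nth:
  fixes Z :: "complex^2"
  assumes "Z $ 0 \<noteq> 0"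
  shows "((\<lambda>Z. cmod (Z $ 0)) has_derivative (\<lambda>h. Re (cnj (Z $ 0) * h $ 0) / cmod (Z $ 0))) (at Z)"
proof -
  have "((\<lambda>Z::complex^2. Z $ 0) has_derivative (\<lambda>h. h $ 0)) (at Z)"
    by (intro has_derivative_vec_nth has_derivative_ident)
  from has_derivative_compose[OF this has_derivative_norm[OF assms]] show ?thesis
    by (simp add: inner_complex_def sgn_div_norm field_simps add_divide_distrib)
qed

text \<open>Expresses the cubic term of r^2 and f through Im(\<open>Z^1\<close> cnj
  \<open>Z^0\<close>) and |\<open>Z^0\<close>|, whose real derivatives are immediate, in place of
  the quotient \<open>Z^1 / Z^0\<close>.\<close>

lemma cmod_square_Im_divide:
  assumes "w \<noteq> 0"
  shows "(cmod w)\<^sup>2 * (Im (z / w)) ^ 3 = (Im (z * cnj w)) ^ 3 / cmod w ^ 4"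
proof -
  have "Im (z / w) = Im (z * cnj w) / (cmod w)\<^sup>2"
    by (simp add: complex_div_cnj[of z w] Im_divide_of_real flip: of_real_power)
  hence "(cmod w)\<^sup>2 * (Im (z / w)) ^ 3 = (cmod w)\<^sup>2 * ((Im (z * cnj w)) ^ 3 / ((cmod w)\<^sup>2) ^ 3)"
    by (simp only: power_divide)
  also have "\<dots> = (Im (z * cnj w)) ^ 3 / cmod w ^ 4"
    using assms by (simp add: divide_simps del: times_complex.sel flip: power_mult power_add)
  finally show ?thesis .
qed

lemma has_derivative_cube_over_fourth:
  fixes a r :: "'a :: real_normed_vector \<Rightarrow> real"
  assumes a: "(a has_derivative a') (at x)" and r: "(r has_derivative r') (at x)" and nz: "r x \<noteq> 0"
  shows "((\<lambda>x. a x ^ 3 / r x ^ 4) has_derivative (\<lambda>h. 3 * (a x)\<^sup>2 / r x ^ 4 * a' h - 4 * a x ^ 3 / r x ^ 5 * r' h)) (at x)"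
proof (rule has_derivative_eq_rhs)
  show "((\<lambda>x. a x ^ 3 / r x ^ 4) has_derivative (\<lambda>h. ((3 * a' h * (a x)\<^sup>2) * r x ^ 4 - a x ^ 3 * (4 * r' h * r x ^ 3)) / (r x ^ 4 * r x ^ 4))) (at x)"
    using nz by (auto intro!: derivative_eq_intros a r)
  show "(\<lambda>h. ((3 * a' h * (a x)\<^sup>2) * r x ^ 4 - a x ^ 3 * (4 * r' h * r x ^ 3)) / (r x ^ 4 * r x ^ 4)) =
      (\<lambda>h. 3 * (a x)\<^sup>2 / r x ^ 4 * a' h - 4 * a x ^ 3 / r x ^ 5 * r' h)"
    using nz by (simp add: fun_eq_iff field_simps eval_nat_numeral)
qed

lemma open_nz_nth: "open {Z :: complex^2. Z $ 0 \<noteq> 0}"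
proof -
  have "open ((\<lambda>Z :: complex^2. Z $ 0) -` (- {0}))"
    by (intro open_vimage continuous_intros)
  thus ?thesis by (simp add: vimage_def)
qed

lemma r_squared_has_derivative:
  fixes Z :: "complex^2"
  assumes Z: "Z $ 0 \<noteq> 0"
  defines "A \<equiv> Im (Z $ 1 * cnj (Z $ 0))" and "r \<equiv> cmod (Z $ 0)"
  shows "(r_squared (prepotential chi) has_derivative
     (\<lambda>h. 2 * A\<^sup>2 / r ^ 4 * Im (h $ 1 * cnj (Z $ 0) + Z $ 1 * cnj (h $ 0))
        - (8 * A ^ 3 / (3 * r ^ 6) + real chi * zeta3 / (4 * pi ^ 3)) * Re (cnj (Z $ 0) * h $ 0))) (at Z)"
proof -
  have r: "r \<noteq> 0" using Z by (simp add: r_def)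
  have "((\<lambda>Z. 2 / 3 * ((Im (Z $ 1 * cnj (Z $ 0))) ^ 3 / cmod (Z $ 0) ^ 4) - (cmod (Z $ 0))\<^sup>2 * (real chi * zeta3 / (8 * pi ^ 3))) has_derivative
     (\<lambda>h. 2 * A\<^sup>2 / r ^ 4 * Im (h $ 1 * cnj (Z $ 0) + Z $ 1 * cnj (h $ 0))
        - (8 * A ^ 3 / (3 * r ^ 6) + real chi * zeta3 / (4 * pi ^ 3)) * Re (cnj (Z $ 0) * h $ 0))) (at Z)"
  proof (rule has_derivative_eq_rhs)
    define a' where "a' h = Im (h $ 1 * cnj (Z $ 0) + Z $ 1 * cnj (h $ 0))" for h :: "complex^2"
    define y' where "y' h = Re (cnj (Z $ 0) * h $ 0)" for h :: "complex^2"
    note da = has_derivative_Im_mult_cnj[of Z, folded a'_def] and dr = has_derivative_cmod_nth[OF Z, folded y'_def r_def]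
    have dr2: "((\<lambda>Z :: complex^2. (cmod (Z $ 0))\<^sup>2) has_derivative (\<lambda>h. 2 * (y' h / r) * r)) (at Z)"
      using has_derivative_power[OF dr, of 2] by (simp add: r_def)
    show "((\<lambda>Z. 2 / 3 * ((Im (Z $ 1 * cnj (Z $ 0))) ^ 3 / cmod (Z $ 0) ^ 4) - (cmod (Z $ 0))\<^sup>2 * (real chi * zeta3 / (8 * pi ^ 3))) has_derivative
      (\<lambda>h. 2 / 3 * (3 * A\<^sup>2 / r ^ 4 * a' h - 4 * A ^ 3 / r ^ 5 * (y' h / r)) - (2 * (y' h / r) * r) * (real chi * zeta3 / (8 * pi ^ 3)))) (at Z)"
      unfolding A_def r_def
      by (intro has_derivative_diff has_derivative_mult_right has_derivative_mult_left dr2[unfolded r_def]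
            has_derivative_cube_over_fourth[OF da dr[unfolded r_def]]) (use Z in simp)
    have "2 / 3 * (3 * A\<^sup>2 / r ^ 4 * x - 4 * A ^ 3 / r ^ 5 * (y / r)) - (2 * (y / r) * r) * c =
       2 * A\<^sup>2 / r ^ 4 * x - (8 * A ^ 3 / (3 * r ^ 6) + 2 * c) * y" for x y c
      using r by (simp add: field_simps) (simp add: eval_nat_numeral algebra_simps)
    moreover have "2 * (real chi * zeta3 / (8 * pi ^ 3)) = real chi * zeta3 / (4 * pi ^ 3)" by simp
    ultimately
    show "(\<lambda>h. 2 / 3 * (3 * A\<^sup>2 / r ^ 4 * a' h - 4 * A ^ 3 / r ^ 5 * (y' h / r)) - (2 * (y' h / r) * r) * (real chi * zeta3 / (8 * pi ^ 3))) =
      (\<lambda>h. 2 * A\<^sup>2 / r ^ 4 * Im (h $ 1 * cnj (Z $ 0) + Z $ 1 * cnj (h $ 0))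
        - (8 * A ^ 3 / (3 * r ^ 6) + real chi * zeta3 / (4 * pi ^ 3)) * Re (cnj (Z $ 0) * h $ 0))"
      unfolding a'_def[symmetric] y'_def[symmetric] by (simp only:)
  qed
  thus ?thesis
  proof (rule has_derivative_transform_within_open[OF _ open_nz_nth])
    fix Z' :: "complex^2" assume "Z' \<in> {Z. Z $ 0 \<noteq> 0}"
    hence Z': "Z' $ 0 \<noteq> 0" by simp
    have "r_squared (prepotential chi) Z' = 2 / 3 * ((cmod (Z' $ 0))\<^sup>2 * (Im (Z' $ 1 / Z' $ 0)) ^ 3) - (cmod (Z' $ 0))\<^sup>2 * (real chi * zeta3 / (8 * pi ^ 3))"
      unfolding r_squared_prepotential[OF Z'] by (simp add: algebra_simps)
    thus "2 / 3 * ((Im (Z' $ 1 * cnj (Z' $ 0))) ^ 3 / cmod (Z' $ 0) ^ 4) - (cmod (Z' $ 0))\<^sup>2 * (real chi * zeta3 / (8 * pi ^ 3)) = r_squared (prepotential chi) Z'"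
      unfolding cmod_square_Im_divide[OF Z'] by simp
  qed (use Z in auto)
qed

lemma f_fun_has_derivative:
  fixes P :: nspace
  assumes Z: "Z_of P $ 0 \<noteq> 0" and c: "c_l = real chi / (192 * pi)"
  defines "A \<equiv> Im (Z_of P $ 1 * cnj (Z_of P $ 0))" and "r \<equiv> cmod (Z_of P $ 0)" and "\<tau> \<equiv> Complex (zeta_of P $ 0) (cmod (Z_of P $ 0))"
  shows "(f_fun (prepotential chi) chi c_l has_derivative
     (\<lambda>h. 4 * pi * (A\<^sup>2 / r ^ 4 * Im (Z_of h $ 1 * cnj (Z_of P $ 0) + Z_of P $ 1 * cnj (Z_of h $ 0))
        - 4 * A ^ 3 / (3 * r ^ 6) * Re (cnj (Z_of P $ 0) * Z_of h $ 0)
        - kap chi * (2 * Re (cnj (Z_of P $ 0) * Z_of h $ 0) * eisenstein \<tau> + r\<^sup>2 *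
            (- (3 / (2 * r)) * (eisenstein \<tau> * (Re (cnj (Z_of P $ 0) * Z_of h $ 0) / r)
              - Im (cnj (latticeG \<tau>) * Complex (zeta_of h $ 0) (Re (cnj (Z_of P $ 0) * Z_of h $ 0) / r)))))))) (at P)"
proof -
  have r: "r \<noteq> 0" "r > 0" using Z by (simp_all add: r_def)
  have \<tau>0: "Im \<tau> > 0" "Im \<tau> = r" using r by (simp_all add: \<tau>_def r_def)
  have dZ: "(fst has_derivative fst) (at P)" for P :: nspace
    by (rule bounded_linear_imp_has_derivative[OF bounded_linear_fst])
  have dA: "((\<lambda>P::nspace. Im (Z_of P $ 1 * cnj (Z_of P $ 0))) has_derivative (\<lambda>h. Im (Z_of h $ 1 * cnj (Z_of P $ 0) + Z_of P $ 1 * cnj (Z_of h $ 0)))) (at P)"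
    using has_derivative_compose[OF dZ has_derivative_Im_mult_cnj] .
  have dr: "((\<lambda>P::nspace. cmod (Z_of P $ 0)) has_derivative (\<lambda>h. Re (cnj (Z_of P $ 0) * Z_of h $ 0) / r)) (at P)"
    unfolding r_def using has_derivative_compose[OF dZ has_derivative_cmod_nth[OF Z]] .
  have d\<zeta>: "((\<lambda>P::nspace. zeta_of P $ 0) has_derivative (\<lambda>h. zeta_of h $ 0)) (at P)"
    by (intro has_derivative_vec_nth has_derivative_fst has_derivative_snd has_derivative_ident)
  have dC: "((\<lambda>P::nspace. Complex (zeta_of P $ 0) (cmod (Z_of P $ 0))) has_derivative
      (\<lambda>h. Complex (zeta_of h $ 0) (Re (cnj (Z_of P $ 0) * Z_of h $ 0) / r))) (at P)"
    unfolding Complex_eq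
    by (intro has_derivative_add has_derivative_mult_right has_derivative_of_real dr d\<zeta>)
  have dE: "((\<lambda>P::nspace. eisenstein (Complex (zeta_of P $ 0) (cmod (Z_of P $ 0)))) has_derivative
      (\<lambda>h. - (3 / (2 * r)) * (eisenstein \<tau> * (Re (cnj (Z_of P $ 0) * Z_of h $ 0) / r)
              - Im (cnj (latticeG \<tau>) * Complex (zeta_of h $ 0) (Re (cnj (Z_of P $ 0) * Z_of h $ 0) / r))))) (at P)"
    using has_derivative_compose[OF dC eisenstein_has_derivative[OF \<tau>0(1)[unfolded \<tau>_def]]] unfolding \<tau>_def[symmetric] \<tau>0(2) by simp
  have "((\<lambda>P. 4 * pi * (1 / 3 * ((Im (Z_of P $ 1 * cnj (Z_of P $ 0))) ^ 3 / cmod (Z_of P $ 0) ^ 4) - kap chi * ((cmod (Z_of P $ 0))\<^sup>2 * eisenstein (Complex (zeta_of P $ 0) (cmod (Z_of P $ 0)))))) has_derivative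
     (\<lambda>h. 4 * pi * (A\<^sup>2 / r ^ 4 * Im (Z_of h $ 1 * cnj (Z_of P $ 0) + Z_of P $ 1 * cnj (Z_of h $ 0))
        - 4 * A ^ 3 / (3 * r ^ 6) * Re (cnj (Z_of P $ 0) * Z_of h $ 0)
        - kap chi * (2 * Re (cnj (Z_of P $ 0) * Z_of h $ 0) * eisenstein \<tau> + r\<^sup>2 *
            (- (3 / (2 * r)) * (eisenstein \<tau> * (Re (cnj (Z_of P $ 0) * Z_of h $ 0) / r)
              - Im (cnj (latticeG \<tau>) * Complex (zeta_of h $ 0) (Re (cnj (Z_of P $ 0) * Z_of h $ 0) / r)))))))) (at P)"
  proof (rule has_derivative_eq_rhs)
    define a' where "a' h = Im (Z_of h $ 1 * cnj (Z_of P $ 0) + Z_of P $ 1 * cnj (Z_of h $ 0))" for h :: nspace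
    define y' where "y' h = Re (cnj (Z_of P $ 0) * Z_of h $ 0)" for h :: nspace
    define e' where "e' h = - (3 / (2 * r)) * (eisenstein \<tau> * (y' h / r) - Im (cnj (latticeG \<tau>) * Complex (zeta_of h $ 0) (y' h / r)))" for h :: nspace
    note dA' = dA[folded a'_def] and dr' = dr[folded y'_def] and dE' = dE[folded y'_def, folded e'_def]
    have dr2: "((\<lambda>P::nspace. (cmod (Z_of P $ 0))\<^sup>2) has_derivative (\<lambda>h. 2 * (y' h / r) * r)) (at P)"
      using has_derivative_power[OF dr', of 2] by (simp add: r_def)
    have dp: "((\<lambda>P::nspace. (cmod (Z_of P $ 0))\<^sup>2 * eisenstein (Complex (zeta_of P $ 0) (cmod (Z_of P $ 0)))) has_derivative
        (\<lambda>h. r\<^sup>2 * e' h + 2 * (y' h / r) * r * eisenstein \<tau>)) (at P)"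
      using has_derivative_mult[OF dr2 dE'] unfolding \<tau>_def[symmetric] unfolding r_def[symmetric] .
    have dc: "((\<lambda>P::nspace. (Im (Z_of P $ 1 * cnj (Z_of P $ 0))) ^ 3 / cmod (Z_of P $ 0) ^ 4) has_derivative
        (\<lambda>h. 3 * A\<^sup>2 / r ^ 4 * a' h - 4 * A ^ 3 / r ^ 5 * (y' h / r))) (at P)"
      using has_derivative_cube_over_fourth[OF dA' dr'] r(1) unfolding r_def[symmetric] A_def[symmetric] by simp
    show "((\<lambda>P. 4 * pi * (1 / 3 * ((Im (Z_of P $ 1 * cnj (Z_of P $ 0))) ^ 3 / cmod (Z_of P $ 0) ^ 4) - kap chi * ((cmod (Z_of P $ 0))\<^sup>2 * eisenstein (Complex (zeta_of P $ 0) (cmod (Z_of P $ 0)))))) has_derivative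
      (\<lambda>h. 4 * pi * (1 / 3 * (3 * A\<^sup>2 / r ^ 4 * a' h - 4 * A ^ 3 / r ^ 5 * (y' h / r)) - kap chi * (r\<^sup>2 * e' h + 2 * (y' h / r) * r * eisenstein \<tau>)))) (at P)"
      by (intro has_derivative_diff has_derivative_mult_right dp dc)
    have "4 * pi * (1 / 3 * (3 * A\<^sup>2 / r ^ 4 * x - 4 * A ^ 3 / r ^ 5 * (y / r)) - k * (r\<^sup>2 * u + 2 * (y / r) * r * v)) =
      4 * pi * (A\<^sup>2 / r ^ 4 * x - 4 * A ^ 3 / (3 * r ^ 6) * y - k * (2 * y * v + r\<^sup>2 * u))" for x y u v k
    proof -
      have "1 / 3 * (3 * A\<^sup>2 / r ^ 4 * x - 4 * A ^ 3 / r ^ 5 * (y / r)) = A\<^sup>2 / r ^ 4 * x - 4 * A ^ 3 / (3 * r ^ 6) * y"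
        using r by (simp add: field_simps) (simp add: eval_nat_numeral algebra_simps)
      moreover have "r\<^sup>2 * u + 2 * (y / r) * r * v = 2 * y * v + r\<^sup>2 * u" using r by simp
      ultimately show ?thesis by (simp only:)
    qed
    thus "(\<lambda>h. 4 * pi * (1 / 3 * (3 * A\<^sup>2 / r ^ 4 * a' h - 4 * A ^ 3 / r ^ 5 * (y' h / r)) - kap chi * (r\<^sup>2 * e' h + 2 * (y' h / r) * r * eisenstein \<tau>))) =
      (\<lambda>h. 4 * pi * (A\<^sup>2 / r ^ 4 * Im (Z_of h $ 1 * cnj (Z_of P $ 0) + Z_of P $ 1 * cnj (Z_of h $ 0))
        - 4 * A ^ 3 / (3 * r ^ 6) * Re (cnj (Z_of P $ 0) * Z_of h $ 0)
        - kap chi * (2 * Re (cnj (Z_of P $ 0) * Z_of h $ 0) * eisenstein \<tau> + r\<^sup>2 *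
            (- (3 / (2 * r)) * (eisenstein \<tau> * (Re (cnj (Z_of P $ 0) * Z_of h $ 0) / r)
              - Im (cnj (latticeG \<tau>) * Complex (zeta_of h $ 0) (Re (cnj (Z_of P $ 0) * Z_of h $ 0) / r)))))))"
      unfolding e'_def unfolding a'_def[symmetric] y'_def[symmetric] by (simp only:)
  qed
  thus ?thesis
  proof (rule has_derivative_transform_within_open)
    show "open {P :: nspace. Z_of P $ 0 \<noteq> 0}"
    proof -
      have "open (fst -` {Z :: complex^2. Z $ 0 \<noteq> 0} :: nspace set)" by (intro open_vimage_fst open_nz_nth)
      thus ?thesis by (simp add: vimage_def)
    qed
    fix P' :: nspace assume "P' \<in> {P. Z_of P $ 0 \<noteq> 0}"
    hence Z': "Z_of P' $ 0 \<noteq> 0" by simp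
    show "4 * pi * (1 / 3 * ((Im (Z_of P' $ 1 * cnj (Z_of P' $ 0))) ^ 3 / cmod (Z_of P' $ 0) ^ 4) - kap chi * ((cmod (Z_of P' $ 0))\<^sup>2 * eisenstein (Complex (zeta_of P' $ 0) (cmod (Z_of P' $ 0))))) = f_fun (prepotential chi) chi c_l P'"
      unfolding f_fun_prepotential[OF Z' c] R1_kap cmod_square_Im_divide[OF Z', symmetric] by (simp add: algebra_simps)
  qed (use Z in auto)
qed

text \<open>The real identity behind \<open>qmap_metric_eq\<close>. Forms enter through their real
  and imaginary parts, polarised by primes, and X stands for the product of the two values of a - c,
  which passes through unchanged.\<close>

lemma qk_assembly:
  fixes \<tau>2 t R B K g1 g2 a1 a2 c1 c2 p1 p2 d1 d2 a1' a2' c1' c2' p1' p2' d1' d2' :: real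
  assumes nz: "\<tau>2 \<noteq> 0" "t \<noteq> 0" "R \<noteq> 0" and D: "D = B + g1" "D \<noteq> 0" and M: "M = B\<^sup>2 - (g1\<^sup>2 + g2\<^sup>2)" "M \<noteq> 0"
    and K: "K = B + R / 4 - t ^ 3 / 4"
  shows "- 1 / (4 * pi * \<tau>2\<^sup>2 * R) *
     (2 / (4 * pi * \<tau>2\<^sup>2 / D * - M) * ((- 2 * pi * (c1 + g2 * c2 / D)) * (- 2 * pi * (c1' + g2 * c2' / D)))
      + 2 * pi * (- D * (d1 * d1' + d2 * d2')
          + 1 / t * ((p1 + t\<^sup>2 / 2 * d1) * (p1' + t\<^sup>2 / 2 * d1') + (p2 + t\<^sup>2 / 2 * d2) * (p2' + t\<^sup>2 / 2 * d2'))
          + X / (\<tau>2\<^sup>2 * t ^ 3) - c2 * c2' / (D * \<tau>2\<^sup>2))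
      - 2 / (4 * pi * \<tau>2\<^sup>2 * R) * (4 * pi\<^sup>2 * \<tau>2\<^sup>2 * (
           (t * p1 + R / 2 * d1 - (g1 * d1 + g2 * d2)) * (t * p1' + R / 2 * d1' - (g1 * d1' + g2 * d2'))
         + (t * p2 + R / 2 * d2 - (g1 * d2 - g2 * d1)) * (t * p2' + R / 2 * d2' - (g1 * d2' - g2 * d1')))
         + 4 * pi\<^sup>2 * (a1 * a1' + a2 * a2')))
    = 1 / (2 * \<tau>2\<^sup>2 * R) * (
       1 / \<tau>2\<^sup>2 * ((B * (c1 * c1' + c2 * c2') + (g1 * (c1 * c1' - c2 * c2') + g2 * (c1 * c2' + c2 * c1'))) / M
          - X / t ^ 3 + (a1 * a1' + a2 * a2') / R)
       + (p1 * p1' + p2 * p2') * ((t ^ 3 - R) / (t * R))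
       - t / R * ((p1 * (g1 * d1' + g2 * d2') + p2 * (g1 * d2' - g2 * d1')) + (p1' * (g1 * d1 + g2 * d2) + p2' * (g1 * d2 - g2 * d1)))
       + (d1 * d1' + d2 * d2') * (K + (g1\<^sup>2 + g2\<^sup>2) / R))"
proof -
  define C where "C = (B * (c1 * c1' + c2 * c2') + (g1 * (c1 * c1' - c2 * c2') + g2 * (c1 * c2' + c2 * c1'))) / M"
  have pi0: "pi \<noteq> 0" by simp
  \<comment> \<open>A completed square is undone: the square of \<open>eta\<close> divided by
    \<open>f_3\<close> and the remaining term in Im c from \<open>g_N\<close> together are regular
    in D and leave only the determinant M.\<close>
  have 1: "2 / (4 * pi * \<tau>2\<^sup>2 / D * - M) * ((- 2 * pi * (c1 + g2 * c2 / D)) * (- 2 * pi * (c1' + g2 * c2' / D)))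
      - 2 * pi * (c2 * c2' / (D * \<tau>2\<^sup>2)) = - (2 * pi / \<tau>2\<^sup>2) * C"
  proof -
    have "(D * c1 + g2 * c2) * (D * c1' + g2 * c2') + M * (c2 * c2') =
       D * (B * (c1 * c1' + c2 * c2') + (g1 * (c1 * c1' - c2 * c2') + g2 * (c1 * c2' + c2 * c1')))"
      unfolding D(1) M(1) by (simp add: algebra_simps power2_eq_square)
    hence e: "C = ((D * c1 + g2 * c2) * (D * c1' + g2 * c2') + M * (c2 * c2')) / (D * M)"
      unfolding C_def using D M by simp
    have f: "c1 + g2 * c2 / D = (D * c1 + g2 * c2) / D" "c1' + g2 * c2' / D = (D * c1' + g2 * c2') / D"
      using D by (simp_all add: field_simps)
    define x y where "x = D * c1 + g2 * c2" and "y = D * c1' + g2 * c2'"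
    show ?thesis unfolding e f x_def[symmetric] y_def[symmetric]
      using D(2) M(2) nz pi0 by (simp add: field_simps power2_eq_square)
  qed
  define A where "A = a1 * a1' + a2 * a2'"
  define TT where "TT = (t * p1 + R / 2 * d1 - (g1 * d1 + g2 * d2)) * (t * p1' + R / 2 * d1' - (g1 * d1' + g2 * d2'))
         + (t * p2 + R / 2 * d2 - (g1 * d2 - g2 * d1)) * (t * p2' + R / 2 * d2' - (g1 * d2' - g2 * d1'))"
  define PP where "PP = (p1 + t\<^sup>2 / 2 * d1) * (p1' + t\<^sup>2 / 2 * d1') + (p2 + t\<^sup>2 / 2 * d2) * (p2' + t\<^sup>2 / 2 * d2')"
  \<comment> \<open>The cross terms t / 2 of p with d cancel between \<open>PP\<close> and
    \<open>TT\<close>, and the summand g1 of D cancels against \<open>TT\<close>. The coefficient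
    left at d with d is K + |g|^2 / R.\<close>
  have 2: "D * (d1 * d1' + d2 * d2') - 1 / t * PP + TT / R = (p1 * p1' + p2 * p2') * ((t ^ 3 - R) / (t * R))
       - t / R * ((p1 * (g1 * d1' + g2 * d2') + p2 * (g1 * d2' - g2 * d1')) + (p1' * (g1 * d1 + g2 * d2) + p2' * (g1 * d2 - g2 * d1)))
       + (d1 * d1' + d2 * d2') * (K + (g1\<^sup>2 + g2\<^sup>2) / R)"
  proof -
    define pp pd pg dd gg where "pp = p1 * p1' + p2 * p2'" and "pd = p1 * d1' + p2 * d2' + (p1' * d1 + p2' * d2)"
      and "pg = (p1 * (g1 * d1' + g2 * d2') + p2 * (g1 * d2' - g2 * d1')) + (p1' * (g1 * d1 + g2 * d2) + p2' * (g1 * d2 - g2 * d1))"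
      and "dd = d1 * d1' + d2 * d2'" and "gg = g1\<^sup>2 + g2\<^sup>2"
    have P: "PP = pp + t\<^sup>2 / 2 * pd + t ^ 4 / 4 * dd"
      unfolding PP_def pp_def pd_def dd_def by (simp add: field_simps eval_nat_numeral)
    have T: "TT = t\<^sup>2 * pp + t * R / 2 * pd - t * pg + (R\<^sup>2 / 4 - R * g1 + gg) * dd"
      unfolding TT_def pp_def pd_def dd_def pg_def gg_def by (simp add: field_simps power2_eq_square)
    have e1: "1 / t * PP = pp / t + t / 2 * pd + t ^ 3 / 4 * dd"
      unfolding P using nz by (simp add: field_simps eval_nat_numeral)
    have e2: "TT / R = t\<^sup>2 / R * pp + t / 2 * pd - t / R * pg + (R / 4 - g1 + gg / R) * dd"
      unfolding T using nz by (simp add: field_simps power2_eq_square)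
    have e3: "(t ^ 3 - R) / (t * R) = t\<^sup>2 / R - 1 / t"
      using nz by (simp add: field_simps power2_eq_square power3_eq_cube)
    show ?thesis unfolding pp_def[symmetric] pg_def[symmetric] dd_def[symmetric] gg_def[symmetric] D(1) K e1 e2 e3
      by (simp add: algebra_simps)
  qed
  have "- 1 / (4 * pi * \<tau>2\<^sup>2 * R) *
     (2 / (4 * pi * \<tau>2\<^sup>2 / D * - M) * ((- 2 * pi * (c1 + g2 * c2 / D)) * (- 2 * pi * (c1' + g2 * c2' / D)))
      + 2 * pi * (- D * (d1 * d1' + d2 * d2') + 1 / t * PP + X / (\<tau>2\<^sup>2 * t ^ 3) - c2 * c2' / (D * \<tau>2\<^sup>2))
      - 2 / (4 * pi * \<tau>2\<^sup>2 * R) * (4 * pi\<^sup>2 * \<tau>2\<^sup>2 * TT + 4 * pi\<^sup>2 * A))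
    = - 1 / (4 * pi * \<tau>2\<^sup>2 * R) *
     ((2 / (4 * pi * \<tau>2\<^sup>2 / D * - M) * ((- 2 * pi * (c1 + g2 * c2 / D)) * (- 2 * pi * (c1' + g2 * c2' / D)))
      - 2 * pi * (c2 * c2' / (D * \<tau>2\<^sup>2))) - 2 * pi * (D * (d1 * d1' + d2 * d2') - 1 / t * PP + TT / R)
      + 2 * pi * (X / (\<tau>2\<^sup>2 * t ^ 3)) - 2 * pi / (\<tau>2\<^sup>2 * R) * A)"
  proof -
    have "2 / (4 * pi * \<tau>2\<^sup>2 * R) * (4 * pi\<^sup>2 * \<tau>2\<^sup>2 * TT + 4 * pi\<^sup>2 * A) = 2 * pi * (TT / R) + 2 * pi / (\<tau>2\<^sup>2 * R) * A"
      using nz pi0 by (simp add: field_simps power2_eq_square)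
    thus ?thesis by (simp add: algebra_simps)
  qed
  also have "\<dots> = - 1 / (4 * pi * \<tau>2\<^sup>2 * R) * (- (2 * pi / \<tau>2\<^sup>2) * C - 2 * pi * (D * (d1 * d1' + d2 * d2') - 1 / t * PP + TT / R)
      + 2 * pi * (X / (\<tau>2\<^sup>2 * t ^ 3)) - 2 * pi / (\<tau>2\<^sup>2 * R) * A)" unfolding 1 ..
  also have "\<dots> = 1 / (2 * \<tau>2\<^sup>2 * R) * (1 / \<tau>2\<^sup>2 * (C - X / t ^ 3 + A / R) + (D * (d1 * d1' + d2 * d2') - 1 / t * PP + TT / R))"
  proof -
    define S where "S = D * (d1 * d1' + d2 * d2') - 1 / t * PP + TT / R"
    show ?thesis unfolding S_def[symmetric] using nz pi0 by (simp add: field_simps)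
  qed
  finally show ?thesis unfolding 2 unfolding C_def A_def PP_def TT_def by (simp only: add_diff_eq add.assoc[symmetric])
qed


section \<open>Evaluation of the metric data at a point of the slice\<close>

locale slice_point =
  fixes chi :: nat and c_l :: real and \<tau>2 :: real and z :: complex and \<zeta> \<zeta>t :: "real^2" and \<sigma> :: real
  assumes c_l: "c_l = real chi / (192 * pi)" and \<tau>2: "\<tau>2 > 0"
    and R1_pos: "R1 chi (Im z) (Complex (\<zeta> $ 0) \<tau>2) > 0"
begin

definition p :: iia where "p = (\<tau>2, z, \<zeta>, \<zeta>t, \<sigma>)"
definition b where "b = Re z"
definition t where "t = Im z"
definition \<tau> where "\<tau> = Complex (\<zeta> $ 0) \<tau>2"
definition R where "R = R1 chi t \<tau>"
definition B where "B = Bf chi t \<tau>"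
definition D where "D = Df chi t \<tau>"
definition g where "g = gf chi \<tau>"
abbreviation FF where "FF \<equiv> prepotential chi"

lemma Im_\<tau>: "Im \<tau> > 0" and Im_\<tau>': "Im \<tau> = \<tau>2" using \<tau>2 by (simp_all add: \<tau>_def)

lemma R_pos: "R > 0" using R1_pos by (simp add: R_def t_def \<tau>_def)

lemmas bounds = coefficient_bounds[OF Im_\<tau> R_pos[unfolded R_def], folded R_def B_def D_def g_def]

lemma t_pos: "t > 0" by (rule bounds(3))
lemma D_pos: "D > 0" by (rule bounds(2))
lemma D_eq: "D = B + Re g" unfolding D_def B_def g_def by (rule Df_eq)

lemma norm_g: "(cmod g)\<^sup>2 = (Re g)\<^sup>2 + (Im g)\<^sup>2" by (rule cmod_power2)

lemma M_pos: "B\<^sup>2 - (cmod g)\<^sup>2 > 0"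
proof -
  have "(cmod g)\<^sup>2 < B\<^sup>2" using bounds(1) by (intro power_strict_mono) auto
  thus ?thesis by simp
qed

lemma R_t_B: "R - t ^ 3 = - 2 * B"
  unfolding R_def B_def R1_kap Bf_def by simp

lemma slice_p: "slice p = (pair (of_real \<tau>2) (of_real \<tau>2 * z), \<zeta>, \<zeta>t, \<sigma>)" by (simp add: p_def)

lemma Z0: "Z_of (slice p) $ 0 \<noteq> 0" and Z0': "Z_of (slice p) $ 0 = of_real \<tau>2"
  and Z1': "Z_of (slice p) $ 1 = of_real \<tau>2 * z"
  and z_eq: "z = Z_of (slice p) $ 1 / Z_of (slice p) $ 0"
  and \<tau>_eq: "\<tau> = Complex (zeta_of (slice p) $ 0) (cmod (Z_of (slice p) $ 0))"
  using \<tau>2 by (simp_all add: slice_p \<tau>_def)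

lemma dlog_dslice: "dlog_Z0 (slice p) (dslice p X) = 0"
  by (cases X) (simp add: dlog_Z0_def slice_p, simp add: p_def)

lemma W_dslice:
  shows "W_tot FF chi (slice p) 0 (dslice p X) + of_real b * W_tot FF chi (slice p) 1 (dslice p X) =
      Complex (Im (form_c p X) / \<tau>2) (- D * Re (form_d X))"
    and "W_tot FF chi (slice p) 1 (dslice p X) = Complex (Re (form_p p X) + t\<^sup>2 / 2 * Re (form_d X)) (- t * Re (form_u p X))"
proof -
  obtain d\<tau>2 dz d\<zeta> d\<zeta>t d\<sigma> where X: "X = (d\<tau>2, dz, d\<zeta>, d\<zeta>t, d\<sigma>)" by (cases X)
  note W = W_tot_tangent[OF Z0 z_eq \<tau>_eq dlog_dslice, of chi X]
  have z: "z = Complex b t" by (simp add: b_def t_def)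
  have "\<tau>2 \<noteq> 0" using \<tau>2 by simp
  hence e: "Im (form_c p X) / \<tau>2 = d\<zeta>t $ 0 + b * d\<zeta>t $ 1 + b\<^sup>2 / 2 * d\<zeta> $ 1 - b ^ 3 / 6 * d\<zeta> $ 0 - t\<^sup>2 / 2 * (b * d\<zeta> $ 0 - d\<zeta> $ 1)"
    unfolding p_def X by (simp add: b_def[symmetric] t_def[symmetric] field_simps)
  have third: "1 / 3 * w = of_real (1 / 3) * w" and half: "1 / 2 * w = of_real (1 / 2) * w" for w :: complex by simp_all
  have z3: "1 / 3 * z ^ 3 = Complex ((b ^ 3 - 3 * b * t\<^sup>2) / 3) ((3 * b\<^sup>2 * t - t ^ 3) / 3)"
    and z2: "1 / 2 * z\<^sup>2 = Complex ((b\<^sup>2 - t\<^sup>2) / 2) (b * t)"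
    unfolding third half complex_eq_iff times_complex.sel Re_complex_of_real Im_complex_of_real Im_powers b_def t_def by simp_all
  have f: "zeta_of (dslice p X) = d\<zeta>" "tzeta_of (dslice p X) = d\<zeta>t" "Re (form_d X) = d\<zeta> $ 0"
    "Re (form_p p X) = d\<zeta>t $ 1 + b * d\<zeta> $ 1 - b\<^sup>2 / 2 * d\<zeta> $ 0" "Re (form_u p X) = b * d\<zeta> $ 0 - d\<zeta> $ 1"
    by (simp_all add: X p_def b_def)
  show "W_tot FF chi (slice p) 0 (dslice p X) + of_real b * W_tot FF chi (slice p) 1 (dslice p X) =
      Complex (Im (form_c p X) / \<tau>2) (- D * Re (form_d X))"
  proof (rule complex_eqI)
    have "Re (W_tot FF chi (slice p) 0 (dslice p X) + of_real b * W_tot FF chi (slice p) 1 (dslice p X)) =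
       d\<zeta>t $ 0 + (b ^ 3 - 3 * b * t\<^sup>2) / 3 * d\<zeta> $ 0 - (b\<^sup>2 - t\<^sup>2) / 2 * d\<zeta> $ 1 + b * (d\<zeta>t $ 1 - (b\<^sup>2 - t\<^sup>2) / 2 * d\<zeta> $ 0 + b * d\<zeta> $ 1)"
      unfolding W z3 z2 f by (simp add: b_def)
    also have "\<dots> = Im (form_c p X) / \<tau>2" unfolding e by (simp add: field_simps power2_eq_square power3_eq_cube)
    finally show "Re (W_tot FF chi (slice p) 0 (dslice p X) + of_real b * W_tot FF chi (slice p) 1 (dslice p X)) =
      Re (Complex (Im (form_c p X) / \<tau>2) (- D * Re (form_d X)))" by simp
    have "Im (W_tot FF chi (slice p) 0 (dslice p X) + of_real b * W_tot FF chi (slice p) 1 (dslice p X)) =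
       ((3 * b\<^sup>2 * t - t ^ 3) / 3 - Qf chi \<tau>) * d\<zeta> $ 0 - b * t * d\<zeta> $ 1 + b * (- (b * t) * d\<zeta> $ 0 + t * d\<zeta> $ 1)"
      unfolding W z3 z2 f by (simp add: t_def)
    also have "\<dots> = - D * d\<zeta> $ 0" unfolding D_def Df_def by (simp add: field_simps power2_eq_square)
    finally show "Im (W_tot FF chi (slice p) 0 (dslice p X) + of_real b * W_tot FF chi (slice p) 1 (dslice p X)) =
      Im (Complex (Im (form_c p X) / \<tau>2) (- D * Re (form_d X)))" by (simp add: f)
  qed
  show "W_tot FF chi (slice p) 1 (dslice p X) = Complex (Re (form_p p X) + t\<^sup>2 / 2 * Re (form_d X)) (- t * Re (form_u p X))"
    unfolding W z2 f by (simp add: complex_eq_iff b_def[symmetric] t_def[symmetric]) (simp add: field_simps)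
qed

lemma D_Df: "D = Df chi (Im z) \<tau>" "D \<noteq> 0" "Im z \<noteq> 0"
  using D_pos t_pos by (auto simp: D_def t_def)

lemmas gN = g_N_prepotential[OF Z0 z_eq \<tau>_eq D_Df(3) D_Df(1,2), folded b_def t_def]

text \<open>The diagonal form of \<open>gN\<close> with the components of both arguments as
  variables, so that the values for \<open>dslice\<close> and for \<open>V_field\<close> can be
  substituted independently.\<close>

lemma gN_alt:
  assumes "Z_of X $ 0 = x0" "Z_of X $ 1 - of_real b * Z_of X $ 0 = x1"
    "W_tot FF chi (slice p) 0 X + of_real b * W_tot FF chi (slice p) 1 X = x2" "W_tot FF chi (slice p) 1 X = x3"
    "Z_of Y $ 0 = y0" "Z_of Y $ 1 - of_real b * Z_of Y $ 0 = y1"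
    "W_tot FF chi (slice p) 0 Y + of_real b * W_tot FF chi (slice p) 1 Y = y2" "W_tot FF chi (slice p) 1 Y = y3"
  shows "g_N FF chi (slice p) X Y = 2 * pi * (- D * Re (x0 * cnj y0) + t * Re (x1 * cnj y1) - 1 / D * Re (x2 * cnj y2) + 1 / t * Re (x3 * cnj y3))"
proof -
  have r: "Re (of_real x * w) = x * Re w" "Re (- of_real x * w) = - x * Re w" for x w by simp_all
  show ?thesis
    unfolding gN(1) unfolding assms(2,3,6,7) unfolding assms(1,4,5,8)
    unfolding plus_complex.sel minus_complex.sel r ..
qed

text \<open>The term t |u|^2 is rewritten by a - c = \<open>i \<tau>_2 t^2 u\<close> as |a - c|^2 /
  (\<open>\<tau>_2^2 t^3\<close>), since a and c, but not u, appear in the remaining terms of the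
  metric.\<close>

lemma gN_dslice:
  "g_N FF chi (slice p) (dslice p X) (dslice p Y) = 2 * pi * (- D * (Re (form_d X) * Re (form_d Y) + Im (form_d X) * Im (form_d Y))
     + 1 / t * ((Re (form_p p X) + t\<^sup>2 / 2 * Re (form_d X)) * (Re (form_p p Y) + t\<^sup>2 / 2 * Re (form_d Y))
              + (Im (form_p p X) + t\<^sup>2 / 2 * Im (form_d X)) * (Im (form_p p Y) + t\<^sup>2 / 2 * Im (form_d Y)))
     + Re ((form_a p X - form_c p X) * cnj (form_a p Y - form_c p Y)) / (\<tau>2\<^sup>2 * t ^ 3)
     - Im (form_c p X) * Im (form_c p Y) / (D * \<tau>2\<^sup>2))"
proof -
  have nz: "t \<noteq> 0" "\<tau>2 \<noteq> 0" "D \<noteq> 0" using t_pos \<tau>2 D_pos by auto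
  have zx: "Z_of (dslice p X) $ 0 = of_real (Im (form_d X))"
    "Z_of (dslice p X) $ 1 - of_real b * Z_of (dslice p X) $ 0 = Complex (- Im (form_u p X)) (1 / t * (Im (form_p p X) + t\<^sup>2 / 2 * Im (form_d X)))" for X
    using nz by (cases X, simp add: p_def complex_eq_iff b_def[symmetric] t_def[symmetric] power2_eq_square field_simps)+
  have ac: "form_a p X - form_c p X = \<i> * of_real (\<tau>2 * t\<^sup>2) * form_u p X" for X
    by (simp add: p_def t_def[symmetric])
  have ac': "Re ((form_a p X - form_c p X) * cnj (form_a p Y - form_c p Y)) / (\<tau>2\<^sup>2 * t ^ 3) = t * (Re (form_u p X) * Re (form_u p Y) + Im (form_u p X) * Im (form_u p Y))"
    unfolding ac using nz by (simp add: field_simps) (simp add: eval_nat_numeral algebra_simps)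
  have r: "Re (of_real x * cnj (of_real y)) = x * y" "Re (Complex (- x) (1 / t * x') * cnj (Complex (- y) (1 / t * y'))) = x * y + x' * y' / t\<^sup>2"
    "Re (Complex (x / \<tau>2) (- D * x') * cnj (Complex (y / \<tau>2) (- D * y'))) = x * y / \<tau>2\<^sup>2 + D\<^sup>2 * (x' * y')"
    "Re (Complex x (- t * x') * cnj (Complex y (- t * y'))) = x * y + t\<^sup>2 * (x' * y')" for x x' y y' :: real
    by (simp_all add: power2_eq_square)
  have e2: "t * (x + y / t\<^sup>2) = t * x + 1 / t * y" and e3: "1 / D * (x / \<tau>2\<^sup>2 + D\<^sup>2 * y) = x / (D * \<tau>2\<^sup>2) + D * y"
    and e4: "1 / t * (x + t\<^sup>2 * y) = 1 / t * x + t * y" for x y :: real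
    using nz by (simp_all add: field_simps power2_eq_square)
  define PX PY where "PX = Im (form_p p X) + t\<^sup>2 / 2 * Im (form_d X)" and "PY = Im (form_p p Y) + t\<^sup>2 / 2 * Im (form_d Y)"
  define QX QY where "QX = Re (form_p p X) + t\<^sup>2 / 2 * Re (form_d X)" and "QY = Re (form_p p Y) + t\<^sup>2 / 2 * Re (form_d Y)"
  show ?thesis unfolding gN_alt[OF zx W_dslice zx W_dslice] ac'
    unfolding PX_def[symmetric] PY_def[symmetric] QX_def[symmetric] QY_def[symmetric] r e2 e3 e4
    by (simp add: algebra_simps)
qed

lemma W_V:
  "W_tot FF chi (slice p) 0 (V_field (slice p)) = of_real (- 2 * \<tau>2 * Im g)" "W_tot FF chi (slice p) 1 (V_field (slice p)) = 0"
  using W_tot_V_field[OF Z0 \<tau>_eq, of chi] by (simp_all add: g_def gf_def \<tau>_def mult_ac)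

lemma Z_V: "Z_of (V_field (slice p)) $ 0 = 2 * \<i> * of_real \<tau>2" "Z_of (V_field (slice p)) $ 1 = 2 * \<i> * (of_real \<tau>2 * z)"
  "Z_of (V_field (slice p)) $ 1 - of_real b * Z_of (V_field (slice p)) $ 0 = of_real (- 2 * \<tau>2 * t)"
  by (simp_all add: V_field_def slice_p complex_eq_iff b_def t_def algebra_simps)

lemma gN_V_dslice:
  "g_N FF chi (slice p) (V_field (slice p)) (dslice p X) = 2 * pi * (2 * \<tau>2 * t\<^sup>2 * Im (form_u p X) + 2 * Im g / D * Im (form_c p X))"
proof -
  obtain d\<tau>2 dz d\<zeta> d\<zeta>t d\<sigma> where X: "X = (d\<tau>2, dz, d\<zeta>, d\<zeta>t, d\<sigma>)" by (cases X)
  have zx: "Re (Z_of (dslice p X) $ 1 - of_real b * Z_of (dslice p X) $ 0) = - Im (form_u p X)" "Im (Z_of (dslice p X) $ 0) = 0"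
    by (simp_all add: X p_def b_def)
  have nz: "\<tau>2 \<noteq> 0" "D \<noteq> 0" using \<tau>2 D_pos by auto
  have W: "W_tot FF chi (slice p) 0 (V_field (slice p)) + of_real b * W_tot FF chi (slice p) 1 (V_field (slice p)) = of_real (- 2 * \<tau>2 * Im g)"
    unfolding W_V by simp
  have r: "Re (of_real x * cnj w) = x * Re w" "Re (2 * \<i> * of_real x * cnj w) = 2 * x * Im w" for x w by simp_all
  show ?thesis unfolding gN_alt[OF Z_V(1,3) W W_V(2) refl refl W_dslice] r zx
    using nz by (simp add: field_simps power2_eq_square)
qed

lemma gN_V_V: "g_N FF chi (slice p) (V_field (slice p)) (V_field (slice p)) = 8 * pi * \<tau>2\<^sup>2 * (t ^ 3 - D - (Im g)\<^sup>2 / D)"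
proof -
  have W: "W_tot FF chi (slice p) 0 (V_field (slice p)) + of_real b * W_tot FF chi (slice p) 1 (V_field (slice p)) = of_real (- 2 * \<tau>2 * Im g)"
    unfolding W_V by simp
  show ?thesis unfolding gN_alt[OF Z_V(1,3) W W_V(2) Z_V(1,3) W W_V(2)]
    using D_pos by (simp add: field_simps power2_eq_square power3_eq_cube)
qed

lemma f_slice: "f_fun FF chi c_l (slice p) = 4 * pi * \<tau>2\<^sup>2 * R"
proof -
  have "cmod (Z_of (slice p) $ 0) = \<tau>2" using \<tau>2 by (simp add: Z0')
  thus ?thesis unfolding f_fun_prepotential[OF Z0 c_l] z_eq[symmetric] \<tau>_eq[symmetric] R_def t_def by simp
qed

text \<open>From R - t^3 = - 2 B and D = B + Re g one gets (R - t^3 + D) D + (Im g)^2 = |g|^2 - B^2.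
  So \<open>f_3\<close> is negative on the slice, precisely because |g| < B.\<close>

lemma f3_slice: "f3_fun FF chi c_l (slice p) = 4 * pi * \<tau>2\<^sup>2 / D * - (B\<^sup>2 - (cmod g)\<^sup>2)"
proof -
  have "f3_fun FF chi c_l (slice p) = 4 * pi * \<tau>2\<^sup>2 * (R - t ^ 3 + D + (Im g)\<^sup>2 / D)"
    unfolding f3_fun_def f_slice gN_V_V by (simp add: algebra_simps)
  also have "R - t ^ 3 + D + (Im g)\<^sup>2 / D = - (B\<^sup>2 - (cmod g)\<^sup>2) / D"
  proof -
    have "(R - t ^ 3 + D) * D + (Im g)\<^sup>2 = - (B\<^sup>2 - (cmod g)\<^sup>2)"
      unfolding R_t_B norm_g D_eq by (simp add: algebra_simps power2_eq_square)
    thus ?thesis using D_pos by (simp add: field_simps)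
  qed
  finally show ?thesis by simp
qed

lemma defined: "qmap_metric_defined FF chi c_l p"
  unfolding qmap_metric_defined_def f_slice f3_slice using gN(2) R_pos \<tau>2 D_pos M_pos by simp


lemma theta3_slice: "theta3 FF chi (slice p) (dslice p X) = - 2 * pi * Re (form_a p X)"
proof -
  obtain d\<tau>2 dz d\<zeta> d\<zeta>t d\<sigma> where X: "X = (d\<tau>2, dz, d\<zeta>, d\<zeta>t, d\<sigma>)" by (cases X)
  have eta: "inst_eta q (slice p) (dslice p X) = 0" for q by (simp add: inst_eta_def dlog_dslice)
  \<comment> \<open>By the definitions of \<open>del\<close> and \<open>delbar\<close>,
    \<open>d_c r^2\<close> on X is minus the derivative of r^2 along iX, so this one direction
    suffices.\<close>
  define h where "h = \<i> *s Z_of (dslice p X)"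
  have h: "h $ 0 = \<i> * of_real d\<tau>2" "h $ 1 = \<i> * (of_real d\<tau>2 * z + of_real \<tau>2 * dz)"
    by (simp_all add: h_def X p_def)
  have nz: "\<tau>2 \<noteq> 0" using \<tau>2 by simp
  have Z: "Z_of (slice p) $ 0 = of_real \<tau>2" "Z_of (slice p) $ 1 = of_real \<tau>2 * z" "cmod (of_real \<tau>2) = \<tau>2"
    using \<tau>2 by (simp_all add: slice_p)
  have "frechet_derivative (r_squared FF) (at (Z_of (slice p))) h = 2 * \<tau>2\<^sup>2 * t\<^sup>2 * Re dz"
  proof -
    have 1: "Im (h $ 1 * cnj (of_real \<tau>2) + of_real \<tau>2 * z * cnj (h $ 0)) = \<tau>2\<^sup>2 * Re dz"
      unfolding h by (simp add: algebra_simps power2_eq_square)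
    have 2: "Re (cnj (of_real \<tau>2) * h $ 0) = 0" unfolding h by simp
    have 3: "Im (of_real \<tau>2 * z * cnj (of_real \<tau>2)) = \<tau>2\<^sup>2 * t" by (simp add: t_def power2_eq_square)
    show ?thesis unfolding frechet_derivativeI[OF r_squared_has_derivative[OF Z0]] unfolding Z 1 2 3
      using nz by (simp add: field_simps eval_nat_numeral)
  qed
  hence dc: "d_c (r_squared FF) (Z_of (slice p)) (Z_of (dslice p X)) = - 2 * \<tau>2\<^sup>2 * t\<^sup>2 * Re dz"
    unfolding d_c_def del_def delbar_def h_def[symmetric] by simp
  show ?thesis unfolding theta3_def eta dc sum_UNIV_2 unfolding X p_def
    by (simp add: t_def[symmetric] field_simps power2_eq_square)
qed

lemma eta_slice: "eta_form FF chi (slice p) (dslice p X) = - 2 * pi * (Re (form_c p X) + Im g * Im (form_c p X) / D)"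
proof -
  have e: "Re (form_a p X) = Re (form_c p X) - \<tau>2 * t\<^sup>2 * Im (form_u p X)" by (simp add: p_def t_def[symmetric])
  show ?thesis unfolding eta_form_def theta3_slice gN_V_dslice e by (simp add: algebra_simps)
qed

lemma omega_slice:
  "omega12 FF chi (slice p) (V_field (slice p)) (dslice p X) = 4 * pi * Complex (- \<tau>2 * (t * Re (form_p p X) + R / 2 * Re (form_d X) - (Re g * Re (form_d X) + Im g * Im (form_d X))))
     (Im (form_a p X))"
proof -
  let ?W = "\<lambda>i. W_tot FF chi (slice p) i (dslice p X)"
  have zd: "Z_of (dslice p X) $ 0 = of_real (Im (form_d X))" by (cases X) (simp add: p_def)
  have z: "z = of_real b + \<i> * of_real t" by (simp add: complex_eq_iff b_def t_def)
  have "omega12 FF chi (slice p) (V_field (slice p)) (dslice p X) =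
     2 * of_real pi * (2 * \<i> * of_real \<tau>2 * (?W 0 + z * ?W 1) - of_real (Im (form_d X)) * of_real (- 2 * \<tau>2 * Im g))"
    unfolding omega12_def sum_UNIV_2 Z_V(1,2) W_V zd by (simp add: algebra_simps)
  also have "?W 0 + z * ?W 1 = (?W 0 + of_real b * ?W 1) + \<i> * of_real t * ?W 1" by (subst z) (simp add: algebra_simps)
  also have "\<dots> = Complex (Im (form_c p X) / \<tau>2 + t\<^sup>2 * Re (form_u p X)) (t * Re (form_p p X) + (t ^ 3 / 2 - D) * Re (form_d X))"
    unfolding W_dslice(1) unfolding W_dslice(2) by (simp add: complex_eq_iff algebra_simps power2_eq_square power3_eq_cube)
  also have "t ^ 3 / 2 - D = R / 2 - Re g"
    using R_t_B unfolding D_eq by simp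
  also have "Im (form_c p X) / \<tau>2 + t\<^sup>2 * Re (form_u p X) = Im (form_a p X) / \<tau>2"
    using \<tau>2 by (simp add: p_def t_def[symmetric] field_simps power2_eq_square)
  finally have w: "omega12 FF chi (slice p) (V_field (slice p)) (dslice p X) =
     2 * of_real pi * (2 * \<i> * of_real \<tau>2 * Complex (Im (form_a p X) / \<tau>2) (t * Re (form_p p X) + (R / 2 - Re g) * Re (form_d X)) - of_real (Im (form_d X)) * of_real (- 2 * \<tau>2 * Im g))" .
  show ?thesis unfolding w using \<tau>2 by (simp add: complex_eq_iff algebra_simps)
qed

text \<open>Together with the other two evaluations, \<open>theta_3 - i theta_1\<close> = - 2 pi a
  and \<open>theta_2 - i theta_0\<close> = 2 pi \<open>\<tau>_2\<close> (t p + (R / 2 - cnj g) d):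
  the four squares are two complex norms.\<close>

lemma theta12_slice:
  "theta1 FF chi (slice p) (dslice p X) = 2 * pi * Im (form_a p X)"
  "theta2 FF chi (slice p) (dslice p X) = 2 * pi * \<tau>2 * (t * Re (form_p p X) + R / 2 * Re (form_d X) - (Re g * Re (form_d X) + Im g * Im (form_d X)))"
  unfolding theta1_def theta2_def omega_slice by simp_all

text \<open>The derivative of E contributes G through Im(cnj G d\<tau>), which is how g enters
  \<open>theta_0\<close>; E itself is eliminated in favour of R.\<close>

lemma theta0_slice:
  "theta0 FF chi c_l (slice p) (dslice p X) = - 2 * pi * \<tau>2 * (t * Im (form_p p X) + R / 2 * Im (form_d X) - (Re g * Im (form_d X) - Im g * Re (form_d X)))"
proof -
  obtain d\<tau>2 dz d\<zeta> d\<zeta>t d\<sigma> where X: "X = (d\<tau>2, dz, d\<zeta>, d\<zeta>t, d\<sigma>)" by (cases X)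
  have nz: "\<tau>2 \<noteq> 0" using \<tau>2 by simp
  have Z: "Z_of (slice p) $ 0 = of_real \<tau>2" "Z_of (slice p) $ 1 = of_real \<tau>2 * z" "cmod (of_real \<tau>2) = \<tau>2"
    using \<tau>2 by (simp_all add: slice_p)
  have h: "Z_of (dslice p X) $ 0 = of_real d\<tau>2" "Z_of (dslice p X) $ 1 = of_real d\<tau>2 * z + of_real \<tau>2 * dz" "zeta_of (dslice p X) $ 0 = d\<zeta> $ 0"
    by (simp_all add: X p_def)
  have 1: "Im ((of_real d\<tau>2 * z + of_real \<tau>2 * dz) * cnj (of_real \<tau>2) + of_real \<tau>2 * z * cnj (of_real d\<tau>2)) = \<tau>2 * (2 * t * d\<tau>2 + \<tau>2 * Im dz)"
    by (simp add: t_def algebra_simps)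
  have 2: "Re (cnj (of_real \<tau>2) * of_real d\<tau>2) = \<tau>2 * d\<tau>2" by simp
  have 3: "Im (of_real \<tau>2 * z * cnj (of_real \<tau>2)) = \<tau>2\<^sup>2 * t" by (simp add: t_def power2_eq_square)
  have 4: "kap chi * Im (cnj (latticeG \<tau>) * Complex (d\<zeta> $ 0) d\<tau>2) = 2 / 3 * (Re g * d\<tau>2 - Im g * d\<zeta> $ 0)"
    by (simp add: g_def gf_def algebra_simps)
  have 5: "\<tau>2 * d\<tau>2 / \<tau>2 = d\<tau>2" using nz by simp
  have E: "kap chi * eisenstein \<tau> = t ^ 3 / 3 - R" by (simp add: R_def R1_kap)
  define k e m where "k = kap chi" and "e = eisenstein \<tau>" and "m = Im (cnj (latticeG \<tau>) * Complex (d\<zeta> $ 0) d\<tau>2)"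
  have "theta0 FF chi c_l (slice p) (dslice p X) = - 1 / 2 * (4 * pi * ((\<tau>2\<^sup>2 * t)\<^sup>2 / \<tau>2 ^ 4 * (\<tau>2 * (2 * t * d\<tau>2 + \<tau>2 * Im dz))
      - 4 * (\<tau>2\<^sup>2 * t) ^ 3 / (3 * \<tau>2 ^ 6) * (\<tau>2 * d\<tau>2) - k * (2 * (\<tau>2 * d\<tau>2) * e + \<tau>2\<^sup>2 * (- (3 / (2 * \<tau>2)) * (e * d\<tau>2 - m)))))"
    unfolding theta0_def frechet_derivativeI[OF f_fun_has_derivative[OF Z0 c_l]] \<tau>_eq[symmetric] h
    unfolding Z 1 2 3 5 k_def e_def m_def ..
  also have "\<dots> = - 2 * pi * \<tau>2 * (\<tau>2 * t\<^sup>2 * Im dz + 2 / 3 * t ^ 3 * d\<tau>2 - 1 / 2 * (k * e) * d\<tau>2 - 3 / 2 * (k * m))"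
  proof -
    have e1: "(\<tau>2\<^sup>2 * t)\<^sup>2 / \<tau>2 ^ 4 = t\<^sup>2" and e2: "4 * (\<tau>2\<^sup>2 * t) ^ 3 / (3 * \<tau>2 ^ 6) = 4 / 3 * t ^ 3"
      using nz by (simp_all add: power_mult_distrib flip: power_mult)
    have e3: "\<tau>2\<^sup>2 * (- (3 / (2 * \<tau>2)) * x) = - 3 / 2 * \<tau>2 * x" for x
      using nz by (simp add: power2_eq_square)
    show ?thesis unfolding e1 e2 e3 by (simp add: field_simps power2_eq_square power3_eq_cube)
  qed
  also have "k * e = t ^ 3 / 3 - R" unfolding k_def e_def by (rule E)
  also have "k * m = 2 / 3 * (Re g * d\<tau>2 - Im g * d\<zeta> $ 0)" unfolding k_def m_def by (rule 4)
  finally show ?thesis unfolding X p_def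
    by (simp add: t_def[symmetric] field_simps power2_eq_square power3_eq_cube)
qed

lemma K_eq: "Kf chi t \<tau> = B + R / 4 - t ^ 3 / 4"
  unfolding Kf_def B_def Bf_def R_def R1_kap by (simp add: field_simps)

lemma qmap_metric_eq:
  "qmap_metric FF chi c_l p X Y = gform \<tau>2 t R B (Kf chi t \<tau>) g (forms p X) (forms p Y)"
proof -
  have nz: "\<tau>2 \<noteq> 0" "t \<noteq> 0" "R \<noteq> 0" "D \<noteq> 0" using \<tau>2 t_pos R_pos D_pos by auto
  have M: "B\<^sup>2 - ((Re g)\<^sup>2 + (Im g)\<^sup>2) \<noteq> 0" using M_pos unfolding norm_g by simp
  note A = qk_assembly[OF nz(1-3) D_eq nz(4) refl M K_eq, of "Re (form_c p X)" "Im (form_c p X)" "Re (form_c p Y)" "Im (form_c p Y)"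
    "Re (form_d X)" "Re (form_d Y)" "Im (form_d X)" "Im (form_d Y)" "Re (form_p p X)" "Re (form_p p Y)" "Im (form_p p X)" "Im (form_p p Y)"
    "Re ((form_a p X - form_c p X) * cnj (form_a p Y - form_c p Y))" "Re (form_a p X)" "Re (form_a p Y)" "Im (form_a p X)" "Im (form_a p Y)"]
  have "qmap_metric FF chi c_l p X Y = 1 / (2 * \<tau>2\<^sup>2 * R) * (
       1 / \<tau>2\<^sup>2 * ((B * (Re (form_c p X) * Re (form_c p Y) + Im (form_c p X) * Im (form_c p Y)) + (Re g * (Re (form_c p X) * Re (form_c p Y) - Im (form_c p X) * Im (form_c p Y)) + Im g * (Re (form_c p X) * Im (form_c p Y) + Im (form_c p X) * Re (form_c p Y)))) / (B\<^sup>2 - ((Re g)\<^sup>2 + (Im g)\<^sup>2))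
          - Re ((form_a p X - form_c p X) * cnj (form_a p Y - form_c p Y)) / t ^ 3 + (Re (form_a p X) * Re (form_a p Y) + Im (form_a p X) * Im (form_a p Y)) / R)
       + (Re (form_p p X) * Re (form_p p Y) + Im (form_p p X) * Im (form_p p Y)) * ((t ^ 3 - R) / (t * R))
       - t / R * ((Re (form_p p X) * (Re g * Re (form_d Y) + Im g * Im (form_d Y)) + Im (form_p p X) * (Re g * Im (form_d Y) - Im g * Re (form_d Y))) + (Re (form_p p Y) * (Re g * Re (form_d X) + Im g * Im (form_d X)) + Im (form_p p Y) * (Re g * Im (form_d X) - Im g * Re (form_d X))))
       + (Re (form_d X) * Re (form_d Y) + Im (form_d X) * Im (form_d Y)) * (Kf chi t \<tau> + ((Re g)\<^sup>2 + (Im g)\<^sup>2) / R))"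
    unfolding A[symmetric] qmap_metric_def frechet_slice qk_form_def f_slice f3_slice eta_slice gN_dslice theta0_slice theta12_slice theta3_slice norm_g
    by (rule arg_cong2[where f = "(*)"], rule refl) (simp add: algebra_simps power2_eq_square)
  also have "\<dots> = gform \<tau>2 t R B (Kf chi t \<tau>) g (forms p X) (forms p Y)"
    unfolding gform_def forms.simps prod.case norm_g by (simp add: algebra_simps)
  finally show ?thesis .
qed

end

section \<open>Positivity and S-duality covariance\<close>

lemma gform_add_left: "gform \<tau>2 t R B K g (x + y) w = gform \<tau>2 t R B K g x w + gform \<tau>2 t R B K g y w"
proof -
  obtain a c p d where x: "x = (a, c, p, d)" by (cases x)
  obtain a' c' p' d' where y: "y = (a', c', p', d')" by (cases y)
  obtain a2 c2 p2 d2 where w: "w = (a2, c2, p2, d2)" by (cases w)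
  show ?thesis unfolding x y w gform_def
    by (simp add: add_divide_distrib diff_divide_distrib distrib_left distrib_right left_diff_distrib right_diff_distrib)
qed

lemma gform_scale_left: "gform \<tau>2 t R B K g (r *\<^sub>R x) w = r * gform \<tau>2 t R B K g x w"
proof -
  obtain a c p d where x: "x = (a, c, p, d)" by (cases x)
  obtain a2 c2 p2 d2 where w: "w = (a2, c2, p2, d2)" by (cases w)
  have 1: "Re (r *\<^sub>R u * v) = r * Re (u * v)" "Re (cnj g * (r *\<^sub>R u) * v) = r * Re (cnj g * u * v)"
    "Re (r *\<^sub>R u - r *\<^sub>R v) = r * (Re u - Re v)" "cnj (r *\<^sub>R u) * v * u' = r *\<^sub>R (cnj u * v * u')"
    "r *\<^sub>R u - r *\<^sub>R v = r *\<^sub>R (u - v)" "Re (r *\<^sub>R u) = r * Re u" "u * (r *\<^sub>R v) = r *\<^sub>R (u * v)" for u v u' :: complex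
    by (simp_all add: algebra_simps)
  define k i M Kp Kd tR where "k = 1 / (2 * \<tau>2\<^sup>2 * R)" and "i = 1 / \<tau>2\<^sup>2" and "M = B\<^sup>2 - (cmod g)\<^sup>2"
    and "Kp = (t ^ 3 - R) / (t * R)" and "Kd = K + (cmod g)\<^sup>2 / R" and "tR = t / R"
  show ?thesis unfolding x w gform_def scaleR_prod_def fst_conv snd_conv prod.case 1
    unfolding k_def[symmetric] i_def[symmetric] M_def[symmetric] Kp_def[symmetric] Kd_def[symmetric] tR_def[symmetric]
    by (simp add: algebra_simps add_divide_distrib diff_divide_distrib)
qed

lemma gform_sym: "gform \<tau>2 t R B K g x y = gform \<tau>2 t R B K g y x"
  by (cases x, cases y) (simp add: gform_def algebra_simps)

text \<open>The form splits into a block in (a, c) and one in (p, d). In the first, the inverse form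
  is at least |c|^2 / s with s = B + |g|, and the negative term is absorbed because R + s < t^3. The
  second is a binary form whose discriminant is controlled by 2 |g| < t^3 - R.\<close>

lemma gform_pos:
  assumes \<tau>2: "\<tau>2 > 0" and t: "t > 0" and R: "R > 0" and gB: "cmod g < B" and RB: "R + B + cmod g < t ^ 3"
    and K: "K = (t ^ 3 - R) / 4" and gR: "2 * cmod g < t ^ 3 - R" and x: "x \<noteq> 0"
  shows "gform \<tau>2 t R B K g x x > 0"
proof -
  obtain a c p d where x4: "x = (a, c, p, d)" by (cases x)
  define n where "n = cmod g"
  have n0: "n \<ge> 0" by (simp add: n_def)
  define T where "T = t ^ 3"
  define s where "s = B + n"
  have s: "s > 0" using gB n0 unfolding s_def n_def by linarith
  have T: "T > 0" "R + s < T" using RB t by (auto simp: T_def s_def n_def)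
  have sq: "Re (u * cnj u) = (cmod u)\<^sup>2" for u unfolding cmod_power2 by (simp add: power2_eq_square)
  have M: "B\<^sup>2 - (cmod g)\<^sup>2 = (B - n) * s" by (simp add: s_def n_def power2_eq_square algebra_simps)
  have Bn: "B - n > 0" using gB by (simp add: n_def)
  define S1 where "S1 = (B * (cmod c)\<^sup>2 + Re (cnj g * c * c)) / (B\<^sup>2 - (cmod g)\<^sup>2) - (cmod (a - c))\<^sup>2 / T + (cmod a)\<^sup>2 / R"
  define S2 where "S2 = (cmod p)\<^sup>2 * ((T - R) / (t * R)) - t / R * (2 * Re (cnj p * cnj g * d)) + (cmod d)\<^sup>2 * (K + n\<^sup>2 / R)"
  have eq: "gform \<tau>2 t R B K g x x = 1 / (2 * \<tau>2\<^sup>2 * R) * (1 / \<tau>2\<^sup>2 * S1 + S2)"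
    unfolding gform_def x4 prod.case S1_def S2_def sq T_def n_def by simp
  have S1: "S1 \<ge> (1 - (R + s) / T) * ((cmod a)\<^sup>2 / R + (cmod c)\<^sup>2 / s)"
  proof -
    have "- Re (cnj g * c * c) \<le> cmod (cnj g * c * c)" using abs_Re_le_cmod[of "cnj g * c * c"] by linarith
    also have "\<dots> = n * (cmod c)\<^sup>2" by (simp add: norm_mult n_def power2_eq_square)
    finally have "(B - n) * (cmod c)\<^sup>2 \<le> B * (cmod c)\<^sup>2 + Re (cnj g * c * c)" by (simp add: algebra_simps)
    hence "(B - n) * (cmod c)\<^sup>2 / ((B - n) * s) \<le> (B * (cmod c)\<^sup>2 + Re (cnj g * c * c)) / ((B - n) * s)"
      using Bn s by (intro divide_right_mono) auto
    hence 1: "(cmod c)\<^sup>2 / s \<le> (B * (cmod c)\<^sup>2 + Re (cnj g * c * c)) / (B\<^sup>2 - (cmod g)\<^sup>2)" unfolding M using Bn by simp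
    have "(cmod (a - c))\<^sup>2 \<le> (cmod a + cmod c)\<^sup>2" by (intro power_mono norm_triangle_ineq4) auto
    \<comment> \<open>Cauchy-Schwarz with the weights R and s, so that the right side is a multiple
      of the positive terms already present.\<close>
    also have "\<dots> \<le> (R + s) * ((cmod a)\<^sup>2 / R + (cmod c)\<^sup>2 / s)"
    proof -
      have "(R + s) * ((cmod a)\<^sup>2 / R + (cmod c)\<^sup>2 / s) - (cmod a + cmod c)\<^sup>2 = (s * cmod a - R * cmod c)\<^sup>2 / (R * s)"
        using R s by (simp add: field_simps power2_eq_square)
      also have "\<dots> \<ge> 0" using R s by simp
      finally show ?thesis by simp
    qed
    finally have "(cmod (a - c))\<^sup>2 / T \<le> (R + s) * ((cmod a)\<^sup>2 / R + (cmod c)\<^sup>2 / s) / T" using T by (intro divide_right_mono) auto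
    moreover have "(1 - (R + s) / T) * ((cmod a)\<^sup>2 / R + (cmod c)\<^sup>2 / s) = (cmod a)\<^sup>2 / R + (cmod c)\<^sup>2 / s - (R + s) * ((cmod a)\<^sup>2 / R + (cmod c)\<^sup>2 / s) / T"
      by (simp add: left_diff_distrib)
    ultimately show ?thesis unfolding S1_def using 1 by linarith
  qed
  have f: "1 - (R + s) / T > 0" using T by simp
  have nn: "(cmod a)\<^sup>2 / R + (cmod c)\<^sup>2 / s \<ge> 0" using R s by simp
  have S1nn: "S1 \<ge> 0" using order_trans[OF mult_nonneg_nonneg[OF less_imp_le[OF f] nn] S1] .
  have S1pos: "S1 > 0" if "(a, c) \<noteq> 0"
  proof -
    have "(cmod a)\<^sup>2 / R + (cmod c)\<^sup>2 / s > 0"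
    proof (cases "a = 0")
      case True
      hence "c \<noteq> 0" using that by (simp add: zero_prod_def)
      thus ?thesis using R s by (intro add_nonneg_pos) auto
    next
      case False thus ?thesis using R s by (intro add_pos_nonneg) auto
    qed
    from less_le_trans[OF mult_pos_pos[OF f this] S1] show ?thesis .
  qed
  define L where "L = T - R"
  have L: "L > 0" "2 * n < L" using gR norm_ge_zero[of g] unfolding L_def T_def n_def by linarith+
  define \<alpha> \<beta> \<gamma> where "\<alpha> = L / (t * R)" and "\<beta> = t * n / R" and "\<gamma> = L / 4 + n\<^sup>2 / R"
  have \<alpha>: "\<alpha> > 0" using L t R by (simp add: \<alpha>_def)
  \<comment> \<open>Since T = t^3 and L = T - R, the terms in n^2 combine to - R n^2 and the
    numerator becomes R ((L / 2)^2 - n^2).\<close>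
  have disc: "\<alpha> * \<gamma> - \<beta>\<^sup>2 > 0"
  proof -
    have "\<alpha> * \<gamma> - \<beta>\<^sup>2 = (L\<^sup>2 * R / 4 + L * n\<^sup>2 - T * n\<^sup>2) / (t * R\<^sup>2)"
      unfolding \<alpha>_def \<beta>_def \<gamma>_def T_def using t R by (simp add: field_simps power2_eq_square power3_eq_cube)
    also have "L\<^sup>2 * R / 4 + L * n\<^sup>2 - T * n\<^sup>2 = R * ((L / 2)\<^sup>2 - n\<^sup>2)" unfolding L_def by (simp add: power2_eq_square field_simps)
    also have "\<dots> / (t * R\<^sup>2) > 0"
    proof -
      have "n\<^sup>2 < (L / 2)\<^sup>2" using L n0 by (intro power_strict_mono) auto
      thus ?thesis using t R by simp
    qed
    finally show ?thesis .
  qed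
  have S2: "\<alpha> * S2 \<ge> (\<alpha> * cmod p - \<beta> * cmod d)\<^sup>2 + (\<alpha> * \<gamma> - \<beta>\<^sup>2) * (cmod d)\<^sup>2"
  proof -
    have "Re (cnj p * cnj g * d) \<le> cmod (cnj p * cnj g * d)" by (rule complex_Re_le_cmod)
    also have "\<dots> = cmod p * n * cmod d" by (simp add: norm_mult n_def)
    finally have "t / R * (2 * Re (cnj p * cnj g * d)) \<le> t / R * (2 * (cmod p * n * cmod d))" using t R by (intro mult_left_mono) auto
    hence "S2 \<ge> \<alpha> * (cmod p)\<^sup>2 - 2 * \<beta> * (cmod p * cmod d) + \<gamma> * (cmod d)\<^sup>2"
      unfolding S2_def K \<alpha>_def \<beta>_def \<gamma>_def L_def T_def[symmetric] by (simp add: algebra_simps)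
    hence "\<alpha> * S2 \<ge> \<alpha> * (\<alpha> * (cmod p)\<^sup>2 - 2 * \<beta> * (cmod p * cmod d) + \<gamma> * (cmod d)\<^sup>2)" using \<alpha> by (intro mult_left_mono) auto
    thus ?thesis by (simp add: power2_eq_square algebra_simps)
  qed
  have rhs: "(\<alpha> * cmod p - \<beta> * cmod d)\<^sup>2 + (\<alpha> * \<gamma> - \<beta>\<^sup>2) * (cmod d)\<^sup>2 \<ge> 0" using disc by simp
  have S2nn: "S2 \<ge> 0" using order_trans[OF rhs S2] \<alpha> by (simp add: zero_le_mult_iff)
  have S2pos: "S2 > 0" if "(p, d) \<noteq> 0"
  proof -
    have "(\<alpha> * cmod p - \<beta> * cmod d)\<^sup>2 + (\<alpha> * \<gamma> - \<beta>\<^sup>2) * (cmod d)\<^sup>2 > 0"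
    proof (cases "d = 0")
      case True
      hence "p \<noteq> 0" using that by (simp add: zero_prod_def)
      thus ?thesis using True \<alpha> by simp
    next
      case False thus ?thesis using disc by (intro add_nonneg_pos) auto
    qed
    from less_le_trans[OF this S2] show ?thesis using \<alpha> by (simp add: zero_less_mult_iff)
  qed
  have "1 / \<tau>2\<^sup>2 * S1 + S2 > 0"
  proof (cases "(a, c) = 0")
    case True
    hence "(p, d) \<noteq> 0" using x x4 by (auto simp: zero_prod_def)
    thus ?thesis using S2pos S1nn \<tau>2 by (intro add_nonneg_pos) auto
  next
    case False thus ?thesis using S1pos S2nn \<tau>2 by (intro add_pos_nonneg) auto
  qed
  thus ?thesis unfolding eq using \<tau>2 R by simp
qed

lemma form_d_linear: "form_d (X + Y) = form_d X + form_d Y" "form_d (r *\<^sub>R X) = r *\<^sub>R form_d X"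
  by (cases X; cases Y; simp add: complex_eq_iff)+

lemma form_s_linear: "form_s p (X + Y) = form_s p X + form_s p Y" "form_s p (r *\<^sub>R X) = r *\<^sub>R form_s p X"
  by (cases p; cases X; cases Y; simp add: complex_eq_iff algebra_simps add_divide_distrib diff_divide_distrib)+

lemma form_u_linear: "form_u p (X + Y) = form_u p X + form_u p Y" "form_u p (r *\<^sub>R X) = r *\<^sub>R form_u p X"
  by (cases p; cases X; cases Y; simp add: complex_eq_iff algebra_simps)+

lemma form_p_linear: "form_p p (X + Y) = form_p p X + form_p p Y" "form_p p (r *\<^sub>R X) = r *\<^sub>R form_p p X"
  by (cases p; cases X; cases Y; simp add: complex_eq_iff algebra_simps add_divide_distrib)+

lemma forms_linear: "forms p (X + Y) = forms p X + forms p Y" "forms p (r *\<^sub>R X) = r *\<^sub>R forms p X"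
  by (cases p; simp add: form_d_linear form_s_linear form_u_linear form_p_linear algebra_simps)+

text \<open>The four complex forms are a coframe: a - c gives u, then a gives s, and the system for
  the components of X is triangular in the order d, u, p, s.\<close>

lemma forms_eq_0:
  assumes "\<tau>2 > 0" "Im z > 0" "forms (\<tau>2, z, \<zeta>, \<zeta>t, \<sigma>) X = 0"
  shows "X = 0"
proof -
  let ?p = "(\<tau>2, z, \<zeta>, \<zeta>t, \<sigma>)"
  obtain d\<tau>2 dz d\<zeta> d\<zeta>t d\<sigma> where X: "X = (d\<tau>2, dz, d\<zeta>, d\<zeta>t, d\<sigma>)" by (cases X)
  have a: "form_a ?p X = 0" and c: "form_c ?p X = 0" and q: "form_p ?p X = 0" and d: "form_d X = 0"
    using assms(3) by (simp_all add: zero_prod_def)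
  have "form_a ?p X - form_c ?p X = \<i> * of_real (\<tau>2 * (Im z)\<^sup>2) * form_u ?p X" by simp
  hence u: "form_u ?p X = 0" unfolding a c using assms(1,2) by simp
  have s: "form_s ?p X = 0" using a u by simp
  have 1: "d\<zeta> $ 0 = 0" "d\<tau>2 = 0" using d by (simp_all add: X complex_eq_iff)
  have 2: "d\<zeta> $ 1 = 0" "Re dz = 0" using u 1 assms(1) by (simp_all add: X complex_eq_iff)
  have 3: "d\<zeta>t $ 1 = 0" "Im dz = 0" using q 1 2 assms(1,2) by (simp_all add: X complex_eq_iff)
  have 4: "d\<zeta>t $ 0 = 0" using s 1 2 3 assms(1) by (simp add: X complex_eq_iff)
  have 5: "d\<sigma> = 0" using s 1 2 3 4 by (simp add: X complex_eq_iff)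
  show ?thesis unfolding X using 1 2 3 4 5 by (simp add: zero_prod_def vec_eq_iff all_2 complex_eq_iff)
qed

lemma (in slice_point) metric_positive_definite: "positive_definite (qmap_metric FF chi c_l p)"
  unfolding positive_definite_def
proof (intro conjI allI impI)
  show "qmap_metric FF chi c_l p X Y = qmap_metric FF chi c_l p Y X" for X Y
    unfolding qmap_metric_eq by (rule gform_sym)
  show "bilinear (qmap_metric FF chi c_l p)"
    unfolding bilinear_def
    by (intro conjI allI linearI)
       (simp_all only: qmap_metric_eq forms_linear gform_add_left gform_scale_left gform_sym[of _ _ _ _ _ _ "forms p _" "_ + _"]
          gform_sym[of _ _ _ _ _ _ "forms p _" "_ *\<^sub>R _"] real_scaleR_def gform_sym[of _ _ _ _ _ _ "forms p _" "forms p _"])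
  fix X :: iia assume "X \<noteq> 0"
  hence "forms p X \<noteq> 0" using forms_eq_0[OF \<tau>2 t_pos[unfolded t_def]] unfolding p_def by blast
  thus "qmap_metric FF chi c_l p X X > 0" unfolding qmap_metric_eq
    by (intro gform_pos \<tau>2 t_pos R_pos bounds)
qed

text \<open>With n = |j| the prefactor gains n and each block gains 1 / n, the first one as n^4 from
  \<open>1 / \<tau>_2^2\<close> times n^(-5). The phase of j cancels because cnj g always meets
  total weight 1 / j^2, and n^3 (j / cnj j) / j^2 = n.\<close>

lemma gform_scaling:
  fixes j :: complex
  assumes j: "j \<noteq> 0"
  defines "n \<equiv> cmod j"
  shows "gform (\<tau>2 / n\<^sup>2) (n * t) (n ^ 3 * R) (n ^ 3 * B) (n ^ 3 * K) (of_real n ^ 3 * (cnj j / j) * g)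
      (a / j, c / j, p, d / j\<^sup>2) (a' / j, c' / j, p', d' / j\<^sup>2) = gform \<tau>2 t R B K g (a, c, p, d) (a', c', p', d')"
proof -
  have n: "n > 0" using j by (simp add: n_def)
  have jj: "j * cnj j = of_real n ^ 2" by (simp add: n_def complex_norm_square[symmetric])
  have r1: "Re (u / j * cnj (v / j)) = Re (u * cnj v) / n\<^sup>2" for u v
  proof -
    have "u / j * cnj (v / j) = (u * cnj v) / of_real (n\<^sup>2)" using jj by simp
    thus ?thesis by (simp only: Re_divide_of_real)
  qed
  have r2: "Re (u / j\<^sup>2 * cnj (v / j\<^sup>2)) = Re (u * cnj v) / n ^ 4" for u v
  proof -
    have "j\<^sup>2 * cnj (j\<^sup>2) = (j * cnj j)\<^sup>2" by (simp add: power_mult_distrib)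
    also have "\<dots> = of_real (n ^ 4)" unfolding jj by (simp flip: power_mult)
    finally have "u / j\<^sup>2 * cnj (v / j\<^sup>2) = (u * cnj v) / of_real (n ^ 4)" by simp
    thus ?thesis by (simp only: Re_divide_of_real)
  qed
  have cg: "cnj (of_real n ^ 3 * (cnj j / j) * g) = of_real n ^ 3 * (j / cnj j) * cnj g" by simp
  have k: "of_real n ^ 3 * (j / cnj j) / j\<^sup>2 = of_real n"
  proof -
    have "of_real n ^ 3 * (j / cnj j) / j\<^sup>2 = of_real n ^ 3 / (j * cnj j)" using j by (simp add: power2_eq_square)
    thus ?thesis unfolding jj using n by (simp add: power2_eq_square power3_eq_cube)
  qed
  have r3: "Re (cnj (of_real n ^ 3 * (cnj j / j) * g) * (c / j) * (c' / j)) = n * Re (cnj g * c * c')"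
  proof -
    have "cnj (of_real n ^ 3 * (cnj j / j) * g) * (c / j) * (c' / j) = (of_real n ^ 3 * (j / cnj j) / j\<^sup>2) * (cnj g * c * c')"
      unfolding cg by (simp add: power2_eq_square)
    thus ?thesis unfolding k by simp
  qed
  have r4: "Re (cnj u * cnj (of_real n ^ 3 * (cnj j / j) * g) * (v / j\<^sup>2)) = n * Re (cnj u * cnj g * v)" for u v
  proof -
    have "cnj u * cnj (of_real n ^ 3 * (cnj j / j) * g) * (v / j\<^sup>2) = (of_real n ^ 3 * (j / cnj j) / j\<^sup>2) * (cnj u * cnj g * v)"
      unfolding cg by simp
    thus ?thesis unfolding k by simp
  qed
  have ng: "cmod (of_real n ^ 3 * (cnj j / j) * g) = n ^ 3 * cmod g"
    using j n by (simp add: norm_mult norm_divide norm_power)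
  have ac: "a / j - c / j = (a - c) / j" "a' / j - c' / j = (a' - c') / j" by (simp_all add: diff_divide_distrib)
  define A1 A2 A3 A4 A5 A6 A7 where "A1 = Re (c * cnj c')" and "A2 = Re (cnj g * c * c')" and "A3 = Re ((a - c) * cnj (a' - c'))"
    and "A4 = Re (a * cnj a')" and "A5 = Re (p * cnj p')" and "A6 = Re (cnj p * cnj g * d') + Re (cnj p' * cnj g * d)" and "A7 = Re (d * cnj d')"
  define G where "G = cmod g"
  have "1 / (2 * (\<tau>2 / n\<^sup>2)\<^sup>2 * (n ^ 3 * R)) * (
       1 / (\<tau>2 / n\<^sup>2)\<^sup>2 * ((n ^ 3 * B * (A1 / n\<^sup>2) + n * A2) / ((n ^ 3 * B)\<^sup>2 - (n ^ 3 * G)\<^sup>2) - A3 / n\<^sup>2 / (n * t) ^ 3 + A4 / n\<^sup>2 / (n ^ 3 * R))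
       + A5 * (((n * t) ^ 3 - n ^ 3 * R) / (n * t * (n ^ 3 * R)))
       - n * t / (n ^ 3 * R) * (n * A6)
       + A7 / n ^ 4 * (n ^ 3 * K + (n ^ 3 * G)\<^sup>2 / (n ^ 3 * R)))
    = 1 / (2 * \<tau>2\<^sup>2 * R) * (
       1 / \<tau>2\<^sup>2 * ((B * A1 + A2) / (B\<^sup>2 - G\<^sup>2) - A3 / t ^ 3 + A4 / R)
       + A5 * ((t ^ 3 - R) / (t * R)) - t / R * A6 + A7 * (K + G\<^sup>2 / R))"
  proof -
    have e0: "1 / (2 * (\<tau>2 / n\<^sup>2)\<^sup>2 * (n ^ 3 * R)) = n * (1 / (2 * \<tau>2\<^sup>2 * R))"
      using n by (simp add: field_simps eval_nat_numeral)
    have e1: "1 / (\<tau>2 / n\<^sup>2)\<^sup>2 = n ^ 4 * (1 / \<tau>2\<^sup>2)" using n by (simp add: field_simps eval_nat_numeral)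
    have e2: "(n ^ 3 * B * (A1 / n\<^sup>2) + n * A2) / ((n ^ 3 * B)\<^sup>2 - (n ^ 3 * G)\<^sup>2) = (1 / n ^ 5) * ((B * A1 + A2) / (B\<^sup>2 - G\<^sup>2))"
    proof -
      have "n ^ 3 * B * (A1 / n\<^sup>2) + n * A2 = n * (B * A1 + A2)" using n by (simp add: field_simps eval_nat_numeral)
      moreover have "(n ^ 3 * B)\<^sup>2 - (n ^ 3 * G)\<^sup>2 = n * (n ^ 5 * (B\<^sup>2 - G\<^sup>2))" by (simp add: algebra_simps eval_nat_numeral)
      ultimately show ?thesis using n by simp
    qed
    have e3: "A3 / n\<^sup>2 / (n * t) ^ 3 = (1 / n ^ 5) * (A3 / t ^ 3)" "A4 / n\<^sup>2 / (n ^ 3 * R) = (1 / n ^ 5) * (A4 / R)"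
      using n by (simp_all add: field_simps eval_nat_numeral)
    have e4: "((n * t) ^ 3 - n ^ 3 * R) / (n * t * (n ^ 3 * R)) = (1 / n) * ((t ^ 3 - R) / (t * R))"
    proof -
      have "(n * t) ^ 3 - n ^ 3 * R = n ^ 3 * (t ^ 3 - R)" by (simp add: power_mult_distrib algebra_simps)
      moreover have "n * t * (n ^ 3 * R) = n ^ 3 * (n * (t * R))" by simp
      ultimately show ?thesis using n by simp
    qed
    have e5: "n * t / (n ^ 3 * R) * (n * A6) = (1 / n) * (t / R * A6)" using n by (simp add: field_simps eval_nat_numeral)
    have e6: "A7 / n ^ 4 * (n ^ 3 * K + (n ^ 3 * G)\<^sup>2 / (n ^ 3 * R)) = (1 / n) * (A7 * (K + G\<^sup>2 / R))"
    proof -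
      have "(n ^ 3 * G)\<^sup>2 / (n ^ 3 * R) = n ^ 3 * (G\<^sup>2 / R)" using n by (simp add: power2_eq_square)
      hence "n ^ 3 * K + (n ^ 3 * G)\<^sup>2 / (n ^ 3 * R) = n ^ 3 * (K + G\<^sup>2 / R)" by (simp add: distrib_left)
      thus ?thesis using n by (simp add: field_simps eval_nat_numeral)
    qed
    have e7: "n * (n ^ 4 * ((1 / n ^ 5) * x)) = x" "n * ((1 / n) * x) = x" for x
      using n by (simp_all add: mult.assoc[symmetric] flip: power_Suc)
    define U1 U2 U3 U4 U5 where "U1 = (B * A1 + A2) / (B\<^sup>2 - G\<^sup>2) - A3 / t ^ 3 + A4 / R" and "U2 = A5 * ((t ^ 3 - R) / (t * R))"
      and "U3 = t / R * A6" and "U4 = A7 * (K + G\<^sup>2 / R)" and "U5 = 1 / (2 * \<tau>2\<^sup>2 * R)"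
    have "1 / (2 * (\<tau>2 / n\<^sup>2)\<^sup>2 * (n ^ 3 * R)) * (
       1 / (\<tau>2 / n\<^sup>2)\<^sup>2 * ((n ^ 3 * B * (A1 / n\<^sup>2) + n * A2) / ((n ^ 3 * B)\<^sup>2 - (n ^ 3 * G)\<^sup>2) - A3 / n\<^sup>2 / (n * t) ^ 3 + A4 / n\<^sup>2 / (n ^ 3 * R))
       + A5 * (((n * t) ^ 3 - n ^ 3 * R) / (n * t * (n ^ 3 * R)))
       - n * t / (n ^ 3 * R) * (n * A6)
       + A7 / n ^ 4 * (n ^ 3 * K + (n ^ 3 * G)\<^sup>2 / (n ^ 3 * R)))
     = U5 * (1 / \<tau>2\<^sup>2 * (n * (n ^ 4 * ((1 / n ^ 5) * U1))) + n * ((1 / n) * U2) - n * ((1 / n) * U3) + n * ((1 / n) * U4))"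
    proof -
      define v1 v3 v4 v5 i n5 n1 where "v1 = (B * A1 + A2) / (B\<^sup>2 - G\<^sup>2)" and "v3 = A3 / t ^ 3" and "v4 = A4 / R"
        and "v5 = (t ^ 3 - R) / (t * R)" and "i = 1 / \<tau>2\<^sup>2" and "n5 = 1 / n ^ 5" and "n1 = 1 / n"
      show ?thesis unfolding e0 e1 e2 e3 e4 e5 e6 U3_def[symmetric] U4_def[symmetric] U5_def[symmetric] U1_def U2_def
        unfolding v1_def[symmetric] v3_def[symmetric] v4_def[symmetric] v5_def[symmetric] i_def[symmetric] n5_def[symmetric] n1_def[symmetric]
        by (simp add: algebra_simps)
    qed
    thus ?thesis unfolding e7 U1_def U2_def U3_def U4_def U5_def .
  qed
  thus ?thesis unfolding gform_def prod.case r1 r2 r3 r4 ng ac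
    unfolding A1_def A2_def A3_def A4_def A5_def A6_def A7_def G_def by (simp only: distrib_left)
qed

section \<open>Type IIB coordinates and the S-duality weights of the coframe\<close>

fun iia_to_iib :: "iia \<Rightarrow> iib" where
  "iia_to_iib (\<tau>2, z, \<zeta>, \<zeta>t, \<sigma>) =
     (let b = Re z; cu1 = \<zeta> $ 0 * b - \<zeta> $ 1; c1 = \<zeta>t $ 1 + b * \<zeta> $ 1 / 2; c0 = \<zeta>t $ 0 - b\<^sup>2 * \<zeta> $ 1 / 6 in
      (Complex (\<zeta> $ 0) \<tau>2, z, cu1, c1, c0, (- \<sigma> - \<zeta> $ 0 * c0 - c1 * \<zeta> $ 1 + b * cu1 * \<zeta> $ 1 / 6) / 2))"

lemma pair_eta: "pair (x $ 0) (x $ 1) = x"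
  by (simp add: vec_eq_iff all_2)

lemma pair_eqI: "x $ 0 = a \<Longrightarrow> x $ 1 = b \<Longrightarrow> pair a b = x"
  by (simp add: vec_eq_iff all_2)

lemma iib_to_iia_to_iib: "iib_to_iia (iia_to_iib p) = p"
proof -
  obtain \<tau>2 z \<zeta> \<zeta>t \<sigma> where p: "p = (\<tau>2, z, \<zeta>, \<zeta>t, \<sigma>)" by (cases p)
  show ?thesis unfolding p by (auto simp: Let_def intro!: pair_eqI) (simp_all add: field_simps)
qed

lemma iia_to_iib_to_iia: "iia_to_iib (iib_to_iia q) = q"
proof -
  obtain \<tau> z cu1 c1 c0 \<psi> where q: "q = (\<tau>, z, cu1, c1, c0, \<psi>)" by (cases q)
  show ?thesis unfolding q by (simp add: Let_def complex_eq_iff) (simp add: field_simps power2_eq_square)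
qed

lemma the_inv_iib: "the_inv iib_to_iia p = iia_to_iib p"
  by (metis iia_to_iib_to_iia iib_to_iia_to_iib injI the_inv_f_f)

lemma S_duality_alt: "S_duality A p = iib_to_iia (S_duality_iib A (iia_to_iib p))"
  by (simp add: S_duality_def the_inv_iib)

fun d_iib_to_iia :: "iib \<Rightarrow> iib \<Rightarrow> iia" where
  "d_iib_to_iia (\<tau>, z, cu1, c1, c0, \<psi>) (d\<tau>, dz, dcu1, dc1, dc0, d\<psi>) =
     (let \<tau>1 = Re \<tau>; b = Re z; db = Re dz; w = cu1 - \<tau>1 * b; dw = dcu1 - Re d\<tau> * b - \<tau>1 * db in
      (Im d\<tau>, dz, pair (Re d\<tau>) (- dw),
       pair (dc0 - 1 / 3 * b * db * w - 1 / 6 * b\<^sup>2 * dw) (dc1 + 1 / 2 * db * w + 1 / 2 * b * dw),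
       - 2 * (d\<psi> + 1 / 2 * Re d\<tau> * c0 + 1 / 2 * \<tau>1 * dc0) + dc1 * w + c1 * dw
         - 1 / 6 * (db * cu1 * w + b * dcu1 * w + b * cu1 * dw)))"

lemma iib_to_iia_projections:
  "iib_to_iia = (\<lambda>q. (Im (fst q), fst (snd q), pair (Re (fst q)) (- (fst (snd (snd q)) - Re (fst q) * Re (fst (snd q)))),
     pair (fst (snd (snd (snd (snd q)))) - 1 / 6 * (Re (fst (snd q)))\<^sup>2 * (fst (snd (snd q)) - Re (fst q) * Re (fst (snd q))))
          (fst (snd (snd (snd q))) + 1 / 2 * Re (fst (snd q)) * (fst (snd (snd q)) - Re (fst q) * Re (fst (snd q)))),
     - 2 * (snd (snd (snd (snd (snd q)))) + 1 / 2 * Re (fst q) * fst (snd (snd (snd (snd q))))) + fst (snd (snd (snd q))) * (fst (snd (snd q)) - Re (fst q) * Re (fst (snd q)))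
       - 1 / 6 * Re (fst (snd q)) * fst (snd (snd q)) * (fst (snd (snd q)) - Re (fst q) * Re (fst (snd q)))))"
  by (auto simp: fun_eq_iff Let_def)

lemma iib_to_iia_has_derivative: "(iib_to_iia has_derivative d_iib_to_iia q) (at q)"
  unfolding iib_to_iia_projections
  by (rule has_derivative_eq_rhs, (rule derivative_intros bounded_linear.has_derivative[OF bounded_linear_Re] bounded_linear.has_derivative[OF bounded_linear_Im] | simp)+)
     (cases q, auto simp: fun_eq_iff Let_def vec_eq_iff all_2 algebra_simps power2_eq_square)

text \<open>The pullback of \<open>forms\<close>, arranged so that covariance is visible:
  \<open>e = c^1 db - b dc^1\<close> is a determinant of two doublets, hence invariant, and u and s
  are doublets contracted with (1, - \<tau>) or (1, \<tau>).\<close>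

fun iibforms :: "iib \<Rightarrow> iib \<Rightarrow> complex \<times> complex \<times> complex \<times> complex" where
  "iibforms (\<tau>, z, cu1, c1, c0, \<psi>) (d\<tau>, dz, dcu1, dc1, dc0, d\<psi>) =
     (let b = Re z; t = Im z; db = Re dz; e = cu1 * db - b * dcu1; u = of_real dcu1 - \<tau> * of_real db;
          s = of_real (d\<psi> - cu1 * (dc1 + e / 6)) + \<tau> * of_real (dc0 + b * (dc1 + e / 6));
          k = \<i> * of_real (Im \<tau> * t\<^sup>2 / 2) in
      (s + k * u, s - k * u, Complex (dc1 + e / 2) (t * (Im \<tau> * Im dz + t * Im d\<tau> / 2)), d\<tau>))"

lemma forms_iib: "forms (iib_to_iia q) (d_iib_to_iia q Q) = iibforms q Q"
proof -
  obtain \<tau> z cu1 c1 c0 \<psi> where q: "q = (\<tau>, z, cu1, c1, c0, \<psi>)" by (cases q)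
  obtain d\<tau> dz dcu1 dc1 dc0 d\<psi> where Q: "Q = (d\<tau>, dz, dcu1, dc1, dc0, d\<psi>)" by (cases Q)
  define b where "b = Re z"
  define e where "e = cu1 * Re dz - b * dcu1"
  have u: "form_u (iib_to_iia q) (d_iib_to_iia q Q) = of_real dcu1 - \<tau> * of_real (Re dz)"
    unfolding q Q by (simp add: Let_def complex_eq_iff algebra_simps)
  have s: "form_s (iib_to_iia q) (d_iib_to_iia q Q) = of_real (d\<psi> - cu1 * (dc1 + e / 6)) + \<tau> * of_real (dc0 + b * (dc1 + e / 6))"
    unfolding q Q e_def b_def by (simp add: Let_def complex_eq_iff) (simp add: field_simps power2_eq_square power3_eq_cube)
  have p: "form_p (iib_to_iia q) (d_iib_to_iia q Q) = Complex (dc1 + e / 2) (Im z * (Im \<tau> * Im dz + Im z * Im d\<tau> / 2))"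
    unfolding q Q e_def b_def by (simp add: Let_def complex_eq_iff) (simp add: field_simps power2_eq_square)
  have d: "form_d (d_iib_to_iia q Q) = d\<tau>" unfolding q Q by (simp add: Let_def)
  obtain r where r: "iib_to_iia q = (Im \<tau>, z, r)" unfolding q by (simp add: Let_def)
  show ?thesis unfolding forms.simps p d unfolding r form_a.simps form_c.simps unfolding r[symmetric] u s unfolding q Q e_def b_def
    by (simp add: Let_def)
qed


fun d_S_duality_iib :: "int^2^2 \<Rightarrow> iib \<Rightarrow> iib \<Rightarrow> iib" where
  "d_S_duality_iib A (\<tau>, z, cu1, c1, c0, \<psi>) (d\<tau>, dz, dcu1, dc1, dc0, d\<psi>) =
     (let \<alpha> = A $ 0 $ 0; \<beta> = A $ 0 $ 1; \<gamma> = A $ 1 $ 0; \<delta> = A $ 1 $ 1; j = of_int \<gamma> * \<tau> + of_int \<delta> in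
      (d\<tau> / j\<^sup>2,
       Complex (of_int \<gamma> * dcu1 + of_int \<delta> * Re dz) (cmod j * Im dz + Re (cnj j * (of_int \<gamma> * d\<tau>)) / cmod j * Im z),
       of_int \<alpha> * dcu1 + of_int \<beta> * Re dz,
       dc1,
       of_int \<delta> * dc0 - of_int \<gamma> * d\<psi>,
       - of_int \<beta> * dc0 + of_int \<alpha> * d\<psi>))"

lemma det_SL2: "det (A :: int^2^2) = A $ 0 $ 0 * A $ 1 $ 1 - A $ 0 $ 1 * A $ 1 $ 0"
proof -
  have e: "(2 :: 2) = 0" by simp
  show ?thesis using det_2[of A] unfolding e by (simp add: algebra_simps)
qed

lemma S_duality_iib_has_derivative:
  assumes A: "det A = 1" and \<tau>: "Im (fst q) > 0"
  shows "(S_duality_iib A has_derivative d_S_duality_iib A q) (at q)"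
proof -
  define \<alpha> \<beta> \<gamma> \<delta> where "\<alpha> = A $ 0 $ 0" and "\<beta> = A $ 0 $ 1" and "\<gamma> = A $ 1 $ 0" and "\<delta> = A $ 1 $ 1"
  have det: "\<alpha> * \<delta> - \<beta> * \<gamma> = 1" using A unfolding det_SL2 \<alpha>_def \<beta>_def \<gamma>_def \<delta>_def by simp
  have j: "of_int \<gamma> * fst q + of_int \<delta> \<noteq> 0" by (rule moebius_denominator_nz[OF det \<tau>])
  have f: "S_duality_iib A = (\<lambda>q. ((of_int \<alpha> * fst q + of_int \<beta>) / (of_int \<gamma> * fst q + of_int \<delta>),
      of_real (of_int \<gamma> * fst (snd (snd q)) + of_int \<delta> * Re (fst (snd q))) + \<i> * of_real (cmod (of_int \<gamma> * fst q + of_int \<delta>) * Im (fst (snd q))),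
      of_int \<alpha> * fst (snd (snd q)) + of_int \<beta> * Re (fst (snd q)),
      fst (snd (snd (snd q))), of_int \<delta> * fst (snd (snd (snd (snd q)))) - of_int \<gamma> * snd (snd (snd (snd (snd q)))),
      - of_int \<beta> * fst (snd (snd (snd (snd q)))) + of_int \<alpha> * snd (snd (snd (snd (snd q))))))"
    by (auto simp: fun_eq_iff Let_def \<alpha>_def \<beta>_def \<gamma>_def \<delta>_def Complex_eq)
  have d1: "((\<lambda>q :: iib. (of_int \<alpha> * fst q + of_int \<beta>) / (of_int \<gamma> * fst q + of_int \<delta>)) has_derivative (\<lambda>h. fst h / (of_int \<gamma> * fst q + of_int \<delta>)\<^sup>2)) (at q)"
  proof -
    have "((\<lambda>w. (of_int \<alpha> * w + of_int \<beta>) / (of_int \<gamma> * w + of_int \<delta>)) has_field_derivative 1 / (of_int \<gamma> * fst q + of_int \<delta>)\<^sup>2) (at (fst q))"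
    proof -
      have "((\<lambda>w. (of_int \<alpha> * w + of_int \<beta>) / (of_int \<gamma> * w + of_int \<delta>)) has_field_derivative
         (of_int \<alpha> * (of_int \<gamma> * fst q + of_int \<delta>) - (of_int \<alpha> * fst q + of_int \<beta>) * of_int \<gamma>) / ((of_int \<gamma> * fst q + of_int \<delta>) * (of_int \<gamma> * fst q + of_int \<delta>))) (at (fst q))"
        using j by (auto intro!: derivative_eq_intros)
      moreover have "of_int \<alpha> * (of_int \<gamma> * fst q + of_int \<delta>) - (of_int \<alpha> * fst q + of_int \<beta>) * of_int \<gamma> = (of_int (\<alpha> * \<delta> - \<beta> * \<gamma>) :: complex)"
        by (simp add: algebra_simps)
      ultimately show ?thesis unfolding det by (simp add: power2_eq_square)
    qed
    hence "((\<lambda>w. (of_int \<alpha> * w + of_int \<beta>) / (of_int \<gamma> * w + of_int \<delta>)) has_derivative (\<lambda>h. 1 / (of_int \<gamma> * fst q + of_int \<delta>)\<^sup>2 * h)) (at (fst q))"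
      unfolding has_field_derivative_def .
    from has_derivative_compose[OF bounded_linear_imp_has_derivative[OF bounded_linear_fst] this] show ?thesis by simp
  qed
  have d2: "((\<lambda>q :: iib. cmod (of_int \<gamma> * fst q + of_int \<delta>)) has_derivative
      (\<lambda>h. Re (cnj (of_int \<gamma> * fst q + of_int \<delta>) * (of_int \<gamma> * fst h)) / cmod (of_int \<gamma> * fst q + of_int \<delta>))) (at q)"
  proof -
    have l: "((\<lambda>q :: iib. of_int \<gamma> * fst q + of_int \<delta>) has_derivative (\<lambda>h. of_int \<gamma> * fst h)) (at q)"
      by (auto intro!: derivative_eq_intros)
    have i: "inner a (sgn w) = Re (cnj w * a) / cmod w" for a w
      by (simp add: inner_complex_def sgn_div_norm divide_inverse algebra_simps)
    show ?thesis using has_derivative_compose[OF l has_derivative_norm[OF j]] by (simp only: i)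
  qed
  show ?thesis unfolding f
    by (rule has_derivative_eq_rhs, (rule d1 d2 derivative_intros bounded_linear.has_derivative[OF bounded_linear_Re] bounded_linear.has_derivative[OF bounded_linear_Im])+)
       (cases q, auto simp: fun_eq_iff Let_def Complex_eq \<alpha>_def \<beta>_def \<gamma>_def \<delta>_def algebra_simps)
qed

text \<open>For u and s the claim reduces to the two scalar identities \<open>k1\<close> and
  \<open>k2\<close>. The combination \<open>\<tau>_2 t^2\<close> is invariant, so k is unchanged and
  a and c inherit the weight of s and u.\<close>

lemma iibforms_S_duality:
  assumes A: "det A = 1" and \<tau>: "Im (fst q) > 0"
  defines "j \<equiv> of_int (A $ 1 $ 0) * fst q + of_int (A $ 1 $ 1)"
  shows "iibforms (S_duality_iib A q) (d_S_duality_iib A q Q) =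
     (case iibforms q Q of (a, c, p, d) \<Rightarrow> (a / j, c / j, p, d / j\<^sup>2))"
proof -
  obtain \<tau> z cu1 c1 c0 \<psi> where q: "q = (\<tau>, z, cu1, c1, c0, \<psi>)" by (cases q)
  obtain d\<tau> dz dcu1 dc1 dc0 d\<psi> where Q: "Q = (d\<tau>, dz, dcu1, dc1, dc0, d\<psi>)" by (cases Q)
  define \<alpha> \<beta> \<gamma> \<delta> :: real where "\<alpha> = of_int (A $ 0 $ 0)" and "\<beta> = of_int (A $ 0 $ 1)" and "\<gamma> = of_int (A $ 1 $ 0)" and "\<delta> = of_int (A $ 1 $ 1)"
  have c: "of_int (A $ 0 $ 0) = complex_of_real \<alpha>" "of_int (A $ 0 $ 1) = complex_of_real \<beta>" "of_int (A $ 1 $ 0) = complex_of_real \<gamma>" "of_int (A $ 1 $ 1) = complex_of_real \<delta>"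
    by (simp_all add: \<alpha>_def \<beta>_def \<gamma>_def \<delta>_def)
  have det: "\<alpha> * \<delta> - \<beta> * \<gamma> = 1" using A unfolding det_SL2 \<alpha>_def \<beta>_def \<gamma>_def \<delta>_def by (simp flip: of_int_mult of_int_diff)
  have det': "of_real \<alpha> * of_real \<delta> = (1 + of_real \<beta> * of_real \<gamma> :: complex)"
    using arg_cong[OF det, of complex_of_real] by (simp add: algebra_simps)
  have jq: "j = of_real \<gamma> * \<tau> + of_real \<delta>" by (simp add: j_def q c)
  have t: "Im \<tau> > 0" using \<tau> by (simp add: q)
  have j0: "j \<noteq> 0" unfolding j_def by (rule moebius_denominator_nz[of "A $ 0 $ 0" _ "A $ 0 $ 1"]) (use A \<tau> in \<open>simp_all add: det_SL2\<close>)
  define \<tau>' where "\<tau>' = (of_real \<alpha> * \<tau> + of_real \<beta>) / j"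
  \<comment> \<open>Contracting the transformed doublet with the transformed \<tau> reproduces the
    old contraction divided by j; the unit determinant enters exactly here.\<close>
  have k1: "of_real \<alpha> - \<tau>' * of_real \<gamma> = 1 / j" and k2: "\<tau>' * of_real \<delta> - of_real \<beta> = \<tau> / j"
    unfolding \<tau>'_def using j0 det' by (simp_all add: divide_simps) (simp_all add: jq algebra_simps)
  define n where "n = cmod j"
  have n0: "n > 0" using j0 by (simp add: n_def)
  have Im\<tau>': "Im \<tau>' = Im \<tau> / n\<^sup>2"
  proof -
    have "\<tau>' = (of_real \<alpha> * \<tau> + of_real \<beta>) * cnj j / of_real (n\<^sup>2)" unfolding \<tau>'_def n_def complex_norm_square using j0 by simp
    hence "Im \<tau>' = Im ((of_real \<alpha> * \<tau> + of_real \<beta>) * cnj j) / n\<^sup>2" by (simp only: Im_divide_of_real)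
    also have "Im ((of_real \<alpha> * \<tau> + of_real \<beta>) * cnj j) = (\<alpha> * \<delta> - \<beta> * \<gamma>) * Im \<tau>" by (simp add: jq algebra_simps)
    finally show ?thesis unfolding det by simp
  qed
  define b t where "b = Re z" and "t = Im z"
  define b' cu1' where "b' = \<gamma> * cu1 + \<delta> * b" and "cu1' = \<alpha> * cu1 + \<beta> * b"
  define db' dcu1' where "db' = \<gamma> * dcu1 + \<delta> * Re dz" and "dcu1' = \<alpha> * dcu1 + \<beta> * Re dz"
  define e where "e = cu1 * Re dz - b * dcu1"
  have e': "cu1' * db' - b' * dcu1' = e"
  proof -
    have "cu1' * db' - b' * dcu1' = (\<alpha> * \<delta> - \<beta> * \<gamma>) * e" unfolding cu1'_def db'_def b'_def dcu1'_def e_def by (simp add: algebra_simps)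
    thus ?thesis unfolding det by simp
  qed
  have u': "of_real dcu1' - \<tau>' * of_real db' = (of_real dcu1 - \<tau> * of_real (Re dz)) / j"
  proof -
    have "of_real dcu1' - \<tau>' * of_real db' = of_real dcu1 * (of_real \<alpha> - \<tau>' * of_real \<gamma>) - of_real (Re dz) * (\<tau>' * of_real \<delta> - of_real \<beta>)"
      unfolding dcu1'_def db'_def by (simp add: algebra_simps)
    thus ?thesis unfolding k1 k2 by (simp add: diff_divide_distrib mult.commute)
  qed
  define w where "w = dc1 + e / 6"
  have s': "of_real (- \<beta> * dc0 + \<alpha> * d\<psi> - cu1' * w) + \<tau>' * of_real (\<delta> * dc0 - \<gamma> * d\<psi> + b' * w) = (of_real (d\<psi> - cu1 * w) + \<tau> * of_real (dc0 + b * w)) / j"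
  proof -
    have "of_real (- \<beta> * dc0 + \<alpha> * d\<psi> - cu1' * w) + \<tau>' * of_real (\<delta> * dc0 - \<gamma> * d\<psi> + b' * w) =
       of_real (d\<psi> - cu1 * w) * (of_real \<alpha> - \<tau>' * of_real \<gamma>) + of_real (dc0 + b * w) * (\<tau>' * of_real \<delta> - of_real \<beta>)"
      unfolding cu1'_def b'_def by (simp add: algebra_simps)
    thus ?thesis unfolding k1 k2 by (simp add: add_divide_distrib mult.commute)
  qed
  have k': "Im \<tau>' * (n * t)\<^sup>2 / 2 = Im \<tau> * t\<^sup>2 / 2" unfolding Im\<tau>' using n0 by (simp add: power_mult_distrib)
  \<comment> \<open>Invariance of \<open>d(\<tau>_2 t^2) / 2\<close>: with Im j = \<gamma> Im
    \<tau>, the term from the derivative of |j| compensates the rotation in Im(d\<tau> /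
    j^2).\<close>
  have p': "n * t * (Im \<tau>' * (n * Im dz + Re (cnj j * (of_real \<gamma> * d\<tau>)) / n * t) + n * t * Im (d\<tau> / j\<^sup>2) / 2) = t * (Im \<tau> * Im dz + t * Im d\<tau> / 2)"
  proof -
    define x y where "x = Re j" and "y = Im j"
    have yg: "y = \<gamma> * Im \<tau>" by (simp add: y_def jq)
    have nn: "n\<^sup>2 = x\<^sup>2 + y\<^sup>2" by (simp add: n_def x_def y_def cmod_power2)
    have r: "Re (cnj j * (of_real \<gamma> * d\<tau>)) = \<gamma> * (x * Re d\<tau> + y * Im d\<tau>)" by (simp add: x_def y_def algebra_simps)
    have i: "Im (d\<tau> / j\<^sup>2) = ((x\<^sup>2 - y\<^sup>2) * Im d\<tau> - 2 * x * y * Re d\<tau>) / n ^ 4"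
    proof -
      have "j\<^sup>2 * cnj (j\<^sup>2) = of_real (n ^ 4)"
      proof -
        have "j\<^sup>2 * cnj (j\<^sup>2) = (j * cnj j)\<^sup>2" by (simp add: power_mult_distrib)
        also have "j * cnj j = of_real (n\<^sup>2)" by (simp only: n_def complex_norm_square)
        finally show ?thesis by (simp flip: power_mult of_real_power)
      qed
      hence "d\<tau> / j\<^sup>2 = d\<tau> * cnj (j\<^sup>2) / of_real (n ^ 4)" using j0 n0 by (simp add: field_simps)
      hence "Im (d\<tau> / j\<^sup>2) = Im (d\<tau> * cnj (j\<^sup>2)) / n ^ 4" by (simp only: Im_divide_of_real)
      thus ?thesis by (simp add: x_def y_def power2_eq_square algebra_simps)
    qed
    have "n * t * (Im \<tau> / n\<^sup>2 * (n * Im dz + \<gamma> * (x * Re d\<tau> + y * Im d\<tau>) / n * t) + n * t * (((x\<^sup>2 - y\<^sup>2) * Im d\<tau> - 2 * x * y * Re d\<tau>) / n ^ 4) / 2)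
       = t * (Im \<tau> * Im dz) + t\<^sup>2 / (2 * n\<^sup>2) * (2 * (\<gamma> * Im \<tau>) * (x * Re d\<tau> + y * Im d\<tau>) + ((x\<^sup>2 - y\<^sup>2) * Im d\<tau> - 2 * x * y * Re d\<tau>))"
    proof -
      define X Y where "X = x * Re d\<tau> + y * Im d\<tau>" and "Y = (x\<^sup>2 - y\<^sup>2) * Im d\<tau> - 2 * x * y * Re d\<tau>"
      show ?thesis unfolding X_def[symmetric] Y_def[symmetric] using n0 by (simp add: field_simps eval_nat_numeral)
    qed
    also have "2 * (\<gamma> * Im \<tau>) * (x * Re d\<tau> + y * Im d\<tau>) + ((x\<^sup>2 - y\<^sup>2) * Im d\<tau> - 2 * x * y * Re d\<tau>) = n\<^sup>2 * Im d\<tau>"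
      unfolding yg[symmetric] nn by (simp add: algebra_simps power2_eq_square)
    also have "t * (Im \<tau> * Im dz) + t\<^sup>2 / (2 * n\<^sup>2) * (n\<^sup>2 * Im d\<tau>) = t * (Im \<tau> * Im dz + t * Im d\<tau> / 2)"
      using n0 by (simp add: field_simps power2_eq_square)
    finally show ?thesis unfolding Im\<tau>' r i .
  qed
  have S: "S_duality_iib A q = (\<tau>', Complex b' (n * t), cu1', c1, \<delta> * c0 - \<gamma> * \<psi>, - \<beta> * c0 + \<alpha> * \<psi>)"
    unfolding q by (simp add: Let_def c \<tau>'_def jq n_def b'_def cu1'_def b_def t_def \<alpha>_def[symmetric] \<beta>_def[symmetric] \<gamma>_def[symmetric] \<delta>_def[symmetric])
  have dS: "d_S_duality_iib A q Q = (d\<tau> / j\<^sup>2, Complex db' (n * Im dz + Re (cnj j * (of_real \<gamma> * d\<tau>)) / n * t), dcu1', dc1, \<delta> * dc0 - \<gamma> * d\<psi>, - \<beta> * dc0 + \<alpha> * d\<psi>)"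
    unfolding q Q by (simp add: Let_def c jq n_def db'_def dcu1'_def t_def \<alpha>_def[symmetric] \<beta>_def[symmetric] \<gamma>_def[symmetric] \<delta>_def[symmetric])
  show ?thesis unfolding S dS unfolding q Q iibforms.simps Let_def complex.sel e' w_def[symmetric] k' p' u' s' prod.case
    unfolding b_def[symmetric] t_def[symmetric] e_def[symmetric] w_def[symmetric]
    by (simp only: times_divide_eq_right add_divide_distrib[symmetric] diff_divide_distrib[symmetric])
qed

section \<open>Behaviour of the coefficients and of the domain under S-duality\<close>

lemma slice_point_N_tilde:
  assumes "(\<tau>2, z, \<zeta>, \<zeta>t, \<sigma>) \<in> N_tilde chi" "c_l = real chi / (192 * pi)"
  shows "slice_point chi c_l \<tau>2 z \<zeta>"
  using assms by (auto simp: N_tilde_def slice_point_def)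

lemma N_tilde_metric:
  assumes "p \<in> N_tilde chi" "c_l = real chi / (192 * pi)"
  shows "qmap_metric_defined (prepotential chi) chi c_l p" "positive_definite (qmap_metric (prepotential chi) chi c_l p)"
proof -
  obtain \<tau>2 z \<zeta> \<zeta>t \<sigma> where p: "p = (\<tau>2, z, \<zeta>, \<zeta>t, \<sigma>)" by (cases p)
  interpret slice_point chi c_l \<tau>2 z \<zeta> \<zeta>t \<sigma> using assms unfolding p by (rule slice_point_N_tilde)
  show "qmap_metric_defined (prepotential chi) chi c_l p" "positive_definite (qmap_metric (prepotential chi) chi c_l p)"
    using defined metric_positive_definite unfolding p p_def by auto
qed

lemma qmap_metric_N_tilde:
  assumes "(\<tau>2, z, \<zeta>, \<zeta>t, \<sigma>) \<in> N_tilde chi" "c_l = real chi / (192 * pi)"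
  defines "\<tau> \<equiv> Complex (\<zeta> $ 0) \<tau>2"
  shows "qmap_metric (prepotential chi) chi c_l (\<tau>2, z, \<zeta>, \<zeta>t, \<sigma>) X Y =
     gform \<tau>2 (Im z) (R1 chi (Im z) \<tau>) (Bf chi (Im z) \<tau>) (Kf chi (Im z) \<tau>) (gf chi \<tau>)
       (forms (\<tau>2, z, \<zeta>, \<zeta>t, \<sigma>) X) (forms (\<tau>2, z, \<zeta>, \<zeta>t, \<sigma>) Y)"
proof -
  interpret slice_point chi c_l \<tau>2 z \<zeta> \<zeta>t \<sigma> using assms(1,2) by (rule slice_point_N_tilde)
  show ?thesis using qmap_metric_eq unfolding p_def t_def R_def B_def g_def \<tau>_def assms(3) .
qed

text \<open>E scales by |j|^3 exactly as t^3 does, so every expression homogeneous of degree one in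
  the two scales alike, including the quotient E^2 / \<open>R1\<close> inside
  \<open>R2\<close>.\<close>

lemma coefficients_moebius:
  fixes \<alpha> \<beta> \<gamma> \<delta> :: int
  assumes det: "\<alpha> * \<delta> - \<beta> * \<gamma> = 1" and \<tau>: "Im \<tau> > 0"
  defines "j \<equiv> of_int \<gamma> * \<tau> + of_int \<delta>"
  defines "\<tau>' \<equiv> (of_int \<alpha> * \<tau> + of_int \<beta>) / j"
  shows "R1 chi (cmod j * t) \<tau>' = cmod j ^ 3 * R1 chi t \<tau>"
    "R2 chi (cmod j * t) \<tau>' = cmod j ^ 3 * R2 chi t \<tau>"
    "Bf chi (cmod j * t) \<tau>' = cmod j ^ 3 * Bf chi t \<tau>"
    "Kf chi (cmod j * t) \<tau>' = cmod j ^ 3 * Kf chi t \<tau>"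
    "gf chi \<tau>' = of_real (cmod j) ^ 3 * (cnj j / j) * gf chi \<tau>"
    "Im \<tau>' = Im \<tau> / (cmod j)\<^sup>2"
proof -
  have j: "j \<noteq> 0" unfolding j_def by (rule moebius_denominator_nz[OF det \<tau>])
  note E = eisenstein_moebius[OF det \<tau>, folded j_def, folded \<tau>'_def]
  show 1: "R1 chi (cmod j * t) \<tau>' = cmod j ^ 3 * R1 chi t \<tau>"
    unfolding R1_def E by (simp add: power_mult_distrib algebra_simps)
  show "R2 chi (cmod j * t) \<tau>' = cmod j ^ 3 * R2 chi t \<tau>"
  proof -
    have "(n * e)\<^sup>2 * inverse (n * r) = n * (e\<^sup>2 * inverse r)" if "n \<noteq> 0" for n e r :: real
      using that by (simp add: power2_eq_square)
    from this[of "cmod j ^ 3"] j have e: "c * (cmod j ^ 3 * e)\<^sup>2 * inverse (cmod j ^ 3 * r) = cmod j ^ 3 * (c * e\<^sup>2 * inverse r)" for c e r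
      by (simp add: mult.assoc)
    show ?thesis unfolding R2_def 1 E e by (simp add: power_mult_distrib algebra_simps)
  qed
  show "Bf chi (cmod j * t) \<tau>' = cmod j ^ 3 * Bf chi t \<tau>" "Kf chi (cmod j * t) \<tau>' = cmod j ^ 3 * Kf chi t \<tau>"
    unfolding Bf_def Kf_def E by (simp_all add: power_mult_distrib algebra_simps)
  show "gf chi \<tau>' = of_real (cmod j) ^ 3 * (cnj j / j) * gf chi \<tau>" unfolding gf_def E by (simp add: mult_ac)
  have "\<tau>' = (of_int \<alpha> * \<tau> + of_int \<beta>) * cnj j / of_real ((cmod j)\<^sup>2)" unfolding \<tau>'_def complex_norm_square using j by simp
  hence "Im \<tau>' = Im ((of_int \<alpha> * \<tau> + of_int \<beta>) * cnj j) / (cmod j)\<^sup>2" by (simp only: Im_divide_of_real)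
  also have "Im ((of_int \<alpha> * \<tau> + of_int \<beta>) * cnj j) = of_int (\<alpha> * \<delta> - \<beta> * \<gamma>) * Im \<tau>" by (simp add: j_def algebra_simps)
  finally show "Im \<tau>' = Im \<tau> / (cmod j)\<^sup>2" unfolding det by simp
qed

lemma S_duality_components:
  fixes p :: iia and A :: "int^2^2"
  defines "\<tau> \<equiv> Complex (fst (snd (snd p)) $ 0) (fst p)"
  defines "j \<equiv> of_int (A $ 1 $ 0) * \<tau> + of_int (A $ 1 $ 1)"
  defines "\<tau>' \<equiv> (of_int (A $ 0 $ 0) * \<tau> + of_int (A $ 0 $ 1)) / j"
  shows "fst (S_duality A p) = Im \<tau>'" "Im (fst (snd (S_duality A p))) = cmod j * Im (fst (snd p))"
    "fst (snd (snd (S_duality A p))) $ 0 = Re \<tau>'"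
  unfolding S_duality_alt \<tau>'_def j_def \<tau>_def by (cases p, simp add: Let_def)+

lemma N_tilde_iff:
  "p \<in> N_tilde chi \<longleftrightarrow> fst p > 0 \<and> Im (fst (snd p)) > 0 \<and>
     R1 chi (Im (fst (snd p))) (Complex (fst (snd (snd p)) $ 0) (fst p)) > 0 \<and>
     R2 chi (Im (fst (snd p))) (Complex (fst (snd (snd p)) $ 0) (fst p)) > 0"
  by (cases p) (simp add: N_tilde_def)

lemma iia_space_iff: "p \<in> iia_space \<longleftrightarrow> fst p > 0 \<and> Im (fst (snd p)) > 0"
  by (cases p) (simp add: iia_space_def)

lemma S_duality_domains:
  assumes A: "det A = 1"
  shows "p \<in> iia_space \<Longrightarrow> S_duality A p \<in> iia_space" "p \<in> N_tilde chi \<Longrightarrow> S_duality A p \<in> N_tilde chi"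
proof -
  define \<tau> where "\<tau> = Complex (fst (snd (snd p)) $ 0) (fst p)"
  define j where "j = of_int (A $ 1 $ 0) * \<tau> + of_int (A $ 1 $ 1)"
  define \<tau>' where "\<tau>' = (of_int (A $ 0 $ 0) * \<tau> + of_int (A $ 0 $ 1)) / j"
  note S = S_duality_components[of A p, folded \<tau>_def, folded j_def, folded \<tau>'_def]
  have det: "A $ 0 $ 0 * A $ 1 $ 1 - A $ 0 $ 1 * A $ 1 $ 0 = 1" using A by (simp add: det_SL2)
  have C: "Complex (Re \<tau>') (Im \<tau>') = \<tau>'" by simp
  have pos: "Im \<tau>' > 0" "cmod j > 0" if "fst p > 0"
  proof -
    have "Im \<tau> > 0" using that by (simp add: \<tau>_def)
    moreover from this have "j \<noteq> 0" unfolding j_def by (rule moebius_denominator_nz[OF det])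
    ultimately show "Im \<tau>' > 0" "cmod j > 0"
      using coefficients_moebius(6)[OF det, of \<tau>, folded j_def, folded \<tau>'_def] by simp_all
  qed
  show "p \<in> iia_space \<Longrightarrow> S_duality A p \<in> iia_space" unfolding iia_space_iff S using pos by simp
  assume p: "p \<in> N_tilde chi"
  hence p0: "fst p > 0" by (simp add: N_tilde_iff)
  hence t: "Im \<tau> > 0" by (simp add: \<tau>_def)
  note c = coefficients_moebius[OF det t, folded j_def, folded \<tau>'_def]
  show "S_duality A p \<in> N_tilde chi"
    using p pos[OF p0] unfolding N_tilde_iff S C c(1,2) \<tau>_def[symmetric] by simp
qed

lemma iia_to_iib_projections:
  "iia_to_iib = (\<lambda>p. (of_real (fst (snd (snd p)) $ 0) + \<i> * of_real (fst p), fst (snd p),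
     fst (snd (snd p)) $ 0 * Re (fst (snd p)) - fst (snd (snd p)) $ 1,
     fst (snd (snd (snd p))) $ 1 + Re (fst (snd p)) * fst (snd (snd p)) $ 1 / 2,
     fst (snd (snd (snd p))) $ 0 - (Re (fst (snd p)))\<^sup>2 * fst (snd (snd p)) $ 1 / 6,
     (- snd (snd (snd (snd p))) - fst (snd (snd p)) $ 0 * (fst (snd (snd (snd p))) $ 0 - (Re (fst (snd p)))\<^sup>2 * fst (snd (snd p)) $ 1 / 6)
       - (fst (snd (snd (snd p))) $ 1 + Re (fst (snd p)) * fst (snd (snd p)) $ 1 / 2) * fst (snd (snd p)) $ 1
       + Re (fst (snd p)) * (fst (snd (snd p)) $ 0 * Re (fst (snd p)) - fst (snd (snd p)) $ 1) * fst (snd (snd p)) $ 1 / 6) / 2))"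
  by (auto simp: fun_eq_iff Let_def Complex_eq)

lemma iia_to_iib_differentiable: "iia_to_iib differentiable (at p)"
  unfolding differentiable_def iia_to_iib_projections
  by (rule exI, (rule derivative_intros bounded_linear.has_derivative[OF bounded_linear_Re] bounded_linear.has_derivative[OF bounded_linear_Im] | simp)+)

text \<open>The differential E of the inverse chart is never computed: differentiating
  \<open>iib_to_iia (iia_to_iib p) = p\<close> shows that \<open>d_iib_to_iia\<close> undoes it,
  which suffices to transport \<open>iibforms_S_duality\<close>.\<close>

lemma S_duality_derivative:
  fixes p :: iia and A :: "int^2^2"
  assumes A: "det A = 1" and p: "fst p > 0"
  defines "j \<equiv> of_int (A $ 1 $ 0) * Complex (fst (snd (snd p)) $ 0) (fst p) + of_int (A $ 1 $ 1)"
  shows "\<exists>D. (S_duality A has_derivative D) (at p) \<and>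
    (\<forall>X. forms (S_duality A p) (D X) = (case forms p X of (a, c, q, d) \<Rightarrow> (a / j, c / j, q, d / j\<^sup>2)))"
proof -
  from iia_to_iib_differentiable[of p] obtain E where E: "(iia_to_iib has_derivative E) (at p)" by (auto simp: differentiable_def)
  define q where "q = iia_to_iib p"
  have fq: "fst q = Complex (fst (snd (snd p)) $ 0) (fst p)" unfolding q_def by (cases p) (simp add: Let_def)
  have q0: "Im (fst q) > 0" using p by (simp add: fq)
  have "((\<lambda>p. iib_to_iia (iia_to_iib p)) has_derivative (\<lambda>X. d_iib_to_iia q (E X))) (at p)"
    unfolding q_def by (rule has_derivative_compose[OF E iib_to_iia_has_derivative])
  hence "((\<lambda>p. p) has_derivative (\<lambda>X. d_iib_to_iia q (E X))) (at p)" by (simp only: iib_to_iia_to_iib)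
  from has_derivative_unique[OF this has_derivative_ident] have id: "d_iib_to_iia q (E X) = X" for X by (rule fun_cong)
  define D where "D X = d_iib_to_iia (S_duality_iib A q) (d_S_duality_iib A q (E X))" for X
  have "((\<lambda>p. iib_to_iia (S_duality_iib A (iia_to_iib p))) has_derivative D) (at p)"
    unfolding D_def[abs_def] q_def
    by (rule has_derivative_compose[OF has_derivative_compose[OF E S_duality_iib_has_derivative[OF A q0[unfolded q_def]]] iib_to_iia_has_derivative])
  moreover have "S_duality A = (\<lambda>p. iib_to_iia (S_duality_iib A (iia_to_iib p)))" by (rule ext) (rule S_duality_alt)
  ultimately have "(S_duality A has_derivative D) (at p)" by simp
  moreover have "forms (S_duality A p) (D X) = (case forms p X of (a, c, q, d) \<Rightarrow> (a / j, c / j, q, d / j\<^sup>2))" for X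
  proof -
    have "forms p X = iibforms q (E X)" using forms_iib[of q "E X"] unfolding id unfolding q_def iib_to_iia_to_iib .
    moreover have "forms (S_duality A p) (D X) = iibforms (S_duality_iib A q) (d_S_duality_iib A q (E X))"
      unfolding S_duality_alt D_def q_def[symmetric] by (rule forms_iib)
    ultimately show ?thesis using iibforms_S_duality[OF A q0, of "E X"] unfolding j_def fq by simp
  qed
  ultimately show ?thesis by blast
qed

text \<open>A pointwise notion with the derivative existential and the image required to stay in the
  domain, so that it composes by the chain rule.\<close>

definition isom_at :: "nat \<Rightarrow> real \<Rightarrow> (iia \<Rightarrow> iia) \<Rightarrow> iia \<Rightarrow> bool" where
  "isom_at chi c_l F p \<longleftrightarrow> F p \<in> N_tilde chi \<and> (\<exists>D. (F has_derivative D) (at p) \<and>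
     (\<forall>X Y. qmap_metric (prepotential chi) chi c_l (F p) (D X) (D Y) = qmap_metric (prepotential chi) chi c_l p X Y))"

lemma isom_at_compose:
  assumes "isom_at chi c_l F p" "isom_at chi c_l G (F p)"
  shows "isom_at chi c_l (\<lambda>x. G (F x)) p"
proof -
  from assms obtain D E where D: "(F has_derivative D) (at p)" "(G has_derivative E) (at (F p))"
    "\<And>X Y. qmap_metric (prepotential chi) chi c_l (F p) (D X) (D Y) = qmap_metric (prepotential chi) chi c_l p X Y"
    "\<And>X Y. qmap_metric (prepotential chi) chi c_l (G (F p)) (E X) (E Y) = qmap_metric (prepotential chi) chi c_l (F p) X Y"
    unfolding isom_at_def by blast
  show ?thesis unfolding isom_at_def
    using assms(2) has_derivative_compose[OF D(1,2)] D(3,4) unfolding isom_at_def by (intro conjI exI[of _ "\<lambda>X. E (D X)"]) auto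
qed

lemma isom_at_frechet:
  assumes "isom_at chi c_l F p"
  shows "qmap_metric (prepotential chi) chi c_l (F p) (frechet_derivative F (at p) X) (frechet_derivative F (at p) Y) =
    qmap_metric (prepotential chi) chi c_l p X Y"
  using assms frechet_derivativeI unfolding isom_at_def by metis

lemma S_duality_isom:
  assumes A: "det A = 1" and p: "p \<in> N_tilde chi" and c: "c_l = real chi / (192 * pi)"
  shows "isom_at chi c_l (S_duality A) p"
proof -
  obtain \<tau>2 z \<zeta> \<zeta>t \<sigma> where p4: "p = (\<tau>2, z, \<zeta>, \<zeta>t, \<sigma>)" by (cases p)
  obtain \<tau>2' z' \<zeta>' \<zeta>t' \<sigma>' where S4: "S_duality A p = (\<tau>2', z', \<zeta>', \<zeta>t', \<sigma>')" by (cases "S_duality A p")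
  define \<tau> where "\<tau> = Complex (\<zeta> $ 0) \<tau>2"
  define j where "j = of_int (A $ 1 $ 0) * \<tau> + of_int (A $ 1 $ 1)"
  define \<tau>' where "\<tau>' = (of_int (A $ 0 $ 0) * \<tau> + of_int (A $ 0 $ 1)) / j"
  have \<tau>2: "\<tau>2 > 0" using p by (simp add: N_tilde_iff p4)
  have t: "Im \<tau> > 0" using \<tau>2 by (simp add: \<tau>_def)
  have det: "A $ 0 $ 0 * A $ 1 $ 1 - A $ 0 $ 1 * A $ 1 $ 0 = 1" using A by (simp add: det_SL2)
  have j0: "j \<noteq> 0" unfolding j_def by (rule moebius_denominator_nz[OF det t])
  note cm = coefficients_moebius[OF det t, folded j_def, folded \<tau>'_def]
  note SC = S_duality_components[of A p, unfolded S4, unfolded p4 fst_conv snd_conv, folded \<tau>_def, folded j_def, folded \<tau>'_def]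
  have SN: "S_duality A p \<in> N_tilde chi" by (rule S_duality_domains(2)[OF A p])
  have \<tau>2': "\<tau>2' = \<tau>2 / (cmod j)\<^sup>2" unfolding SC(1) cm(6) by (simp add: \<tau>_def)
  have C': "Complex (\<zeta>' $ 0) \<tau>2' = \<tau>'" unfolding SC(1,3) by simp
  from S_duality_derivative[OF A, of p, unfolded p4 fst_conv snd_conv, OF \<tau>2, folded \<tau>_def, folded j_def, folded p4]
  obtain D where D: "(S_duality A has_derivative D) (at p)"
    "\<And>X. forms (S_duality A p) (D X) = (case forms p X of (a, c, q, d) \<Rightarrow> (a / j, c / j, q, d / j\<^sup>2))" by blast
  have "qmap_metric (prepotential chi) chi c_l (S_duality A p) (D X) (D Y) = qmap_metric (prepotential chi) chi c_l p X Y" for X Y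
  proof -
    obtain a1 c1 q1 d1 where 1: "forms p X = (a1, c1, q1, d1)" by (cases "forms p X")
    obtain a2 c2 q2 d2 where 2: "forms p Y = (a2, c2, q2, d2)" by (cases "forms p Y")
    have "qmap_metric (prepotential chi) chi c_l (S_duality A p) (D X) (D Y) =
       gform (\<tau>2 / (cmod j)\<^sup>2) (cmod j * Im z) (cmod j ^ 3 * R1 chi (Im z) \<tau>) (cmod j ^ 3 * Bf chi (Im z) \<tau>) (cmod j ^ 3 * Kf chi (Im z) \<tau>)
         (of_real (cmod j) ^ 3 * (cnj j / j) * gf chi \<tau>) (forms (S_duality A p) (D X)) (forms (S_duality A p) (D Y))"
      using qmap_metric_N_tilde[OF SN[unfolded S4] c, of "D X" "D Y"] unfolding S4 C' unfolding SC(2) cm(1,3,4,5) unfolding \<tau>2' .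
    also have "\<dots> = gform \<tau>2 (Im z) (R1 chi (Im z) \<tau>) (Bf chi (Im z) \<tau>) (Kf chi (Im z) \<tau>) (gf chi \<tau>) (forms p X) (forms p Y)"
      unfolding D(2) 1 2 prod.case by (rule gform_scaling[OF j0])
    also have "\<dots> = qmap_metric (prepotential chi) chi c_l p X Y"
      unfolding p4 \<tau>_def by (rule qmap_metric_N_tilde[OF p[unfolded p4] c, symmetric])
    finally show ?thesis .
  qed
  thus ?thesis unfolding isom_at_def using SN D(1) by blast
qed

text \<open>The coefficients of \<open>gform\<close> depend only on \<tau> and t. A map that fixes
  these and pulls the coframe back to itself preserves the metric without any further property of E
  and G.\<close>

lemma isom_atI:
  assumes p: "p \<in> N_tilde chi" and c: "c_l = real chi / (192 * pi)"
    and F: "fst (F p) = fst p" "Im (fst (snd (F p))) = Im (fst (snd p))" "fst (snd (snd (F p))) $ 0 = fst (snd (snd p)) $ 0"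
    and D: "(F has_derivative D) (at p)" "\<And>X. forms (F p) (D X) = forms p X"
  shows "isom_at chi c_l F p"
proof -
  obtain \<tau>2 z \<zeta> \<zeta>t \<sigma> where p4: "p = (\<tau>2, z, \<zeta>, \<zeta>t, \<sigma>)" by (cases p)
  obtain \<tau>2' z' \<zeta>' \<zeta>t' \<sigma>' where S4: "F p = (\<tau>2', z', \<zeta>', \<zeta>t', \<sigma>')" by (cases "F p")
  have e: "\<tau>2' = \<tau>2" "Im z' = Im z" "\<zeta>' $ 0 = \<zeta> $ 0" using F unfolding S4 by (simp_all add: p4)
  have FN: "F p \<in> N_tilde chi" using p unfolding N_tilde_iff F .
  have "qmap_metric (prepotential chi) chi c_l (F p) (D X) (D Y) = qmap_metric (prepotential chi) chi c_l p X Y" for X Y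
  proof -
    have "qmap_metric (prepotential chi) chi c_l (F p) (D X) (D Y) =
      gform \<tau>2 (Im z) (R1 chi (Im z) (Complex (\<zeta> $ 0) \<tau>2)) (Bf chi (Im z) (Complex (\<zeta> $ 0) \<tau>2)) (Kf chi (Im z) (Complex (\<zeta> $ 0) \<tau>2)) (gf chi (Complex (\<zeta> $ 0) \<tau>2)) (forms (F p) (D X)) (forms (F p) (D Y))"
      using qmap_metric_N_tilde[OF FN[unfolded S4] c, of "D X" "D Y"] unfolding S4 e .
    also have "\<dots> = qmap_metric (prepotential chi) chi c_l p X Y"
      unfolding D(2) unfolding p4 by (rule qmap_metric_N_tilde[OF p[unfolded p4] c, symmetric])
    finally show ?thesis .
  qed
  thus ?thesis unfolding isom_at_def using FN D(1) by blast
qed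

section \<open>Isometries from the shifts of b and from the Heisenberg group\<close>

fun d_R_act :: "real \<Rightarrow> iia \<Rightarrow> iia" where
  "d_R_act v (d\<tau>2, dz, d\<zeta>, d\<zeta>t, d\<sigma>) = (d\<tau>2, dz, pair (d\<zeta> $ 0) (d\<zeta> $ 1 + d\<zeta> $ 0 * v),
      pair (d\<zeta>t $ 0 + 1 / 6 * v ^ 3 * d\<zeta> $ 0 + 1 / 2 * v\<^sup>2 * d\<zeta> $ 1 - d\<zeta>t $ 1 * v) (d\<zeta>t $ 1 - 1 / 2 * d\<zeta> $ 0 * v\<^sup>2 - v * d\<zeta> $ 1), d\<sigma>)"

lemma R_act_projections:
  "R_act v = (\<lambda>p. (fst p, fst (snd p) + of_real v, pair (fst (snd (snd p)) $ 0) (fst (snd (snd p)) $ 1 + fst (snd (snd p)) $ 0 * v),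
     pair (fst (snd (snd (snd p))) $ 0 + 1 / 6 * v ^ 3 * fst (snd (snd p)) $ 0 + 1 / 2 * v\<^sup>2 * fst (snd (snd p)) $ 1 - fst (snd (snd (snd p))) $ 1 * v)
          (fst (snd (snd (snd p))) $ 1 - 1 / 2 * fst (snd (snd p)) $ 0 * v\<^sup>2 - v * fst (snd (snd p)) $ 1), snd (snd (snd (snd p)))))"
  by (auto simp: fun_eq_iff)

lemma R_act_has_derivative: "(R_act v has_derivative d_R_act v) (at p)"
  unfolding R_act_projections
  by (rule has_derivative_eq_rhs, (rule derivative_intros | simp)+) (auto simp: fun_eq_iff)

lemma R_act_isom:
  assumes "p \<in> N_tilde chi" "c_l = real chi / (192 * pi)"
  shows "isom_at chi c_l (R_act v) p"
proof (rule isom_atI[OF assms])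
  show "(R_act v has_derivative d_R_act v) (at p)" by (rule R_act_has_derivative)
  show "fst (R_act v p) = fst p" "Im (fst (snd (R_act v p))) = Im (fst (snd p))" "fst (snd (snd (R_act v p))) $ 0 = fst (snd (snd p)) $ 0"
    by (cases p, simp)+
  fix X :: iia
  obtain \<tau>2 z \<zeta> \<zeta>t \<sigma> where p: "p = (\<tau>2, z, \<zeta>, \<zeta>t, \<sigma>)" by (cases p)
  obtain d\<tau>2 dz d\<zeta> d\<zeta>t d\<sigma> where X: "X = (d\<tau>2, dz, d\<zeta>, d\<zeta>t, d\<sigma>)" by (cases X)
  have u: "form_u (R_act v p) (d_R_act v X) = form_u p X" unfolding p X by (simp add: complex_eq_iff algebra_simps)
  have s: "form_s (R_act v p) (d_R_act v X) = form_s p X" unfolding p X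
    by (simp add: complex_eq_iff) (simp add: field_simps power2_eq_square power3_eq_cube)
  have q: "form_p (R_act v p) (d_R_act v X) = form_p p X" unfolding p X
    by (simp add: complex_eq_iff) (simp add: field_simps power2_eq_square)
  have d: "form_d (d_R_act v X) = form_d X" unfolding X by simp
  obtain r where r: "R_act v p = (\<tau>2, z + of_real v, r)" unfolding p by simp
  have "form_a (R_act v p) (d_R_act v X) = form_a p X" "form_c (R_act v p) (d_R_act v X) = form_c p X"
    using u s unfolding r unfolding p by simp_all
  thus "forms (R_act v p) (d_R_act v X) = forms p X" using q d by simp
qed

fun d_Heis5_act :: "(real^2) \<times> (real^2) \<times> real \<Rightarrow> iia \<Rightarrow> iia" where
  "d_Heis5_act (\<eta>, \<eta>t, \<kappa>) (d\<tau>2, dz, d\<zeta>, d\<zeta>t, d\<sigma>) =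
     (d\<tau>2, dz, d\<zeta>, d\<zeta>t, d\<sigma> + (d\<zeta>t $ 0 * \<eta> $ 0 - d\<zeta> $ 0 * \<eta>t $ 0 + (d\<zeta>t $ 1 * \<eta> $ 1 - d\<zeta> $ 1 * \<eta>t $ 1)))"

lemma Heis5_act_projections:
  "Heis5_act h = (\<lambda>p. (fst p, fst (snd p), fst (snd (snd p)) + fst h, fst (snd (snd (snd p))) + fst (snd h),
     snd (snd (snd (snd p))) + snd (snd h) + (fst (snd (snd (snd p))) $ 0 * fst h $ 0 - fst (snd (snd p)) $ 0 * fst (snd h) $ 0
       + (fst (snd (snd (snd p))) $ 1 * fst h $ 1 - fst (snd (snd p)) $ 1 * fst (snd h) $ 1))))"
  by (cases h) (auto simp: fun_eq_iff sum_UNIV_2)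

lemma Heis5_act_has_derivative: "(Heis5_act h has_derivative d_Heis5_act h) (at p)"
  unfolding Heis5_act_projections
  by (rule has_derivative_eq_rhs, (rule derivative_intros | simp)+) (cases h, auto simp: fun_eq_iff)

lemma Heis5_act_isom:
  assumes "p \<in> N_tilde chi" "c_l = real chi / (192 * pi)" and h: "fst h $ 0 = 0"
  shows "isom_at chi c_l (Heis5_act h) p"
proof (rule isom_atI[OF assms(1,2)])
  show "(Heis5_act h has_derivative d_Heis5_act h) (at p)" by (rule Heis5_act_has_derivative)
  show "fst (Heis5_act h p) = fst p" "Im (fst (snd (Heis5_act h p))) = Im (fst (snd p))" "fst (snd (snd (Heis5_act h p))) $ 0 = fst (snd (snd p)) $ 0"
    using h by (cases p, cases h, simp)+
  fix X :: iia
  obtain \<tau>2 z \<zeta> \<zeta>t \<sigma> where p: "p = (\<tau>2, z, \<zeta>, \<zeta>t, \<sigma>)" by (cases p)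
  obtain \<eta> \<eta>t \<kappa> where h4: "h = (\<eta>, \<eta>t, \<kappa>)" by (cases h)
  obtain d\<tau>2 dz d\<zeta> d\<zeta>t d\<sigma> where X: "X = (d\<tau>2, dz, d\<zeta>, d\<zeta>t, d\<sigma>)" by (cases X)
  have u: "form_u (Heis5_act h p) (d_Heis5_act h X) = form_u p X" unfolding p X h4 by simp
  have s: "form_s (Heis5_act h p) (d_Heis5_act h X) = form_s p X" unfolding p X h4
    by (simp add: complex_eq_iff algebra_simps)
  have q: "form_p (Heis5_act h p) (d_Heis5_act h X) = form_p p X" unfolding p X h4 by simp
  have d: "form_d (d_Heis5_act h X) = form_d X" unfolding X h4 by simp
  obtain r where r: "Heis5_act h p = (\<tau>2, z, r)" unfolding p h4 by simp
  have "form_a (Heis5_act h p) (d_Heis5_act h X) = form_a p X" "form_c (Heis5_act h p) (d_Heis5_act h X) = form_c p X"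
    using u s unfolding r unfolding p by simp_all
  thus "forms (Heis5_act h p) (d_Heis5_act h X) = forms p X" using q d by simp
qed

section \<open>Smoothness\<close>

lemma Ck_on_const: "Ck_on k S (\<lambda>x. c)"
  by (induction k arbitrary: c) auto

lemma Ck_on_bounded_linear:
  assumes "bounded_linear f"
  shows "Ck_on k S f"
proof (cases k)
  case 0
  thus ?thesis using assms by (simp add: linear_continuous_on)
next
  case (Suc k)
  have "frechet_derivative f (at x) = f" for x
    by (rule frechet_derivativeI[OF bounded_linear_imp_has_derivative[OF assms]])
  thus ?thesis using Suc assms by (simp add: Ck_on_const bounded_linear_imp_differentiable_on)
qed

text \<open>\<open>Ck_on (Suc k)\<close> speaks of derivatives only, so dropping one order is itself
  an induction, starting from continuity of differentiable maps.\<close>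

lemma Ck_on_SucD: "Ck_on (Suc k) S f \<Longrightarrow> Ck_on k S f"
proof (induction k arbitrary: f)
  case 0
  thus ?case by (simp add: differentiable_imp_continuous_on)
next
  case (Suc k)
  have "f differentiable_on S" "Ck_on (Suc k) S (\<lambda>x. frechet_derivative f (at x) v)" for v
    using Suc.prems by (simp_all only: Ck_on.simps(2)[of "Suc k"])
  thus ?case by (subst Ck_on.simps(2)) (intro conjI allI Suc.IH)
qed

context
  fixes S :: "'a :: real_normed_vector set"
  assumes S: "open S"
begin

lemma Ck_on_SucE:
  assumes "Ck_on (Suc k) S f" "x \<in> S"
  shows "(f has_derivative frechet_derivative f (at x)) (at x)"
  using assms differentiable_on_eq_differentiable_at[OF S] frechet_derivative_works[of f "at x"] by (auto simp only: Ck_on.simps)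

text \<open>\<open>frechet_derivative\<close> is taken in the full space; agreement on S passes to
  derivatives because S is open.\<close>

lemma Ck_on_cong:
  assumes "\<And>x. x \<in> S \<Longrightarrow> f x = g x" "Ck_on k S f"
  shows "Ck_on k S g"
  using assms
proof (induction k arbitrary: f g)
  case 0
  thus ?case using continuous_on_cong[of S S f g] by simp
next
  case (Suc k)
  have d: "(f has_derivative frechet_derivative f (at x)) (at x)" if "x \<in> S" for x
    by (rule Ck_on_SucE[OF Suc.prems(2) that])
  have d': "(g has_derivative frechet_derivative f (at x)) (at x)" if "x \<in> S" for x
    by (rule has_derivative_transform_within_open[OF d[OF that] S that]) (use Suc.prems(1) in auto)
  have "g differentiable_on S"
    unfolding differentiable_on_eq_differentiable_at[OF S] using d' by (auto simp: differentiable_def)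
  moreover have "Ck_on k S (\<lambda>x. frechet_derivative g (at x) v)" for v
    by (rule Suc.IH[of "\<lambda>x. frechet_derivative f (at x) v"])
       (use frechet_derivativeI[OF d'] Suc.prems(2) in simp_all)
  ultimately show ?case by simp
qed

lemma Ck_on_SucI:
  assumes "\<And>x. x \<in> S \<Longrightarrow> (f has_derivative f' x) (at x)" "\<And>v. Ck_on k S (\<lambda>x. f' x v)"
  shows "Ck_on (Suc k) S f"
proof -
  have "f differentiable_on S"
    unfolding differentiable_on_eq_differentiable_at[OF S] using assms(1) by (auto simp: differentiable_def)
  moreover have "Ck_on k S (\<lambda>x. frechet_derivative f (at x) v)" for v
    by (rule Ck_on_cong[OF _ assms(2)[of v]]) (use frechet_derivativeI[OF assms(1)] in simp)
  ultimately show ?thesis by simp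
qed

lemma Ck_on_linear_image:
  assumes h: "bounded_linear h" and f: "Ck_on k S f"
  shows "Ck_on k S (\<lambda>x. h (f x))"
  using f
proof (induction k arbitrary: f)
  case 0
  thus ?case using bounded_linear.continuous_on[OF h] by auto
next
  case (Suc k)
  show ?case
    by (rule Ck_on_SucI[OF bounded_linear.has_derivative[OF h Ck_on_SucE[OF Suc.prems]]], assumption, rule Suc.IH)
       (use Suc.prems in simp)
qed

lemma Ck_on_add:
  assumes "Ck_on k S f" "Ck_on k S g"
  shows "Ck_on k S (\<lambda>x. f x + g x)"
  using assms
proof (induction k arbitrary: f g)
  case 0
  thus ?case using continuous_on_add[of S f g] by simp
next
  case (Suc k)
  show ?case
    by (rule Ck_on_SucI[OF has_derivative_add[OF Ck_on_SucE[OF Suc.prems(1)] Ck_on_SucE[OF Suc.prems(2)]]], assumption, assumption, rule Suc.IH)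
       (use Suc.prems in simp_all)
qed

text \<open>In each term of the product rule one factor is differentiated and the other is needed
  only with one order less, which \<open>Ck_on_SucD\<close> provides.\<close>

lemma Ck_on_bilinear:
  assumes h: "bounded_bilinear h" and "Ck_on k S f" "Ck_on k S g"
  shows "Ck_on k S (\<lambda>x. h (f x) (g x))"
  using assms(2,3)
proof (induction k arbitrary: f g)
  case 0
  thus ?case using bounded_bilinear.continuous_on[OF h] by auto
next
  case (Suc k)
  show ?case
  proof (rule Ck_on_SucI[OF bounded_bilinear.FDERIV[OF h Ck_on_SucE[OF Suc.prems(1)] Ck_on_SucE[OF Suc.prems(2)]]])
    fix v
    show "Ck_on k S (\<lambda>x. h (f x) (frechet_derivative g (at x) v) + h (frechet_derivative f (at x) v) (g x))"
      by (intro Ck_on_add Suc.IH Ck_on_SucD[OF Suc.prems(1)] Ck_on_SucD[OF Suc.prems(2)]; use Suc.prems in simp)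
  qed
qed

lemma Ck_on_Pair:
  assumes "Ck_on k S f" "Ck_on k S g"
  shows "Ck_on k S (\<lambda>x. (f x, g x))"
  using assms
proof (induction k arbitrary: f g)
  case 0
  thus ?case using continuous_on_Pair[of S f g] by simp
next
  case (Suc k)
  show ?case
    by (rule Ck_on_SucI[OF has_derivative_Pair[OF Ck_on_SucE[OF Suc.prems(1)] Ck_on_SucE[OF Suc.prems(2)]]], assumption, assumption, rule Suc.IH)
       (use Suc.prems in simp_all)
qed

lemma Ck_on_mult:
  fixes f g :: "'a \<Rightarrow> 'b :: real_normed_algebra"
  assumes "Ck_on k S f" "Ck_on k S g"
  shows "Ck_on k S (\<lambda>x. f x * g x)"
  by (rule Ck_on_bilinear[OF bounded_bilinear_mult assms])

lemma Ck_on_minus: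
  assumes "Ck_on k S f"
  shows "Ck_on k S (\<lambda>x. - f x)"
  by (rule Ck_on_linear_image[OF bounded_linear_minus[OF bounded_linear_ident] assms])

text \<open>The derivative of 1 / f involves f again only through 1 / f, to which the induction
  hypothesis applies at lower order. The square root below follows the same pattern.\<close>

lemma Ck_on_inverse:
  fixes f :: "'a \<Rightarrow> 'b :: real_normed_field"
  assumes "Ck_on k S f" "\<And>x. x \<in> S \<Longrightarrow> f x \<noteq> 0"
  shows "Ck_on k S (\<lambda>x. inverse (f x))"
  using assms
proof (induction k arbitrary: f)
  case 0
  thus ?case using continuous_on_inverse[of S f] by simp
next
  case (Suc k)
  have I: "Ck_on k S (\<lambda>x. inverse (f x))" by (rule Suc.IH[OF Ck_on_SucD[OF Suc.prems(1)] Suc.prems(2)])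
  show ?case
  proof (rule Ck_on_SucI)
    show "((\<lambda>x. inverse (f x)) has_derivative (\<lambda>v. - (inverse (f x) * frechet_derivative f (at x) v * inverse (f x)))) (at x)" if "x \<in> S" for x
      by (rule Deriv.has_derivative_inverse[OF Suc.prems(2)[OF that] Ck_on_SucE[OF Suc.prems(1) that]])
    fix v
    have D: "Ck_on k S (\<lambda>x. frechet_derivative f (at x) v)" using Suc.prems(1) by simp
    show "Ck_on k S (\<lambda>x. - (inverse (f x) * frechet_derivative f (at x) v * inverse (f x)))"
      by (rule Ck_on_minus[OF Ck_on_mult[OF Ck_on_mult[OF I D] I]])
  qed
qed

lemma Ck_on_sqrt:
  assumes "Ck_on k S f" "\<And>x. x \<in> S \<Longrightarrow> f x > 0"
  shows "Ck_on k S (\<lambda>x. sqrt (f x))"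
  using assms
proof (induction k arbitrary: f)
  case 0
  thus ?case using continuous_on_real_sqrt[of S f] by simp
next
  case (Suc k)
  have I: "Ck_on k S (\<lambda>x. sqrt (f x))" by (rule Suc.IH[OF Ck_on_SucD[OF Suc.prems(1)] Suc.prems(2)])
  show ?case
  proof (rule Ck_on_SucI)
    show "((\<lambda>x. sqrt (f x)) has_derivative (\<lambda>v. frechet_derivative f (at x) v * (inverse (sqrt (f x)) / 2))) (at x)" if "x \<in> S" for x
      using has_derivative_real_sqrt[OF Suc.prems(2)[OF that] Ck_on_SucE[OF Suc.prems(1) that]] by simp
    fix v
    have D: "Ck_on k S (\<lambda>x. frechet_derivative f (at x) v)" using Suc.prems(1) by simp
    have J: "Ck_on k S (\<lambda>x. inverse (sqrt (f x)) / 2)" unfolding divide_inverse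
      by (rule Ck_on_mult[OF Ck_on_inverse[OF I] Ck_on_const]) (use Suc.prems(2) in fastforce)
    show "Ck_on k S (\<lambda>x. frechet_derivative f (at x) v * (inverse (sqrt (f x)) / 2))"
      by (rule Ck_on_mult[OF D J])
  qed
qed

lemma Ck_on_diff:
  assumes "Ck_on k S f" "Ck_on k S g"
  shows "Ck_on k S (\<lambda>x. f x - g x)"
  using Ck_on_add[OF assms(1) Ck_on_minus[OF assms(2)]] by simp

lemma Ck_on_power:
  fixes f :: "'a \<Rightarrow> 'b :: real_normed_field"
  assumes "Ck_on k S f"
  shows "Ck_on k S (\<lambda>x. f x ^ n)"
proof (induction n)
  case (Suc n)
  show ?case unfolding power_Suc by (rule Ck_on_mult[OF assms Suc.IH])
qed (simp add: Ck_on_const)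

lemma Ck_on_divide:
  fixes f g :: "'a \<Rightarrow> 'b :: real_normed_field"
  assumes "Ck_on k S f" "Ck_on k S g" "\<And>x. x \<in> S \<Longrightarrow> g x \<noteq> 0"
  shows "Ck_on k S (\<lambda>x. f x / g x)"
  unfolding divide_inverse by (intro Ck_on_mult Ck_on_inverse assms)

lemma Ck_on_pair:
  fixes f g :: "'a \<Rightarrow> 'b :: euclidean_space"
  assumes "Ck_on k S f" "Ck_on k S g"
  shows "Ck_on k S (\<lambda>x. pair (f x) (g x))"
  using Ck_on_linear_image[OF linear_conv_bounded_linear[THEN iffD1, OF linear_pair] Ck_on_Pair[OF assms]] by simp

lemmas Ck_on_proj =
  Ck_on_linear_image[OF bounded_linear_fst] Ck_on_linear_image[OF bounded_linear_snd]
  Ck_on_linear_image[OF bounded_linear_vec_nth] Ck_on_linear_image[OF bounded_linear_Re]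
  Ck_on_linear_image[OF bounded_linear_Im] Ck_on_linear_image[OF bounded_linear_of_real]

lemma Ck_on_cmod:
  assumes "Ck_on k S f" "\<And>x. x \<in> S \<Longrightarrow> f x \<noteq> 0"
  shows "Ck_on k S (\<lambda>x. cmod (f x))"
  unfolding cmod_def
  by (intro Ck_on_sqrt Ck_on_add Ck_on_power Ck_on_proj assms(1))
     (use assms(2) in \<open>simp add: complex_neq_0[symmetric]\<close>)

lemmas Ck_intros = Ck_on_const Ck_on_add Ck_on_diff Ck_on_minus Ck_on_mult Ck_on_power Ck_on_divide Ck_on_pair Ck_on_Pair Ck_on_proj Ck_on_cmod

lemma Ck_on_R_act: "Ck_on k S f \<Longrightarrow> Ck_on k S (\<lambda>x. R_act v (f x))"
  unfolding R_act_projections by (intro Ck_intros) auto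

lemma Ck_on_Heis5_act: "Ck_on k S f \<Longrightarrow> Ck_on k S (\<lambda>x. Heis5_act h (f x))"
  unfolding Heis5_act_projections by (intro Ck_intros)

lemma Ck_on_S_duality:
  assumes f: "Ck_on k S f" and A: "det A = 1" and pos: "\<And>x. x \<in> S \<Longrightarrow> fst (f x) > 0"
  shows "Ck_on k S (\<lambda>x. S_duality A (f x))"
proof -
  have 1: "Ck_on k S (\<lambda>x. iia_to_iib (f x))" unfolding iia_to_iib_projections by (intro Ck_intros f) auto
  have s: "S_duality_iib A q = ((of_int (A $ 0 $ 0) * fst q + of_int (A $ 0 $ 1)) / (of_int (A $ 1 $ 0) * fst q + of_int (A $ 1 $ 1)),
      of_real (of_int (A $ 1 $ 0) * fst (snd (snd q)) + of_int (A $ 1 $ 1) * Re (fst (snd q))) + \<i> * of_real (cmod (of_int (A $ 1 $ 0) * fst q + of_int (A $ 1 $ 1)) * Im (fst (snd q))),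
      of_int (A $ 0 $ 0) * fst (snd (snd q)) + of_int (A $ 0 $ 1) * Re (fst (snd q)),
      fst (snd (snd (snd q))), of_int (A $ 1 $ 1) * fst (snd (snd (snd (snd q)))) - of_int (A $ 1 $ 0) * snd (snd (snd (snd (snd q)))),
      - of_int (A $ 0 $ 1) * fst (snd (snd (snd (snd q)))) + of_int (A $ 0 $ 0) * snd (snd (snd (snd (snd q)))))" for q
    by (cases q) (simp add: Let_def Complex_eq)
  have nz: "of_int (A $ 1 $ 0) * fst (iia_to_iib (f x)) + of_int (A $ 1 $ 1) \<noteq> 0" if "x \<in> S" for x
  proof (rule moebius_denominator_nz[of "A $ 0 $ 0" _ "A $ 0 $ 1"])
    show "Im (fst (iia_to_iib (f x))) > 0" using pos[OF that] unfolding iia_to_iib_projections by simp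
  qed (use A in \<open>simp add: det_SL2\<close>)
  have 2: "Ck_on k S (\<lambda>x. S_duality_iib A (iia_to_iib (f x)))" unfolding s by (intro Ck_intros 1 nz)
  show ?thesis unfolding S_duality_alt iib_to_iia_projections by (intro Ck_intros 2) auto
qed

end

text \<open>\<open>R2\<close> contains the inverse of \<open>R1\<close> and is continuous only where
  \<open>R1\<close> does not vanish, so the domain is cut out in two stages, U and then V.\<close>

lemma open_N_tilde: "open (N_tilde chi)"
proof -
  define U where "U = {p :: iia. fst p > 0 \<and> Im (fst (snd p)) > 0}"
  define \<tau> where "\<tau> p = Complex (fst (snd (snd p)) $ 0) (fst p)" for p :: iia
  have U: "open U" unfolding U_def by (intro open_Collect_conj open_Collect_less continuous_intros)
  have e: "continuous_on {\<tau>. Im \<tau> > 0} eisenstein"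
    by (intro continuous_at_imp_continuous_on ballI has_derivative_continuous[OF eisenstein_has_derivative]) auto
  have \<tau>: "continuous_on U \<tau>" unfolding \<tau>_def Complex_eq by (intro continuous_intros)
  have E: "continuous_on U (\<lambda>p. eisenstein (\<tau> p))"
    by (rule continuous_on_compose2[OF e \<tau>]) (auto simp: U_def \<tau>_def)
  have t: "continuous_on U (\<lambda>p :: iia. Im (fst (snd p)))" by (intro continuous_intros)
  have R1: "continuous_on U (\<lambda>p. R1 chi (Im (fst (snd p))) (\<tau> p))" unfolding R1_def by (intro continuous_intros E t) auto
  define V where "V = {p \<in> U. R1 chi (Im (fst (snd p))) (\<tau> p) > 0}"
  have V: "open V"
    using continuous_openin_preimage_gen[OF R1 open_greaterThan[of 0]] openin_open_trans[OF _ U]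
    unfolding V_def by (simp add: vimage_def Int_def)
  have VU: "V \<subseteq> U" by (auto simp: V_def)
  have R2: "continuous_on V (\<lambda>p. R2 chi (Im (fst (snd p))) (\<tau> p))" unfolding R2_def
    by (intro continuous_intros continuous_on_subset[OF E VU] continuous_on_subset[OF t VU] continuous_on_subset[OF R1 VU]) (auto simp: V_def)
  have "open {p \<in> V. R2 chi (Im (fst (snd p))) (\<tau> p) > 0}"
    using continuous_openin_preimage_gen[OF R2 open_greaterThan[of 0]] openin_open_trans[OF _ V]
    by (simp add: vimage_def Int_def)
  also have "{p \<in> V. R2 chi (Im (fst (snd p))) (\<tau> p) > 0} = N_tilde chi"
    by (auto simp: V_def U_def N_tilde_iff \<tau>_def)
  finally show ?thesis .
qed

section \<open>Group actions\<close>

text \<open>Actions are kept as total functions constrained on E, so that composition is plain;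
  \<open>acts_on_faithful_action\<close> converts to the extensional bijections of
  \<open>faithful_action\<close>.\<close>

definition acts_on :: "('g, 'm) monoid_scheme \<Rightarrow> 'x set \<Rightarrow> ('g \<Rightarrow> 'x \<Rightarrow> 'x) \<Rightarrow> bool" where
  "acts_on G E act \<longleftrightarrow> group G \<and> (\<forall>g\<in>carrier G. \<forall>x\<in>E. act g x \<in> E) \<and> (\<forall>x\<in>E. act \<one>\<^bsub>G\<^esub> x = x) \<and>
     (\<forall>g\<in>carrier G. \<forall>h\<in>carrier G. \<forall>x\<in>E. act (g \<otimes>\<^bsub>G\<^esub> h) x = act g (act h x))"

definition acts_faithfully :: "('g, 'm) monoid_scheme \<Rightarrow> 'x set \<Rightarrow> ('g \<Rightarrow> 'x \<Rightarrow> 'x) \<Rightarrow> bool" where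
  "acts_faithfully G E act \<longleftrightarrow> (\<forall>g\<in>carrier G. \<forall>h\<in>carrier G. (\<forall>x\<in>E. act g x = act h x) \<longrightarrow> g = h)"

lemma acts_onD:
  assumes "acts_on G E act"
  shows "group G" "\<And>g x. g \<in> carrier G \<Longrightarrow> x \<in> E \<Longrightarrow> act g x \<in> E" "\<And>x. x \<in> E \<Longrightarrow> act \<one>\<^bsub>G\<^esub> x = x"
    "\<And>g h x. g \<in> carrier G \<Longrightarrow> h \<in> carrier G \<Longrightarrow> x \<in> E \<Longrightarrow> act (g \<otimes>\<^bsub>G\<^esub> h) x = act g (act h x)"
  using assms by (auto simp: acts_on_def)

lemma acts_on_inverse:
  assumes "acts_on G E act" "g \<in> carrier G" "x \<in> E"
  shows "act g (act (inv\<^bsub>G\<^esub> g) x) = x" "act (inv\<^bsub>G\<^esub> g) (act g x) = x"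
proof -
  interpret group G by (rule acts_onD(1)[OF assms(1)])
  show "act g (act (inv\<^bsub>G\<^esub> g) x) = x" "act (inv\<^bsub>G\<^esub> g) (act g x) = x"
    using acts_onD(3,4)[OF assms(1)] assms(2,3) by (metis inv_closed r_inv, metis inv_closed l_inv)
qed

lemma acts_on_subset:
  assumes "acts_on G E act" "F \<subseteq> E" "\<And>g x. g \<in> carrier G \<Longrightarrow> x \<in> F \<Longrightarrow> act g x \<in> F"
  shows "acts_on G F act"
  using assms unfolding acts_on_def by blast

lemma acts_faithfullyI:
  assumes a: "acts_on G E act" and k: "\<And>g. g \<in> carrier G \<Longrightarrow> \<forall>x\<in>E. act g x = x \<Longrightarrow> g = \<one>\<^bsub>G\<^esub>"
  shows "acts_faithfully G E act"
  unfolding acts_faithfully_def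
proof (intro ballI impI)
  interpret group G by (rule acts_onD(1)[OF a])
  fix g h assume g: "g \<in> carrier G" "h \<in> carrier G" "\<forall>x\<in>E. act g x = act h x"
  have "inv\<^bsub>G\<^esub> h \<otimes>\<^bsub>G\<^esub> g = \<one>\<^bsub>G\<^esub>"
    using g by (intro k ballI) (simp_all add: acts_onD(4)[OF a] acts_on_inverse[OF a])
  thus "g = h" using g by (metis inv_equality inv_closed inv_inv)
qed

lemma acts_on_bij_betw:
  assumes a: "acts_on G E act" and g: "g \<in> carrier G"
  shows "bij_betw (act g) E E"
proof -
  interpret group G by (rule acts_onD(1)[OF a])
  show ?thesis
    by (rule bij_betw_byWitness[of _ "act (inv\<^bsub>G\<^esub> g)"]) (use g acts_on_inverse[OF a] acts_onD(2)[OF a] in auto)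
qed

lemma acts_on_inv_into:
  assumes a: "acts_on G E act" and g: "g \<in> carrier G" and x: "x \<in> E"
  shows "inv_into E (act g) x = act (inv\<^bsub>G\<^esub> g) x"
proof -
  interpret group G by (rule acts_onD(1)[OF a])
  show ?thesis
    using acts_on_bij_betw[OF a g] acts_on_inverse(1)[OF a g x] acts_onD(2)[OF a inv_closed[OF g] x]
    by (metis bij_betw_imp_inj_on inv_into_f_f)
qed

lemma acts_on_faithful_action:
  assumes a: "acts_on G E act" and f: "acts_faithfully G E act"
  shows "faithful_action G E (\<lambda>g. restrict (act g) E)"
proof -
  interpret group G by (rule acts_onD(1)[OF a])
  have B: "restrict (act g) E \<in> Bij E" if "g \<in> carrier G" for g
    using acts_on_bij_betw[OF a that] by (simp add: Bij_def)
  have "group_hom G (BijGroup E) (\<lambda>g. restrict (act g) E)"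
  proof (intro group_hom.intro group_hom_axioms.intro homI group_BijGroup is_group)
    fix g h assume g: "g \<in> carrier G" "h \<in> carrier G"
    show "restrict (act (g \<otimes>\<^bsub>G\<^esub> h)) E = restrict (act g) E \<otimes>\<^bsub>BijGroup E\<^esub> restrict (act h) E"
      using g acts_onD(2,4)[OF a] B by (auto simp: BijGroup_def compose_def fun_eq_iff)
  qed (use B in \<open>simp add: BijGroup_def\<close>)
  moreover have "inj_on (\<lambda>g. restrict (act g) E) (carrier G)"
    using f unfolding acts_faithfully_def inj_on_def by (metis restrict_apply')
  ultimately show ?thesis
    by (intro faithful_action.intro group_action.intro faithful_action_axioms.intro)
qed

text \<open>The action of g is onto E, so the defining equation fixes the transformation induced by
  h' on all of E; faithfulness then fixes h' itself and makes the \<open>THE\<close> in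
  \<open>conjugation\<close> meaningful.\<close>

lemma conjugationI:
  assumes a: "acts_on G E actG" and f: "acts_faithfully H E actH"
    and g: "g \<in> carrier G" and h: "h' \<in> carrier H" "\<And>x. x \<in> E \<Longrightarrow> actH h' (actG g x) = actG g (actH h x)"
  shows "conjugation E actG H actH g h = h'"
  unfolding conjugation_def
proof (rule the_equality)
  fix k assume k: "k \<in> carrier H \<and> (\<forall>x\<in>E. actH k (actG g x) = actG g (actH h x))"
  have "actH k y = actH h' y" if "y \<in> E" for y
  proof -
    interpret group G by (rule acts_onD(1)[OF a])
    have "actG (inv\<^bsub>G\<^esub> g) y \<in> E" using acts_onD(2)[OF a] g that by simp
    thus ?thesis using k h(2) acts_on_inverse(1)[OF a g that] by metis
  qed
  thus "k = h'" using f k h(1) unfolding acts_faithfully_def by blast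
qed (use h in auto)

text \<open>As a transformation, \<open>\<phi> g h\<close> is the conjugate of h by g. Each identity
  needed for the group axioms is therefore checked by letting both sides act on E, where it is
  associativity of composition.\<close>

lemma semidirect_conjugation:
  assumes aG: "acts_on G E actG" and aH: "acts_on H E actH" and f: "acts_faithfully H E actH"
    and n: "\<And>g h. g \<in> carrier G \<Longrightarrow> h \<in> carrier H \<Longrightarrow> \<exists>h'\<in>carrier H. \<forall>x\<in>E. actH h' (actG g x) = actG g (actH h x)"
  shows "acts_on (semidirect G H (conjugation E actG H actH)) E (semidirect_act actG actH)"
proof -
  interpret G: group G by (rule acts_onD(1)[OF aG])
  interpret H: group H by (rule acts_onD(1)[OF aH])
  define \<phi> where "\<phi> = conjugation E actG H actH"
  have \<phi>: "\<phi> g h \<in> carrier H \<and> (\<forall>x\<in>E. actH (\<phi> g h) (actG g x) = actG g (actH h x))"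
    if gh: "g \<in> carrier G" "h \<in> carrier H" for g h
  proof -
    obtain h' where "h' \<in> carrier H" "\<And>x. x \<in> E \<Longrightarrow> actH h' (actG g x) = actG g (actH h x)" using n[OF gh] by blast
    thus ?thesis using conjugationI[OF aG f gh(1)] unfolding \<phi>_def by metis
  qed
  have c: "\<phi> g h \<in> carrier H" if "g \<in> carrier G" "h \<in> carrier H" for g h using \<phi>[OF that] by blast
  note inG = acts_onD(2)[OF aG] and inH = acts_onD(2)[OF aH]
  have act: "actH (\<phi> g h) x = actG g (actH h (actG (inv\<^bsub>G\<^esub> g) x))" if "g \<in> carrier G" "h \<in> carrier H" "x \<in> E" for g h x
    using \<phi>[OF that(1,2)] inG[of "inv\<^bsub>G\<^esub> g" x] acts_on_inverse(1)[OF aG that(1,3)] that by (metis G.inv_closed)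
  note S = acts_onD(3,4)[OF aG] acts_onD(3,4)[OF aH] acts_on_inverse[OF aG] acts_on_inverse[OF aH] act c inG inH
  \<comment> \<open>The principle by which identities of maps become identities in H;
    \<open>1\<close>, \<open>2\<close> and \<open>3\<close> are derived from it by rewriting with
    \<open>S\<close> alone.\<close>
  have eq: "h = k" if "h \<in> carrier H" "k \<in> carrier H" "\<And>x. x \<in> E \<Longrightarrow> actH h x = actH k x" for h k
    using f that unfolding acts_faithfully_def by blast
  have 1: "\<phi> \<one>\<^bsub>G\<^esub> h = h" if "h \<in> carrier H" for h
    by (rule eq) (use that in \<open>simp_all add: S\<close>)
  have 2: "\<phi> g (h \<otimes>\<^bsub>H\<^esub> \<phi> g' h') = \<phi> g h \<otimes>\<^bsub>H\<^esub> \<phi> (g \<otimes>\<^bsub>G\<^esub> g') h'"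
    if "g \<in> carrier G" "g' \<in> carrier G" "h \<in> carrier H" "h' \<in> carrier H" for g g' h h'
    by (rule eq) (use that in \<open>simp_all add: S G.inv_mult_group\<close>)
  have 3: "\<phi> (inv\<^bsub>G\<^esub> g) (inv\<^bsub>H\<^esub> h) \<otimes>\<^bsub>H\<^esub> \<phi> (inv\<^bsub>G\<^esub> g) h = \<one>\<^bsub>H\<^esub>" if "g \<in> carrier G" "h \<in> carrier H" for g h
    by (rule eq) (use that in \<open>simp_all add: S\<close>)
  have gr: "group (semidirect G H \<phi>)"
  proof (rule groupI)
    fix x assume x: "x \<in> carrier (semidirect G H \<phi>)"
    obtain g h where gh: "x = (g, h)" by (cases x)
    show "\<exists>y\<in>carrier (semidirect G H \<phi>). y \<otimes>\<^bsub>semidirect G H \<phi>\<^esub> x = \<one>\<^bsub>semidirect G H \<phi>\<^esub>"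
      by (rule bexI[of _ "(inv\<^bsub>G\<^esub> g, \<phi> (inv\<^bsub>G\<^esub> g) (inv\<^bsub>H\<^esub> h))"]) (use x in \<open>auto simp: gh semidirect_def 3 c\<close>)
  qed (auto simp: semidirect_def 1 2 c H.m_assoc G.m_assoc)
  show ?thesis unfolding acts_on_def \<phi>_def[symmetric]
    using gr by (auto simp: semidirect_def semidirect_act_def S G.inv_mult_group)
qed

section \<open>The concrete groups and their actions on the ambient space\<close>

lemma matrix_mult_2: "(A ** B) $ i $ j = A $ i $ 0 * B $ 0 $ j + A $ i $ 1 * B $ 1 $ j"
  for A B :: "int^2^2"
  by (simp add: matrix_matrix_mult_def sum_UNIV_2)

lemma group_SL2Z: "group SL2Z"
proof (rule groupI)
  fix A assume A: "A \<in> carrier SL2Z"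
  define B :: "int^2^2" where "B = pair (pair (A $ 1 $ 1) (- A $ 0 $ 1)) (pair (- A $ 1 $ 0) (A $ 0 $ 0))"
  show "\<exists>y\<in>carrier SL2Z. y \<otimes>\<^bsub>SL2Z\<^esub> A = \<one>\<^bsub>SL2Z\<^esub>"
    by (rule bexI[of _ B]) (use A in \<open>simp_all add: SL2Z_def B_def det_SL2 vec_eq_iff all_2 matrix_mult_2 mat_def algebra_simps\<close>)
qed (auto simp: SL2Z_def det_mul matrix_mul_assoc)

text \<open>The identity \<open>e\<close> contains the cocycle relation of j, for i = 1, and its
  counterpart for the numerator, for i = 0; the common factor j cancels in the Moebius quotient and
  multiplies the moduli in t. The doublets compose by the matrix product.\<close>

lemma S_duality_iib_mult:
  assumes B: "det B = 1" and q: "Im (fst q) > 0"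
  shows "S_duality_iib (A ** B) q = S_duality_iib A (S_duality_iib B q)"
proof -
  obtain \<tau> z cu1 c1 c0 \<psi> where q4: "q = (\<tau>, z, cu1, c1, c0, \<psi>)" by (cases q)
  define j where "j = of_int (B $ 1 $ 0) * \<tau> + of_int (B $ 1 $ 1)"
  have j: "j \<noteq> 0" unfolding j_def
    by (rule moebius_denominator_nz[of "B $ 0 $ 0" _ "B $ 0 $ 1"]) (use B q in \<open>simp_all add: det_SL2 q4\<close>)
  have e: "of_int ((A ** B) $ i $ 0) * \<tau> + of_int ((A ** B) $ i $ 1) =
     j * (of_int (A $ i $ 0) * ((of_int (B $ 0 $ 0) * \<tau> + of_int (B $ 0 $ 1)) / j) + of_int (A $ i $ 1))" for i
  proof -
    have f: "j * (a * (u / j) + b) = a * u + b * j" for a u b using j by (simp add: field_simps)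
    show ?thesis unfolding f by (simp add: j_def matrix_mult_2 algebra_simps)
  qed
  show ?thesis unfolding q4 S_duality_iib.simps Let_def e j_def[symmetric]
    using j by (simp add: norm_mult matrix_mult_2) (simp add: algebra_simps)
qed

lemma S_duality_one: "S_duality (mat 1) p = p"
proof -
  have "S_duality_iib (mat 1) q = q" for q by (cases q) (simp add: mat_def Let_def)
  thus ?thesis by (simp add: S_duality_alt iib_to_iia_to_iib)
qed

lemma acts_on_SL2Z: "acts_on SL2Z iia_space S_duality"
  unfolding acts_on_def
proof (intro conjI ballI group_SL2Z)
  fix x :: iia
  show "S_duality \<one>\<^bsub>SL2Z\<^esub> x = x" by (simp add: SL2Z_def S_duality_one)
next
  fix A B :: "int^2^2" and x :: iia assume A: "A \<in> carrier SL2Z" "B \<in> carrier SL2Z" "x \<in> iia_space"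
  have "Im (fst (iia_to_iib x)) = fst x" by (cases x) (simp add: Let_def)
  with A show "S_duality (A \<otimes>\<^bsub>SL2Z\<^esub> B) x = S_duality A (S_duality B x)"
    by (simp add: SL2Z_def S_duality_alt iia_to_iib_to_iia S_duality_iib_mult iia_space_iff)
qed (auto simp: SL2Z_def S_duality_domains)

lemma acts_on_R_add: "acts_on R_add iia_space R_act"
  unfolding acts_on_def
proof (intro conjI ballI)
  show "group R_add"
    by (rule groupI) (auto simp: R_add_def intro: exI[of _ "- _"])
  fix x :: iia assume x: "x \<in> iia_space"
  obtain \<tau>2 z \<zeta> \<zeta>t \<sigma> where x4: "x = (\<tau>2, z, \<zeta>, \<zeta>t, \<sigma>)" by (cases x)
  show "R_act \<one>\<^bsub>R_add\<^esub> x = x" by (simp add: x4 R_add_def pair_eta)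
  fix v show "R_act v x \<in> iia_space" using x by (simp add: x4 iia_space_def)
  fix w show "R_act (v \<otimes>\<^bsub>R_add\<^esub> w) x = R_act v (R_act w x)"
    by (simp add: x4 R_add_def vec_eq_iff all_2) (simp add: field_simps power2_eq_square power3_eq_cube)
qed

lemma acts_on_H4: "acts_on H4 iia_space Heis5_act"
  unfolding acts_on_def
proof (intro conjI ballI)
  show "group H4"
  proof (rule groupI)
    fix h assume h: "h \<in> carrier H4"
    obtain \<eta> \<eta>t \<kappa> where h4: "h = (\<eta>, \<eta>t, \<kappa>)" by (cases h)
    show "\<exists>y\<in>carrier H4. y \<otimes>\<^bsub>H4\<^esub> h = \<one>\<^bsub>H4\<^esub>"
      by (rule bexI[of _ "(- \<eta>, - \<eta>t, - \<kappa>)"]) (use h in \<open>simp_all add: h4 H4_def Heis5_def sum_UNIV_2\<close>)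
  qed (auto simp: H4_def Heis5_def sum_UNIV_2 algebra_simps)
  fix x :: iia assume x: "x \<in> iia_space"
  obtain \<tau>2 z \<zeta> \<zeta>t \<sigma> where x4: "x = (\<tau>2, z, \<zeta>, \<zeta>t, \<sigma>)" by (cases x)
  show "Heis5_act \<one>\<^bsub>H4\<^esub> x = x" by (simp add: x4 H4_def Heis5_def)
  fix h :: "(real^2) \<times> (real^2) \<times> real"
  obtain \<eta> \<eta>t \<kappa> where h4: "h = (\<eta>, \<eta>t, \<kappa>)" by (cases h)
  show "Heis5_act h x \<in> iia_space" using x by (simp add: x4 h4 iia_space_def)
  fix h' :: "(real^2) \<times> (real^2) \<times> real"
  obtain \<eta>' \<eta>t' \<kappa>' where h5: "h' = (\<eta>', \<eta>t', \<kappa>')" by (cases h')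
  show "Heis5_act (h \<otimes>\<^bsub>H4\<^esub> h') x = Heis5_act h (Heis5_act h' x)"
    by (simp add: x4 h4 h5 H4_def Heis5_def sum_UNIV_2) (simp add: algebra_simps)
qed

lemma one_semidirect: "\<one>\<^bsub>semidirect G H \<phi>\<^esub> = (\<one>\<^bsub>G\<^esub>, \<one>\<^bsub>H\<^esub>)"
  and carrier_semidirect: "carrier (semidirect G H \<phi>) = carrier G \<times> carrier H"
  by (simp_all add: semidirect_def)

lemma i_point: "(1, \<i>, 0, 0, 0) \<in> iia_space"
  by (simp add: iia_space_def)

text \<open>The action is free: the shift components are read off at any single point, and then the
  central one from \<open>\<sigma>\<close>. A single test point therefore suffices for
  faithfulness.\<close>

lemma Heis5_act_fixed_point: "Heis5_act h x = x \<Longrightarrow> h = \<one>\<^bsub>H4\<^esub>"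
  by (cases h; cases x) (auto simp: H4_def Heis5_def)

lemma H4_faithful: "acts_faithfully H4 iia_space Heis5_act"
  using acts_on_H4 by (rule acts_faithfullyI) (blast intro: Heis5_act_fixed_point i_point)

lemma acts_on_R_H4: "acts_on R_H4 iia_space R_H4_act"
  unfolding R_H4_def R_H4_act_def
proof (rule semidirect_conjugation[OF acts_on_R_add acts_on_H4 H4_faithful])
  fix v :: real and h assume h: "h \<in> carrier H4"
  obtain \<eta> \<eta>t \<kappa> where h4: "h = (\<eta>, \<eta>t, \<kappa>)" by (cases h)
  \<comment> \<open>\<open>R_act v\<close> is linear in (\<open>\<zeta>\<close>,
    \<open>\<zeta>~\<close>) and preserves the symplectic pairing in the \<open>\<sigma>\<close>
    component. Conjugating a translation thus gives the translation by the image vector, with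
    \<open>\<kappa>\<close> unchanged.\<close>
  define h' where "h' = (pair (\<eta> $ 0) (\<eta> $ 1 + \<eta> $ 0 * v),
     pair (\<eta>t $ 0 + 1 / 6 * v ^ 3 * \<eta> $ 0 + 1 / 2 * v\<^sup>2 * \<eta> $ 1 - \<eta>t $ 1 * v) (\<eta>t $ 1 - 1 / 2 * \<eta> $ 0 * v\<^sup>2 - v * \<eta> $ 1), \<kappa>)"
  have "Heis5_act h' (R_act v x) = R_act v (Heis5_act h x)" for x
    by (cases x) (simp add: h4 h'_def sum_UNIV_2 vec_eq_iff all_2, simp add: field_simps power2_eq_square power3_eq_cube)
  moreover have "h' \<in> carrier H4" using h by (simp add: h'_def h4 H4_def)
  ultimately show "\<exists>h'\<in>carrier H4. \<forall>x\<in>iia_space. Heis5_act h' (R_act v x) = R_act v (Heis5_act h x)" by blast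
qed

lemma R_act_0: "R_act 0 x = x"
  by (cases x) (simp add: pair_eta)

lemma R_H4_act_fixed_point:
  assumes "R_H4_act g x = x"
  shows "g = \<one>\<^bsub>R_H4\<^esub>"
proof -
  obtain v \<eta> \<eta>t \<kappa> where g: "g = (v, \<eta>, \<eta>t, \<kappa>)" by (cases g)
  have v: "v = 0" using assms by (cases x) (simp add: g R_H4_act_def semidirect_act_def)
  hence "(\<eta>, \<eta>t, \<kappa>) = \<one>\<^bsub>H4\<^esub>" using assms Heis5_act_fixed_point[of "(\<eta>, \<eta>t, \<kappa>)" x]
    by (simp add: g R_H4_act_def semidirect_act_def R_act_0)
  thus ?thesis by (simp add: g R_H4_def one_semidirect v R_add_def)
qed

lemma R_H4_faithful: "acts_faithfully R_H4 iia_space R_H4_act"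
  using acts_on_R_H4 by (rule acts_faithfullyI) (blast intro: R_H4_act_fixed_point i_point)

text \<open>
  In type IIB coordinates the elements of \<open>R_H4\<close> take a form in which S-duality covariance is visible:
  \<open>(c\<^sup>1, b)\<close>, \<open>(x, v)\<close>, \<open>(\<psi>, - c\<^sub>0)\<close> and \<open>(k1, - k0)\<close> are doublets, while \<open>c\<^sub>1\<close>, \<open>e\<close> and
  \<open>v c\<^sup>1 - b x\<close> are invariant.
\<close>

fun iib_shift :: "real \<times> real \<times> real \<times> real \<times> real \<Rightarrow> iib \<Rightarrow> iib" where
  "iib_shift (x, v, e, k0, k1) (\<tau>, z, cu1, c1, c0, \<psi>) = (let b = Re z; w = v * cu1 - b * x in
     (\<tau>, z + of_real v, cu1 + x, c1 + e + w / 2, c0 + k0 - v * c1 - (b / 6 + v / 3) * w, \<psi> + k1 + x * c1 + (cu1 / 6 + x / 3) * w))"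

text \<open>The entries solve for the element that induces the given shift in type IIB coordinates;
  the terms with products of v and x compensate the polynomial change of coordinates.\<close>

fun R_H4_of_shift :: "real \<times> real \<times> real \<times> real \<times> real \<Rightarrow> real \<times> ((real^2) \<times> (real^2) \<times> real)" where
  "R_H4_of_shift (x, v, e, k0, k1) =
     (v, pair 0 (- x), pair (k0 - v\<^sup>2 * x / 6) (e + v * x / 2), - 2 * (k1 - (e + v * x / 2) * x / 2 + v * x\<^sup>2 / 3))"

lemma R_H4_of_shift_carrier: "R_H4_of_shift s \<in> carrier R_H4"
  by (cases s) (simp add: R_H4_def carrier_semidirect R_add_def H4_def)

lemma R_H4_of_shift_surj:
  assumes "g \<in> carrier R_H4"
  shows "\<exists>s. g = R_H4_of_shift s"
proof -
  obtain v \<eta> \<eta>t \<kappa> where g: "g = (v, \<eta>, \<eta>t, \<kappa>)" by (cases g)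
  have "\<eta> $ 0 = 0" using assms by (simp add: g R_H4_def carrier_semidirect H4_def)
  hence "g = R_H4_of_shift (- \<eta> $ 1, v, \<eta>t $ 1 + v * \<eta> $ 1 / 2, \<eta>t $ 0 - v\<^sup>2 * \<eta> $ 1 / 6, - \<kappa> / 2 - \<eta>t $ 1 * \<eta> $ 1 / 2 - v * (\<eta> $ 1)\<^sup>2 / 3)"
    by (simp add: g vec_eq_iff all_2)
  thus ?thesis by blast
qed

lemma R_H4_act_iib: "R_H4_act (R_H4_of_shift s) (iib_to_iia q) = iib_to_iia (iib_shift s q)"
proof -
  obtain x v e k0 k1 where s: "s = (x, v, e, k0, k1)" by (cases s)
  obtain \<tau> z cu1 c1 c0 \<psi> where q: "q = (\<tau>, z, cu1, c1, c0, \<psi>)" by (cases q)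
  show ?thesis unfolding s q
    by (simp add: R_H4_act_def semidirect_act_def Let_def vec_eq_iff all_2 sum_UNIV_2)
       (simp add: field_simps power2_eq_square power3_eq_cube)
qed

fun S_duality_shift :: "int^2^2 \<Rightarrow> real \<times> real \<times> real \<times> real \<times> real \<Rightarrow> real \<times> real \<times> real \<times> real \<times> real" where
  "S_duality_shift A (x, v, e, k0, k1) =
     (of_int (A $ 0 $ 0) * x + of_int (A $ 0 $ 1) * v, of_int (A $ 1 $ 0) * x + of_int (A $ 1 $ 1) * v, e,
      of_int (A $ 1 $ 1) * k0 - of_int (A $ 1 $ 0) * k1, - of_int (A $ 0 $ 1) * k0 + of_int (A $ 0 $ 0) * k1)"

lemma S_duality_iib_shift:
  assumes A: "det A = 1"
  shows "S_duality_iib A (iib_shift s q) = iib_shift (S_duality_shift A s) (S_duality_iib A q)"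
proof -
  obtain x v e k0 k1 where s: "s = (x, v, e, k0, k1)" by (cases s)
  obtain \<tau> z cu1 c1 c0 \<psi> where q: "q = (\<tau>, z, cu1, c1, c0, \<psi>)" by (cases q)
  define \<alpha> \<beta> \<gamma> \<delta> where "\<alpha> = real_of_int (A $ 0 $ 0)" and "\<beta> = real_of_int (A $ 0 $ 1)" and "\<gamma> = real_of_int (A $ 1 $ 0)" and "\<delta> = real_of_int (A $ 1 $ 1)"
  have det: "\<alpha> * \<delta> - \<beta> * \<gamma> = 1"
    using A unfolding det_SL2 \<alpha>_def \<beta>_def \<gamma>_def \<delta>_def by (metis of_int_1 of_int_diff of_int_mult)
  define w where "w = v * cu1 - Re z * x"
  \<comment> \<open>w is the determinant of the doublets (\<open>c^1\<close>, b) and (x, v), hence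
    multiplied by det A = 1.\<close>
  have "(\<gamma> * x + \<delta> * v) * (\<alpha> * cu1 + \<beta> * Re z) - (\<gamma> * cu1 + \<delta> * Re z) * (\<alpha> * x + \<beta> * v) = (\<alpha> * \<delta> - \<beta> * \<gamma>) * w"
    by (simp add: w_def algebra_simps)
  hence w: "(\<gamma> * x + \<delta> * v) * (\<alpha> * cu1 + \<beta> * Re z) - (\<gamma> * cu1 + \<delta> * Re z) * (\<alpha> * x + \<beta> * v) = w"
    by (simp add: det)
  show ?thesis unfolding s q
    by (simp add: Let_def \<alpha>_def[symmetric] \<beta>_def[symmetric] \<gamma>_def[symmetric] \<delta>_def[symmetric] w w_def[symmetric])
       (simp add: complex_eq_iff algebra_simps add_divide_distrib)
qed

lemma acts_on_SL2Z_R_H4: "acts_on SL2Z_R_H4 iia_space SL2Z_R_H4_act"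
  unfolding SL2Z_R_H4_def SL2Z_R_H4_act_def
proof (rule semidirect_conjugation[OF acts_on_SL2Z acts_on_R_H4 R_H4_faithful])
  fix A g assume A: "A \<in> carrier SL2Z" and "g \<in> carrier R_H4"
  then obtain s where g: "g = R_H4_of_shift s" using R_H4_of_shift_surj by blast
  have "R_H4_act (R_H4_of_shift (S_duality_shift A s)) (S_duality A p) = S_duality A (R_H4_act g p)" for p
  proof -
    obtain q where p: "p = iib_to_iia q" using iib_to_iia_to_iib by metis
    show ?thesis using A unfolding p g
      by (simp add: S_duality_alt R_H4_act_iib iia_to_iib_to_iia S_duality_iib_shift SL2Z_def)
  qed
  thus "\<exists>h'\<in>carrier R_H4. \<forall>x\<in>iia_space. R_H4_act h' (S_duality A x) = S_duality A (R_H4_act g x)"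
    using R_H4_of_shift_carrier by blast
qed

text \<open>Provides points of the domain above every \<tau> and every b, which the proof of
  faithfulness uses as test points.\<close>

lemma R1_R2_pos: "\<exists>t>0. R1 chi t \<tau> > 0 \<and> R2 chi t \<tau> > 0"
proof -
  define a b c where "a = real chi / (4 * (2 * pi) ^ 3) * eisenstein \<tau>" and "b = 3 * real chi / (4 * (2 * pi) ^ 3) * eisenstein \<tau>"
    and "c = (3 * real chi)\<^sup>2 / (4 * pi) ^ 6 * (eisenstein \<tau>)\<^sup>2"
  define M where "M = 1 + \<bar>a\<bar> + \<bar>b\<bar> + c"
  have c: "c \<ge> 0" by (simp add: c_def)
  hence M: "M > 0" by (simp add: M_def)
  \<comment> \<open>Makes t^3 / 3 = M, hence \<open>R1\<close> >= 1; then the inverse in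
    \<open>R2\<close> is at most 1 and M outweighs b and c as well.\<close>
  define t where "t = root 3 (3 * M)"
  have t: "t > 0" "t ^ 3 / 3 = M" using M by (simp_all add: t_def)
  have R1: "R1 chi t \<tau> \<ge> 1" unfolding R1_def t(2) a_def[symmetric] M_def using c by linarith
  hence "c * inverse (R1 chi t \<tau>) \<le> c * 1" using c by (intro mult_left_mono) (auto simp: inverse_le_1_iff)
  hence "R2 chi t \<tau> \<ge> 1" unfolding R2_def t(2) b_def[symmetric] c_def[symmetric] M_def by linarith
  thus ?thesis using t(1) R1 by (intro exI[of _ t]) simp
qed

section \<open>The full action on the domain: invariance, faithfulness, smoothness\<close>

lemma R_act_N_tilde: "R_act v p \<in> N_tilde chi \<longleftrightarrow> p \<in> N_tilde chi"
  by (cases p) (simp add: N_tilde_def)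

lemma Heis5_act_N_tilde: "fst h $ 0 = 0 \<Longrightarrow> Heis5_act h p \<in> N_tilde chi \<longleftrightarrow> p \<in> N_tilde chi"
  by (cases p; cases h) (simp add: N_tilde_def)

lemma SL2Z_R_H4_cases:
  assumes "g \<in> carrier SL2Z_R_H4"
  obtains A v h where "g = (A, v, h)" "det A = 1" "fst h $ 0 = 0"
    "SL2Z_R_H4_act g = (\<lambda>p. Heis5_act h (R_act v (S_duality A p)))"
proof -
  obtain A v h where g: "g = (A, v, h)" by (cases g) auto
  have "det A = 1" "fst h $ 0 = 0"
    using assms by (auto simp: g SL2Z_R_H4_def R_H4_def carrier_semidirect SL2Z_def H4_def)
  thus ?thesis using that[OF g] by (auto simp: g SL2Z_R_H4_act_def R_H4_act_def semidirect_act_def fun_eq_iff)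
qed

lemma acts_on_N_tilde: "acts_on SL2Z_R_H4 (N_tilde chi) SL2Z_R_H4_act"
proof (rule acts_on_subset[OF acts_on_SL2Z_R_H4])
  show "N_tilde chi \<subseteq> iia_space" by (auto simp: N_tilde_def iia_space_def)
  fix g p assume g: "g \<in> carrier SL2Z_R_H4" and p: "p \<in> N_tilde chi"
  from g show "SL2Z_R_H4_act g p \<in> N_tilde chi"
    by (rule SL2Z_R_H4_cases) (use p in \<open>simp add: Heis5_act_N_tilde R_act_N_tilde S_duality_domains\<close>)
qed

text \<open>\<real> and \<open>H4\<close> fix \<tau>, so an element acting trivially has A acting
  trivially on \<tau>, which leaves A = 1 or A = - 1. The sign is detected by b, which A = - 1
  reverses and which no shift by v can restore for all b. What is left lies in \<open>H4\<close>,
  whose action is free.\<close>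

lemma SL2Z_R_H4_faithful: "acts_faithfully SL2Z_R_H4 (N_tilde chi) SL2Z_R_H4_act"
proof (rule acts_faithfullyI[OF acts_on_N_tilde])
  fix g assume g: "g \<in> carrier SL2Z_R_H4" and id: "\<forall>p\<in>N_tilde chi. SL2Z_R_H4_act g p = p"
  from g obtain A v h where g4: "g = (A, v, h)" and A: "det A = 1" and h: "fst h $ 0 = 0"
    and act: "SL2Z_R_H4_act g = (\<lambda>p. Heis5_act h (R_act v (S_duality A p)))" by (rule SL2Z_R_H4_cases)
  have fp: "\<exists>t. Heis5_act h (R_act v (S_duality A (y, Complex b t, 0, 0, 0))) = (y, Complex b t, 0, 0, 0)" if "y > 0" for y b
  proof -
    obtain t where "t > 0" "R1 chi t (Complex 0 y) > 0" "R2 chi t (Complex 0 y) > 0" using R1_R2_pos by blast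
    hence "(y, Complex b t, 0, 0, 0) \<in> N_tilde chi" using that by (simp add: N_tilde_def)
    thus ?thesis using id unfolding act by blast
  qed
  have comp: "fst (Heis5_act h (R_act v q)) = fst q" "fst (snd (snd (Heis5_act h (R_act v q)))) $ 0 = fst (snd (snd q)) $ 0"
    "Re (fst (snd (Heis5_act h (R_act v q)))) = Re (fst (snd q)) + v" for q
    using h by (cases q, cases h, simp)+
  have det: "A $ 0 $ 0 * A $ 1 $ 1 - A $ 0 $ 1 * A $ 1 $ 0 = 1" using A by (simp add: det_SL2)
  have \<tau>: "A $ 0 $ 0 = A $ 1 $ 1 \<and> real_of_int (A $ 0 $ 1) = - y\<^sup>2 * of_int (A $ 1 $ 0)" if y: "y > 0" for y
  proof -
    define j where "j = of_int (A $ 1 $ 0) * Complex 0 y + of_int (A $ 1 $ 1)"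
    define \<tau>' where "\<tau>' = (of_int (A $ 0 $ 0) * Complex 0 y + of_int (A $ 0 $ 1)) / j"
    have j: "j \<noteq> 0" unfolding j_def by (rule moebius_denominator_nz[OF det]) (use y in simp)
    obtain t where t: "Heis5_act h (R_act v (S_duality A (y, Complex 0 t, 0, 0, 0))) = (y, Complex 0 t, 0, 0, 0)"
      using fp[OF y] by blast
    have "Im \<tau>' = y" "Re \<tau>' = 0"
      using S_duality_components(1,3)[of A "(y, Complex 0 t, 0, 0, 0)"]
        comp(1,2)[of "S_duality A (y, Complex 0 t, 0, 0, 0)"] unfolding t \<tau>'_def j_def by simp_all
    hence "\<tau>' = Complex 0 y" by (simp add: complex_eq_iff)
    hence "of_int (A $ 0 $ 0) * Complex 0 y + of_int (A $ 0 $ 1) = Complex 0 y * j"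
      using j unfolding \<tau>'_def by (simp add: divide_eq_eq)
    thus ?thesis using y by (simp add: j_def complex_eq_iff power2_eq_square)
  qed
  \<comment> \<open>Fixing both i and 2 i forces the off-diagonal entries to vanish.\<close>
  have "real_of_int (A $ 0 $ 1) = - of_int (A $ 1 $ 0)" "real_of_int (A $ 0 $ 1) = - 4 * of_int (A $ 1 $ 0)"
    using \<tau>[of 1] \<tau>[of 2] by simp_all
  hence off: "A $ 0 $ 1 = 0" "A $ 1 $ 0 = 0" by linarith+
  \<comment> \<open>The test points have \<open>\<zeta>\<close> = 0, and \<open>A $ 1 $ 0\<close> =
    0, so b transforms by the lower right entry alone; b = 0 and b = 1 then give v and that
    entry.\<close>
  have b: "of_int (A $ 1 $ 1) * b + v = b" for b
  proof -
    obtain t where "Heis5_act h (R_act v (S_duality A (1, Complex b t, 0, 0, 0))) = (1, Complex b t, 0, 0, 0)" using fp by fastforce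
    thus ?thesis using comp(3)[of "S_duality A (1, Complex b t, 0, 0, 0)"] by (simp add: S_duality_alt Let_def off)
  qed
  have v: "v = 0" "A $ 1 $ 1 = 1" using b[of 0] b[of 1] by simp_all
  hence A1: "A = mat 1" using \<tau>[of 1] off by (simp add: vec_eq_iff all_2 mat_def)
  obtain t where "Heis5_act h (R_act v (S_duality A (1, Complex 1 t, 0, 0, 0))) = (1, Complex 1 t, 0, 0, 0)" using fp by fastforce
  hence "h = \<one>\<^bsub>H4\<^esub>" unfolding v(1) A1 R_act_0 S_duality_one by (rule Heis5_act_fixed_point)
  thus "g = \<one>\<^bsub>SL2Z_R_H4\<^esub>"
    by (simp add: g4 v A1 SL2Z_R_H4_def R_H4_def one_semidirect SL2Z_def R_add_def)
qed

lemma smooth_on_SL2Z_R_H4_act: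
  assumes "g \<in> carrier SL2Z_R_H4"
  shows "smooth_on (N_tilde chi) (SL2Z_R_H4_act g)"
  unfolding smooth_on_def
proof
  fix k
  from assms obtain A v h where A: "det A = 1" and act: "SL2Z_R_H4_act g = (\<lambda>p. Heis5_act h (R_act v (S_duality A p)))"
    by (rule SL2Z_R_H4_cases)
  show "Ck_on k (N_tilde chi) (SL2Z_R_H4_act g)" unfolding act
    by (intro Ck_on_Heis5_act Ck_on_R_act Ck_on_S_duality open_N_tilde A Ck_on_bounded_linear bounded_linear_ident) (simp add: N_tilde_iff)
qed

theorem corollary5p5:
  fixes chi :: nat and c_l :: real
  assumes "chi > 0" and "c_l = real chi / (192 * pi)"
  shows "(\<forall>p\<in>N_tilde chi. qmap_metric_defined (prepotential chi) chi c_l p \<and>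
            positive_definite (qmap_metric (prepotential chi) chi c_l p)) \<and>
         faithful_action SL2Z_R_H4 (N_tilde chi)
           (\<lambda>x. restrict (SL2Z_R_H4_act x) (N_tilde chi)) \<and>
         (\<forall>x\<in>carrier SL2Z_R_H4.
            isometry_on (N_tilde chi) (qmap_metric (prepotential chi) chi c_l) (SL2Z_R_H4_act x))"
proof (intro conjI ballI)
  show "faithful_action SL2Z_R_H4 (N_tilde chi) (\<lambda>x. restrict (SL2Z_R_H4_act x) (N_tilde chi))"
    by (rule acts_on_faithful_action[OF acts_on_N_tilde SL2Z_R_H4_faithful])
next
  fix g assume g: "g \<in> carrier SL2Z_R_H4"
  interpret group SL2Z_R_H4 by (rule acts_onD(1)[OF acts_on_N_tilde])
  \<comment> \<open>On the domain the inverse map is the action of the inverse group element, so its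
    smoothness is an instance of the same lemma.\<close>
  have inv: "smooth_on (N_tilde chi) (inv_into (N_tilde chi) (SL2Z_R_H4_act g))"
    using smooth_on_SL2Z_R_H4_act[OF inv_closed[OF g]] acts_on_inv_into[OF acts_on_N_tilde g]
    unfolding smooth_on_def by (metis Ck_on_cong[OF open_N_tilde])
  have "isom_at chi c_l (SL2Z_R_H4_act g) p" if p: "p \<in> N_tilde chi" for p
  proof -
    from g obtain A v h where A: "det A = 1" and h: "fst h $ 0 = 0"
      and act: "SL2Z_R_H4_act g = (\<lambda>p. Heis5_act h (R_act v (S_duality A p)))" by (rule SL2Z_R_H4_cases)
    have S: "S_duality A p \<in> N_tilde chi" by (rule S_duality_domains(2)[OF A p])
    show ?thesis unfolding act
      by (rule isom_at_compose[where G = "Heis5_act h", OF isom_at_compose[where G = "R_act v",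
            OF S_duality_isom[OF A p assms(2)] R_act_isom[OF S assms(2)]] Heis5_act_isom[OF _ assms(2) h]])
         (simp add: R_act_N_tilde S)
  qed
  thus "isometry_on (N_tilde chi) (qmap_metric (prepotential chi) chi c_l) (SL2Z_R_H4_act g)"
    unfolding isometry_on_def
    using acts_on_bij_betw[OF acts_on_N_tilde g] smooth_on_SL2Z_R_H4_act[OF g] inv isom_at_frechet by blast
qed (use N_tilde_metric assms(2) in auto)

end
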